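(* Let $x\in\mathcal E$ be fixed and assume that hypotheses (A1)–(A5) listed in the context are satisfied. Then, as $n\to\infty$, $$\sqrt{n\phi(h)}\,\big(\hat r_{n,h}(x)-r(x)-B_n(x)\big)\to \mathfrak G(0,\mathcal C_x)\quad\text{in distribution},$$ where the covariance operator $\mathcal C_x$ on $\mathcal H$ is characterized by the condition that for each $v=\sum_{k=1}^\infty\gamma_k e_k\in\mathcal H$ $$\langle \mathcal C_x v,v\rangle=\sigma^2_{v,x}=\frac{M_2}{M_1^2 f_1(x)}\Big\{\sum_{j,k}\gamma_j\gamma_k W_{2,j,k}(x)\Big\}.$$
   Context: Setting. $\mathcal E$ is a space with a pseudometric $d$; $\mathcal H$ is a separable Hilbert space with inner product $\langle\cdot,\cdot\rangle$, norm $\|\cdot\|$ and orthonormal basis $\{e_k:k\in\mathbb N\}$, $\mathbb N=\{1,2,\dots\}$. For $A,v\in\mathcal H$ write $A_v=\langle A,v\rangle$. $((X_{n,i},Y_{n,i}):1\le i\le n,\ n\in\mathbb N)$ is a triangular array of (possibly dependent) $\mathcal E\times\mathcal H$-valued pairs, all with the same distribution. For a generic pair $(X,Y)$: $r(x)=\mathbb E[Y|X=x]\in\mathcal H$, $r_v(x)=\mathbb E[\langle Y,v\rangle|X=x]$ for $v\in\mathcal H$. $\mathcal F_{n,i}=\sigma((X_{n,1},Y_{n,1}),\dots,(X_{n,i},Y_{n,i}))$, $\mathcal G_{n,i}=\sigma((X_{n,1},Y_{n,1}),\dots,(X_{n,i},Y_{n,i}),X_{n,i+1})$. $U(x,\delta)=\{y\in\mathcal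 E:d(x,y)\le\delta\}$. $F_x(u)=\mathbb P(d(x,X_{n,i})\le u)$, $F_x^{\mathcal F_{n,i-1}}(u)=\mathbb P(d(x,X_{n,i})\le u|\mathcal F_{n,i-1})$. $h=h_n>0$ and $b=b_n>0$ are bandwidths, $K$ a kernel, $\Delta_{n,h,i}(x)=K(d(x,X_{n,i})/h)$. The point $x\in\mathcal E$ is fixed; limits are for $n\to\infty$ unless stated otherwise. $o_{a.s.}$, $\mathcal O_{a.s.}$: the ratio (of the norm, for $\mathcal H$-valued quantities) to the given rate tends to $0$ a.s., resp. is a.s. bounded. $\|\cdot\|_{\mathbb P,\infty}$ is the essential supremum norm. Estimator and conditional bias. For $j=1,2$ (with $Y^0=1$), $$\hat r_{n,h,j}(x)=\frac{\sum_{i=1}^nY_{n,i}^{j-1}\Delta_{n,h,i}(x)}{n\,\mathbb E[\Delta_{1,h,1}(x)]},\quad \bar r_{n,h,j}(x)=\frac{\sum_{i=1}^n\mathbb E[Y_{n,i}^{j-1}\Delta_{n,h,i}(x)|\mathcal F_{n,i-1}]}{n\,\mathbb E[\Delta_{1,h,1}(x)]},$$ $\hat r_{n,h}(x)=\hat r_{n,h,2}(x)/\hat r_{n,h,1}(x)$, $B_n(x)=\bar r_{n,h,2}(x)/\bar r_{n,h,1}(x)-r(x)$. Gaussian measure. $\mathfrak G(m,\mathcal C)$ is the Borel probability measure on $\mathcal H$ with Fourier transform $x\mapsto\exp(i\langle m,x\rangle-\langle\mathcal Cx,x\rangle/2)$, $m\in\mathcal H$, $\mathcal C$ a positive symmetric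 trace class operator. Hypotheses (indices: $y\in\mathcal E$; $m,n,k\in\mathbb N$; $1\le i\le n$ unless stated otherwise). (A1) $K$ is a nonnegative bounded kernel, of class $C^1$ over its support $[0,1]$; $K'$ exists on $[0,1]$, $K'(t)\le0$ for all $t\in[0,1]$, and $K(1)>0$. (A2) (i) There are $\tilde L_{n,i}\in\mathbb R_+$ and $\alpha\in(0,1]$ such that a.s. $|F^{\mathcal F_{n,i-1}}_{y_1}(u)-F^{\mathcal F_{n,i-1}}_{y_2}(u)|/F^{\mathcal F_{n,i-1}}_x(u)\le\tilde L_{n,i}d(y_1,y_2)^\alpha$ for all $y_1,y_2\in\mathcal E$, uniformly in $u$ in a neighborhood of $0$; moreover a.s. $[F_x^{\mathcal F_{n,i-1}}(u+\varepsilon)-F_x^{\mathcal F_{n,i-1}}(u-\varepsilon)]/F_x^{\mathcal F_{n,i-1}}(u)\le\tilde L_{n,i}\varepsilon u^{-1}$ for $0\le\varepsilon<u$ and $u$ in a neighborhood of $0$; $\limsup_n n^{-1}\sum_{i=1}^n\tilde L_{n,i}^2=\tilde L<\infty$. Further there are nonnegative bounded random functionals $f_{n,i,1}$, random functions $g_{n,i,y}$ ($y\in\mathcal E$), a deterministic nonnegative bounded functional $f_1$ and a nonnegative real function $\phi$ tending to $0$ as its argument tends to $0$ such that: (ii) $F_y(u)=\phi(u)f_1(y)+o(\phi(u))$ as $u\to0$, $y\in\mathcal E$. (iii) $F_y^{\mathcal F_{n,i-1}}(u)=\phi(u)f_{n,i,1}(y)+g_{n,i,y}(u)$ with $|g_{n,i,y}(u)|=o_{a.s.}(\phi(u))$,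 $n^{-1}\sum_{i=1}^n|g_{n,i,y}(u)|=o_{a.s.}(\phi(u))$ as $n\to\infty$, and for some $\delta>0$: $\|f_{n,i,1}(y)\|_{\mathbb P,\infty}\le\tilde L_{n,i}$ and $\phi(u)^{-1}\|g_{n,i,y}(u)\|_{\mathbb P,\infty}\le\tilde L_{n,i}$ for $u\le\delta$ and all $y\in U(x,\delta)$. (iv) $\lim_n n^{-1}\sum_{i=1}^nf_{n,i,1}(x)=f_1(x)>0$ a.s. (v) $\sup_{u\in[0,1]}|\phi(hu)/\phi(h)-\tau_0(u)|=o(1)$ as $h\downarrow0$ for some $\tau_0:[0,1]\to[0,1]$. (A3) (i) $\mathbb E[Y_{n,i}|\mathcal G_{n,i-1}]\equiv r(X_{n,i})$ a.s. (ii) $\mathbb E[\langle e_j,Y_{n,i}-r(X_{n,i})\rangle\langle e_k,Y_{n,i}-r(X_{n,i})\rangle|\mathcal G_{n,i-1}]\equiv W_{2,j,k}(X_{n,i})$ for all $j,k$, with $\sup_{j,k\in\mathbb N}\sup_{y\in U(x,h)}|W_{2,j,k}(y)-W_{2,j,k}(x)|=o(1)$; $\sup_{y\in U(x,h)}|\sum_{k\in\mathbb N}(W_{2,k,k}(y)-W_{2,k,k}(x))|=o(1)$; $\sup_{y\in U(x,\delta)}\sum_{k>m}(W_{2,k,k}(y)+r_{e_k}(y)^2)\le a_0\exp(-a_1m)$ for certain $a_0,a_1>0$. (iii) $\sup_{y\in U(x,\delta)}\mathbb E[\|Y_{n,i}\|^{(2+\delta')m}|X_{n,i}=y,\mathcal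 F_{n,i-1}]\le m!\,\tilde H^{m-2}$ for some $\tilde H\ge1$ and some $\delta'>0$. (A4) (i) $r_{e_k}$ is continuous and $\mathbb E[r_{e_k}(X_{n,i})-r_{e_k}(y)|\mathcal F_{n,i-1},d(y,X_{n,i})=s]\equiv\psi_{k,y}(s)+\bar g_{k,n,i,y}(s)$, where $\psi_{k,y}$ is deterministic, $\bar g_{k,n,i,y}$ is random, $\psi_{k,y}(0)=0$, $\psi_{k,y}$ is differentiable (in $s$) in a neighborhood of $(y,s)=(x,0)$, $\psi'_{k,y}(0)\ne0$, with $\sup_{0\le u\le s,\,y\in U(x,s)}|\psi'_{k,y}(u)-\psi'_{k,x}(0)|\,s+\|\bar g_{k,n,i,y}(s)\|_{\mathbb P,\infty}\le L_ks^{1+\alpha}$ ($\alpha$ from (A2)) and $\sum_k(\psi'_{k,x}(0)^2+L_k^2)<\infty$. (ii) $\mathbb E[|r_{e_k}(X_{n,i})-r_{e_k}(x)|^2|\mathcal F_{n,i-1},d(x,X_{n,i})=s]\equiv\psi_{2,k,x}(s)+\bar g_{2,k,n,i,x}(s)$, where $\psi_{2,k,x}$ is deterministic, $\bar g_{2,k,n,i,x}$ is random, $\psi_{2,k,x}(0)=0$, $\psi_{2,k,x}$ is differentiable in a neighborhood of $0$, $\psi'_{2,k,x}(0)\ne0$, with $\sup_{0\le u\le s}|\psi'_{2,k,x}(u)-\psi'_{2,k,x}(0)|\,s+\|\bar g_{2,k,n,i,x}(s)\|_{\mathbb P,\infty}\le L_{2,k}s^{1+\alpha}$ and $\sum_{k>m}(|\psi'_{2,k,x}(0)|+L_{2,k})\le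 a_0\exp(-a_1m)$ ($a_0,a_1$ from (A3)). (A5) $h,b\to0$, $h/b\to0$, $(n\phi(h))^{1/2}(\log n)^{-[(2+\alpha)\vee(1/2)]}\to\infty$, $[\phi(h)/\phi(b)](\log n)^2=o(1)$, $h(n\phi(h))^{1/2}=\mathcal O(1)$, $b^{1+\alpha}(n\phi(h))^{1/2}=o(1)$, $b=o(h\sqrt{n\phi(h)})$, $h(\log n)^{1/2}=o(1)$. Constants: $M_j=K^j(1)-\int_0^1(K^j(s))'\tau_0(s)\,ds$ for $j\ge1$. *)

theory Defs
  imports "HOL-Probability.Probability" "HOL-Library.Landau_Symbols"
begin

definition pseudometric :: "('e \<Rightarrow> 'e \<Rightarrow> real) \<Rightarrow> bool" where
  "pseudometric d \<longleftrightarrow> (\<forall>y z. 0 \<le> d y z) \<and> (\<forall>y. d y y = 0) \<and> (\<forall>y z. d y z = d z y) \<and>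
     (\<forall>y z w. d y w \<le> d y z + d z w)"

definition pm_topology :: "('e \<Rightarrow> 'e \<Rightarrow> real) \<Rightarrow> 'e topology" where
  "pm_topology d = topology (\<lambda>U. \<forall>y\<in>U. \<exists>\<epsilon>>0. \<forall>z. d y z < \<epsilon> \<longrightarrow> z \<in> U)"

lemma openin_pm_topology:
  "openin (pm_topology d) U \<longleftrightarrow> (\<forall>y\<in>U. \<exists>\<epsilon>>0. \<forall>z. d y z < \<epsilon> \<longrightarrow> z \<in> U)"
proof -
  have "istopology (\<lambda>U. \<forall>y\<in>U. \<exists>\<epsilon>>0. \<forall>z. d y z < \<epsilon> \<longrightarrow> z \<in> U)"
    unfolding istopology_def
  proof (intro conjI allI impI ballI)
    fix S T y assume S: "\<forall>y\<in>S. \<exists>\<epsilon>>0. \<forall>z. d y z < \<epsilon> \<longrightarrow> z \<in> S"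
      and T: "\<forall>y\<in>T. \<exists>\<epsilon>>0. \<forall>z. d y z < \<epsilon> \<longrightarrow> z \<in> T" and y: "y \<in> S \<inter> T"
    from S y obtain \<epsilon>1 where 1: "\<epsilon>1 > 0" "\<forall>z. d y z < \<epsilon>1 \<longrightarrow> z \<in> S" by blast
    from T y obtain \<epsilon>2 where 2: "\<epsilon>2 > 0" "\<forall>z. d y z < \<epsilon>2 \<longrightarrow> z \<in> T" by blast
    show "\<exists>\<epsilon>>0. \<forall>z. d y z < \<epsilon> \<longrightarrow> z \<in> S \<inter> T"
      using 1 2 by (intro exI[of _ "min \<epsilon>1 \<epsilon>2"]) auto
  next
    fix \<K> y assume "\<forall>S\<in>\<K>. \<forall>y\<in>S. \<exists>\<epsilon>>0. \<forall>z. d y z < \<epsilon> \<longrightarrow> z \<in> S" "y \<in> \<Union>\<K>"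
    then show "\<exists>\<epsilon>>0. \<forall>z. d y z < \<epsilon> \<longrightarrow> z \<in> \<Union>\<K>" by (meson UnionE UnionI)
  qed
  then show ?thesis by (simp add: pm_topology_def topology_inverse')
qed

definition pm_borel :: "('e \<Rightarrow> 'e \<Rightarrow> real) \<Rightarrow> 'e measure" where
  "pm_borel d = sigma UNIV {U. openin (pm_topology d) U}"

definition pm_cball :: "('e \<Rightarrow> 'e \<Rightarrow> real) \<Rightarrow> 'e \<Rightarrow> real \<Rightarrow> 'e set" where
  "pm_cball d y \<rho> = {z. d y z \<le> \<rho>}"

text \<open>All indices that range over $\{1,2,\dots\}$ in the mathematics (rows and columns of the
  array, coordinates in the Hilbert space) are natural numbers restricted to be at least 1; the
  values of the data at index 0 are irrelevant.\<close>

definition orthonormal_basis :: "(nat \<Rightarrow> 'h::real_inner) \<Rightarrow> bool" where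
  "orthonormal_basis e \<longleftrightarrow>
     (\<forall>j\<ge>1. \<forall>k\<ge>1. e j \<bullet> e k = (if j = k then 1 else 0)) \<and> closure (span (e ` {1..})) = UNIV"


text \<open>The library has conditional expectations of real and of \<^typ>\<open>ennreal\<close>-valued random
  variables only. For variables with values in a separable Banach space, \<open>is_cond_exp M F f g\<close>
  says that \<open>g\<close> is a version of E[f | F], and \<open>cond_exp M F f\<close> is some such version.\<close>

definition is_cond_exp ::
    "'w measure \<Rightarrow> 'w measure \<Rightarrow> ('w \<Rightarrow> 'v) \<Rightarrow> ('w \<Rightarrow> 'v::{banach,second_countable_topology}) \<Rightarrow> bool" where
  "is_cond_exp M F f g \<longleftrightarrow> integrable M f \<and> integrable M g \<and> g \<in> borel_measurable F \<and>
     (\<forall>A\<in>sets F. (LINT \<omega>:A|M. f \<omega>) = (LINT \<omega>:A|M. g \<omega>))"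

definition cond_exp ::
    "'w measure \<Rightarrow> 'w measure \<Rightarrow> ('w \<Rightarrow> 'v) \<Rightarrow> 'w \<Rightarrow> 'v::{banach,second_countable_topology}" where
  "cond_exp M F f = (SOME g. is_cond_exp M F f g)"

text \<open>\<open>sigma_join M F T N\<close> is the sigma-algebra generated by \<open>F\<close> and \<open>T : M \<rightarrow> N\<close>.\<close>

definition sigma_join :: "'w measure \<Rightarrow> 'w measure \<Rightarrow> ('w \<Rightarrow> 't) \<Rightarrow> 't measure \<Rightarrow> 'w measure" where
  "sigma_join M F T N = sigma (space M) (sets F \<union> {T -` A \<inter> space M | A. A \<in> sets N})"

text \<open>\<open>cond_exp_at M F T Z q\<close> expresses that E[Z | F, T = s] is equal to \<open>q s\<close>, for a random
  function \<open>q\<close>. This is the usual factorised conditional expectation: \<open>q\<close> is jointly measurable in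
  \<open>s\<close> and (through \<open>F\<close>) in the random element, and substituting \<open>T\<close> for \<open>s\<close> gives the conditional
  expectation of \<open>Z\<close> given the sigma-algebra generated by \<open>F\<close> and \<open>T\<close>.\<close>

definition cond_exp_at ::
    "'w measure \<Rightarrow> 'w measure \<Rightarrow> ('w \<Rightarrow> real) \<Rightarrow> ('w \<Rightarrow> real) \<Rightarrow> (real \<Rightarrow> 'w \<Rightarrow> real) \<Rightarrow> bool" where
  "cond_exp_at M F T Z q \<longleftrightarrow>
     (\<lambda>(s, \<omega>). q s \<omega>) \<in> borel_measurable (borel \<Otimes>\<^sub>M F) \<and>
     (AE \<omega> in M. real_cond_exp M (sigma_join M F T borel) Z \<omega> = q (T \<omega>) \<omega>)"

definition Linf_norm :: "'w measure \<Rightarrow> ('w \<Rightarrow> real) \<Rightarrow> ereal" where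
  "Linf_norm M f = esssup M (\<lambda>\<omega>. ereal \<bar>f \<omega>\<bar>)"


definition identically_distributed_array ::
    "'w measure \<Rightarrow> ('e \<Rightarrow> 'e \<Rightarrow> real) \<Rightarrow> (nat \<Rightarrow> nat \<Rightarrow> 'w \<Rightarrow> 'e) \<Rightarrow>
     (nat \<Rightarrow> nat \<Rightarrow> 'w \<Rightarrow> 'h::real_normed_vector) \<Rightarrow> bool" where
  "identically_distributed_array M d X Y \<longleftrightarrow>
     (\<forall>n\<ge>1. \<forall>i\<in>{1..n}.
        (\<lambda>\<omega>. (X n i \<omega>, Y n i \<omega>)) \<in> M \<rightarrow>\<^sub>M pm_borel d \<Otimes>\<^sub>M borel \<and>
        distr M (pm_borel d \<Otimes>\<^sub>M borel) (\<lambda>\<omega>. (X n i \<omega>, Y n i \<omega>)) =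
        distr M (pm_borel d \<Otimes>\<^sub>M borel) (\<lambda>\<omega>. (X 1 1 \<omega>, Y 1 1 \<omega>)))"

text \<open>Since the array is identically distributed, the pair with indices (1,1) serves as generic
  pair: \<open>r(y) = E[Y | X = y]\<close>, and \<open>dist_cdf\<close> is $F_y(u)$.\<close>

definition regression_function ::
    "'w measure \<Rightarrow> ('e \<Rightarrow> 'e \<Rightarrow> real) \<Rightarrow> (nat \<Rightarrow> nat \<Rightarrow> 'w \<Rightarrow> 'e) \<Rightarrow>
     (nat \<Rightarrow> nat \<Rightarrow> 'w \<Rightarrow> 'h::{banach,second_countable_topology}) \<Rightarrow> ('e \<Rightarrow> 'h) \<Rightarrow> bool" where
  "regression_function M d X Y r \<longleftrightarrow> r \<in> pm_borel d \<rightarrow>\<^sub>M borel \<and>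
     is_cond_exp M (vimage_algebra (space M) (X 1 1) (pm_borel d)) (Y 1 1) (\<lambda>\<omega>. r (X 1 1 \<omega>))"

definition dist_cdf ::
    "'w measure \<Rightarrow> ('e \<Rightarrow> 'e \<Rightarrow> real) \<Rightarrow> (nat \<Rightarrow> nat \<Rightarrow> 'w \<Rightarrow> 'e) \<Rightarrow> 'e \<Rightarrow> real \<Rightarrow> real" where
  "dist_cdf M d X y u = measure M {\<omega> \<in> space M. d y (X 1 1 \<omega>) \<le> u}"

definition sigF ::
    "'w measure \<Rightarrow> ('e \<Rightarrow> 'e \<Rightarrow> real) \<Rightarrow> (nat \<Rightarrow> nat \<Rightarrow> 'w \<Rightarrow> 'e) \<Rightarrow>
     (nat \<Rightarrow> nat \<Rightarrow> 'w \<Rightarrow> 'h::real_normed_vector) \<Rightarrow> nat \<Rightarrow> nat \<Rightarrow> 'w measure" where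
  "sigF M d X Y n i = sigma (space M)
     (\<Union>j\<in>{1..i}. {(\<lambda>\<omega>. (X n j \<omega>, Y n j \<omega>)) -` A \<inter> space M | A. A \<in> sets (pm_borel d \<Otimes>\<^sub>M borel)})"

definition sigG ::
    "'w measure \<Rightarrow> ('e \<Rightarrow> 'e \<Rightarrow> real) \<Rightarrow> (nat \<Rightarrow> nat \<Rightarrow> 'w \<Rightarrow> 'e) \<Rightarrow>
     (nat \<Rightarrow> nat \<Rightarrow> 'w \<Rightarrow> 'h::real_normed_vector) \<Rightarrow> nat \<Rightarrow> nat \<Rightarrow> 'w measure" where
  "sigG M d X Y n i = sigma_join M (sigF M d X Y n i) (X n (i + 1)) (pm_borel d)"

definition cond_cdf ::
    "'w measure \<Rightarrow> ('e \<Rightarrow> 'e \<Rightarrow> real) \<Rightarrow> (nat \<Rightarrow> nat \<Rightarrow> 'w \<Rightarrow> 'e) \<Rightarrow>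
     (nat \<Rightarrow> nat \<Rightarrow> 'w \<Rightarrow> 'h::real_normed_vector) \<Rightarrow> nat \<Rightarrow> nat \<Rightarrow> 'e \<Rightarrow> real \<Rightarrow> 'w \<Rightarrow> real" where
  "cond_cdf M d X Y n i y u =
     real_cond_exp M (sigF M d X Y n (i - 1)) (\<lambda>\<omega>. indicator {..u} (d y (X n i \<omega>)))"


definition Delta ::
    "('e \<Rightarrow> 'e \<Rightarrow> real) \<Rightarrow> (nat \<Rightarrow> nat \<Rightarrow> 'w \<Rightarrow> 'e) \<Rightarrow> (real \<Rightarrow> real) \<Rightarrow> 'e \<Rightarrow>
     nat \<Rightarrow> real \<Rightarrow> nat \<Rightarrow> 'w \<Rightarrow> real" where
  "Delta d X K x n h i \<omega> = K (d x (X n i \<omega>) / h)"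

definition norming ::
    "'w measure \<Rightarrow> ('e \<Rightarrow> 'e \<Rightarrow> real) \<Rightarrow> (nat \<Rightarrow> nat \<Rightarrow> 'w \<Rightarrow> 'e) \<Rightarrow> (real \<Rightarrow> real) \<Rightarrow> 'e \<Rightarrow>
     nat \<Rightarrow> real \<Rightarrow> real" where
  "norming M d X K x n h = real n * (LINT \<omega>|M. Delta d X K x 1 h 1 \<omega>)"

definition rhat1 ::
    "'w measure \<Rightarrow> ('e \<Rightarrow> 'e \<Rightarrow> real) \<Rightarrow> (nat \<Rightarrow> nat \<Rightarrow> 'w \<Rightarrow> 'e) \<Rightarrow> (real \<Rightarrow> real) \<Rightarrow> 'e \<Rightarrow>
     nat \<Rightarrow> real \<Rightarrow> 'w \<Rightarrow> real" where
  "rhat1 M d X K x n h \<omega> = (\<Sum>i=1..n. Delta d X K x n h i \<omega>) / norming M d X K x n h"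

definition rhat2 ::
    "'w measure \<Rightarrow> ('e \<Rightarrow> 'e \<Rightarrow> real) \<Rightarrow> (nat \<Rightarrow> nat \<Rightarrow> 'w \<Rightarrow> 'e) \<Rightarrow>
     (nat \<Rightarrow> nat \<Rightarrow> 'w \<Rightarrow> 'h::real_normed_vector) \<Rightarrow> (real \<Rightarrow> real) \<Rightarrow> 'e \<Rightarrow>
     nat \<Rightarrow> real \<Rightarrow> 'w \<Rightarrow> 'h" where
  "rhat2 M d X Y K x n h \<omega> =
     (\<Sum>i=1..n. Delta d X K x n h i \<omega> *\<^sub>R Y n i \<omega>) /\<^sub>R norming M d X K x n h"

definition rbar1 ::
    "'w measure \<Rightarrow> ('e \<Rightarrow> 'e \<Rightarrow> real) \<Rightarrow> (nat \<Rightarrow> nat \<Rightarrow> 'w \<Rightarrow> 'e) \<Rightarrow>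
     (nat \<Rightarrow> nat \<Rightarrow> 'w \<Rightarrow> 'h::real_normed_vector) \<Rightarrow> (real \<Rightarrow> real) \<Rightarrow> 'e \<Rightarrow>
     nat \<Rightarrow> real \<Rightarrow> 'w \<Rightarrow> real" where
  "rbar1 M d X Y K x n h \<omega> =
     (\<Sum>i=1..n. real_cond_exp M (sigF M d X Y n (i - 1)) (Delta d X K x n h i) \<omega>)
       / norming M d X K x n h"

definition rbar2 ::
    "'w measure \<Rightarrow> ('e \<Rightarrow> 'e \<Rightarrow> real) \<Rightarrow> (nat \<Rightarrow> nat \<Rightarrow> 'w \<Rightarrow> 'e) \<Rightarrow>
     (nat \<Rightarrow> nat \<Rightarrow> 'w \<Rightarrow> 'h::{banach,second_countable_topology}) \<Rightarrow> (real \<Rightarrow> real) \<Rightarrow> 'e \<Rightarrow>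
     nat \<Rightarrow> real \<Rightarrow> 'w \<Rightarrow> 'h" where
  "rbar2 M d X Y K x n h \<omega> =
     (\<Sum>i=1..n. cond_exp M (sigF M d X Y n (i - 1))
        (\<lambda>\<omega>'. Delta d X K x n h i \<omega>' *\<^sub>R Y n i \<omega>') \<omega>) /\<^sub>R norming M d X K x n h"

definition rhat ::
    "'w measure \<Rightarrow> ('e \<Rightarrow> 'e \<Rightarrow> real) \<Rightarrow> (nat \<Rightarrow> nat \<Rightarrow> 'w \<Rightarrow> 'e) \<Rightarrow>
     (nat \<Rightarrow> nat \<Rightarrow> 'w \<Rightarrow> 'h::real_normed_vector) \<Rightarrow> (real \<Rightarrow> real) \<Rightarrow> 'e \<Rightarrow>
     nat \<Rightarrow> real \<Rightarrow> 'w \<Rightarrow> 'h" where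
  "rhat M d X Y K x n h \<omega> = rhat2 M d X Y K x n h \<omega> /\<^sub>R rhat1 M d X K x n h \<omega>"

definition cond_bias ::
    "'w measure \<Rightarrow> ('e \<Rightarrow> 'e \<Rightarrow> real) \<Rightarrow> (nat \<Rightarrow> nat \<Rightarrow> 'w \<Rightarrow> 'e) \<Rightarrow>
     (nat \<Rightarrow> nat \<Rightarrow> 'w \<Rightarrow> 'h::{banach,second_countable_topology}) \<Rightarrow> (real \<Rightarrow> real) \<Rightarrow>
     ('e \<Rightarrow> 'h) \<Rightarrow> 'e \<Rightarrow> nat \<Rightarrow> real \<Rightarrow> 'w \<Rightarrow> 'h" where
  "cond_bias M d X Y K r x n h \<omega> = rbar2 M d X Y K x n h \<omega> /\<^sub>R rbar1 M d X Y K x n h \<omega> - r x"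

definition M_const :: "(real \<Rightarrow> real) \<Rightarrow> (real \<Rightarrow> real) \<Rightarrow> nat \<Rightarrow> real" where
  "M_const K \<tau>0 j = K 1 ^ j
     - integral {0..1} (\<lambda>s. vector_derivative (\<lambda>t. K t ^ j) (at s within {0..1}) * \<tau>0 s)"


definition hyp_A1 :: "(real \<Rightarrow> real) \<Rightarrow> bool" where
  "hyp_A1 K \<longleftrightarrow> (\<forall>t. 0 \<le> K t) \<and> bounded (range K) \<and> (\<forall>t. t \<notin> {0..1} \<longrightarrow> K t = 0) \<and>
     (\<exists>K'. (\<forall>t\<in>{0..1}. (K has_real_derivative K' t) (at t within {0..1})) \<and>
           continuous_on {0..1} K' \<and> (\<forall>t\<in>{0..1}. K' t \<le> 0)) \<and>
     K 1 > 0"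

text \<open>Remarks on \<open>hyp_A2\<close>.
  In (i), the bounds on quotients with denominator $F_x^{\mathcal F}(u)$ are multiplied out, so that
  a vanishing denominator forces a vanishing numerator.
  Relations between conditional distribution functions hold almost surely for each fixed choice of
  the points and radii, hence do not depend on the versions.
  In (iii), the first $o_{a.s.}$ relation is for $u \to 0$ in each cell of the array. The second
  one, for the row averages as $n \to \infty$, is along every deterministic sequence of radii
  $u_n \to 0$ (in the applications the radius is a multiple of the bandwidth).
  The quotient by \<open>ereal (\<phi> u)\<close> follows the conventions for \<^typ>\<open>ereal\<close>, where
  division of a positive number by 0 yields infinity.\<close>

definition hyp_A2 ::
    "'w measure \<Rightarrow> ('e \<Rightarrow> 'e \<Rightarrow> real) \<Rightarrow> (nat \<Rightarrow> nat \<Rightarrow> 'w \<Rightarrow> 'e) \<Rightarrow>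
     (nat \<Rightarrow> nat \<Rightarrow> 'w \<Rightarrow> 'h::real_normed_vector) \<Rightarrow> 'e \<Rightarrow> real \<Rightarrow> real \<Rightarrow>
     (real \<Rightarrow> real) \<Rightarrow> ('e \<Rightarrow> real) \<Rightarrow> (real \<Rightarrow> real) \<Rightarrow> bool" where
  "hyp_A2 M d X Y x \<alpha> \<delta> \<phi> f1 \<tau>0 \<longleftrightarrow>
     0 < \<alpha> \<and> \<alpha> \<le> 1 \<and> 0 < \<delta> \<and>
     (\<forall>u\<ge>0. 0 \<le> \<phi> u) \<and> (\<phi> \<longlongrightarrow> 0) (at_right 0) \<and>
     (\<forall>y. 0 \<le> f1 y) \<and> bounded (range f1) \<and>
     (\<exists>(L :: nat \<Rightarrow> nat \<Rightarrow> real) (Lsup :: real)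
        (f :: nat \<Rightarrow> nat \<Rightarrow> 'e \<Rightarrow> 'w \<Rightarrow> real) (g :: nat \<Rightarrow> nat \<Rightarrow> 'e \<Rightarrow> real \<Rightarrow> 'w \<Rightarrow> real).
        \<comment> \<open>(i)\<close>
        (\<forall>n\<ge>1. \<forall>i\<in>{1..n}. 0 \<le> L n i) \<and>
        (\<exists>u0>0. \<forall>n\<ge>1. \<forall>i\<in>{1..n}. \<forall>u\<in>{0<..u0}.
           (\<forall>y1 y2. AE \<omega> in M.
              \<bar>cond_cdf M d X Y n i y1 u \<omega> - cond_cdf M d X Y n i y2 u \<omega>\<bar>
                \<le> L n i * d y1 y2 powr \<alpha> * cond_cdf M d X Y n i x u \<omega>) \<and>
           (\<forall>\<epsilon>. 0 \<le> \<epsilon> \<and> \<epsilon> < u \<longrightarrow> (AE \<omega> in M.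
              cond_cdf M d X Y n i x (u + \<epsilon>) \<omega> - cond_cdf M d X Y n i x (u - \<epsilon>) \<omega>
                \<le> L n i * \<epsilon> / u * cond_cdf M d X Y n i x u \<omega>))) \<and>
        limsup (\<lambda>n. ereal ((\<Sum>i=1..n. (L n i)\<^sup>2) / real n)) = ereal Lsup \<and>
        \<comment> \<open>the random functions in (iii)\<close>
        (\<forall>n\<ge>1. \<forall>i\<in>{1..n}. (\<forall>y. f n i y \<in> borel_measurable M) \<and>
           (\<forall>y. \<forall>\<omega>\<in>space M. 0 \<le> f n i y \<omega>) \<and> (\<exists>B. \<forall>y. \<forall>\<omega>\<in>space M. f n i y \<omega> \<le> B)) \<and>
        (\<forall>n\<ge>1. \<forall>i\<in>{1..n}. \<forall>y. \<forall>u>0. g n i y u \<in> borel_measurable M) \<and>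
        \<comment> \<open>(ii)\<close>
        (\<forall>y. (\<lambda>u. dist_cdf M d X y u - \<phi> u * f1 y) \<in> o[at_right 0](\<phi>)) \<and>
        \<comment> \<open>(iii)\<close>
        (\<forall>n\<ge>1. \<forall>i\<in>{1..n}. \<forall>y. \<forall>u>0. AE \<omega> in M.
           cond_cdf M d X Y n i y u \<omega> = \<phi> u * f n i y \<omega> + g n i y u \<omega>) \<and>
        (\<forall>n\<ge>1. \<forall>i\<in>{1..n}. \<forall>y. AE \<omega> in M. (\<lambda>u. \<bar>g n i y u \<omega>\<bar>) \<in> o[at_right 0](\<phi>)) \<and>
        (\<forall>y. \<forall>u. (\<forall>n. 0 < u n) \<and> u \<longlonglongrightarrow> 0 \<longrightarrow> (AE \<omega> in M.
           (\<lambda>n. (\<Sum>i=1..n. \<bar>g n i y (u n) \<omega>\<bar>) / real n) \<in> o(\<lambda>n. \<phi> (u n)))) \<and>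
        (\<forall>n\<ge>1. \<forall>i\<in>{1..n}. \<forall>y\<in>pm_cball d x \<delta>.
           Linf_norm M (f n i y) \<le> ereal (L n i) \<and>
           (\<forall>u\<in>{0<..\<delta>}. Linf_norm M (g n i y u) / ereal (\<phi> u) \<le> ereal (L n i))) \<and>
        \<comment> \<open>(iv)\<close>
        (AE \<omega> in M. (\<lambda>n. (\<Sum>i=1..n. f n i x \<omega>) / real n) \<longlonglongrightarrow> f1 x) \<and> 0 < f1 x) \<and>
     \<comment> \<open>(v)\<close>
     (\<forall>u\<in>{0..1}. \<tau>0 u \<in> {0..1}) \<and>
     uniform_limit {0..1} (\<lambda>h u. \<phi> (h * u) / \<phi> h) \<tau>0 (at_right 0)"

text \<open>In part (iii) of \<open>hyp_A3\<close>, the supremum of E[ . | X = y, F] over the ball around \<open>x\<close> is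
  rendered as an almost sure bound, on the event that \<open>X\<close> is in the ball, of the conditional
  expectation given the sigma-algebra generated by \<open>F\<close> and \<open>X\<close>, which is \<open>sigG\<close>.\<close>

definition hyp_A3 ::
    "'w measure \<Rightarrow> ('e \<Rightarrow> 'e \<Rightarrow> real) \<Rightarrow> (nat \<Rightarrow> nat \<Rightarrow> 'w \<Rightarrow> 'e) \<Rightarrow>
     (nat \<Rightarrow> nat \<Rightarrow> 'w \<Rightarrow> 'h::{real_inner,banach,second_countable_topology}) \<Rightarrow> (nat \<Rightarrow> 'h) \<Rightarrow>
     ('e \<Rightarrow> 'h) \<Rightarrow> 'e \<Rightarrow> (nat \<Rightarrow> real) \<Rightarrow> real \<Rightarrow> (nat \<Rightarrow> nat \<Rightarrow> 'e \<Rightarrow> real) \<Rightarrow> real \<Rightarrow> real \<Rightarrow> bool" where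
  "hyp_A3 M d X Y e r x h \<delta> W a0 a1 \<longleftrightarrow>
     \<comment> \<open>(i)\<close>
     (\<forall>n\<ge>1. \<forall>i\<in>{1..n}. is_cond_exp M (sigG M d X Y n (i - 1)) (Y n i) (\<lambda>\<omega>. r (X n i \<omega>))) \<and>
     \<comment> \<open>(ii)\<close>
     (\<forall>n\<ge>1. \<forall>i\<in>{1..n}. \<forall>j\<ge>1. \<forall>k\<ge>1. AE \<omega> in M.
        real_cond_exp M (sigG M d X Y n (i - 1))
          (\<lambda>\<omega>'. (e j \<bullet> (Y n i \<omega>' - r (X n i \<omega>'))) * (e k \<bullet> (Y n i \<omega>' - r (X n i \<omega>')))) \<omega>
        = W j k (X n i \<omega>)) \<and>
     (\<lambda>n. SUP j\<in>{1..}. SUP k\<in>{1..}. SUP y\<in>pm_cball d x (h n). ereal \<bar>W j k y - W j k x\<bar>)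
        \<longlonglongrightarrow> 0 \<and>
     (\<lambda>n. SUP y\<in>pm_cball d x (h n). ereal \<bar>\<Sum>\<^sub>\<infinity>k\<in>{1..}. W k k y - W k k x\<bar>) \<longlonglongrightarrow> 0 \<and>
     0 < a0 \<and> 0 < a1 \<and>
     (\<forall>m\<ge>1. \<forall>y\<in>pm_cball d x \<delta>.
        (\<lambda>k. W k k y + (r y \<bullet> e k)\<^sup>2) summable_on {m<..} \<and>
        (\<Sum>\<^sub>\<infinity>k\<in>{m<..}. W k k y + (r y \<bullet> e k)\<^sup>2) \<le> a0 * exp (- a1 * real m)) \<and>
     \<comment> \<open>(iii)\<close>
     (\<exists>H\<ge>1. \<exists>\<delta>'>0. \<forall>n\<ge>1. \<forall>i\<in>{1..n}. \<forall>m\<ge>1. AE \<omega> in M.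
        X n i \<omega> \<in> pm_cball d x \<delta> \<longrightarrow>
        nn_cond_exp M (sigG M d X Y n (i - 1))
          (\<lambda>\<omega>'. ennreal (norm (Y n i \<omega>') powr ((2 + \<delta>') * real m))) \<omega>
        \<le> ennreal (fact m * H powi (int m - 2)))"

text \<open>In \<open>hyp_A4\<close>, derivatives in \<open>s\<close> at 0 are one-sided since \<open>s\<close> is a distance; the
  neighbourhoods in which the differentiability and the bounds hold are uniform in \<open>k\<close>.\<close>

definition hyp_A4 ::
    "'w measure \<Rightarrow> ('e \<Rightarrow> 'e \<Rightarrow> real) \<Rightarrow> (nat \<Rightarrow> nat \<Rightarrow> 'w \<Rightarrow> 'e) \<Rightarrow>
     (nat \<Rightarrow> nat \<Rightarrow> 'w \<Rightarrow> 'h::real_inner) \<Rightarrow> (nat \<Rightarrow> 'h) \<Rightarrow>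
     ('e \<Rightarrow> 'h) \<Rightarrow> 'e \<Rightarrow> real \<Rightarrow> real \<Rightarrow> real \<Rightarrow> bool" where
  "hyp_A4 M d X Y e r x \<alpha> a0 a1 \<longleftrightarrow>
     \<comment> \<open>(i)\<close>
     (\<forall>k\<ge>1. continuous_map (pm_topology d) euclideanreal (\<lambda>y. r y \<bullet> e k)) \<and>
     (\<exists>(\<psi> :: nat \<Rightarrow> 'e \<Rightarrow> real \<Rightarrow> real) (\<psi>' :: nat \<Rightarrow> 'e \<Rightarrow> real \<Rightarrow> real)
        (gb :: nat \<Rightarrow> nat \<Rightarrow> nat \<Rightarrow> 'e \<Rightarrow> real \<Rightarrow> 'w \<Rightarrow> real) (L :: nat \<Rightarrow> real) s0.
        (\<forall>k\<ge>1. \<forall>n\<ge>1. \<forall>i\<in>{1..n}. \<forall>y.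
           cond_exp_at M (sigF M d X Y n (i - 1)) (\<lambda>\<omega>. d y (X n i \<omega>))
             (\<lambda>\<omega>. r (X n i \<omega>) \<bullet> e k - r y \<bullet> e k)
             (\<lambda>s \<omega>. \<psi> k y s + gb k n i y s \<omega>)) \<and>
        (\<forall>k\<ge>1. \<forall>y. \<psi> k y 0 = 0) \<and>
        0 < s0 \<and>
        (\<forall>k\<ge>1. \<forall>y\<in>pm_cball d x s0.
           (\<forall>s\<in>{0..s0}. (\<psi> k y has_real_derivative \<psi>' k y s) (at s within {0..})) \<and>
           \<psi>' k y 0 \<noteq> 0) \<and>
        (\<forall>k\<ge>1. \<forall>n\<ge>1. \<forall>i\<in>{1..n}. \<forall>s\<in>{0<..s0}. \<forall>y\<in>pm_cball d x s.
           (SUP u\<in>{0..s}. SUP z\<in>pm_cball d x s. ereal \<bar>\<psi>' k z u - \<psi>' k x 0\<bar>) * ereal s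
             + Linf_norm M (gb k n i y s) \<le> ereal (L k * s powr (1 + \<alpha>))) \<and>
        (\<lambda>k. (\<psi>' k x 0)\<^sup>2 + (L k)\<^sup>2) summable_on {1..}) \<and>
     \<comment> \<open>(ii)\<close>
     (\<exists>(\<psi>2 :: nat \<Rightarrow> real \<Rightarrow> real) (\<psi>2' :: nat \<Rightarrow> real \<Rightarrow> real)
        (gb2 :: nat \<Rightarrow> nat \<Rightarrow> nat \<Rightarrow> real \<Rightarrow> 'w \<Rightarrow> real) (L2 :: nat \<Rightarrow> real) s0.
        (\<forall>k\<ge>1. \<forall>n\<ge>1. \<forall>i\<in>{1..n}.
           cond_exp_at M (sigF M d X Y n (i - 1)) (\<lambda>\<omega>. d x (X n i \<omega>))
             (\<lambda>\<omega>. \<bar>r (X n i \<omega>) \<bullet> e k - r x \<bullet> e k\<bar>\<^sup>2)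
             (\<lambda>s \<omega>. \<psi>2 k s + gb2 k n i s \<omega>)) \<and>
        (\<forall>k\<ge>1. \<psi>2 k 0 = 0) \<and>
        0 < s0 \<and>
        (\<forall>k\<ge>1. (\<forall>s\<in>{0..s0}. (\<psi>2 k has_real_derivative \<psi>2' k s) (at s within {0..})) \<and>
           \<psi>2' k 0 \<noteq> 0) \<and>
        (\<forall>k\<ge>1. \<forall>n\<ge>1. \<forall>i\<in>{1..n}. \<forall>s\<in>{0<..s0}.
           (SUP u\<in>{0..s}. ereal \<bar>\<psi>2' k u - \<psi>2' k 0\<bar>) * ereal s
             + Linf_norm M (gb2 k n i s) \<le> ereal (L2 k * s powr (1 + \<alpha>))) \<and>
        (\<forall>m\<ge>1. (\<lambda>k. \<bar>\<psi>2' k 0\<bar> + L2 k) summable_on {m<..} \<and>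
           (\<Sum>\<^sub>\<infinity>k\<in>{m<..}. \<bar>\<psi>2' k 0\<bar> + L2 k) \<le> a0 * exp (- a1 * real m)))"

definition hyp_A5 :: "(nat \<Rightarrow> real) \<Rightarrow> (nat \<Rightarrow> real) \<Rightarrow> (real \<Rightarrow> real) \<Rightarrow> real \<Rightarrow> bool" where
  "hyp_A5 h b \<phi> \<alpha> \<longleftrightarrow>
     h \<longlonglongrightarrow> 0 \<and> b \<longlonglongrightarrow> 0 \<and> (\<lambda>n. h n / b n) \<longlonglongrightarrow> 0 \<and>
     filterlim (\<lambda>n. sqrt (real n * \<phi> (h n)) * ln (real n) powr (- max (2 + \<alpha>) (1 / 2)))
       at_top sequentially \<and>
     (\<lambda>n. \<phi> (h n) / \<phi> (b n) * (ln (real n))\<^sup>2) \<in> o(\<lambda>_. 1) \<and>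
     (\<lambda>n. h n * sqrt (real n * \<phi> (h n))) \<in> O(\<lambda>_. 1) \<and>
     (\<lambda>n. b n powr (1 + \<alpha>) * sqrt (real n * \<phi> (h n))) \<in> o(\<lambda>_. 1) \<and>
     b \<in> o(\<lambda>n. h n * sqrt (real n * \<phi> (h n))) \<and>
     (\<lambda>n. h n * sqrt (ln (real n))) \<in> o(\<lambda>_. 1)"


text \<open>For positive symmetric operators, being trace class means that the trace in an orthonormal
  basis (and then in every one) is finite.\<close>

definition pos_trace_class :: "(nat \<Rightarrow> 'h::real_inner) \<Rightarrow> ('h \<Rightarrow> 'h) \<Rightarrow> bool" where
  "pos_trace_class e C \<longleftrightarrow> bounded_linear C \<and> (\<forall>v w. C v \<bullet> w = v \<bullet> C w) \<and> (\<forall>v. 0 \<le> C v \<bullet> v) \<and>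
     (\<lambda>k. C (e k) \<bullet> e k) summable_on {1..}"

definition gaussian_measure ::
    "'h::real_inner \<Rightarrow> ('h \<Rightarrow> 'h) \<Rightarrow> 'h measure \<Rightarrow> bool" where
  "gaussian_measure m C \<mu> \<longleftrightarrow> prob_space \<mu> \<and> sets \<mu> = sets borel \<and>
     (\<forall>v. (CLINT z|\<mu>. iexp (z \<bullet> v)) = exp (\<i> * complex_of_real (m \<bullet> v) - complex_of_real (C v \<bullet> v / 2)))"

definition converges_in_distribution ::
    "'w measure \<Rightarrow> (nat \<Rightarrow> 'w \<Rightarrow> 'h::topological_space) \<Rightarrow> 'h measure \<Rightarrow> bool" where
  "converges_in_distribution M Z \<mu> \<longleftrightarrow>
     (\<forall>f :: 'h \<Rightarrow> real. continuous_on UNIV f \<and> bounded (range f) \<longrightarrow>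
        (\<lambda>n. LINT z|distr M borel (Z n). f z) \<longlonglongrightarrow> (LINT z|\<mu>. f z))"

definition asymptotic_covariance ::
    "(nat \<Rightarrow> 'h::real_inner) \<Rightarrow> (real \<Rightarrow> real) \<Rightarrow> (real \<Rightarrow> real) \<Rightarrow> ('e \<Rightarrow> real) \<Rightarrow>
     (nat \<Rightarrow> nat \<Rightarrow> 'e \<Rightarrow> real) \<Rightarrow> 'e \<Rightarrow> ('h \<Rightarrow> 'h) \<Rightarrow> bool" where
  "asymptotic_covariance e K \<tau>0 f1 W x C \<longleftrightarrow> pos_trace_class e C \<and>
     (\<forall>v \<gamma>. ((\<lambda>k. \<gamma> k *\<^sub>R e k) has_sum v) {1..} \<longrightarrow>
        (\<lambda>(j, k). \<gamma> j * \<gamma> k * W j k x) summable_on {1..} \<times> {1..} \<and>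
        C v \<bullet> v = M_const K \<tau>0 2 / ((M_const K \<tau>0 1)\<^sup>2 * f1 x)
                    * (\<Sum>\<^sub>\<infinity>(j, k)\<in>{1..} \<times> {1..}. \<gamma> j * \<gamma> k * W j k x))"

end

theory Submission
  imports Defs
begin

text \<open>
The error of the estimator splits into a martingale part and remainders. With the kernel weights
\<open>weight n i\<close>, the residuals \<open>Y - r(X)\<close> give the \<open>score n i\<close>, which is the weight times the residual and is a
martingale difference because \<open>r(X)\<close> is the conditional expectation of \<open>Y\<close> given the past and the present
position. The increments \<open>r(X) - r(x)\<close>, weighted in the same way, are centred at their conditional
expectations, which is exactly what the subtraction of the conditional bias does. In
\<open>statistic_expansion\<close> the normalised error becomes
\<open>(T + R) / a - (w / (a b)) A\<close>, where \<open>T\<close> is the normalised sum of the scores, \<open>R\<close> the normalised sum of the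
centred increments, \<open>A\<close> the mean of their conditional expectations, \<open>w\<close> the normalised sum of the centred
weights, and \<open>a\<close>, \<open>b\<close> are the denominators of the estimator and of the bias. Since \<open>r\<close> varies over the
window only by the order of the square root of the bandwidth (in mean square), \<open>R\<close> and \<open>A\<close> vanish in the
limit; \<open>a\<close> and \<open>b\<close> tend to 1 and \<open>w\<close> is bounded in mean square. So the error has the same limit as \<open>T\<close>
(\<open>statistic_close\<close>), and all estimates are in the mean, so that dependence within the array only enters
through orthogonality of martingale differences.

For \<open>T\<close>, fix finitely many coordinates. The conditional variance of a score is, by continuity of the \<open>W j k\<close>,
nearly the squared weight times a quadratic form in the values at \<open>x\<close>. The conditional moments of the
weights obey a weak law (\<open>kernel_moment_L1\<close>): for a step function in place of the kernel this is the
convergence of averaged conditional distribution functions at radii \<open>h n * s\<close>, and summation by parts turns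
the limits into \<open>M_const\<close>. Together with a Lyapunov condition from the moments of order above 2, the
martingale estimate \<open>martingale_char_estimate\<close> gives the Gaussian limit of the characteristic functions of
the projections of \<open>T\<close> (\<open>char_score_sum_proj\<close>).

The passage from finitely many coordinates to the Hilbert space rests on the exponential decay of the
variances in the coordinates: it bounds the mean norm of \<open>T\<close> outside the first \<open>N\<close> coordinates, uniformly in
\<open>n\<close>, by a quantity that tends to 0 as \<open>N\<close> grows. This extends the convergence to all characteristic
functionals and replaces tightness in the continuity theorem \<open>integral_lipschitz_tendsto\<close>, which is derived from
the theorem of Levy on the real line by tilting the measures with bounded weights and by the theorem of
Stone and Weierstrass. The Gaussian measure itself is the law of a random series whose coefficients come from
a Cholesky decomposition of the covariance operator.
\<close>

section \<open>Orthonormal bases\<close>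

locale hilbert_basis =
 fixes u :: "nat \<Rightarrow> 'h::{real_inner,banach}"
 assumes ortho: "u j \<bullet> u k = (if j = k then 1 else 0)"
  and total: "closure (span (range u)) = UNIV"
begin

definition proj :: "nat \<Rightarrow> 'h \<Rightarrow> 'h" where
 "proj N v = (\<Sum>k<N. (v \<bullet> u k) *\<^sub>R u k)"

lemma inner_sum_basis: "(\<Sum>k<N. c k *\<^sub>R u k) \<bullet> u j = (if j < N then c j else 0)"
 by (simp add: inner_sum_left ortho if_distrib[of "\<lambda>x. _ * x"] cong: if_cong)

lemma norm_sum_basis: "(norm (\<Sum>k<N. c k *\<^sub>R u k))^2 = (\<Sum>k<N. (c k)^2)"
proof -
 have "(norm (\<Sum>k<N. c k *\<^sub>R u k))^2 = (\<Sum>j<N. c j * ((\<Sum>k<N. c k *\<^sub>R u k) \<bullet> u j))"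
  by (simp only: power2_norm_eq_inner inner_sum_right inner_scaleR_right)
 also have "\<dots> = (\<Sum>j<N. (c j)^2)"
  by (intro sum.cong) (auto simp: inner_sum_basis power2_eq_square)
 finally show ?thesis .
qed

lemma norm_sum_basis_interval: "(norm (\<Sum>k\<in>{m..<N}. c k *\<^sub>R u k))^2 = (\<Sum>k\<in>{m..<N}. (c k)^2)"
proof -
 have "(\<Sum>k\<in>{m..<N}. c k *\<^sub>R u k) = (\<Sum>k<N. (if m \<le> k then c k else 0) *\<^sub>R u k)"
  by (intro sum.mono_neutral_cong_left) auto
 moreover have "(\<Sum>k\<in>{m..<N}. (c k)^2) = (\<Sum>k<N. (if m \<le> k then c k else 0)^2)"
  by (intro sum.mono_neutral_cong_left) auto
 ultimately show ?thesis by (simp only: norm_sum_basis)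
qed

lemma inner_proj: "proj N v \<bullet> u j = (if j < N then v \<bullet> u j else 0)"
 unfolding proj_def by (rule inner_sum_basis)

lemma norm_proj: "(norm (proj N v))^2 = (\<Sum>k<N. (v \<bullet> u k)^2)"
 unfolding proj_def by (rule norm_sum_basis)

lemma inner_proj_eq: "v \<bullet> proj N w = (\<Sum>k<N. (v \<bullet> u k) * (w \<bullet> u k))"
 by (simp add: proj_def inner_sum_right mult.commute)

lemma inner_proj_swap: "v \<bullet> proj N w = proj N v \<bullet> w"
 unfolding inner_proj_eq inner_commute[of _ w] by (simp only: inner_proj_eq mult.commute)

lemma proj_add: "proj N (v + w) = proj N v + proj N w"
 by (simp add: proj_def inner_add_left scaleR_add_left sum.distrib)

lemma proj_diff: "proj N (v - w) = proj N v - proj N w"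
 by (simp add: proj_def inner_diff_left scaleR_diff_left sum_subtractf)

lemma proj_scaleR: "proj N (c *\<^sub>R v) = c *\<^sub>R proj N v"
 by (simp add: proj_def scaleR_sum_right)

lemma norm_minus_proj: "(norm (v - proj N v))^2 = (norm v)^2 - (\<Sum>k<N. (v \<bullet> u k)^2)"
proof -
 have "(norm (v - proj N v))^2 = (norm v)^2 - 2 * (v \<bullet> proj N v) + (norm (proj N v))^2"
  by (simp add: power2_norm_eq_inner inner_diff_left inner_diff_right inner_commute)
 then show ?thesis unfolding norm_proj inner_proj_eq by (simp add: power2_eq_square)
qed

lemma norm_minus_proj_le: "norm (v - proj N v) \<le> norm v"
 by (rule power2_le_imp_le) (use norm_minus_proj[of v N] in \<open>auto intro: sum_nonneg\<close>)

text \<open>A vector of the span involves finitely many basis vectors, so a projection with larger index fixes it;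
  the projections being contractions, this gives convergence on the closure.\<close>

lemma proj_span_eventually:
 assumes "w \<in> span (range u)"
 shows "\<exists>N0. \<forall>N\<ge>N0. proj N w = w"
 using assms
proof (induction rule: span_induct_alt)
 case base
 then show ?case by (auto simp: proj_def)
next
 case (step c v y)
 then obtain j N0 where j: "v = u j" and N0: "\<And>N. N \<ge> N0 \<Longrightarrow> proj N y = y" by auto
 have "proj N (u j) = u j" if "N > j" for N
  using that by (simp add: proj_def ortho if_distrib[of "\<lambda>x. x *\<^sub>R _"] cong: if_cong)
 then show ?case
  by (intro exI[of _ "max N0 (Suc j)"]) (auto simp: proj_add proj_scaleR j N0)
qed

lemma proj_tendsto: "(\<lambda>N. proj N v) \<longlonglongrightarrow> v"
proof (rule LIMSEQ_I)
 fix r :: real assume r: "0 < r"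
 have "v \<in> closure (span (range u))" using total by simp
 then obtain w where w: "w \<in> span (range u)" "dist w v < r"
  using r unfolding closure_approachable by blast
 obtain N0 where N0: "\<And>N. N \<ge> N0 \<Longrightarrow> proj N w = w" using proj_span_eventually[OF w(1)] by auto
 have "norm (proj N v - v) < r" if "N \<ge> N0" for N
 proof -
  have "proj N v - v = - ((v - w) - proj N (v - w))" using N0[OF that] by (simp add: proj_diff)
  then have "norm (proj N v - v) \<le> norm (v - w)" using norm_minus_proj_le[of "v - w" N] by (metis norm_minus_cancel)
  then show ?thesis using w(2) by (simp add: dist_norm norm_minus_commute)
 qed
 then show "\<exists>no. \<forall>n\<ge>no. norm (proj n v - v) < r" by blast
qed

lemma parseval: "(\<lambda>k. (v \<bullet> u k)^2) sums (norm v)\<^sup>2"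
proof -
 have "(\<lambda>N. (norm (proj N v))^2) \<longlonglongrightarrow> (norm v)\<^sup>2"
  by (intro tendsto_intros proj_tendsto)
 then show ?thesis by (simp add: sums_def norm_proj)
qed

lemma eq_if_coordinates_eq: "(\<And>k. v \<bullet> u k = w \<bullet> u k) \<Longrightarrow> v = w"
 using proj_tendsto[of v] proj_tendsto[of w] by (simp add: proj_def LIMSEQ_unique)

text \<open>Riesz--Fischer: the partial sums are Cauchy because their increments have squared norm equal
 to a piece of a convergent series.\<close>

lemma riesz_fischer:
 assumes c: "summable (\<lambda>k. (c k)^2)"
 shows "summable (\<lambda>k. c k *\<^sub>R u k)" and "(\<Sum>k. c k *\<^sub>R u k) \<bullet> u j = c j"
proof -
 show sm: "summable (\<lambda>k. c k *\<^sub>R u k)"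
  unfolding summable_Cauchy
 proof (intro allI impI)
  fix r :: real assume "0 < r"
  then have "0 < r\<^sup>2" by simp
  then obtain N where N: "\<And>m n. m \<ge> N \<Longrightarrow> norm (\<Sum>k\<in>{m..<n}. (c k)^2) < r\<^sup>2"
   using c unfolding summable_Cauchy by metis
  have "norm (\<Sum>k\<in>{m..<n}. c k *\<^sub>R u k) < r" if "m \<ge> N" for m n
  proof (rule power2_less_imp_less)
   show "(norm (\<Sum>k\<in>{m..<n}. c k *\<^sub>R u k))^2 < r\<^sup>2"
    using N[OF that, of n] by (simp add: norm_sum_basis_interval)
  qed (use \<open>0 < r\<close> in simp)
  then show "\<exists>N. \<forall>m\<ge>N. \<forall>n. norm (\<Sum>k\<in>{m..<n}. c k *\<^sub>R u k) < r" by blast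
 qed
 have "(\<lambda>N. (\<Sum>k<N. c k *\<^sub>R u k) \<bullet> u j) \<longlonglongrightarrow> (\<Sum>k. c k *\<^sub>R u k) \<bullet> u j"
  by (intro tendsto_intros summable_LIMSEQ sm)
 moreover have "(\<lambda>N. (\<Sum>k<N. c k *\<^sub>R u k) \<bullet> u j) \<longlonglongrightarrow> c j"
  by (rule tendsto_eventually)
    (auto simp: inner_sum_basis eventually_sequentially intro!: exI[of _ "Suc j"])
 ultimately show "(\<Sum>k. c k *\<^sub>R u k) \<bullet> u j = c j" by (rule LIMSEQ_unique)
qed

lemma proj_measurable [measurable]:
 "proj N \<in> borel_measurable borel"
 unfolding proj_def by (intro borel_measurable_continuous_onI continuous_intros)

end

locale separable_hilbert_basis = hilbert_basis u
 for u :: "nat \<Rightarrow> 'h::{real_inner,banach,second_countable_topology}"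

section \<open>Gaussian measures with prescribed trace class covariance\<close>

text \<open>A symmetric nonnegative bilinear form, possibly degenerate. The next lemmas subtract from it the square
  of a linear functional without losing nonnegativity, which is one step of the Cholesky algorithm.\<close>

definition psd_form :: "('h::real_vector \<Rightarrow> 'h \<Rightarrow> real) \<Rightarrow> bool" where
 "psd_form B \<longleftrightarrow> (\<forall>v. linear (B v)) \<and> (\<forall>v w. B v w = B w v) \<and> (\<forall>v. 0 \<le> B v v)"

lemma psd_form_expand:
 assumes "psd_form B"
 shows "B (v + c *\<^sub>R w) (v + c *\<^sub>R w) = B v v + 2 * c * B v w + c\<^sup>2 * B w w"
proof -
 have lin: "linear (B a)" and sym: "B a b = B b a" for a b using assms by (auto simp: psd_form_def)
 have "B a (b + c *\<^sub>R d) = B a b + c * B a d" for a b d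
  using lin[of a] by (simp add: linear_add linear_scale)
 moreover have "B (b + c *\<^sub>R d) a = B b a + c * B d a" for a b d
  using calculation sym by metis
 ultimately show ?thesis by (simp add: sym[of w v] power2_eq_square algebra_simps)
qed

lemma psd_form_cauchy_schwarz:
 assumes B: "psd_form B"
 shows "(B v w)^2 \<le> B v v * B w w"
proof (cases "B w w = 0")
 case True
 have "0 \<le> B v v + 2 * c * B v w" for c
 proof -
  have "0 \<le> B (v + c *\<^sub>R w) (v + c *\<^sub>R w)" using B by (simp only: psd_form_def)
  then show ?thesis using True by (simp add: psd_form_expand[OF B])
 qed
 from this[of "- (B v v + 1) / (2 * B v w)"] have "B v w = 0"
  by (cases "B v w = 0") (simp_all add: field_simps)
 then show ?thesis using True by simp
next
 case False
 then have pos: "B w w > 0" using B unfolding psd_form_def by (metis order_le_less)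
 have "0 \<le> B (v + (- B v w / B w w) *\<^sub>R w) (v + (- B v w / B w w) *\<^sub>R w)"
  using B by (simp only: psd_form_def)
 also have "\<dots> = B v v - (B v w)\<^sup>2 / B w w"
  unfolding psd_form_expand[OF B] using pos by (simp add: field_simps power2_eq_square)
 finally show ?thesis using pos by (simp add: field_simps)
qed

text \<open>The linear functional whose square is subtracted. If \<open>w\<close> is a null vector of the form, the division by 0
  makes it vanish, which is correct because then \<open>B v w = 0\<close> for all \<open>v\<close>.\<close>

definition psd_pivot :: "('h::real_vector \<Rightarrow> 'h \<Rightarrow> real) \<Rightarrow> 'h \<Rightarrow> 'h \<Rightarrow> real" where
 "psd_pivot B w v = B v w / sqrt (B w w)"

lemma psd_pivot_step:
 assumes B: "psd_form B"
 shows "psd_form (\<lambda>v v'. B v v' - psd_pivot B w v * psd_pivot B w v')"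
  and "B v w - psd_pivot B w v * psd_pivot B w w = 0"
  and "B w v - psd_pivot B w w * psd_pivot B w v = 0"
  and "B v w = 0 \<Longrightarrow> psd_pivot B w v = 0"
proof -
 have lin: "linear (B a)" and sym: "B a b = B b a" and nn: "0 \<le> B a a" for a b
  using B by (auto simp: psd_form_def)
 have cs: "(B v w)^2 \<le> B v v * B w w" for v by (rule psd_form_cauchy_schwarz[OF B])
 have "psd_pivot B w = (\<lambda>v. B w v / sqrt (B w w))"
  unfolding psd_pivot_def by (intro ext arg_cong2[where f="(/)"] sym refl)
 then have lin': "linear (psd_pivot B w)"
  by (simp only:) (intro linearI, simp_all only: linear_add[OF lin] linear_scale[OF lin] add_divide_distrib
   real_scaleR_def times_divide_eq_right)
 have 1: "(psd_pivot B w v)^2 \<le> B v v" for v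
  using cs[of v] nn[of w] nn[of v] by (auto simp: psd_pivot_def power_divide divide_le_eq)
 show "psd_form (\<lambda>v v'. B v v' - psd_pivot B w v * psd_pivot B w v')"
  unfolding psd_form_def
 proof (intro conjI allI)
  show "linear (\<lambda>v'. B v v' - psd_pivot B w v * psd_pivot B w v')" for v
   using lin[of v] lin' by (intro linearI) (simp_all add: linear_add linear_scale algebra_simps)
  show "B v v' - psd_pivot B w v * psd_pivot B w v' = B v' v - psd_pivot B w v' * psd_pivot B w v" for v v'
   by (simp add: sym[of v v'])
  show "0 \<le> B v v - psd_pivot B w v * psd_pivot B w v" for v
   using 1[of v] by (simp add: power2_eq_square)
 qed
 show *: "B v w - psd_pivot B w v * psd_pivot B w w = 0" for v
 proof (cases "B w w = 0")
  case True
  then show ?thesis using cs[of v] by (simp add: psd_pivot_def)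
 next
  case False
  then have "B w w > 0" using nn[of w] by simp
  then show ?thesis by (simp add: psd_pivot_def)
 qed
 then show "B w v - psd_pivot B w w * psd_pivot B w v = 0" by (metis sym mult.commute)
 show "B v w = 0 \<Longrightarrow> psd_pivot B w v = 0" by (simp add: psd_pivot_def)
qed

fun cholesky_rest :: "('h::real_vector \<Rightarrow> 'h \<Rightarrow> real) \<Rightarrow> (nat \<Rightarrow> 'h) \<Rightarrow> nat \<Rightarrow> 'h \<Rightarrow> 'h \<Rightarrow> real" where
 "cholesky_rest B u 0 = B"
| "cholesky_rest B u (Suc l) = (\<lambda>v v'. cholesky_rest B u l v v'
   - psd_pivot (cholesky_rest B u l) (u l) v * psd_pivot (cholesky_rest B u l) (u l) v')"

text \<open>The rows of a Cholesky decomposition of \<open>B\<close> along the sequence \<open>u\<close>: the \<open>l\<close>-th functional vanishes on the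
  earlier vectors of the sequence, so that the coordinates of the Gaussian vector built from it are finite sums.\<close>

definition cholesky :: "('h::real_vector \<Rightarrow> 'h \<Rightarrow> real) \<Rightarrow> (nat \<Rightarrow> 'h) \<Rightarrow> nat \<Rightarrow> 'h \<Rightarrow> real" where
 "cholesky B u l = psd_pivot (cholesky_rest B u l) (u l)"

lemma psd_form_cholesky_rest: "psd_form B \<Longrightarrow> psd_form (cholesky_rest B u l)"
 by (induction l) (simp_all add: psd_pivot_step(1))

lemma cholesky_rest_vanishes:
 assumes "psd_form B" and "k < l"
 shows "cholesky_rest B u l v (u k) = 0"
 using \<open>k < l\<close>
proof (induction l arbitrary: v)
 case (Suc l)
 note P = psd_form_cholesky_rest[OF assms(1), of u l]
 show ?case
 proof (cases "k = l")
  case True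
  then show ?thesis using psd_pivot_step(2)[OF P, of v "u l"] by simp
 next
  case False
  then have "k < l" using Suc.prems by simp
  then have "cholesky_rest B u l v (u k) = 0" "cholesky_rest B u l (u l) (u k) = 0"
   by (rule Suc.IH)+
  moreover have "cholesky_rest B u l (u k) (u l) = 0"
   using calculation(2) P by (simp add: psd_form_def)
  ultimately show ?thesis using psd_pivot_step(4)[OF P, of "u k" "u l"] by simp
 qed
qed simp

lemma cholesky_vanishes: "psd_form B \<Longrightarrow> k < l \<Longrightarrow> cholesky B u l (u k) = 0"
 unfolding cholesky_def
 using psd_form_cholesky_rest[of B u l] cholesky_rest_vanishes[of B k l u "u l"]
 by (intro psd_pivot_step(4)) (auto simp: psd_form_def)

lemma linear_cholesky: "psd_form B \<Longrightarrow> linear (cholesky B u l)"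
proof -
 assume "psd_form B"
 then have P: "psd_form (cholesky_rest B u l)" by (rule psd_form_cholesky_rest)
 then have lin: "linear (cholesky_rest B u l (u l))" by (simp add: psd_form_def)
 have sym: "cholesky_rest B u l v (u l) = cholesky_rest B u l (u l) v" for v
  using P unfolding psd_form_def by blast
 have "cholesky B u l = (\<lambda>v. cholesky_rest B u l (u l) v / sqrt (cholesky_rest B u l (u l) (u l)))"
  unfolding cholesky_def psd_pivot_def by (intro ext arg_cong2[where f="(/)"] sym refl)
 then show ?thesis
  by (simp only:) (intro linearI, simp_all only: linear_add[OF lin] linear_scale[OF lin] add_divide_distrib
   real_scaleR_def times_divide_eq_right)
qed

lemma cholesky_decomposition:
 "B v v' = (\<Sum>l<N. cholesky B u l v * cholesky B u l v') + cholesky_rest B u N v v'"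
 by (induction N) (simp_all add: cholesky_def)

lemma cholesky_basis:
 assumes "psd_form B" "k < N"
 shows "B v (u k) = (\<Sum>l<N. cholesky B u l v * cholesky B u l (u k))"
 using cholesky_decomposition[of B v "u k" u N] cholesky_rest_vanishes[OF assms, of u v] by simp

lemma indep_vars_PiM_coordinates:
 assumes "\<And>i. i \<in> I \<Longrightarrow> prob_space (N i)" and "I \<noteq> {}"
 shows "prob_space.indep_vars (PiM I N) N (\<lambda>i w. w i) I"
proof -
 interpret P: prob_space "PiM I N" by (intro prob_space_PiM assms)
 show ?thesis
 proof (subst P.indep_vars_iff_distr_eq_PiM'[OF assms(2)])
  show "distr (PiM I N) (PiM I N) (\<lambda>x. \<lambda>i\<in>I. x i) = PiM I (\<lambda>i. distr (PiM I N) (N i) (\<lambda>w. w i))"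
  proof -
   have "distr (PiM I N) (PiM I N) (\<lambda>x. \<lambda>i\<in>I. x i) = distr (PiM I N) (PiM I N) (\<lambda>x. x)"
    by (intro distr_cong) (auto simp: space_PiM PiE_def extensional_restrict)
   moreover have "PiM I (\<lambda>i. distr (PiM I N) (N i) (\<lambda>w. w i)) = PiM I N"
    by (intro PiM_cong refl distr_PiM_component assms)
   ultimately show ?thesis by (simp only: distr_id)
  qed
 qed simp
qed

abbreviation gauss_seq :: "(nat \<Rightarrow> real) measure" where
 "gauss_seq \<equiv> PiM UNIV (\<lambda>_. std_normal_distribution)"

lemma prob_space_std_normal: "prob_space std_normal_distribution"
 using real_dist_normal_dist by (simp add: real_distribution_def)

lemma prob_space_gauss_seq: "prob_space gauss_seq"
 by (intro prob_space_PiM prob_space_std_normal)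

lemma coordinate_measurable [measurable]: "(\<lambda>w. w l) \<in> borel_measurable gauss_seq"
 using measurable_component_singleton[of l UNIV "\<lambda>_. std_normal_distribution"] by simp

lemma gauss_seq_component: "distr gauss_seq borel (\<lambda>w. w l) = std_normal_distribution"
proof -
 have "distr gauss_seq borel (\<lambda>w. w l) = distr gauss_seq std_normal_distribution (\<lambda>w. w l)"
  by (rule distr_cong) auto
 also have "\<dots> = std_normal_distribution"
  by (rule distr_PiM_component) (auto intro: prob_space_std_normal)
 finally show ?thesis .
qed

lemma indep_gauss_seq: "prob_space.indep_vars gauss_seq (\<lambda>_. borel) (\<lambda>l w. w l) UNIV"
proof -
 interpret prob_space gauss_seq by (rule prob_space_gauss_seq)
 have "indep_vars (\<lambda>_. std_normal_distribution) (\<lambda>l w. w l) UNIV"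
  by (rule indep_vars_PiM_coordinates) (auto intro: prob_space_std_normal)
 then have "indep_vars (\<lambda>_. borel) (\<lambda>l w. id (w l)) UNIV"
  by (rule indep_vars_compose2) auto
 then show ?thesis by simp
qed

lemma gauss_seq_square:
 "integrable gauss_seq (\<lambda>w. (w l)^2)" "(\<integral>w. (w l)^2 \<partial>gauss_seq) = 1"
 "integrable gauss_seq (\<lambda>w. w l)" "(\<integral>w. w l \<partial>gauss_seq) = 0"
proof -
 have "integrable (distr gauss_seq borel (\<lambda>w. w l)) (\<lambda>x. x ^ k)" for k
  unfolding gauss_seq_component by (rule integrable_std_normal_distribution_moment)
 from integrable_distr[OF coordinate_measurable this]
 have i: "integrable gauss_seq (\<lambda>w. (w l) ^ k)" for k by simp
 show "integrable gauss_seq (\<lambda>w. (w l)^2)" "integrable gauss_seq (\<lambda>w. w l)"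
  using i[of 2] i[of 1] by simp_all
 have e: "(\<integral>w. (w l) ^ k \<partial>gauss_seq) = (\<integral>x. x ^ k \<partial>std_normal_distribution)" for k
 proof -
  have "(\<integral>x. x ^ k \<partial>distr gauss_seq borel (\<lambda>w. w l)) = (\<integral>w. (w l) ^ k \<partial>gauss_seq)"
   by (rule integral_distr) auto
  then show ?thesis by (simp only: gauss_seq_component)
 qed
 show "(\<integral>w. (w l)^2 \<partial>gauss_seq) = 1" "(\<integral>w. w l \<partial>gauss_seq) = 0"
  using e[of 2] e[of 1] std_normal_distribution_even_moments(1)[of 1]
   integral_std_normal_distribution_moment_odd[of 1]
  by simp_all
qed

lemma gauss_seq_linear_square:
 "integrable gauss_seq (\<lambda>w. (\<Sum>l<N. c l * w l)^2)"
 "(\<integral>w. (\<Sum>l<N. c l * w l)^2 \<partial>gauss_seq) = (\<Sum>l<N. (c l)^2)"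
proof -
 interpret prob_space gauss_seq by (rule prob_space_gauss_seq)
 have ip: "integrable gauss_seq (\<lambda>w. w j * w l) \<and> (\<integral>w. w j * w l \<partial>gauss_seq) = (if j = l then 1 else 0)" for j l
 proof (cases "j = l")
  case True
  then show ?thesis using gauss_seq_square[of l] by (simp add: power2_eq_square)
 next
  case False
  have "indep_vars (\<lambda>_. borel) (\<lambda>l w. w l) {j, l}"
   by (rule indep_vars_subset[OF indep_gauss_seq]) simp
  then have "(\<integral>w. (\<Prod>i\<in>{j, l}. w i) \<partial>gauss_seq) = (\<Prod>i\<in>{j, l}. \<integral>w. w i \<partial>gauss_seq)"
   and "integrable gauss_seq (\<lambda>w. \<Prod>i\<in>{j, l}. w i)"
   by (intro indep_vars_lebesgue_integral indep_vars_integrable; simp add: gauss_seq_square)+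
  then show ?thesis using False by (simp add: gauss_seq_square)
 qed
 have sq: "(\<Sum>l<N. c l * w l)^2 = (\<Sum>j<N. \<Sum>l<N. c j * c l * (w j * w l))" for w :: "nat \<Rightarrow> real"
  unfolding power2_eq_square sum_product by (intro sum.cong) (auto simp: algebra_simps)
 show "integrable gauss_seq (\<lambda>w. (\<Sum>l<N. c l * w l)^2)"
  unfolding sq using ip by (intro Bochner_Integration.integrable_sum integrable_mult_right) auto
 show "(\<integral>w. (\<Sum>l<N. c l * w l)^2 \<partial>gauss_seq) = (\<Sum>l<N. (c l)^2)"
  unfolding sq using ip
  by (simp add: Bochner_Integration.integral_sum if_distrib[of "\<lambda>x. _ * x"] power2_eq_square cong: if_cong)
qed

lemma gauss_seq_linear_char:
 "(CLINT w|gauss_seq. iexp (\<Sum>l<N. c l * w l)) = complex_of_real (exp (- (\<Sum>l<N. (c l)^2) / 2))"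
proof -
 interpret prob_space gauss_seq by (rule prob_space_gauss_seq)
 have one: "(CLINT w|gauss_seq. iexp (c l * w l)) = complex_of_real (exp (- (c l)\<^sup>2 / 2))" for l
 proof -
  have "char (distr gauss_seq borel (\<lambda>w. w l)) (c l) = (CLINT w|gauss_seq. iexp (c l * w l))"
   unfolding char_def by (subst integral_distr) auto
  then show ?thesis by (simp add: gauss_seq_component char_std_normal_distribution)
 qed
 have ind: "indep_vars (\<lambda>_. borel) (\<lambda>l w. iexp (c l * w l)) {..<N}"
  by (rule indep_vars_compose2[OF indep_vars_subset[OF indep_gauss_seq]]) auto
 have "(CLINT w|gauss_seq. iexp (\<Sum>l<N. c l * w l)) = (CLINT w|gauss_seq. (\<Prod>l<N. iexp (c l * w l)))"
  by (simp add: sum_distrib_left exp_sum)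
 also have "\<dots> = (\<Prod>l<N. CLINT w|gauss_seq. iexp (c l * w l))"
  by (rule indep_vars_lebesgue_integral[OF _ ind]) (auto intro!: integrable_iexp simp del: of_real_mult)
 also have "\<dots> = complex_of_real (\<Prod>l<N. exp (- (c l)\<^sup>2 / 2))"
  by (simp only: one of_real_prod)
 also have "(\<Prod>l<N. exp (- (c l)\<^sup>2 / 2)) = exp (- (\<Sum>l<N. (c l)^2) / 2)"
  by (simp add: exp_sum[symmetric] sum_negf sum_divide_distrib)
 finally show ?thesis .
qed

context separable_hilbert_basis
begin

text \<open>The \<open>k\<close>-th coordinate of the random vector is the sum over \<open>l \<le> k\<close> of \<open>cholesky B u l (u k)\<close> times the
  \<open>l\<close>-th normal variable. Its second moment is \<open>C (u k) \<bullet> u k\<close>, so the trace condition makes the sum of the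
  squared coordinates integrable, and the theorem of Riesz and Fischer yields the vector.\<close>

theorem gaussian_measure_exists:
 fixes C :: "'h \<Rightarrow> 'h" 
 assumes C: "bounded_linear C" and sym: "\<And>v y. C v \<bullet> y = v \<bullet> C y" and nn: "\<And>v. 0 \<le> C v \<bullet> v"
  and tr: "summable (\<lambda>k. C (u k) \<bullet> u k)"
 shows "\<exists>\<mu>. gaussian_measure 0 C \<mu>"
proof -
 interpret prob_space gauss_seq by (rule prob_space_gauss_seq)
 define B where "B = (\<lambda>v y. C v \<bullet> y)"
 interpret C: bounded_linear C by fact
 have B: "psd_form B"
  unfolding psd_form_def B_def using nn sym
  by (auto intro!: linearI simp: inner_add_right inner_commute)
 define L where "L = cholesky B u"
 have lin: "linear (L l)" for l unfolding L_def by (rule linear_cholesky[OF B])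
 define \<gamma> where "\<gamma> k w = (\<Sum>l<Suc k. L l (u k) * w l)" for k and w :: "nat \<Rightarrow> real"
 define G where "G w = (\<Sum>k. \<gamma> k w *\<^sub>R u k)" for w
 have \<gamma>_meas [measurable]: "\<gamma> k \<in> borel_measurable gauss_seq" for k unfolding \<gamma>_def by measurable
 have G_meas [measurable]: "G \<in> borel_measurable gauss_seq" unfolding G_def by measurable
 have var: "(\<Sum>l<Suc k. (L l (u k))^2) = C (u k) \<bullet> u k" for k
  using cholesky_basis[OF B, of k "Suc k" "u k" u] by (simp add: L_def B_def power2_eq_square)
 have "(\<integral>\<^sup>+w. (\<Sum>k. ennreal ((\<gamma> k w)^2)) \<partial>gauss_seq) = (\<Sum>k. \<integral>\<^sup>+w. ennreal ((\<gamma> k w)^2) \<partial>gauss_seq)"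
  by (rule nn_integral_suminf) measurable
 also have "\<dots> = (\<Sum>k. ennreal (C (u k) \<bullet> u k))"
 proof (intro suminf_cong)
  fix k
  have "(\<integral>\<^sup>+w. ennreal ((\<gamma> k w)^2) \<partial>gauss_seq) = ennreal (\<integral>w. (\<gamma> k w)^2 \<partial>gauss_seq)"
   unfolding \<gamma>_def by (intro nn_integral_eq_integral gauss_seq_linear_square) auto
  then show "(\<integral>\<^sup>+w. ennreal ((\<gamma> k w)^2) \<partial>gauss_seq) = ennreal (C (u k) \<bullet> u k)"
   unfolding \<gamma>_def gauss_seq_linear_square var .
 qed
 also have "\<dots> = ennreal (\<Sum>k. C (u k) \<bullet> u k)" using nn tr by (intro suminf_ennreal2) auto
 finally have "(\<integral>\<^sup>+w. (\<Sum>k. ennreal ((\<gamma> k w)^2)) \<partial>gauss_seq) \<noteq> \<infinity>" by simp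
 then have "AE w in gauss_seq. (\<Sum>k. ennreal ((\<gamma> k w)^2)) \<noteq> \<infinity>"
  by (intro nn_integral_PInf_AE) measurable
 then have summ: "AE w in gauss_seq. summable (\<lambda>k. (\<gamma> k w)^2)"
  by eventually_elim (auto intro!: summable_suminf_not_top)
 define \<mu> where "\<mu> = distr gauss_seq borel G"
 have "(CLINT z|\<mu>. iexp (z \<bullet> v)) = exp (\<i> * complex_of_real (0 \<bullet> v) - complex_of_real (C v \<bullet> v / 2))" for v
 proof -
  have lim1: "(\<lambda>N. CLINT w|gauss_seq. iexp (\<Sum>k<N. \<gamma> k w * (v \<bullet> u k)))
    \<longlonglongrightarrow> (CLINT w|gauss_seq. iexp (G w \<bullet> v))"
  proof (rule integral_dominated_convergence[where w="\<lambda>_. 1"])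
   show "AE w in gauss_seq. (\<lambda>N. iexp (\<Sum>k<N. \<gamma> k w * (v \<bullet> u k))) \<longlonglongrightarrow> iexp (G w \<bullet> v)"
    using summ
   proof eventually_elim
    case (elim w)
    have "(\<lambda>N. (\<Sum>k<N. \<gamma> k w *\<^sub>R u k) \<bullet> v) \<longlonglongrightarrow> G w \<bullet> v"
     unfolding G_def by (intro tendsto_intros summable_LIMSEQ riesz_fischer(1)[OF elim])
    then have "(\<lambda>N. \<Sum>k<N. \<gamma> k w * (v \<bullet> u k)) \<longlonglongrightarrow> G w \<bullet> v"
     by (simp add: inner_sum_left inner_commute[of v])
    then show ?case by (intro tendsto_intros)
   qed
  qed auto
  have "(CLINT w|gauss_seq. iexp (\<Sum>k<N. \<gamma> k w * (v \<bullet> u k)))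
   = complex_of_real (exp (- (C (proj N v) \<bullet> proj N v) / 2))" for N
  proof -
   have "(\<Sum>k<N. \<gamma> k w * (v \<bullet> u k)) = (\<Sum>l<N. L l (proj N v) * w l)" for w
   proof -
    have "\<gamma> k w = (\<Sum>l<N. L l (u k) * w l)" if "k < N" for k
     unfolding \<gamma>_def L_def using that
     by (intro sum.mono_neutral_left) (auto simp: cholesky_vanishes[OF B])
    then have "(\<Sum>k<N. \<gamma> k w * (v \<bullet> u k)) = (\<Sum>k<N. \<Sum>l<N. L l (u k) * w l * (v \<bullet> u k))"
     by (simp add: sum_distrib_right)
    also have "\<dots> = (\<Sum>l<N. \<Sum>k<N. L l (u k) * w l * (v \<bullet> u k))" by (rule sum.swap)
    also have "\<dots> = (\<Sum>l<N. L l (proj N v) * w l)"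
     unfolding proj_def linear_sum[OF lin] linear_scale[OF lin] sum_distrib_right
     by (simp add: mult.commute mult.left_commute)
    finally show ?thesis .
   qed
   moreover have "(\<Sum>l<N. (L l (proj N v))^2) = C (proj N v) \<bullet> proj N v"
   proof -
    have "linear (cholesky_rest B u N (proj N v))"
     using psd_form_cholesky_rest[OF B] by (simp add: psd_form_def)
    then have "cholesky_rest B u N (proj N v) (proj N v) = 0"
     by (subst (2) proj_def) (simp add: linear_sum linear_scale cholesky_rest_vanishes[OF B])
    then show ?thesis
     using cholesky_decomposition[of B "proj N v" "proj N v" u N]
     by (simp add: L_def B_def power2_eq_square)
   qed
   ultimately show ?thesis by (simp only: gauss_seq_linear_char)
  qed
  moreover have "(\<lambda>N. complex_of_real (exp (- (C (proj N v) \<bullet> proj N v) / 2)))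
    \<longlonglongrightarrow> complex_of_real (exp (- (C v \<bullet> v) / 2))"
   by (intro tendsto_intros C.tendsto proj_tendsto) simp
  ultimately have "(CLINT w|gauss_seq. iexp (G w \<bullet> v)) = complex_of_real (exp (- (C v \<bullet> v) / 2))"
   using lim1 LIMSEQ_unique by simp
  then show ?thesis unfolding \<mu>_def by (subst integral_distr) (auto simp: exp_of_real[symmetric])
 qed
 moreover have "prob_space \<mu>" unfolding \<mu>_def by (rule prob_space_distr) measurable
 ultimately show ?thesis by (intro exI[of _ \<mu>]) (auto simp: gaussian_measure_def \<mu>_def)
qed

end

section \<open>Weak convergence in a Hilbert space from characteristic functionals\<close>

lemma bounded_range_obtain:
 fixes f :: "'x \<Rightarrow> 'y::real_normed_vector"
 assumes "bounded (range f)"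
 obtains c where "0 < c" "\<And>z. norm (f z) \<le> c"
 using assms by (auto simp: bounded_pos)

context
 fixes m :: "'h::{real_inner,second_countable_topology} measure" and g :: "'h \<Rightarrow> real" and w :: 'h and B :: real
 assumes m: "prob_space m" and sets_m [measurable_cong]: "sets m = sets borel"
  and g [measurable]: "g \<in> borel_measurable borel" and g1: "\<And>z. 1 \<le> g z" and gB: "\<And>z. g z \<le> B"
begin

text \<open>A weight \<open>g\<close> with \<open>1 \<le> g \<le> B\<close>, normalised by its mean, turns \<open>m\<close> into another probability measure, and
  the image of it under \<open>z \<mapsto> z \<bullet> w\<close> is a law on the real line, to which the continuity theorem of Levy applies.\<close>

definition tilted :: "real measure" where
 "tilted = distr (density m (\<lambda>z. ennreal (g z / (\<integral>z. g z \<partial>m)))) borel (\<lambda>z. z \<bullet> w)"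

lemma tilt_integrable:
 fixes F :: "'h \<Rightarrow> 'y::{banach,second_countable_topology}"
 assumes "F \<in> borel_measurable borel" "\<And>z. norm (F z) \<le> c"
 shows "integrable m F"
 by (rule finite_measure.integrable_const_bound[where B=c])
   (use assms m in \<open>auto simp: prob_space_def\<close>)

lemma tilt_mass: "1 \<le> (\<integral>z. g z \<partial>m)"
proof -
 interpret prob_space m by (rule m)
 have "(\<integral>z. 1 \<partial>m) \<le> (\<integral>z. g z \<partial>m)"
  by (rule integral_mono) (use g1 gB in \<open>auto intro!: tilt_integrable[where c=B] simp: abs_le_iff intro: order_trans[of _ 1]\<close>,
   smt (verit) g1 gB)
 then show ?thesis using prob_space by simp
qed

lemma tilted_integral:
 fixes F :: "real \<Rightarrow> 'y::{banach,second_countable_topology}"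
 assumes [measurable]: "F \<in> borel_measurable borel"
 shows "(\<integral>y. F y \<partial>tilted) = (\<integral>z. g z *\<^sub>R F (z \<bullet> w) \<partial>m) /\<^sub>R (\<integral>z. g z \<partial>m)"
proof -
 have [measurable]: "(\<lambda>z. z \<bullet> w) \<in> borel_measurable borel" by simp
 have nn: "0 \<le> g z / (\<integral>z. g z \<partial>m)" for z using g1[of z] tilt_mass by simp
 have "(\<integral>y. F y \<partial>tilted) = (\<integral>z. F (z \<bullet> w) \<partial>density m (\<lambda>z. ennreal (g z / (\<integral>z. g z \<partial>m))))"
  unfolding tilted_def by (intro integral_distr) (measurable)
 also have "\<dots> = (\<integral>z. (g z / (\<integral>z. g z \<partial>m)) *\<^sub>R F (z \<bullet> w) \<partial>m)"
  by (intro integral_density) (use nn in \<open>auto\<close>)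
 also have "\<dots> = (\<integral>z. (g z *\<^sub>R F (z \<bullet> w)) /\<^sub>R (\<integral>z. g z \<partial>m) \<partial>m)"
  by (simp add: divide_inverse mult.commute)
 also have "\<dots> = (\<integral>z. g z *\<^sub>R F (z \<bullet> w) \<partial>m) /\<^sub>R (\<integral>z. g z \<partial>m)"
  by (rule integral_scaleR_right)
 finally show ?thesis .
qed

lemma tilted_real_distribution: "real_distribution tilted"
proof -
 interpret prob_space m by (rule m)
 have nn: "0 \<le> g z / (\<integral>z. g z \<partial>m)" for z using g1[of z] tilt_mass by simp
 have int: "integrable m g"
  by (rule tilt_integrable[where c=B]) (use g1 gB in \<open>auto simp: abs_le_iff\<close>, smt (verit) g1 gB)
 have "emeasure (density m (\<lambda>z. ennreal (g z / (\<integral>z. g z \<partial>m)))) (space m)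
   = (\<integral>\<^sup>+z. ennreal (g z / (\<integral>z. g z \<partial>m)) \<partial>m)"
  by (subst emeasure_density) (auto intro!: nn_integral_cong)
 also have "\<dots> = ennreal (\<integral>z. g z / (\<integral>z. g z \<partial>m) \<partial>m)"
  by (rule nn_integral_eq_integral) (use int nn in auto)
 also have "\<dots> = 1" using tilt_mass by simp
 finally have "prob_space (density m (\<lambda>z. ennreal (g z / (\<integral>z. g z \<partial>m))))"
  by (intro prob_spaceI) simp
 then have "prob_space tilted"
  unfolding tilted_def by (rule prob_space.prob_space_distr) measurable
 then show ?thesis
  by (simp add: real_distribution_def real_distribution_axioms_def tilted_def)
qed

end

locale char_convergence =
 fixes \<mu> :: "nat \<Rightarrow> 'h::{real_inner,banach,second_countable_topology} measure" and \<nu> :: "'h measure"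
 assumes prob_\<mu>: "prob_space (\<mu> n)" and prob_\<nu>: "prob_space \<nu>"
  and sets_\<mu> [measurable_cong]: "sets (\<mu> n) = sets borel" and sets_\<nu> [measurable_cong]: "sets \<nu> = sets borel"
  and char_tendsto: "(\<lambda>n. CLINT z|\<mu> n. iexp (z \<bullet> v)) \<longlonglongrightarrow> (CLINT z|\<nu>. iexp (z \<bullet> v))"
begin

lemma integrable_bounded:
 fixes F :: "'h \<Rightarrow> 'y::{banach,second_countable_topology}"
 assumes "F \<in> borel_measurable borel" "\<And>z. norm (F z) \<le> c"
 shows "integrable (\<mu> n) F" "integrable \<nu> F"
 by (rule finite_measure.integrable_const_bound[where B=c],
   use assms prob_\<mu> prob_\<nu> in \<open>auto simp: prob_space_def\<close>)+

lemma tilted_tendsto: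
 assumes g [measurable]: "g \<in> borel_measurable borel" and g1: "\<And>z. 1 \<le> g z" and gB: "\<And>z. g z \<le> B"
  and conv: "\<And>t. (\<lambda>n. CLINT z|\<mu> n. of_real (g z) * iexp (t * (z \<bullet> w))) \<longlonglongrightarrow>
   (CLINT z|\<nu>. of_real (g z) * iexp (t * (z \<bullet> w)))"
  and \<theta>: "continuous_on UNIV \<theta>" "\<And>s::real. \<bar>\<theta> s\<bar> \<le> c"
 shows "(\<lambda>n. \<integral>z. g z * \<theta> (z \<bullet> w) \<partial>\<mu> n) \<longlonglongrightarrow> (\<integral>z. g z * \<theta> (z \<bullet> w) \<partial>\<nu>)"
proof -
 have [measurable]: "\<theta> \<in> borel_measurable borel" using \<theta>(1) by (rule borel_measurable_continuous_onI)
 have iG: "integrable (\<mu> n) g" "integrable \<nu> g" for n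
  by (rule integrable_bounded[where c=B]; use g1 gB in \<open>auto simp: abs_le_iff\<close>; smt (verit) g1 gB)+
 note T = tilted_integral[OF prob_\<mu> sets_\<mu> g g1 gB] tilted_integral[OF prob_\<nu> sets_\<nu> g g1 gB]
 note mass = tilt_mass[OF prob_\<mu> sets_\<mu> g g1 gB] tilt_mass[OF prob_\<nu> sets_\<nu> g g1 gB]
 have mass_tendsto: "(\<lambda>n. \<integral>z. g z \<partial>\<mu> n) \<longlonglongrightarrow> (\<integral>z. g z \<partial>\<nu>)"
  using conv[of 0] by (simp add: tendsto_of_real_iff)
 have "char (tilted (\<mu> n) g w) t = (CLINT z|\<mu> n. of_real (g z) * iexp (t * (z \<bullet> w))) /\<^sub>R (\<integral>z. g z \<partial>\<mu> n)" for n t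
  unfolding char_def by (subst T) (auto simp: scaleR_conv_of_real)
 moreover have "char (tilted \<nu> g w) t = (CLINT z|\<nu>. of_real (g z) * iexp (t * (z \<bullet> w))) /\<^sub>R (\<integral>z. g z \<partial>\<nu>)" for t
  unfolding char_def by (subst T) (auto simp: scaleR_conv_of_real)
 moreover have "(\<lambda>n. (CLINT z|\<mu> n. of_real (g z) * iexp (t * (z \<bullet> w))) /\<^sub>R (\<integral>z. g z \<partial>\<mu> n)) \<longlonglongrightarrow>
   (CLINT z|\<nu>. of_real (g z) * iexp (t * (z \<bullet> w))) /\<^sub>R (\<integral>z. g z \<partial>\<nu>)" for t
  using mass(2) by (intro tendsto_intros conv mass_tendsto) auto
 ultimately have wc: "weak_conv_m (\<lambda>n. tilted (\<mu> n) g w) (tilted \<nu> g w)"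
  by (intro levy_continuity tilted_real_distribution[OF prob_\<mu> sets_\<mu> g g1 gB]
    tilted_real_distribution[OF prob_\<nu> sets_\<nu> g g1 gB]) simp
 have "(\<lambda>n. \<integral>y. \<theta> y \<partial>tilted (\<mu> n) g w) \<longlonglongrightarrow> (\<integral>y. \<theta> y \<partial>tilted \<nu> g w)"
  by (rule weak_conv_imp_integral_bdd_continuous_conv[OF _ _ wc, where B=c])
   (use \<theta> in \<open>auto simp: continuous_on_eq_continuous_at
    intro: tilted_real_distribution[OF prob_\<mu> sets_\<mu> g g1 gB] tilted_real_distribution[OF prob_\<nu> sets_\<nu> g g1 gB]\<close>)
 then have "(\<lambda>n. (\<integral>z. g z \<partial>\<mu> n) * ((\<integral>z. g z * \<theta> (z \<bullet> w) \<partial>\<mu> n) / (\<integral>z. g z \<partial>\<mu> n)))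
   \<longlonglongrightarrow> (\<integral>z. g z \<partial>\<nu>) * ((\<integral>z. g z * \<theta> (z \<bullet> w) \<partial>\<nu>) / (\<integral>z. g z \<partial>\<nu>))"
  by (intro tendsto_mult mass_tendsto) (simp add: T divide_inverse mult.commute)
 moreover have "(\<integral>z. g z \<partial>\<mu> n) \<noteq> 0" for n using mass(1)[of n] by linarith
 moreover have "(\<integral>z. g z \<partial>\<nu>) \<noteq> 0" using mass(2) by linarith
 ultimately show ?thesis by simp
qed

text \<open>The weights \<open>\<rho>\<close> for which the characteristic functionals of the signed measures with density
 \<open>\<rho>\<close> converge.\<close>

definition steady :: "('h \<Rightarrow> real) \<Rightarrow> bool" where
 "steady \<rho> \<longleftrightarrow> \<rho> \<in> borel_measurable borel \<and> bounded (range \<rho>) \<and>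
   (\<forall>v. (\<lambda>n. CLINT z|\<mu> n. of_real (\<rho> z) * iexp (z \<bullet> v)) \<longlonglongrightarrow> (CLINT z|\<nu>. of_real (\<rho> z) * iexp (z \<bullet> v)))"

lemma steady_one: "steady (\<lambda>_. 1)"
 using char_tendsto by (simp add: steady_def)

lemma steady_tendsto: "steady \<rho> \<Longrightarrow> (\<lambda>n. \<integral>z. \<rho> z \<partial>\<mu> n) \<longlonglongrightarrow> (\<integral>z. \<rho> z \<partial>\<nu>)"
 unfolding steady_def by (drule conjunct2, drule conjunct2, drule spec[of _ 0]) (simp add: tendsto_of_real_iff)

lemma steady_integrable:
 assumes "steady \<rho>"
 shows "integrable (\<mu> n) (\<lambda>z. of_real (\<rho> z) * iexp (z \<bullet> v))" "integrable \<nu> (\<lambda>z. of_real (\<rho> z) * iexp (z \<bullet> v))"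
  and "integrable (\<mu> n) \<rho>" "integrable \<nu> \<rho>"
proof -
 have [measurable]: "\<rho> \<in> borel_measurable borel" and b: "bounded (range \<rho>)"
  using assms by (auto simp: steady_def)
 obtain c where c: "0 < c" "\<And>z. norm (\<rho> z) \<le> c" using bounded_range_obtain[OF b] by blast
 show "integrable (\<mu> n) (\<lambda>z. of_real (\<rho> z) * iexp (z \<bullet> v))" "integrable \<nu> (\<lambda>z. of_real (\<rho> z) * iexp (z \<bullet> v))"
  by (rule integrable_bounded[where c=c]; use c in \<open>auto simp: norm_mult\<close>)+
 show "integrable (\<mu> n) \<rho>" "integrable \<nu> \<rho>"
  by (rule integrable_bounded[where c=c]; use c in \<open>auto\<close>)+
qed

lemma steady_add:
 assumes "steady \<rho>" "steady \<rho>'"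
 shows "steady (\<lambda>z. \<rho> z + \<rho>' z)"
proof -
 have "bounded (range (\<lambda>z. \<rho> z + \<rho>' z))"
  using assms bounded_plus_comp[of \<rho> UNIV \<rho>'] by (simp add: steady_def)
 moreover have "(\<lambda>n. (CLINT z|\<mu> n. of_real (\<rho> z) * iexp (z \<bullet> v)) + (CLINT z|\<mu> n. of_real (\<rho>' z) * iexp (z \<bullet> v)))
  \<longlonglongrightarrow> (CLINT z|\<nu>. of_real (\<rho> z) * iexp (z \<bullet> v)) + (CLINT z|\<nu>. of_real (\<rho>' z) * iexp (z \<bullet> v))" for v
  using assms by (intro tendsto_add) (auto simp: steady_def)
 ultimately show ?thesis
  using assms steady_integrable[OF assms(1)] steady_integrable[OF assms(2)]
  by (auto simp: steady_def distrib_right Bochner_Integration.integral_add)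
qed

lemma steady_scale:
 assumes "steady \<rho>"
 shows "steady (\<lambda>z. a * \<rho> z)"
proof -
 have "bounded (range (\<lambda>z. a * \<rho> z))"
  using assms bounded_scaling[of "range \<rho>" a] by (simp add: steady_def image_image)
 moreover have "(\<lambda>n. of_real a * (CLINT z|\<mu> n. of_real (\<rho> z) * iexp (z \<bullet> v)))
  \<longlonglongrightarrow> of_real a * (CLINT z|\<nu>. of_real (\<rho> z) * iexp (z \<bullet> v))" for v
  using assms by (intro tendsto_mult tendsto_const) (auto simp: steady_def)
 ultimately show ?thesis using assms by (auto simp: steady_def mult.assoc)
qed

text \<open>A product of a trigonometric function with a character is a combination of two characters.\<close>

lemma steady_trig:
 assumes "steady \<rho>"
 shows "steady (\<lambda>z. \<rho> z * cos (z \<bullet> v))" "steady (\<lambda>z. \<rho> z * sin (z \<bullet> v))"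
proof -
 have [measurable]: "\<rho> \<in> borel_measurable borel" and b: "bounded (range \<rho>)"
  using assms by (auto simp: steady_def)
 obtain c where c: "0 < c" "\<And>z. \<bar>\<rho> z\<bar> \<le> c" using bounded_range_obtain[OF b] by (metis real_norm_def)
 have bd: "\<bar>\<rho> z * s\<bar> \<le> c" if "\<bar>s\<bar> \<le> 1" for s z
  using mult_mono[OF c(2)[of z] that] c(1) by (simp add: abs_mult)
 have conv: "(\<lambda>n. CLINT z|\<mu> n. of_real (\<rho> z) * iexp (z \<bullet> v)) \<longlonglongrightarrow> (CLINT z|\<nu>. of_real (\<rho> z) * iexp (z \<bullet> v))" for v
  using assms by (simp add: steady_def)
 have cos: "of_real (\<rho> z * cos (z \<bullet> v)) * iexp (z \<bullet> w)
  = (1/2) * (of_real (\<rho> z) * iexp (z \<bullet> (w + v)) + of_real (\<rho> z) * iexp (z \<bullet> (w - v)))" for z w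
  by (simp add: inner_add_right inner_diff_right cos_of_real[symmetric] cos_exp_eq algebra_simps exp_add exp_diff exp_minus)
    (simp add: field_simps)?
 have sin: "of_real (\<rho> z * sin (z \<bullet> v)) * iexp (z \<bullet> w)
  = (1/(2*\<i>)) * (of_real (\<rho> z) * iexp (z \<bullet> (w + v)) - of_real (\<rho> z) * iexp (z \<bullet> (w - v)))" for z w
  by (simp add: inner_add_right inner_diff_right sin_of_real[symmetric] sin_exp_eq algebra_simps exp_add exp_diff exp_minus)
    (simp add: field_simps)?
 show "steady (\<lambda>z. \<rho> z * cos (z \<bullet> v))"
  unfolding steady_def
 proof (intro conjI allI)
  show "bounded (range (\<lambda>z. \<rho> z * cos (z \<bullet> v)))" by (intro boundedI[where B=c]) (use bd in auto)
  show "(\<lambda>n. CLINT z|\<mu> n. of_real (\<rho> z * cos (z \<bullet> v)) * iexp (z \<bullet> w)) \<longlonglongrightarrow>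
    (CLINT z|\<nu>. of_real (\<rho> z * cos (z \<bullet> v)) * iexp (z \<bullet> w))" for w
   unfolding cos integral_mult_right_zero Bochner_Integration.integral_add[OF steady_integrable(1)[OF assms] steady_integrable(1)[OF assms]]
    Bochner_Integration.integral_add[OF steady_integrable(2)[OF assms] steady_integrable(2)[OF assms]]
   by (intro tendsto_intros conv)
 qed simp
 show "steady (\<lambda>z. \<rho> z * sin (z \<bullet> v))"
  unfolding steady_def
 proof (intro conjI allI)
  show "bounded (range (\<lambda>z. \<rho> z * sin (z \<bullet> v)))" by (intro boundedI[where B=c]) (use bd in auto)
  show "(\<lambda>n. CLINT z|\<mu> n. of_real (\<rho> z * sin (z \<bullet> v)) * iexp (z \<bullet> w)) \<longlonglongrightarrow>
    (CLINT z|\<nu>. of_real (\<rho> z * sin (z \<bullet> v)) * iexp (z \<bullet> w))" for w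
   unfolding sin integral_mult_right_zero Bochner_Integration.integral_diff[OF steady_integrable(1)[OF assms] steady_integrable(1)[OF assms]]
    Bochner_Integration.integral_diff[OF steady_integrable(2)[OF assms] steady_integrable(2)[OF assms]]
   by (intro tendsto_intros conv)
 qed simp
qed

text \<open>Adding a constant to the weight makes it at least 1; then the tilted laws converge weakly and
  \<open>\<theta>\<close> is a bounded continuous test function for them.\<close>

lemma steady_tendsto_mult:
 assumes "steady \<rho>" and \<theta>: "continuous_on UNIV \<theta>" "\<And>s::real. \<bar>\<theta> s\<bar> \<le> c"
 shows "(\<lambda>n. \<integral>z. \<rho> z * \<theta> (z \<bullet> w) \<partial>\<mu> n) \<longlonglongrightarrow> (\<integral>z. \<rho> z * \<theta> (z \<bullet> w) \<partial>\<nu>)"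
proof -
 have [measurable]: "\<rho> \<in> borel_measurable borel" and b: "bounded (range \<rho>)"
  using assms by (auto simp: steady_def)
 have [measurable]: "\<theta> \<in> borel_measurable borel" using \<theta>(1) by (rule borel_measurable_continuous_onI)
 obtain B where B: "0 < B" "\<And>z. \<bar>\<rho> z\<bar> \<le> B" using bounded_range_obtain[OF b] by (metis real_norm_def)
 have pos: "(\<lambda>n. \<integral>z. g z * \<theta> (z \<bullet> w) \<partial>\<mu> n) \<longlonglongrightarrow> (\<integral>z. g z * \<theta> (z \<bullet> w) \<partial>\<nu>)"
  if "steady g" "\<And>z. 1 \<le> g z" "\<And>z. g z \<le> b" for g b
 proof (rule tilted_tendsto[OF _ that(2,3) _ \<theta>])
  show "(\<lambda>n. CLINT z|\<mu> n. of_real (g z) * iexp (t * (z \<bullet> w))) \<longlonglongrightarrow> (CLINT z|\<nu>. of_real (g z) * iexp (t * (z \<bullet> w)))" for t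
   using that(1) unfolding steady_def by (elim conjE allE[of _ "t *\<^sub>R w"]) simp
 qed (use that(1) in \<open>simp add: steady_def\<close>)
 have "steady (\<lambda>z. \<rho> z + (B + 1) * 1)"
  by (intro steady_add steady_scale assms(1) steady_one)
 then have "(\<lambda>n. \<integral>z. (\<rho> z + (B + 1) * 1) * \<theta> (z \<bullet> w) \<partial>\<mu> n) \<longlonglongrightarrow> (\<integral>z. (\<rho> z + (B + 1) * 1) * \<theta> (z \<bullet> w) \<partial>\<nu>)"
  by (rule pos[where b="2 * B + 1"]) (use B(2) in \<open>smt (verit)\<close>)+
 moreover have "(\<lambda>n. \<integral>z. 1 * \<theta> (z \<bullet> w) \<partial>\<mu> n) \<longlonglongrightarrow> (\<integral>z. 1 * \<theta> (z \<bullet> w) \<partial>\<nu>)"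
  by (rule pos[OF steady_one, where b=1]) auto
 ultimately have L: "(\<lambda>n. (\<integral>z. (\<rho> z + (B + 1) * 1) * \<theta> (z \<bullet> w) \<partial>\<mu> n) - (B + 1) * (\<integral>z. 1 * \<theta> (z \<bullet> w) \<partial>\<mu> n)) \<longlonglongrightarrow>
   (\<integral>z. (\<rho> z + (B + 1) * 1) * \<theta> (z \<bullet> w) \<partial>\<nu>) - (B + 1) * (\<integral>z. 1 * \<theta> (z \<bullet> w) \<partial>\<nu>)"
  by (intro tendsto_intros)
 have c0: "0 \<le> c" using \<theta>(2)[of 0] by linarith
 have "\<bar>\<rho> z * \<theta> (z \<bullet> w)\<bar> \<le> B * c" for z
  unfolding abs_mult by (intro mult_mono B \<theta>) (use B(1) in auto)
 then have i: "integrable (\<mu> n) (\<lambda>z. \<rho> z * \<theta> (z \<bullet> w))" "integrable \<nu> (\<lambda>z. \<rho> z * \<theta> (z \<bullet> w))" for n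
  by (intro integrable_bounded[where c="B * c"]; simp)+
 have j: "integrable (\<mu> n) (\<lambda>z. \<theta> (z \<bullet> w))" "integrable \<nu> (\<lambda>z. \<theta> (z \<bullet> w))" for n
  by (intro integrable_bounded[where c="c"]; simp add: \<theta>)+
 show ?thesis using L by (simp add: distrib_right i j)
qed

text \<open>The multiplier \<open>\<theta>\<close> is tested after the weight has absorbed the trigonometric factor, so that
  products of functions of single coordinates are reached one factor at a time.\<close>

lemma steady_mult:
 assumes "steady \<rho>" and \<theta>: "continuous_on UNIV \<theta>" "\<And>s::real. \<bar>\<theta> s\<bar> \<le> c"
 shows "steady (\<lambda>z. \<rho> z * \<theta> (z \<bullet> w))"
proof -
 have [measurable]: "\<rho> \<in> borel_measurable borel" and b: "bounded (range \<rho>)"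
  using assms by (auto simp: steady_def)
 have [measurable]: "\<theta> \<in> borel_measurable borel" using \<theta>(1) by (rule borel_measurable_continuous_onI)
 obtain B where B: "0 < B" "\<And>z. \<bar>\<rho> z\<bar> \<le> B" using bounded_range_obtain[OF b] by (metis real_norm_def)
 have c0: "0 \<le> c" using \<theta>(2)[of 0] by linarith
 have bd: "\<bar>\<rho> z * \<theta> (z \<bullet> w)\<bar> \<le> B * c" for z
  unfolding abs_mult by (intro mult_mono B \<theta>) (use B(1) in auto)
 have bd': "\<bar>\<rho> z * \<theta> (z \<bullet> w) * s\<bar> \<le> B * c" if "\<bar>s\<bar> \<le> 1" for z s
  using mult_mono[OF bd[of z] that] c0 B(1) by (simp add: abs_mult)
 have split: "(CLINT z|m. of_real (\<rho> z * \<theta> (z \<bullet> w)) * iexp (z \<bullet> v))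
   = of_real (\<integral>z. \<rho> z * cos (z \<bullet> v) * \<theta> (z \<bullet> w) \<partial>m) + \<i> * of_real (\<integral>z. \<rho> z * sin (z \<bullet> v) * \<theta> (z \<bullet> w) \<partial>m)"
  if "m = \<nu> \<or> (\<exists>n. m = \<mu> n)" for m v
 proof -
  have i: "integrable m (\<lambda>z. \<rho> z * \<theta> (z \<bullet> w) * cos (z \<bullet> v))" "integrable m (\<lambda>z. \<rho> z * \<theta> (z \<bullet> w) * sin (z \<bullet> v))"
   using that by (safe; intro integrable_bounded[where c="B * c"]; simp add: bd')+
  have "(CLINT z|m. of_real (\<rho> z * \<theta> (z \<bullet> w)) * iexp (z \<bullet> v))
   = (CLINT z|m. of_real (\<rho> z * \<theta> (z \<bullet> w) * cos (z \<bullet> v)) + \<i> * of_real (\<rho> z * \<theta> (z \<bullet> w) * sin (z \<bullet> v)))"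
   by (intro Bochner_Integration.integral_cong) (auto simp: exp_Euler cos_of_real sin_of_real algebra_simps)
  also have "\<dots> = of_real (\<integral>z. \<rho> z * \<theta> (z \<bullet> w) * cos (z \<bullet> v) \<partial>m) + \<i> * of_real (\<integral>z. \<rho> z * \<theta> (z \<bullet> w) * sin (z \<bullet> v) \<partial>m)"
   by (subst Bochner_Integration.integral_add)
    (use i in \<open>auto simp del: of_real_mult intro: integrable_of_real\<close>)
  finally show ?thesis by (simp add: mult.commute mult.left_commute)
 qed
 have "(\<lambda>n. CLINT z|\<mu> n. of_real (\<rho> z * \<theta> (z \<bullet> w)) * iexp (z \<bullet> v)) \<longlonglongrightarrow>
   (CLINT z|\<nu>. of_real (\<rho> z * \<theta> (z \<bullet> w)) * iexp (z \<bullet> v))" for v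
 proof -
  have "(\<lambda>n. of_real (\<integral>z. \<rho> z * cos (z \<bullet> v) * \<theta> (z \<bullet> w) \<partial>\<mu> n) + \<i> * of_real (\<integral>z. \<rho> z * sin (z \<bullet> v) * \<theta> (z \<bullet> w) \<partial>\<mu> n)) \<longlonglongrightarrow>
   complex_of_real (\<integral>z. \<rho> z * cos (z \<bullet> v) * \<theta> (z \<bullet> w) \<partial>\<nu>) + \<i> * of_real (\<integral>z. \<rho> z * sin (z \<bullet> v) * \<theta> (z \<bullet> w) \<partial>\<nu>)"
   by (intro tendsto_intros steady_tendsto_mult[OF _ \<theta>] steady_trig assms(1))
  moreover have "\<mu> n = \<nu> \<or> (\<exists>n'. \<mu> n = \<mu> n')" "\<nu> = \<nu> \<or> (\<exists>n'. \<nu> = \<mu> n')" for n by auto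
  ultimately show ?thesis by (simp only: split)
 qed
 moreover have "bounded (range (\<lambda>z. \<rho> z * \<theta> (z \<bullet> w)))" by (intro boundedI[where B="B * c"]) (use bd in auto)
 ultimately show ?thesis by (simp add: steady_def)
qed

end

lemma tendsto_by_approximation:
 fixes a :: "nat \<Rightarrow> real"
 assumes "\<And>\<epsilon>. 0 < \<epsilon> \<Longrightarrow> \<exists>b l. b \<longlonglongrightarrow> l \<and> (\<forall>\<^sub>F n in sequentially. \<bar>a n - b n\<bar> \<le> \<epsilon>) \<and> \<bar>a0 - l\<bar> \<le> \<epsilon>"
 shows "a \<longlonglongrightarrow> a0"
proof (rule tendstoI)
 fix e :: real assume "0 < e"
 then obtain b l where b: "b \<longlonglongrightarrow> l" and 1: "\<forall>\<^sub>F n in sequentially. \<bar>a n - b n\<bar> \<le> e / 4" and 2: "\<bar>a0 - l\<bar> \<le> e / 4"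
  using assms[of "e / 4"] by auto
 have "\<forall>\<^sub>F n in sequentially. dist (b n) l < e / 4" using b \<open>0 < e\<close> by (intro tendstoD) auto
 with 1 show "\<forall>\<^sub>F n in sequentially. dist (a n) a0 < e"
  by eventually_elim (use 2 in \<open>unfold dist_real_def, linarith\<close>)
qed

text \<open>The inf-convolutions with multiples of the norm are Lipschitz and increase to a given bounded continuous
  function.\<close>

lemma inf_convolution:
 fixes f :: "'h::real_normed_vector \<Rightarrow> real"
 assumes B: "\<And>z. \<bar>f z\<bar> \<le> B"
 defines "g k z \<equiv> INF w. f w + real k * norm (z - w)"
 shows "g k z \<le> f z" and "\<bar>g k z\<bar> \<le> B" and "\<bar>g k z - g k z'\<bar> \<le> real k * norm (z - z')"
  and "isCont f z \<Longrightarrow> (\<lambda>k. g k z) \<longlonglongrightarrow> f z"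
proof -
 have bdd: "bdd_below (range (\<lambda>w. f w + real k * norm (z - w)))" for k z
 proof (rule bdd_belowI2[of _ "-B"])
  show "- B \<le> f w + real k * norm (z - w)" for w
   using B[of w] by (smt (verit) mult_nonneg_nonneg norm_ge_zero of_nat_0_le_iff)
 qed
 have low: "g k z \<le> f w + real k * norm (z - w)" for k z w
  unfolding g_def by (rule cINF_lower[OF bdd]) simp
 have great: "c \<le> g k z" if "\<And>w. c \<le> f w + real k * norm (z - w)" for c k z
  unfolding g_def by (rule cINF_greatest) (use that in auto)
 show up: "g k z \<le> f z" for k z using low[of k z z] by simp
 have "- B \<le> g k z"
  by (rule great) (smt (verit) B mult_nonneg_nonneg norm_ge_zero of_nat_0_le_iff)
 then show "\<bar>g k z\<bar> \<le> B" using up[of k z] B[of z] by linarith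
 have lip: "g k z - real k * norm (z - z') \<le> g k z'" for z z'
 proof (rule great)
  fix w
  have "real k * norm (z - w) \<le> real k * (norm (z - z') + norm (z' - w))"
   using norm_triangle_ineq[of "z - z'" "z' - w"] by (intro mult_left_mono) auto
  then show "g k z - real k * norm (z - z') \<le> f w + real k * norm (z' - w)"
   using low[of k z w] by (simp add: algebra_simps)
 qed
 show "\<bar>g k z - g k z'\<bar> \<le> real k * norm (z - z')"
  using lip[of z z'] lip[of z' z] by (simp add: abs_le_iff norm_minus_commute)
 assume cont: "isCont f z"
 show "(\<lambda>k. g k z) \<longlonglongrightarrow> f z"
 proof (rule tendstoI)
  fix e :: real assume e: "0 < e"
  obtain \<delta> where \<delta>: "0 < \<delta>" "\<And>w. dist w z < \<delta> \<Longrightarrow> dist (f w) (f z) < e / 2"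
   using cont e unfolding continuous_at_eps_delta by (metis half_gt_zero)
  have "\<forall>\<^sub>F k in sequentially. 2 * B / \<delta> \<le> real k"
   using filterlim_real_sequentially by (auto simp: filterlim_at_top)
  then show "\<forall>\<^sub>F k in sequentially. dist (g k z) (f z) < e"
  proof eventually_elim
   case (elim k)
   have "f z - e / 2 \<le> g k z"
   proof (rule great)
    fix w
    show "f z - e / 2 \<le> f w + real k * norm (z - w)"
    proof (cases "dist w z < \<delta>")
     case True
     have "0 \<le> real k * norm (z - w)" by simp
     then show ?thesis using \<delta>(2)[OF True] unfolding dist_real_def by linarith
    next
     case False
     then have "\<delta> \<le> norm (z - w)" by (simp add: dist_norm norm_minus_commute)
     then have "real k * \<delta> \<le> real k * norm (z - w)" by (intro mult_left_mono) auto
     moreover have "2 * B \<le> real k * \<delta>" using elim \<delta>(1) by (simp add: divide_le_eq)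
     ultimately show ?thesis using B[of z] B[of w] e by linarith
    qed
   qed
   then show ?case using up[of k z] e by (simp add: dist_real_def)
  qed
 qed
qed

definition finite_box :: "(nat \<Rightarrow> 'h::real_vector) \<Rightarrow> real \<Rightarrow> nat \<Rightarrow> 'h set" where
 "finite_box u R N = rec_nat {0} (\<lambda>k S. {x + y | x y. x \<in> S \<and> y \<in> (\<lambda>c. c *\<^sub>R u k) ` {-R..R}}) N"

lemma compact_finite_box: "compact (finite_box u R N)"
 for u :: "nat \<Rightarrow> 'h::real_normed_vector"
proof (induction N)
 case (Suc N)
 have "compact ((\<lambda>c. c *\<^sub>R u N) ` {-R..R})"
  by (intro compact_continuous_image continuous_intros) simp
 from compact_sums[OF Suc this] show ?case by (simp add: finite_box_def)
qed (simp add: finite_box_def)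

locale char_convergence_basis = char_convergence \<mu> \<nu> + hilbert_basis u
 for \<mu> :: "nat \<Rightarrow> 'h::{real_inner,banach,second_countable_topology} measure" and \<nu> :: "'h measure" and u :: "nat \<Rightarrow> 'h"
begin

lemma proj_in_finite_box:
 assumes "\<And>k. k < N \<Longrightarrow> \<bar>v \<bullet> u k\<bar> \<le> R"
 shows "proj N v \<in> finite_box u R N"
 using assms
proof (induction N)
 case (Suc N)
 have "proj (Suc N) v = proj N v + (v \<bullet> u N) *\<^sub>R u N" by (simp add: proj_def)
 moreover have "v \<bullet> u N \<in> {-R..R}" using Suc.prems[of N] by (simp add: abs_le_iff)
 moreover have "proj N v \<in> finite_box u R N" using Suc by simp
 moreover have "finite_box u R (Suc N) = {x + y | x y. x \<in> finite_box u R N \<and> y \<in> (\<lambda>c. c *\<^sub>R u N) ` {-R..R}}"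
  by (simp add: finite_box_def)
 ultimately show ?case by blast
qed (simp add: finite_box_def proj_def)

text \<open>The functions of the first \<open>N\<close> coordinates by which weights may be multiplied. They form an algebra of
  continuous functions that separates points, to which the theorem of Stone and Weierstrass applies on boxes.\<close>

definition multipliers :: "nat \<Rightarrow> ('h \<Rightarrow> real) set" where
 "multipliers N = {q. continuous_on UNIV q \<and> (\<forall>\<rho>. steady \<rho> \<longrightarrow> steady (\<lambda>z. \<rho> z * q (proj N z)))}"

lemma multipliers_coordinate:
 assumes "continuous_on UNIV \<theta>" "\<And>s::real. \<bar>\<theta> s\<bar> \<le> c" 
 shows "(\<lambda>z. \<theta> (z \<bullet> u k)) \<in> multipliers N"
proof -
 have "steady (\<lambda>z. \<rho> z * \<theta> (proj N z \<bullet> u k))" if "steady \<rho>" for \<rho>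
  using steady_mult[OF that assms, of "proj N (u k)"] by (simp add: inner_proj_swap)
 moreover have "continuous_on UNIV (\<lambda>z. \<theta> (z \<bullet> u k))"
  by (rule continuous_on_compose2[OF assms(1)]) (auto intro!: continuous_intros)
 ultimately show ?thesis by (simp add: multipliers_def)
qed

lemma function_ring_multipliers: "function_ring_on (multipliers N) (finite_box u R N)"
proof
 show "compact (finite_box u R N)" by (rule compact_finite_box)
 show "f \<in> multipliers N \<Longrightarrow> continuous_on (finite_box u R N) f" for f
  by (auto simp: multipliers_def intro: continuous_on_subset)
 show "(\<lambda>x. f x + g x) \<in> multipliers N" if "f \<in> multipliers N" "g \<in> multipliers N" for f g
  using that by (auto simp: multipliers_def distrib_left intro!: continuous_intros steady_add)
 show "(\<lambda>x. f x * g x) \<in> multipliers N" if "f \<in> multipliers N" "g \<in> multipliers N" for f g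
  using that by (auto simp: multipliers_def mult.assoc[symmetric] intro!: continuous_intros)
 show "(\<lambda>_. c) \<in> multipliers N" for c
  using steady_scale[of _ c] by (auto simp: multipliers_def mult.commute intro!: continuous_intros)
 show "\<exists>f\<in>multipliers N. f x \<noteq> f y" if "x \<in> finite_box u R N" "y \<in> finite_box u R N" "x \<noteq> y" for x y
 proof -
  have "\<exists>k. x \<bullet> u k \<noteq> y \<bullet> u k" using eq_if_coordinates_eq \<open>x \<noteq> y\<close> by blast
  then obtain k where "x \<bullet> u k \<noteq> y \<bullet> u k" by blast
  moreover have "(\<lambda>z. arctan (z \<bullet> u k)) \<in> multipliers N"
  proof (rule multipliers_coordinate)
   show "\<bar>arctan s\<bar> \<le> pi / 2" for s using arctan_bounded[of s] by linarith
  qed (auto intro!: continuous_intros)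
  ultimately show ?thesis by (intro bexI) (auto simp: arctan_eq_iff)
 qed
qed

text \<open>A continuous truncation in the first \<open>N\<close> coordinates: 1 if all of them are at most \<open>R\<close> in absolute value, and 0
  if one of them exceeds \<open>R + 1\<close>. Being a product of functions of single coordinates, it is a steady weight.\<close>

definition cutoff :: "nat \<Rightarrow> real \<Rightarrow> 'h \<Rightarrow> real" where
 "cutoff N R z = (\<Prod>k<N. max 0 (min 1 (R + 1 - \<bar>z \<bullet> u k\<bar>)))"

lemma cutoff_bounds: "0 \<le> cutoff N R z" "cutoff N R z \<le> 1"
 unfolding cutoff_def by (auto intro!: prod_nonneg prod_le_1)

lemma steady_cutoff: "steady (cutoff N R)"
proof (induction N)
 case 0
 then show ?case using steady_one by (simp add: cutoff_def[abs_def])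
next
 case (Suc N)
 have "steady (\<lambda>z. cutoff N R z * max 0 (min 1 (R + 1 - \<bar>z \<bullet> u N\<bar>)))"
  by (rule steady_mult[OF Suc, of "\<lambda>s. max 0 (min 1 (R + 1 - \<bar>s\<bar>))" 1]) (auto intro!: continuous_intros)
 then show ?case by (simp add: cutoff_def[abs_def])
qed

lemma cutoff_measurable [measurable]: "cutoff N R \<in> borel_measurable borel"
 using steady_cutoff by (simp add: steady_def)

lemma cutoff_tendsto: "(\<lambda>R. \<integral>z. cutoff N (real R) z \<partial>\<nu>) \<longlonglongrightarrow> 1"
proof -
 interpret N: prob_space \<nu> by (rule prob_\<nu>)
 have "(\<lambda>R. \<integral>z. cutoff N (real R) z \<partial>\<nu>) \<longlonglongrightarrow> (\<integral>z. 1 \<partial>\<nu>)"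
 proof (rule integral_dominated_convergence[where w="\<lambda>_. 1"])
  show "AE z in \<nu>. (\<lambda>R. cutoff N (real R) z) \<longlonglongrightarrow> 1"
  proof (rule AE_I2)
   fix z :: 'h
   obtain R0 where R0: "norm z \<le> real R0" using real_arch_simple by blast
   have "cutoff N (real R) z = 1" if "R \<ge> R0" for R
   proof -
    have "\<bar>z \<bullet> u k\<bar> \<le> real R" for k
     using Cauchy_Schwarz_ineq2[of z "u k"] R0 that ortho[of k k]
     by (simp add: norm_eq_1[THEN iffD2] mult.commute)
    then show ?thesis by (auto simp: cutoff_def intro!: prod.neutral)
   qed
   then show "(\<lambda>R. cutoff N (real R) z) \<longlonglongrightarrow> 1"
    by (intro tendsto_eventually) (auto simp: eventually_sequentially)
  qed
 qed (use cutoff_bounds in auto)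
 then show ?thesis using N.prob_space by simp
qed

text \<open>On the box outside of which the truncation vanishes, \<open>f\<close> is uniformly approximated by multipliers. The
  truncation has mean close to 1 under the limit, hence under \<open>\<mu> n\<close> for large \<open>n\<close> as well.\<close>

lemma integral_proj_tendsto:
 fixes f :: "'h \<Rightarrow> real"
 assumes f: "continuous_on UNIV f" and B: "\<And>z. \<bar>f z\<bar> \<le> B"
 shows "(\<lambda>n. \<integral>z. f (proj N z) \<partial>\<mu> n) \<longlonglongrightarrow> (\<integral>z. f (proj N z) \<partial>\<nu>)"
proof -
 have [measurable]: "f \<in> borel_measurable borel" using f by (rule borel_measurable_continuous_onI)
 have B0: "0 \<le> B" using B[of 0] by linarith
 note prob = prob_\<mu> prob_\<nu>
 have bd: "\<bar>f y * cutoff N R z\<bar> \<le> B" for y z R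
  using mult_mono[OF B[of y] cutoff_bounds(2)[of N R z]] cutoff_bounds(1)[of N R z] B0 by (simp add: abs_mult)
 have i1: "integrable (\<mu> n) (\<lambda>z. f (proj N z) * cutoff N R z)" "integrable \<nu> (\<lambda>z. f (proj N z) * cutoff N R z)" for R n
  by (intro integrable_bounded[where c=B]; simp add: bd)+
 have i2: "integrable (\<mu> n) (\<lambda>z. f (proj N z))" "integrable \<nu> (\<lambda>z. f (proj N z))" for n
  by (intro integrable_bounded[where c=B]; simp add: B)+
 have i3: "integrable (\<mu> n) (cutoff N R)" "integrable \<nu> (cutoff N R)" for n R
  by (intro steady_integrable steady_cutoff)+
 have cut: "(\<lambda>n. \<integral>z. f (proj N z) * cutoff N R z \<partial>\<mu> n) \<longlonglongrightarrow> (\<integral>z. f (proj N z) * cutoff N R z \<partial>\<nu>)" for R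
 proof (rule tendsto_by_approximation)
  fix \<epsilon> :: real assume \<epsilon>: "0 < \<epsilon>"
  interpret function_ring_on "multipliers N" "finite_box u (R + 1) N" by (rule function_ring_multipliers)
  have "\<exists>F\<in>UNIV \<rightarrow> multipliers N. uniform_limit (finite_box u (R + 1) N) F f sequentially"
   using f by (intro Stone_Weierstrass) (auto intro: continuous_on_subset)
  then obtain F where F: "\<And>n. F n \<in> multipliers N" "uniform_limit (finite_box u (R + 1) N) F f sequentially"
   by blast
  from uniform_limitD[OF F(2) \<epsilon>] obtain n where n: "\<forall>w\<in>finite_box u (R + 1) N. dist (F n w) (f w) < \<epsilon>"
   by (auto simp: eventually_sequentially)
  define q where "q = F n"
  have st: "steady (\<lambda>z. cutoff N R z * q (proj N z))"
   using F(1)[of n] steady_cutoff by (auto simp: multipliers_def q_def)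
  have close: "\<bar>f (proj N z) * cutoff N R z - cutoff N R z * q (proj N z)\<bar> \<le> \<epsilon>" for z
  proof (cases "cutoff N R z = 0")
   case False
   then have "\<bar>z \<bullet> u k\<bar> \<le> R + 1" if "k < N" for k
    using that unfolding cutoff_def by (force simp: max_def min_def split: if_splits)
   then have "dist (q (proj N z)) (f (proj N z)) < \<epsilon>"
    unfolding q_def using n proj_in_finite_box by blast
   then have "\<bar>f (proj N z) - q (proj N z)\<bar> * cutoff N R z \<le> \<epsilon> * 1"
    using cutoff_bounds[of N R z] by (intro mult_mono) (auto simp: dist_real_def)
   then show ?thesis
    using cutoff_bounds(1)[of N R z]
    by (metis abs_mult abs_of_nonneg left_diff_distrib mult.commute mult.right_neutral)
  qed (use \<epsilon> in simp)
  have diff: "\<bar>(\<integral>z. f (proj N z) * cutoff N R z \<partial>m) - (\<integral>z. cutoff N R z * q (proj N z) \<partial>m)\<bar> \<le> \<epsilon>"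
   if m: "m = \<nu> \<or> (\<exists>n. m = \<mu> n)" for m
  proof -
   interpret m: prob_space m using m prob by auto
   have "integrable m (\<lambda>z. cutoff N R z * q (proj N z))" "integrable m (\<lambda>z. f (proj N z) * cutoff N R z)"
    using m steady_integrable(3,4)[OF st] i1 by auto
   then have "(\<integral>z. f (proj N z) * cutoff N R z \<partial>m) - (\<integral>z. cutoff N R z * q (proj N z) \<partial>m)
     = (\<integral>z. f (proj N z) * cutoff N R z - cutoff N R z * q (proj N z) \<partial>m)"
    and i: "integrable m (\<lambda>z. f (proj N z) * cutoff N R z - cutoff N R z * q (proj N z))" by simp_all
   moreover have "norm (\<integral>z. f (proj N z) * cutoff N R z - cutoff N R z * q (proj N z) \<partial>m) \<le> \<epsilon>"
    using i close by (intro integral_norm_bound[THEN order_trans] m.integral_le_const) auto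
   ultimately show ?thesis by simp
  qed
  show "\<exists>b l. b \<longlonglongrightarrow> l \<and> (\<forall>\<^sub>F n in sequentially. \<bar>(\<integral>z. f (proj N z) * cutoff N R z \<partial>\<mu> n) - b n\<bar> \<le> \<epsilon>)
    \<and> \<bar>(\<integral>z. f (proj N z) * cutoff N R z \<partial>\<nu>) - l\<bar> \<le> \<epsilon>"
  proof (intro exI conjI)
   show "\<forall>\<^sub>F n in sequentially. \<bar>(\<integral>z. f (proj N z) * cutoff N R z \<partial>\<mu> n) - (\<integral>z. cutoff N R z * q (proj N z) \<partial>\<mu> n)\<bar> \<le> \<epsilon>"
    using diff by (intro always_eventually allI) blast
  qed (use steady_tendsto[OF st] diff in auto)
 qed
 show ?thesis
 proof (rule tendsto_by_approximation)
  fix \<epsilon> :: real assume \<epsilon>: "0 < \<epsilon>"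
  have "\<forall>\<^sub>F R in sequentially. \<bar>(\<integral>z. cutoff N (real R) z \<partial>\<nu>) - 1\<bar> < \<epsilon> / (B + 1)"
   using tendstoD[OF cutoff_tendsto, of "\<epsilon> / (B + 1)"] \<epsilon> B0 by (simp add: dist_real_def)
  then obtain R where R: "\<bar>(\<integral>z. cutoff N R z \<partial>\<nu>) - 1\<bar> < \<epsilon> / (B + 1)"
   by (auto simp: eventually_sequentially)
  have "\<forall>\<^sub>F n in sequentially. \<bar>(\<integral>z. cutoff N R z \<partial>\<mu> n) - 1\<bar> < \<epsilon> / (B + 1)"
   using order_tendstoD(2)[OF tendsto_rabs[OF tendsto_diff[OF steady_tendsto[OF steady_cutoff] tendsto_const]] R] .
  then have ev: "\<forall>\<^sub>F n in sequentially. B * \<bar>(\<integral>z. cutoff N R z \<partial>\<mu> n) - 1\<bar> \<le> \<epsilon>"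
  proof eventually_elim
   case (elim n)
   then have "B * \<bar>(\<integral>z. cutoff N R z \<partial>\<mu> n) - 1\<bar> \<le> (B + 1) * (\<epsilon> / (B + 1))" using B0 by (intro mult_mono) auto
   then show ?case using B0 by simp
  qed
  have R': "B * \<bar>(\<integral>z. cutoff N R z \<partial>\<nu>) - 1\<bar> \<le> \<epsilon>"
  proof -
   have "B * \<bar>(\<integral>z. cutoff N R z \<partial>\<nu>) - 1\<bar> \<le> (B + 1) * (\<epsilon> / (B + 1))" using R B0 by (intro mult_mono) auto
   then show ?thesis using B0 by simp
  qed
  have diff: "\<bar>(\<integral>z. f (proj N z) \<partial>m) - (\<integral>z. f (proj N z) * cutoff N R z \<partial>m)\<bar> \<le> B * \<bar>(\<integral>z. cutoff N R z \<partial>m) - 1\<bar>"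
   if m: "m = \<nu> \<or> (\<exists>n. m = \<mu> n)" for m
  proof -
   interpret m: prob_space m using m prob by auto
   have i: "integrable m (\<lambda>z. f (proj N z))" "integrable m (\<lambda>z. f (proj N z) * cutoff N R z)" "integrable m (cutoff N R)"
    using m i1 i2 i3 by auto
   have "\<bar>(\<integral>z. f (proj N z) \<partial>m) - (\<integral>z. f (proj N z) * cutoff N R z \<partial>m)\<bar>
     = norm (\<integral>z. f (proj N z) - f (proj N z) * cutoff N R z \<partial>m)"
    using i by simp
   also have "\<dots> \<le> (\<integral>z. norm (f (proj N z) - f (proj N z) * cutoff N R z) \<partial>m)"
    by (rule integral_norm_bound)
   also have "\<dots> \<le> (\<integral>z. B * (1 - cutoff N R z) \<partial>m)"
   proof (rule integral_mono)
    fix z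
    have "f (proj N z) - f (proj N z) * cutoff N R z = f (proj N z) * (1 - cutoff N R z)" by (simp add: algebra_simps)
    then have "norm (f (proj N z) - f (proj N z) * cutoff N R z) = \<bar>f (proj N z)\<bar> * (1 - cutoff N R z)"
     using cutoff_bounds[of N R z] by (simp add: abs_mult)
    also have "\<dots> \<le> B * (1 - cutoff N R z)" using B cutoff_bounds[of N R z] by (intro mult_right_mono) auto
    finally show "norm (f (proj N z) - f (proj N z) * cutoff N R z) \<le> B * (1 - cutoff N R z)" .
   qed (use i in auto)
   also have "\<dots> = B * (1 - (\<integral>z. cutoff N R z \<partial>m))" using i m.prob_space by simp
   also have "\<dots> \<le> B * \<bar>(\<integral>z. cutoff N R z \<partial>m) - 1\<bar>" using B0 by (intro mult_left_mono) auto
   finally show ?thesis .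
  qed
  show "\<exists>b l. b \<longlonglongrightarrow> l \<and> (\<forall>\<^sub>F n in sequentially. \<bar>(\<integral>z. f (proj N z) \<partial>\<mu> n) - b n\<bar> \<le> \<epsilon>)
    \<and> \<bar>(\<integral>z. f (proj N z) \<partial>\<nu>) - l\<bar> \<le> \<epsilon>"
  proof (intro exI conjI)
   show "\<forall>\<^sub>F n in sequentially. \<bar>(\<integral>z. f (proj N z) \<partial>\<mu> n) - (\<integral>z. f (proj N z) * cutoff N R z \<partial>\<mu> n)\<bar> \<le> \<epsilon>"
    using ev by eventually_elim (use diff in \<open>blast intro: order_trans\<close>)
   show "\<bar>(\<integral>z. f (proj N z) \<partial>\<nu>) - (\<integral>z. f (proj N z) * cutoff N R z \<partial>\<nu>)\<bar> \<le> \<epsilon>"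
    using diff[of \<nu>] R' by simp
  qed (rule cut)
 qed
qed

text \<open>The hypothesis on the tails takes the role of tightness: a Lipschitz function changes little
  when its argument is projected on the first \<open>N\<close> coordinates.\<close>

lemma integral_lipschitz_tendsto:
 fixes f :: "'h \<Rightarrow> real"
 assumes tail: "\<And>\<epsilon>. 0 < \<epsilon> \<Longrightarrow> \<exists>N0. \<forall>N\<ge>N0. \<forall>\<^sub>F n in sequentially. (\<integral>z. min 1 (norm (z - proj N z)) \<partial>\<mu> n) \<le> \<epsilon>"
  and L: "\<And>z z'. \<bar>f z - f z'\<bar> \<le> L * norm (z - z')" "0 \<le> L" and B: "\<And>z. \<bar>f z\<bar> \<le> B"
 shows "(\<lambda>n. \<integral>z. f z \<partial>\<mu> n) \<longlonglongrightarrow> (\<integral>z. f z \<partial>\<nu>)"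
proof (rule tendsto_by_approximation)
 fix \<epsilon> :: real assume \<epsilon>: "0 < \<epsilon>"
 have cont: "continuous_on UNIV f"
  using L by (intro lipschitz_on_continuous_on[of L]) (auto intro!: lipschitz_onI simp: dist_norm)
 have [measurable]: "f \<in> borel_measurable borel" using cont by (rule borel_measurable_continuous_onI)
 have B0: "0 \<le> B" using B[of 0] by linarith
 note prob = prob_\<mu> prob_\<nu>
 define D where "D = L + 2 * B + 1"
 have D: "0 < D" unfolding D_def using L(2) B0 by simp
 have pt: "\<bar>f z - f (proj N z)\<bar> \<le> D * min 1 (norm (z - proj N z))" for z N
 proof (cases "norm (z - proj N z) \<le> 1")
  case True
  have "\<bar>f z - f (proj N z)\<bar> \<le> L * norm (z - proj N z)" by (rule L)
  also have "\<dots> \<le> D * norm (z - proj N z)" unfolding D_def using B0 by (intro mult_right_mono) auto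
  finally show ?thesis using True by (simp add: min_def)
 next
  case False
  have "\<bar>f z - f (proj N z)\<bar> \<le> 2 * B" using B[of z] B[of "proj N z"] by linarith
  then show ?thesis using False L(2) by (simp add: D_def min_def)
 qed
 have diff: "\<bar>(\<integral>z. f z \<partial>m) - (\<integral>z. f (proj N z) \<partial>m)\<bar> \<le> D * (\<integral>z. min 1 (norm (z - proj N z)) \<partial>m)"
  if m: "m = \<nu> \<or> (\<exists>n. m = \<mu> n)" for m N
 proof -
  interpret m: prob_space m using m prob by auto
  have [measurable_cong]: "sets m = sets borel" using m sets_\<mu> sets_\<nu> by auto
  have "integrable m f" "integrable m (\<lambda>z. f (proj N z))"
   by (rule m.integrable_const_bound[where B=B]; simp add: B)+
  moreover have "integrable m (\<lambda>z. min 1 (norm (z - proj N z)))"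
   by (rule m.integrable_const_bound[where B=1]) auto
  ultimately have i: "integrable m f" "integrable m (\<lambda>z. f (proj N z))" "integrable m (\<lambda>z. min 1 (norm (z - proj N z)))"
   by auto
  have "\<bar>(\<integral>z. f z \<partial>m) - (\<integral>z. f (proj N z) \<partial>m)\<bar> = norm (\<integral>z. f z - f (proj N z) \<partial>m)"
   using i by simp
  also have "\<dots> \<le> (\<integral>z. norm (f z - f (proj N z)) \<partial>m)" by (rule integral_norm_bound)
  also have "\<dots> \<le> (\<integral>z. D * min 1 (norm (z - proj N z)) \<partial>m)"
   by (rule integral_mono) (use i pt in auto)
  finally show ?thesis using i by simp
 qed
 interpret N: prob_space \<nu> by (rule prob_\<nu>)
 have "(\<lambda>N. \<integral>z. min 1 (norm (z - proj N z)) \<partial>\<nu>) \<longlonglongrightarrow> (\<integral>z. 0 \<partial>\<nu>)"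
 proof (rule integral_dominated_convergence[where w="\<lambda>_. 1"])
  have "(\<lambda>N. min 1 (norm (z - proj N z))) \<longlonglongrightarrow> min 1 (norm (z - z))" for z
   by (intro tendsto_intros proj_tendsto)
  then show "AE z in \<nu>. (\<lambda>N. min 1 (norm (z - proj N z))) \<longlonglongrightarrow> 0" by simp
 qed auto
 then have "\<forall>\<^sub>F N in sequentially. (\<integral>z. min 1 (norm (z - proj N z)) \<partial>\<nu>) < \<epsilon> / D"
  using \<epsilon> D by (intro order_tendstoD(2)) auto
 then obtain N1 where N1: "\<And>N. N \<ge> N1 \<Longrightarrow> (\<integral>z. min 1 (norm (z - proj N z)) \<partial>\<nu>) < \<epsilon> / D"
  by (auto simp: eventually_sequentially)
 obtain N0 where N0: "\<And>N. N \<ge> N0 \<Longrightarrow> \<forall>\<^sub>F n in sequentially. (\<integral>z. min 1 (norm (z - proj N z)) \<partial>\<mu> n) \<le> \<epsilon> / D"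
  using tail[of "\<epsilon> / D"] \<epsilon> D by auto
 define N where "N = max N0 N1"
 show "\<exists>b l. b \<longlonglongrightarrow> l \<and> (\<forall>\<^sub>F n in sequentially. \<bar>(\<integral>z. f z \<partial>\<mu> n) - b n\<bar> \<le> \<epsilon>) \<and> \<bar>(\<integral>z. f z \<partial>\<nu>) - l\<bar> \<le> \<epsilon>"
 proof (intro exI conjI)
  show "(\<lambda>n. \<integral>z. f (proj N z) \<partial>\<mu> n) \<longlonglongrightarrow> (\<integral>z. f (proj N z) \<partial>\<nu>)"
   by (rule integral_proj_tendsto[OF cont B])
  show "\<forall>\<^sub>F n in sequentially. \<bar>(\<integral>z. f z \<partial>\<mu> n) - (\<integral>z. f (proj N z) \<partial>\<mu> n)\<bar> \<le> \<epsilon>"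
   using N0[of N, unfolded N_def, OF max.cobounded1]
  proof eventually_elim
   case (elim n)
   then have "D * (\<integral>z. min 1 (norm (z - proj N z)) \<partial>\<mu> n) \<le> \<epsilon>"
    using D by (simp add: N_def field_simps)
   moreover have "\<mu> n = \<nu> \<or> (\<exists>n'. \<mu> n = \<mu> n')" by auto
   then have "\<bar>(\<integral>z. f z \<partial>\<mu> n) - (\<integral>z. f (proj N z) \<partial>\<mu> n)\<bar> \<le> D * (\<integral>z. min 1 (norm (z - proj N z)) \<partial>\<mu> n)"
    by (rule diff)
   ultimately show ?case by linarith
  qed
  have "D * (\<integral>z. min 1 (norm (z - proj N z)) \<partial>\<nu>) \<le> \<epsilon>"
   using N1[of N] D by (simp add: N_def field_simps)
  then show "\<bar>(\<integral>z. f z \<partial>\<nu>) - (\<integral>z. f (proj N z) \<partial>\<nu>)\<bar> \<le> \<epsilon>"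
   using diff[of \<nu> N] by auto
 qed
qed

end

text \<open>The inf-convolutions of \<open>f\<close> bound the lower limit of the integrals from below, and those of \<open>- f\<close> bound the
  upper limit from above.\<close>

lemma weak_convergence_if_lipschitz:
 fixes \<mu> :: "nat \<Rightarrow> 'h::{real_normed_vector,second_countable_topology} measure" and f :: "'h \<Rightarrow> real"
 assumes prob: "\<And>n. prob_space (\<mu> n)" "prob_space \<nu>"
  and sets: "\<And>n. sets (\<mu> n) = sets borel" "sets \<nu> = sets borel"
  and lip: "\<And>g L B. (\<And>z z'. \<bar>g z - g z'\<bar> \<le> L * norm (z - z')) \<Longrightarrow> 0 \<le> L \<Longrightarrow> (\<And>z. \<bar>g z\<bar> \<le> B) \<Longrightarrow>
   (\<lambda>n. \<integral>z. g z \<partial>\<mu> n) \<longlonglongrightarrow> (\<integral>z. g z \<partial>\<nu>)"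
  and f: "continuous_on UNIV f" "bounded (range f)"
 shows "(\<lambda>n. \<integral>z. f z \<partial>\<mu> n) \<longlonglongrightarrow> (\<integral>z. f z \<partial>\<nu>)"
proof -
 note [measurable_cong] = sets
 interpret M: prob_space "\<mu> n" for n by (rule prob)
 interpret N: prob_space \<nu> by (rule prob)
 obtain B where B: "\<And>z. \<bar>f z\<bar> \<le> B" using bounded_range_obtain[OF f(2)] by (metis real_norm_def)
 have lower: "\<forall>\<^sub>F n in sequentially. (\<integral>z. f z \<partial>\<nu>) - \<epsilon> < (\<integral>z. f z \<partial>\<mu> n)"
  if \<epsilon>: "0 < \<epsilon>" and cont: "continuous_on UNIV f" and B: "\<And>z. \<bar>f z\<bar> \<le> B" for \<epsilon> and f :: "'h \<Rightarrow> real"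
 proof -
  define g where "g k z = (INF w. f w + real k * norm (z - w))" for k z
  note g = inf_convolution[of f B, OF B, folded g_def]
  have cg: "continuous_on UNIV (g k)" for k
   using g(3) by (intro lipschitz_on_continuous_on[of "real k"]) (auto intro!: lipschitz_onI simp: dist_norm)
  have [measurable]: "g k \<in> borel_measurable borel" "f \<in> borel_measurable borel" for k
   using cg cont by (auto intro: borel_measurable_continuous_onI)
  have "(\<lambda>k. \<integral>z. g k z \<partial>\<nu>) \<longlonglongrightarrow> (\<integral>z. f z \<partial>\<nu>)"
   by (rule integral_dominated_convergence[where w="\<lambda>_. B"])
    (use g cont in \<open>auto simp: continuous_on_eq_continuous_at\<close>)
  then obtain k where k: "(\<integral>z. f z \<partial>\<nu>) - \<epsilon> / 2 < (\<integral>z. g k z \<partial>\<nu>)"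
   using order_tendstoD(1)[of "\<lambda>k. \<integral>z. g k z \<partial>\<nu>" "\<integral>z. f z \<partial>\<nu>" sequentially "(\<integral>z. f z \<partial>\<nu>) - \<epsilon> / 2"] \<epsilon>
   by (auto simp: eventually_sequentially)
  have "(\<lambda>n. \<integral>z. g k z \<partial>\<mu> n) \<longlonglongrightarrow> (\<integral>z. g k z \<partial>\<nu>)"
   by (rule lip[of "g k" "real k" B]) (use g in auto)
  then have "\<forall>\<^sub>F n in sequentially. (\<integral>z. f z \<partial>\<nu>) - \<epsilon> < (\<integral>z. g k z \<partial>\<mu> n)"
   using k \<epsilon> by (intro order_tendstoD(1)) auto
  then show ?thesis
  proof eventually_elim
   case (elim n)
   have "integrable (\<mu> n) (g k)" "integrable (\<mu> n) f"
    by (rule M.integrable_const_bound[where B=B]; simp add: g B)+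
   then have "(\<integral>z. g k z \<partial>\<mu> n) \<le> (\<integral>z. f z \<partial>\<mu> n)" by (rule integral_mono) (rule g(1))
   then show ?case using elim by simp
  qed
 qed
 show ?thesis
 proof (rule tendstoI)
  fix e :: real assume e: "0 < e"
  have "\<forall>\<^sub>F n in sequentially. (\<integral>z. - f z \<partial>\<nu>) - e < (\<integral>z. - f z \<partial>\<mu> n)"
   by (rule lower[OF e]) (use f(1) B in \<open>auto intro: continuous_intros\<close>)
  with lower[OF e f(1) B] show "\<forall>\<^sub>F n in sequentially. dist (\<integral>z. f z \<partial>\<mu> n) (\<integral>z. f z \<partial>\<nu>) < e"
   by eventually_elim (simp add: dist_real_def)
 qed
qed

section \<open>Conditional expectations\<close>

lemma integrable_mult_square:
 fixes f g :: "'w \<Rightarrow> real"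
 assumes [measurable]: "f \<in> borel_measurable M" "g \<in> borel_measurable M"
  and "integrable M (\<lambda>x. (f x)^2)" "integrable M (\<lambda>x. (g x)^2)"
 shows "integrable M (\<lambda>x. f x * g x)"
proof (rule Bochner_Integration.integrable_bound)
 show "integrable M (\<lambda>x. (f x)^2 + (g x)^2)" using assms by simp
 have "\<bar>a * b\<bar> \<le> a\<^sup>2 + b\<^sup>2" for a b :: real
 proof -
  have "0 \<le> (\<bar>a\<bar> - \<bar>b\<bar>)^2" "0 \<le> \<bar>a\<bar> * \<bar>b\<bar>" by simp_all
  then show ?thesis unfolding power2_diff abs_mult power2_abs by linarith
 qed
 then show "AE x in M. norm (f x * g x) \<le> norm ((f x)^2 + (g x)^2)" by simp
qed simp

lemma (in finite_measure) integrable_if_square_integrable: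
 fixes f :: "'a \<Rightarrow> real"
 assumes [measurable]: "f \<in> borel_measurable M" and "integrable M (\<lambda>x. (f x)^2)"
 shows "integrable M f"
 using integrable_mult_square[of f M "\<lambda>_. 1"] assms by simp

locale prob_subalgebra = prob_space M for M :: "'w measure" +
 fixes F :: "'w measure"
 assumes subalg: "subalgebra M F"

sublocale prob_subalgebra \<subseteq> finite_measure_subalgebra M F
 by standard (rule subalg)

context prob_subalgebra
begin

text \<open>Multiplication by an indicator can be pulled out of \<^const>\<open>real_cond_exp\<close> also for functions
 that are not integrable, because this holds for \<^const>\<open>nn_cond_exp\<close> of the positive and of the
 negative part.\<close>

lemma real_cond_exp_indicator:
 assumes B: "B \<in> sets F" and [measurable]: "f \<in> borel_measurable M"
 shows "AE x in M. real_cond_exp M F (\<lambda>x. indicator B x * f x) x = indicator B x * real_cond_exp M F f x"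
proof -
 have [measurable]: "(\<lambda>x. indicator B x :: ennreal) \<in> borel_measurable F" using B by simp
 have *: "ennreal (indicator B x * a) = indicator B x * ennreal a" 
   "ennreal (- (indicator B x * a)) = indicator B x * ennreal (- a)" for x a
  by (auto simp: indicator_def)
 have "AE x in M. indicator B x * nn_cond_exp M F (\<lambda>x. ennreal (f x)) x = nn_cond_exp M F (\<lambda>x. indicator B x * ennreal (f x)) x"
    "AE x in M. indicator B x * nn_cond_exp M F (\<lambda>x. ennreal (- f x)) x = nn_cond_exp M F (\<lambda>x. indicator B x * ennreal (- f x)) x"
  by (rule nn_cond_exp_prod; measurable)+
 then show ?thesis
  unfolding real_cond_exp_def * by eventually_elim (auto simp: indicator_def split: if_splits)
qed

lemma real_cond_exp_square:
 assumes [measurable]: "Z \<in> borel_measurable M" and Z2: "integrable M (\<lambda>x. (Z x)^2)"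
 shows "integrable M (\<lambda>x. (real_cond_exp M F Z x)^2)"
  and "(LINT x|M. (real_cond_exp M F Z x)^2) \<le> (LINT x|M. (Z x)^2)"
proof -
 have Z: "integrable M Z" by (rule integrable_if_square_integrable) (use Z2 in auto)
 have cv: "convex_on UNIV (\<lambda>x::real. x\<^sup>2)" using convex_power2 by simp
 show i: "integrable M (\<lambda>x. (real_cond_exp M F Z x)^2)"
  by (rule integrable_convex_cond_exp[where X=Z and I=UNIV]) (use Z Z2 cv in auto)
 have "AE x in M. (real_cond_exp M F Z x)^2 \<le> real_cond_exp M F (\<lambda>x. (Z x)^2) x"
  by (rule real_cond_exp_jensens_inequality(2)[where I=UNIV and q="\<lambda>x. x\<^sup>2"]) (use Z Z2 cv in auto)
 then have "(LINT x|M. (real_cond_exp M F Z x)^2) \<le> (LINT x|M. real_cond_exp M F (\<lambda>x. (Z x)^2) x)"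
  by (rule integral_mono_AE[OF i real_cond_exp_int(1)[OF Z2]])
 then show "(LINT x|M. (real_cond_exp M F Z x)^2) \<le> (LINT x|M. (Z x)^2)"
  using real_cond_exp_int(2)[OF Z2] by simp
qed

lemma real_cond_exp_L1_contraction:
 assumes "integrable M Z"
 shows "(LINT x|M. \<bar>real_cond_exp M F Z x\<bar>) \<le> (LINT x|M. \<bar>Z x\<bar>)"
proof -
 have "AE x in M. \<bar>real_cond_exp M F Z x\<bar> \<le> real_cond_exp M F (\<lambda>x. \<bar>Z x\<bar>) x"
 proof -
  have "AE x in M. real_cond_exp M F Z x \<le> real_cond_exp M F (\<lambda>x. \<bar>Z x\<bar>) x"
   by (rule real_cond_exp_mono) (use assms in auto)
  moreover have "AE x in M. real_cond_exp M F (\<lambda>x. (-1) * Z x) x \<le> real_cond_exp M F (\<lambda>x. \<bar>Z x\<bar>) x"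
   by (rule real_cond_exp_mono) (use assms in auto)
  moreover have "AE x in M. real_cond_exp M F (\<lambda>x. (-1) * Z x) x = (-1) * real_cond_exp M F Z x"
   by (rule real_cond_exp_cmult) (use assms in auto)
  ultimately show ?thesis by eventually_elim auto
 qed
 then have "(LINT x|M. \<bar>real_cond_exp M F Z x\<bar>) \<le> (LINT x|M. real_cond_exp M F (\<lambda>x. \<bar>Z x\<bar>) x)"
  using assms by (intro integral_mono_AE real_cond_exp_int(1) integrable_abs) auto
 then show ?thesis using real_cond_exp_int(2)[of "\<lambda>x. \<bar>Z x\<bar>"] assms by simp
qed

lemma is_cond_exp_inner:
 fixes f :: "'w \<Rightarrow> 'h::{real_inner,banach,second_countable_topology}"
 assumes "is_cond_exp M F f g"
 shows "AE x in M. real_cond_exp M F (\<lambda>x. f x \<bullet> v) x = g x \<bullet> v"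
proof (rule real_cond_exp_charact)
 have f: "integrable M f" and g: "integrable M g" and [measurable]: "g \<in> borel_measurable F"
  and eq: "\<And>A. A \<in> sets F \<Longrightarrow> (LINT w:A|M. f w) = (LINT w:A|M. g w)"
  using assms by (auto simp: is_cond_exp_def)
 show "integrable M (\<lambda>x. f x \<bullet> v)" "integrable M (\<lambda>x. g x \<bullet> v)" using f g by auto
 fix A assume A: "A \<in> sets F"
 then have "A \<in> sets M" using subalg by (auto simp: subalgebra_def)
 then have i: "integrable M (\<lambda>x. indicator A x *\<^sub>R f x)" "integrable M (\<lambda>x. indicator A x *\<^sub>R g x)"
  using f g by (auto intro: integrable_mult_indicator)
 have "(LINT w:A|M. f w \<bullet> v) = (LINT w:A|M. f w) \<bullet> v" "(LINT w:A|M. g w \<bullet> v) = (LINT w:A|M. g w) \<bullet> v"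
  using integral_inner_left[OF i(1), of v] integral_inner_left[OF i(2), of v]
  by (simp_all add: set_lebesgue_integral_def inner_commute)
 then show "(LINT w:A|M. f w \<bullet> v) = (LINT w:A|M. g w \<bullet> v)" using eq[OF A] by simp
next
 have [measurable]: "g \<in> borel_measurable F" using assms by (simp add: is_cond_exp_def)
 show "(\<lambda>x. g x \<bullet> v) \<in> borel_measurable F" by measurable
qed

text \<open>The norm is the supremum of the functionals \<open>v \<mapsto> g \<bullet> v\<close> over a countable dense set.\<close>

lemma norm_is_cond_exp_le:
 fixes f :: "'w \<Rightarrow> 'h::{real_inner,banach,second_countable_topology}"
 assumes c: "is_cond_exp M F f g"
 shows "AE x in M. norm (g x) \<le> real_cond_exp M F (\<lambda>x. norm (f x)) x"
proof -
 have f: "integrable M f" using c by (simp add: is_cond_exp_def)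
 obtain D :: "'h set" where D: "countable D" "\<And>X. open X \<Longrightarrow> X \<noteq> {} \<Longrightarrow> \<exists>d\<in>D. d \<in> X"
  using countable_dense_setE by blast
 have "AE x in M. \<forall>v\<in>D. g x \<bullet> v \<le> norm v * real_cond_exp M F (\<lambda>x. norm (f x)) x"
 proof (rule AE_ball_countable[THEN iffD2, OF D(1)], rule ballI)
  fix v assume "v \<in> D"
  have "AE x in M. real_cond_exp M F (\<lambda>x. f x \<bullet> v) x \<le> real_cond_exp M F (\<lambda>x. norm v * norm (f x)) x"
   by (rule real_cond_exp_mono) (use f norm_cauchy_schwarz[of _ v] in \<open>auto simp: mult.commute[of "norm v"]\<close>)
  moreover have "AE x in M. real_cond_exp M F (\<lambda>x. norm v * norm (f x)) x = norm v * real_cond_exp M F (\<lambda>x. norm (f x)) x"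
   by (rule real_cond_exp_cmult) (use f in auto)
  ultimately show "AE x in M. g x \<bullet> v \<le> norm v * real_cond_exp M F (\<lambda>x. norm (f x)) x"
   using is_cond_exp_inner[OF c, of v] by eventually_elim simp
 qed
 moreover have "AE x in M. 0 \<le> real_cond_exp M F (\<lambda>x. norm (f x)) x"
  by (rule real_cond_exp_pos) (use f in auto)
 ultimately show ?thesis
 proof eventually_elim
  case (elim x)
  define R where "R = real_cond_exp M F (\<lambda>x. norm (f x)) x"
  have all: "g x \<bullet> v \<le> norm v * R" for v
  proof (rule ccontr)
   assume "\<not> g x \<bullet> v \<le> norm v * R"
   then have "v \<in> {v. norm v * R < g x \<bullet> v}" by simp
   moreover have "open {v. norm v * R < g x \<bullet> v}" by (intro open_Collect_less continuous_intros)
   ultimately obtain d where "d \<in> D" "norm d * R < g x \<bullet> d" using D(2)[of "{v. norm v * R < g x \<bullet> v}"] by blast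
   then show False using elim by (auto simp: R_def not_less[symmetric])
  qed
  have "norm (g x) * norm (g x) \<le> norm (g x) * R"
   using all[of "g x"] by (simp add: power2_norm_eq_inner[symmetric] power2_eq_square)
  moreover have "0 \<le> R" using elim(2) by (simp add: R_def)
  ultimately show ?case
   by (cases "g x = 0") (simp_all add: R_def)
 qed
qed

end

text \<open>Coordinatewise construction of the conditional expectation of a square-integrable random
 vector; the sum of the squared coordinates is finite by the contraction property in $L^2$.\<close>

context separable_hilbert_basis
begin

lemma square_norm_nn_integral:
 assumes [measurable]: "f \<in> borel_measurable M"
 shows "(\<integral>\<^sup>+x. ennreal ((norm (f x))^2) \<partial>M) = (\<Sum>k. \<integral>\<^sup>+x. ennreal ((f x \<bullet> u k)^2) \<partial>M)"
proof -
 have "ennreal ((norm v)^2) = (\<Sum>k. ennreal ((v \<bullet> u k)^2))" for v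
  using parseval[of v] by (subst suminf_ennreal2) (auto simp: sums_iff)
 then have "(\<integral>\<^sup>+x. ennreal ((norm (f x))^2) \<partial>M) = (\<integral>\<^sup>+x. (\<Sum>k. ennreal ((f x \<bullet> u k)^2)) \<partial>M)" by simp
 also have "\<dots> = (\<Sum>k. \<integral>\<^sup>+x. ennreal ((f x \<bullet> u k)^2) \<partial>M)"
  by (rule nn_integral_suminf) measurable
 finally show ?thesis .
qed

lemma integrable_square_coordinate:
 fixes f :: "'w \<Rightarrow> 'h"
 assumes [measurable]: "f \<in> borel_measurable M" and f2: "integrable M (\<lambda>x. (norm (f x))^2)"
 shows "integrable M (\<lambda>x. (f x \<bullet> v)^2)"
proof (rule Bochner_Integration.integrable_bound)
 show "integrable M (\<lambda>x. (norm v)^2 * (norm (f x))^2)" using f2 by simp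
 show "AE x in M. norm ((f x \<bullet> v)^2) \<le> norm ((norm v)^2 * (norm (f x))^2)"
  using Cauchy_Schwarz_ineq[of "f _" v] by (simp add: power2_norm_eq_inner mult.commute)
qed measurable

lemma is_cond_exp_exists:
 fixes f :: "'w \<Rightarrow> 'h"
 assumes "prob_subalgebra M F"
  and [measurable]: "f \<in> borel_measurable M" and f2: "integrable M (\<lambda>x. (norm (f x))^2)"
 shows "\<exists>g. is_cond_exp M F f g"
proof -
 interpret prob_subalgebra M F by fact
 define c where "c k = real_cond_exp M F (\<lambda>x. f x \<bullet> u k)" for k
 have sq: "integrable M (\<lambda>x. (f x \<bullet> u k)^2)" for k
  by (rule integrable_square_coordinate) (use f2 in auto)
 have [measurable]: "c k \<in> borel_measurable F" "c k \<in> borel_measurable M" for k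
  by (simp_all add: c_def)
 have c2: "integrable M (\<lambda>x. (c k x)^2)" "(LINT x|M. (c k x)^2) \<le> (LINT x|M. (f x \<bullet> u k)^2)" for k
  unfolding c_def by (rule real_cond_exp_square; simp add: sq)+
 have "(\<integral>\<^sup>+x. (\<Sum>k. ennreal ((c k x)^2)) \<partial>M) = (\<Sum>k. \<integral>\<^sup>+x. ennreal ((c k x)^2) \<partial>M)"
  by (rule nn_integral_suminf) measurable
 also have "\<dots> \<le> (\<Sum>k. \<integral>\<^sup>+x. ennreal ((f x \<bullet> u k)^2) \<partial>M)"
  using c2 sq by (intro suminf_le) (auto simp: nn_integral_eq_integral ennreal_leI)
 also have "\<dots> = (\<integral>\<^sup>+x. ennreal ((norm (f x))^2) \<partial>M)" by (rule square_norm_nn_integral[symmetric]) simp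
 also have "\<dots> < \<infinity>" using f2 by (simp add: nn_integral_eq_integral)
 finally have fin: "(\<integral>\<^sup>+x. (\<Sum>k. ennreal ((c k x)^2)) \<partial>M) < \<infinity>" .
 then have "AE x in M. (\<Sum>k. ennreal ((c k x)^2)) \<noteq> \<infinity>"
  by (intro nn_integral_PInf_AE) auto
 then have summ: "AE x in M. summable (\<lambda>k. (c k x)^2)"
  by eventually_elim (auto intro!: summable_suminf_not_top)
 define g where "g x = (\<Sum>k. c k x *\<^sub>R u k)" for x
 have gF [measurable]: "g \<in> borel_measurable F" unfolding g_def by measurable
 then have gM [measurable]: "g \<in> borel_measurable M" by (rule measurable_from_subalg[OF subalg])
 have gu: "AE x in M. \<forall>k. g x \<bullet> u k = c k x"
  using summ by eventually_elim (simp add: g_def riesz_fischer)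
 have "(\<integral>\<^sup>+x. ennreal ((norm (g x))^2) \<partial>M) = (\<integral>\<^sup>+x. (\<Sum>k. ennreal ((c k x)^2)) \<partial>M)"
 proof (rule nn_integral_cong_AE)
  show "AE x in M. ennreal ((norm (g x))^2) = (\<Sum>k. ennreal ((c k x)^2))"
   using gu
  proof eventually_elim
   case (elim x)
   have "(\<lambda>k. (c k x)^2) sums (norm (g x))\<^sup>2" using parseval[of "g x"] by (simp only: elim)
   then have "summable (\<lambda>k. (c k x)^2)" "(\<Sum>k. (c k x)^2) = (norm (g x))^2" by (simp_all add: sums_iff)
   then show ?case by (simp add: suminf_ennreal2)
  qed
 qed
 then have "(\<integral>\<^sup>+x. ennreal (norm ((norm (g x))^2)) \<partial>M) < \<infinity>" using fin by (simp only: real_norm_def abs_power2)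
 then have "integrable M (\<lambda>x. (norm (g x))^2)" by (intro integrableI_bounded) measurable
 then have "integrable M (\<lambda>x. norm (g x))" by (rule integrable_if_square_integrable[rotated]) measurable
 then have ig: "integrable M g" by (simp add: integrable_norm_iff)
 have "integrable M (\<lambda>x. norm (f x))" using f2 by (rule integrable_if_square_integrable[rotated]) measurable
 then have fi: "integrable M f" by (simp add: integrable_norm_iff)
 have "(LINT x:A|M. f x) = (LINT x:A|M. g x)" if A: "A \<in> sets F" for A
 proof (rule eq_if_coordinates_eq)
  fix k
  have "A \<in> sets M" using A subalg by (auto simp: subalgebra_def)
  then have i: "integrable M (\<lambda>x. indicator A x *\<^sub>R f x)" "integrable M (\<lambda>x. indicator A x *\<^sub>R g x)"
   using fi ig by (auto intro: integrable_mult_indicator)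
  have "(LINT x:A|M. f x) \<bullet> u k = (LINT x:A|M. f x \<bullet> u k)" "(LINT x:A|M. g x) \<bullet> u k = (LINT x:A|M. g x \<bullet> u k)"
   using integral_inner_left[OF i(1), of "u k"] integral_inner_left[OF i(2), of "u k"]
   by (simp_all add: set_lebesgue_integral_def)
  moreover have "(LINT x:A|M. f x \<bullet> u k) = (LINT x:A|M. c k x)"
   unfolding c_def by (rule real_cond_exp_intA) (use fi A in auto)
  moreover have "(LINT x:A|M. g x \<bullet> u k) = (LINT x:A|M. c k x)"
   unfolding set_lebesgue_integral_def
   by (rule integral_cong_AE) (use gu \<open>A \<in> sets M\<close> in auto)
  ultimately show "(LINT x:A|M. f x) \<bullet> u k = (LINT x:A|M. g x) \<bullet> u k" by simp
 qed
 then show ?thesis unfolding is_cond_exp_def using fi ig gF by blast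
qed

end

section \<open>Martingale difference arrays\<close>

locale filtered_prob = prob_space M for M :: "'w measure" +
 fixes F :: "nat \<Rightarrow> 'w measure"
 assumes subalgs: "subalgebra M (F i)" and filtration: "i \<le> j \<Longrightarrow> subalgebra (F j) (F i)"
begin

sublocale F: prob_subalgebra M "F i" for i
 by standard (rule subalgs)

lemma measurable_M: "f \<in> borel_measurable (F i) \<Longrightarrow> f \<in> borel_measurable M"
 by (rule measurable_from_subalg[OF subalgs])

lemma measurable_later: "i \<le> j \<Longrightarrow> f \<in> borel_measurable (F i) \<Longrightarrow> f \<in> borel_measurable (F j)"
 by (rule measurable_from_subalg[OF filtration])

text \<open>Centred increments are orthogonal, and centring decreases the second moment.\<close>

lemma centred_sum_second_moment:
 assumes Z: "\<And>i. i \<in> {1..n} \<Longrightarrow> Z i \<in> borel_measurable (F i)"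
  and Z2: "\<And>i. i \<in> {1..n} \<Longrightarrow> integrable M (\<lambda>x. (Z i x)^2)"
 defines "D \<equiv> \<lambda>i x. Z i x - real_cond_exp M (F (i - 1)) (Z i) x"
 shows "integrable M (\<lambda>x. (\<Sum>i=1..n. D i x)^2)"
  and "(LINT x|M. (\<Sum>i=1..n. D i x)^2) \<le> (\<Sum>i=1..n. (LINT x|M. (Z i x)^2))"
proof -
 have D: "D i \<in> borel_measurable (F i) \<and> integrable M (\<lambda>x. (D i x)^2) \<and> (LINT x|M. (D i x)^2) \<le> (LINT x|M. (Z i x)^2)
   \<and> (\<forall>S. S \<in> borel_measurable (F (i - 1)) \<longrightarrow> integrable M (\<lambda>x. (S x)^2) \<longrightarrow>
      integrable M (\<lambda>x. S x * D i x) \<and> (LINT x|M. S x * D i x) = 0)"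
  if i: "i \<in> {1..n}" for i
 proof -
  define c where "c = real_cond_exp M (F (i - 1)) (Z i)"
  have ZF [measurable]: "Z i \<in> borel_measurable (F i)" by (rule Z[OF i])
  have ZM [measurable]: "Z i \<in> borel_measurable M" by (rule measurable_M[OF ZF])
  have cF': "c \<in> borel_measurable (F (i - 1))" by (simp add: c_def)
  have cF [measurable]: "c \<in> borel_measurable (F i)" by (rule measurable_later[OF _ cF']) simp
  have cM [measurable]: "c \<in> borel_measurable M" by (rule measurable_M[OF cF])
  have c2: "integrable M (\<lambda>x. (c x)^2)" unfolding c_def by (rule F.real_cond_exp_square(1)[OF ZM Z2[OF i]])
  have cond: "integrable M (\<lambda>x. S x * Z i x)" "integrable M (\<lambda>x. S x * c x)"
   "(LINT x|M. S x * c x) = (LINT x|M. S x * Z i x)"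
   if S: "S \<in> borel_measurable (F (i - 1))" and S2: "integrable M (\<lambda>x. (S x)^2)" for S
  proof -
   have SM: "S \<in> borel_measurable M" by (rule measurable_M[OF S])
   show 1: "integrable M (\<lambda>x. S x * Z i x)" by (rule integrable_mult_square[OF SM ZM S2 Z2[OF i]])
   show "integrable M (\<lambda>x. S x * c x)" by (rule integrable_mult_square[OF SM cM S2 c2])
   show "(LINT x|M. S x * c x) = (LINT x|M. S x * Z i x)"
    unfolding c_def by (rule F.real_cond_exp_intg(2)[OF 1 S ZM])
  qed
  have Dc: "D i = (\<lambda>x. Z i x - c x)" by (simp add: D_def c_def)
  have sqD: "(D i x)^2 = (Z i x)^2 + (c x)^2 - 2 * (c x * Z i x)" for x
   by (simp add: Dc power2_eq_square algebra_simps)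
  note cc = cond[OF cF' c2]
  have D2: "integrable M (\<lambda>x. (D i x)^2)" unfolding sqD using Z2[OF i] c2 cc(1) by simp
  have "(LINT x|M. (D i x)^2) = (LINT x|M. (Z i x)^2) + (LINT x|M. (c x)^2) - 2 * (LINT x|M. c x * Z i x)"
   unfolding sqD using Z2[OF i] c2 cc(1) by simp
  also have "(LINT x|M. c x * Z i x) = (LINT x|M. (c x)^2)" using cc(3) by (simp add: power2_eq_square)
  finally have "(LINT x|M. (D i x)^2) \<le> (LINT x|M. (Z i x)^2)"
   using Bochner_Integration.integral_nonneg[of M "\<lambda>x. (c x)^2"] by simp
  then show ?thesis using D2 cond by (auto simp: Dc right_diff_distrib)
 qed
 have "m \<le> n \<Longrightarrow> (\<lambda>x. \<Sum>i=1..m. D i x) \<in> borel_measurable (F m) \<and> integrable M (\<lambda>x. (\<Sum>i=1..m. D i x)^2)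
   \<and> (LINT x|M. (\<Sum>i=1..m. D i x)^2) \<le> (\<Sum>i=1..m. (LINT x|M. (Z i x)^2))" for m
 proof (induction m)
  case (Suc m)
  define S where "S x = (\<Sum>i=1..m. D i x)" for x
  have S: "S \<in> borel_measurable (F m)" "integrable M (\<lambda>x. (S x)^2)"
   "(LINT x|M. (S x)^2) \<le> (\<Sum>i=1..m. (LINT x|M. (Z i x)^2))"
   using Suc by (simp_all add: S_def[abs_def])
  have i: "Suc m \<in> {1..n}" using Suc.prems by simp
  note Dm = D[OF i, simplified]
  have SF: "S \<in> borel_measurable (F (Suc m))" by (rule measurable_later[OF _ S(1)]) simp
  have prod: "integrable M (\<lambda>x. S x * D (Suc m) x)" "(LINT x|M. S x * D (Suc m) x) = 0"
   using Dm S by blast+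
  have sum: "(\<Sum>i=1..Suc m. D i x) = S x + D (Suc m) x" for x by (simp add: S_def)
  have sq: "(\<Sum>i=1..Suc m. D i x)^2 = (S x)^2 + (D (Suc m) x)^2 + 2 * (S x * D (Suc m) x)" for x
   unfolding sum by (simp add: power2_eq_square algebra_simps)
  show ?case
  proof (intro conjI)
   show "(\<lambda>x. \<Sum>i=1..Suc m. D i x) \<in> borel_measurable (F (Suc m))"
    unfolding sum using SF Dm by (intro borel_measurable_add) auto
   show "integrable M (\<lambda>x. (\<Sum>i=1..Suc m. D i x)^2)" unfolding sq using S Dm prod by simp
   show "(LINT x|M. (\<Sum>i=1..Suc m. D i x)^2) \<le> (\<Sum>i=1..Suc m. (LINT x|M. (Z i x)^2))"
    unfolding sq using S Dm prod by simp
  qed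
 qed simp
 from this[of n] show "integrable M (\<lambda>x. (\<Sum>i=1..n. D i x)^2)"
  "(LINT x|M. (\<Sum>i=1..n. D i x)^2) \<le> (\<Sum>i=1..n. (LINT x|M. (Z i x)^2))" by simp_all
qed

end

text \<open>The remainder is at most the third and at most the second power, hence at most any power in between.\<close>

lemma iexp_second_order:
 assumes "2 < p" "p \<le> (3::real)"
 shows "cmod (iexp x - (1 + \<i> * complex_of_real x - complex_of_real (x\<^sup>2 / 2))) \<le> \<bar>x\<bar> powr p"
proof -
 have s: "(\<Sum>k\<le>2. (\<i> * complex_of_real x) ^ k / fact k) = 1 + \<i> * complex_of_real x - complex_of_real (x\<^sup>2 / 2)"
  by (simp add: numeral_2_eq_2 power2_eq_square algebra_simps)
 have 1: "cmod (iexp x - (1 + \<i> * complex_of_real x - complex_of_real (x\<^sup>2 / 2))) \<le> \<bar>x\<bar> ^ 3 / 6"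
  using iexp_approx1[of x 2] unfolding s by (simp add: fact_numeral)
 have 2: "cmod (iexp x - (1 + \<i> * complex_of_real x - complex_of_real (x\<^sup>2 / 2))) \<le> \<bar>x\<bar> ^ 2"
  using iexp_approx2[of x 2] unfolding s by (simp add: fact_numeral)
 consider "x = 0" | "x \<noteq> 0" "\<bar>x\<bar> \<le> 1" | "1 < \<bar>x\<bar>" by linarith
 then show ?thesis
 proof cases
  case 1
  then show ?thesis by simp
 next
  case 2
  have "\<bar>x\<bar> ^ 3 = \<bar>x\<bar> powr 3" using 2 by (simp add: powr_numeral)
  also have "\<dots> \<le> \<bar>x\<bar> powr p" using 2 assms by (intro powr_mono') auto
  finally have "\<bar>x\<bar> ^ 3 / 6 \<le> \<bar>x\<bar> powr p" using zero_le_power[of "\<bar>x\<bar>" 3] by linarith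
  then show ?thesis using 1 by linarith
 next
  case 3
  have "\<bar>x\<bar> ^ 2 = \<bar>x\<bar> powr 2" using 3 by (simp add: powr_numeral)
  also have "\<dots> \<le> \<bar>x\<bar> powr p" using 3 assms by (intro powr_mono) auto
  finally show ?thesis using 2 by linarith
 qed
qed

lemma exp_minus_second_order:
 assumes "0 \<le> (v::real)"
 shows "\<bar>exp (- v / 2) - (1 - v / 2)\<bar> \<le> v\<^sup>2"
proof -
 define a where "a = v / 2"
 have a: "0 \<le> a" using assms by (simp add: a_def)
 have "1 + a \<le> exp a" by (rule exp_ge_add_one_self)
 then have "(1 + a) * exp (- a) \<le> exp a * exp (- a)" by (intro mult_right_mono) auto
 then have "(1 + a) * exp (- a) \<le> 1" by (simp add: mult_exp_exp)
 also have "\<dots> \<le> (1 + a) * (1 - a + a\<^sup>2)"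
  using a by (simp add: algebra_simps power2_eq_square)
 finally have "exp (- a) \<le> 1 - a + a\<^sup>2" using a by (simp add: mult_le_cancel_left)
 moreover have "1 + (- a) \<le> exp (- a)" by (rule exp_ge_add_one_self)
 moreover have "a\<^sup>2 \<le> v\<^sup>2" using assms by (simp add: a_def power_divide)
 moreover have "- v / 2 = - a" "v / 2 = a" by (simp_all add: a_def)
 ultimately show ?thesis by (simp only: abs_le_iff) linarith
qed

context prob_subalgebra
begin

lemma integral_bounded_times_centred:
 fixes A :: "'w \<Rightarrow> complex"
 assumes A: "A \<in> borel_measurable F" and c: "AE x in M. cmod (A x) \<le> c"
  and Z: "integrable M Z" and Z0: "AE x in M. real_cond_exp M F Z x = 0"
 shows "(CLINT x|M. A x * complex_of_real (Z x)) = 0"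
proof -
 have AM [measurable]: "A \<in> borel_measurable M" by (rule measurable_from_subalg[OF subalg A])
 have ZM [measurable]: "Z \<in> borel_measurable M" using Z by simp
 have real: "integrable M (\<lambda>x. B x * Z x) \<and> (LINT x|M. B x * Z x) = 0"
  if B: "B \<in> borel_measurable F" and Bc: "AE x in M. \<bar>B x\<bar> \<le> c" for B :: "'w \<Rightarrow> real"
 proof -
  have BM [measurable]: "B \<in> borel_measurable M" by (rule measurable_from_subalg[OF subalg B])
  have i: "integrable M (\<lambda>x. B x * Z x)"
  proof (rule Bochner_Integration.integrable_bound)
   show "integrable M (\<lambda>x. c * Z x)" using Z by simp
   show "AE x in M. norm (B x * Z x) \<le> norm (c * Z x)"
    using Bc by eventually_elim (auto simp: abs_mult intro!: mult_right_mono)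
  qed measurable
  have "(LINT x|M. B x * Z x) = (LINT x|M. B x * real_cond_exp M F Z x)"
   by (rule real_cond_exp_intg(2)[symmetric, OF i B ZM])
  also have "\<dots> = (LINT x|M. 0)"
   by (rule integral_cong_AE) (use Z0 in auto)
  finally show ?thesis using i by simp
 qed
 have "(\<lambda>x. Re (A x)) \<in> borel_measurable F" "(\<lambda>x. Im (A x)) \<in> borel_measurable F" using A by measurable
 moreover have "AE x in M. \<bar>Re (A x)\<bar> \<le> c" "AE x in M. \<bar>Im (A x)\<bar> \<le> c"
  using c by (eventually_elim, use abs_Re_le_cmod abs_Im_le_cmod order_trans in blast)+
 ultimately have R: "integrable M (\<lambda>x. Re (A x) * Z x)" "(LINT x|M. Re (A x) * Z x) = 0"
  and I: "integrable M (\<lambda>x. Im (A x) * Z x)" "(LINT x|M. Im (A x) * Z x) = 0"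
  using real by blast+
 have "A x * complex_of_real (Z x) = complex_of_real (Re (A x) * Z x) + \<i> * complex_of_real (Im (A x) * Z x)" for x
  by (rule complex_eqI) auto
 then have "(CLINT x|M. A x * complex_of_real (Z x)) =
   complex_of_real (LINT x|M. Re (A x) * Z x) + \<i> * complex_of_real (LINT x|M. Im (A x) * Z x)"
  using R I by (simp del: of_real_mult add: Bochner_Integration.integral_add integrable_of_real)
 then show ?thesis using R I by simp
qed

end

context filtered_prob
begin

text \<open>Multiplying the characteristic function by the exponential of half the quadratic
 characteristic turns the product over the increments into an approximate martingale: one factor
 has conditional expectation close to 1 by Taylor expansion up to second order.\<close>

lemma martingale_char_bound:
 fixes \<xi> :: "nat \<Rightarrow> 'w \<Rightarrow> real"
 assumes p: "2 < p" "p \<le> 3"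
  and \<xi>: "\<And>i. i \<in> {1..n} \<Longrightarrow> \<xi> i \<in> borel_measurable (F i)"
  and \<xi>2: "\<And>i. i \<in> {1..n} \<Longrightarrow> integrable M (\<lambda>x. (\<xi> i x)^2)"
  and \<xi>p: "\<And>i. i \<in> {1..n} \<Longrightarrow> integrable M (\<lambda>x. \<bar>\<xi> i x\<bar> powr p)"
  and \<xi>0: "\<And>i. i \<in> {1..n} \<Longrightarrow> AE x in M. real_cond_exp M (F (i - 1)) (\<xi> i) x = 0"
 defines "v \<equiv> \<lambda>i. real_cond_exp M (F (i - 1)) (\<lambda>x. (\<xi> i x)^2)"
 assumes V: "AE x in M. (\<Sum>i=1..n. v i x) \<le> C"
 shows "cmod ((CLINT x|M. iexp (\<Sum>i=1..n. \<xi> i x) * exp (complex_of_real ((\<Sum>i=1..n. v i x) / 2))) - 1)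
  \<le> exp (C / 2) * (\<Sum>i=1..n. (LINT x|M. \<bar>\<xi> i x\<bar> powr p) + (LINT x|M. (v i x)^2))"
proof -
 have v0: "AE x in M. \<forall>i\<in>{1..n}. 0 \<le> v i x"
 proof (rule AE_finite_allI)
  show "AE x in M. 0 \<le> v i x" if "i \<in> {1..n}" for i
   unfolding v_def by (rule F.real_cond_exp_pos) (use \<xi>2[OF that] in auto)
 qed simp
 have VC: "AE x in M. (\<forall>i\<in>{1..n}. 0 \<le> v i x) \<and> (\<forall>m\<le>n. (\<Sum>i=1..m. v i x) \<le> C)"
  using v0 V
 proof eventually_elim
  case (elim x)
  have "(\<Sum>i=1..m. v i x) \<le> C" if "m \<le> n" for m
  proof -
   have "(\<Sum>i=1..m. v i x) \<le> (\<Sum>i=1..n. v i x)" using elim that by (intro sum_mono2) auto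
   then show ?thesis using elim by simp
  qed
  then show ?case using elim by auto
 qed
 have vle: "AE x in M. \<bar>v i x\<bar> \<le> C" if "i \<in> {1..n}" for i
  using VC
 proof eventually_elim
  case (elim x)
  have "v i x \<le> (\<Sum>i=1..n. v i x)" using elim that by (intro member_le_sum) auto
  then show ?case using elim that by auto
 qed
 have vF: "v i \<in> borel_measurable (F (i - 1))" for i unfolding v_def by simp
 have v2: "integrable M (\<lambda>x. (v i x)^2)" if "i \<in> {1..n}" for i
 proof (rule integrable_const_bound[where B="C\<^sup>2"])
  show "AE x in M. norm ((v i x)^2) \<le> C\<^sup>2"
   using vle[OF that] by eventually_elim (simp add: abs_le_square_iff[symmetric])
  show "(\<lambda>x. (v i x)^2) \<in> borel_measurable M" using measurable_M[OF vF[of i]] by measurable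
 qed
 define U where "U m x = iexp (\<Sum>i=1..m. \<xi> i x) * exp (complex_of_real ((\<Sum>i=1..m. v i x) / 2))" for m x
 define A where "A m x = iexp (\<Sum>i=1..m. \<xi> i x) * exp (complex_of_real ((\<Sum>i=1..Suc m. v i x) / 2))" for m x
 have \<xi>M [measurable]: "i \<in> {1..n} \<Longrightarrow> \<xi> i \<in> borel_measurable M" for i using \<xi> measurable_M by blast
 have vM [measurable]: "v i \<in> borel_measurable M" for i using vF measurable_M by blast
 have UM: "U m \<in> borel_measurable M" if "m \<le> n" for m
  unfolding U_def using that by (intro borel_measurable_times borel_measurable_sum measurable_compose[OF _ borel_measurable_exp]
    measurable_compose[OF _ borel_measurable_of_real]) (auto intro!: borel_measurable_times borel_measurable_sum borel_measurable_divide measurable_compose[OF _ borel_measurable_of_real])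
 have AF: "A m \<in> borel_measurable (F m)" if "m < n" for m
 proof -
  have "(\<lambda>x. \<Sum>i=1..m. \<xi> i x) \<in> borel_measurable (F m)"
   using that by (intro borel_measurable_sum measurable_later[OF _ \<xi>]) auto
  moreover have "(\<lambda>x. \<Sum>i=1..Suc m. v i x) \<in> borel_measurable (F m)"
   by (intro borel_measurable_sum measurable_later[OF _ vF]) auto
  ultimately show ?thesis unfolding A_def by measurable
 qed
 have cmodE: "cmod (iexp s * exp (complex_of_real t)) = exp t" for s t by (simp add: norm_mult)
 have Ab: "AE x in M. cmod (A m x) \<le> exp (C / 2)" if "m < n" for m
  using VC by eventually_elim (use that in \<open>simp only: A_def cmodE exp_le_cancel_iff, auto dest: spec[of _ "Suc m"]\<close>)
 have Ub: "AE x in M. cmod (U m x) \<le> exp (C / 2)" if "m \<le> n" for m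
  using VC by eventually_elim (use that in \<open>simp only: U_def cmodE exp_le_cancel_iff, auto\<close>)
 have Ui: "integrable M (U m)" if "m \<le> n" for m
  by (rule integrable_const_bound[OF Ub[OF that] UM[OF that]])
 have step: "cmod ((CLINT x|M. U (Suc m) x) - (CLINT x|M. U m x))
   \<le> exp (C / 2) * ((LINT x|M. \<bar>\<xi> (Suc m) x\<bar> powr p) + (LINT x|M. (v (Suc m) x)^2))" if m: "m < n" for m
 proof -
  define i where "i = Suc m"
  have i: "i \<in> {1..n}" "i - 1 = m" using m by (auto simp: i_def)
  define R where "R x = iexp (\<xi> i x) - (1 + \<i> * complex_of_real (\<xi> i x) - complex_of_real ((\<xi> i x)^2 / 2))" for x
  define R' where "R' x = exp (- v i x / 2) - (1 - v i x / 2)" for x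
  have AM [measurable]: "A m \<in> borel_measurable M" by (rule measurable_M[OF AF[OF m]])
  have [measurable]: "\<xi> i \<in> borel_measurable M" using \<xi>M i by blast
  have [measurable]: "R \<in> borel_measurable M" "R' \<in> borel_measurable M" unfolding R_def R'_def by measurable
  have iv: "integrable M (v i)" unfolding v_def by (rule F.real_cond_exp_int(1)[OF \<xi>2[OF i(1)]])
  have i\<xi>: "integrable M (\<xi> i)" by (rule integrable_if_square_integrable[OF _ \<xi>2[OF i(1)]]) simp
  have Rb: "cmod (R x) \<le> \<bar>\<xi> i x\<bar> powr p" for x unfolding R_def by (rule iexp_second_order[OF p])
  have R'b: "AE x in M. \<bar>R' x\<bar> \<le> (v i x)^2"
   using v0 unfolding R'_def by eventually_elim (rule exp_minus_second_order, use i in auto)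
  have iR: "integrable M (\<lambda>x. A m x * (R x - complex_of_real (R' x)))"
   and bR: "cmod (CLINT x|M. A m x * (R x - complex_of_real (R' x)))
     \<le> exp (C / 2) * ((LINT x|M. \<bar>\<xi> i x\<bar> powr p) + (LINT x|M. (v i x)^2))"
  proof -
   have bd: "AE x in M. norm (A m x * (R x - complex_of_real (R' x))) \<le> exp (C / 2) * (\<bar>\<xi> i x\<bar> powr p + (v i x)^2)"
    using Ab[OF m] R'b
   proof eventually_elim
    case (elim x)
    have "norm (R x - complex_of_real (R' x)) \<le> \<bar>\<xi> i x\<bar> powr p + (v i x)^2"
     using Rb[of x] elim(2) norm_triangle_ineq4[of "R x" "complex_of_real (R' x)"] by simp
    then show ?case unfolding norm_mult using elim(1) by (intro mult_mono) auto
   qed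
   have ib: "integrable M (\<lambda>x. exp (C / 2) * (\<bar>\<xi> i x\<bar> powr p + (v i x)^2))"
    using \<xi>p[OF i(1)] v2[OF i(1)] by simp
   show iR: "integrable M (\<lambda>x. A m x * (R x - complex_of_real (R' x)))"
    by (rule Bochner_Integration.integrable_bound[OF ib]) (use bd in \<open>auto elim!: eventually_mono\<close>)
   have "cmod (CLINT x|M. A m x * (R x - complex_of_real (R' x))) \<le> (LINT x|M. norm (A m x * (R x - complex_of_real (R' x))))"
    by (rule integral_norm_bound)
   also have "\<dots> \<le> (LINT x|M. exp (C / 2) * (\<bar>\<xi> i x\<bar> powr p + (v i x)^2))"
    by (rule integral_mono_AE) (use iR ib bd in auto)
   also have "\<dots> = exp (C / 2) * ((LINT x|M. \<bar>\<xi> i x\<bar> powr p) + (LINT x|M. (v i x)^2))"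
    using \<xi>p[OF i(1)] v2[OF i(1)] by simp
   finally show "cmod (CLINT x|M. A m x * (R x - complex_of_real (R' x))) \<le> exp (C / 2) * ((LINT x|M. \<bar>\<xi> i x\<bar> powr p) + (LINT x|M. (v i x)^2))" .
  qed
  define Q where "Q x = v i x - (\<xi> i x)\<^sup>2" for x
  have iQ: "integrable M Q" unfolding Q_def using iv \<xi>2[OF i(1)] by simp
  have z1: "(CLINT x|M. A m x * complex_of_real (\<xi> i x)) = 0"
   using F.integral_bounded_times_centred[OF AF[OF m] Ab[OF m] i\<xi>] \<xi>0[OF i(1)] i(2) by simp
  have "AE x in M. real_cond_exp M (F m) (\<lambda>x. v i x - (\<xi> i x)\<^sup>2) x = real_cond_exp M (F m) (v i) x - real_cond_exp M (F m) (\<lambda>x. (\<xi> i x)^2) x"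
   by (rule F.real_cond_exp_diff[OF iv \<xi>2[OF i(1)]])
  moreover have "AE x in M. real_cond_exp M (F m) (v i) x = v i x"
   by (rule F.real_cond_exp_F_meas[OF iv]) (use vF[of i] i in simp)
  ultimately have "AE x in M. real_cond_exp M (F m) Q x = 0"
  proof eventually_elim
   case (elim x)
   have "v i = real_cond_exp M (F m) (\<lambda>x. (\<xi> i x)^2)" unfolding v_def i(2) ..
   with elim show ?case unfolding Q_def[abs_def] by simp
  qed
  then have z2: "(CLINT x|M. A m x * complex_of_real (Q x)) = 0"
   by (rule F.integral_bounded_times_centred[OF AF[OF m] Ab[OF m] iQ])
  have iA: "integrable M (\<lambda>x. A m x * complex_of_real (Z x))" if "integrable M Z" for Z :: "'w \<Rightarrow> real"
  proof (rule Bochner_Integration.integrable_bound)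
   show "integrable M (\<lambda>x. exp (C / 2) * Z x)" using that by simp
   show "AE x in M. norm (A m x * complex_of_real (Z x)) \<le> norm (exp (C / 2) * Z x)"
    using Ab[OF m] by eventually_elim (auto simp: norm_mult abs_mult intro!: mult_right_mono)
  qed (use that in measurable)
  have decomp: "U (Suc m) x - U m x = \<i> * (A m x * complex_of_real (\<xi> i x)) + (1/2) * (A m x * complex_of_real (Q x))
    + A m x * (R x - complex_of_real (R' x))" for x
  proof -
   have u1: "U (Suc m) x = A m x * iexp (\<xi> i x)"
    by (simp add: U_def A_def i_def exp_add distrib_left)
   have "exp (complex_of_real ((\<Sum>i=1..m. v i x) / 2)) =
     exp (complex_of_real ((\<Sum>i=1..Suc m. v i x) / 2)) * complex_of_real (exp (- v i x / 2))"
    by (simp add: i_def exp_of_real[symmetric] exp_add[symmetric] add_divide_distrib del: exp_of_real)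
     (simp add: exp_of_real[symmetric] exp_add[symmetric])?
   then have u2: "U m x = A m x * complex_of_real (exp (- v i x / 2))"
    by (simp add: U_def A_def)
   have "iexp (\<xi> i x) - complex_of_real (exp (- v i x / 2))
     = \<i> * complex_of_real (\<xi> i x) + (1/2) * complex_of_real (Q x) + (R x - complex_of_real (R' x))"
    by (simp add: R_def R'_def Q_def field_simps)
   then show ?thesis unfolding u1 u2 right_diff_distrib[symmetric] by (simp only:) (simp add: algebra_simps)
  qed
  have "(CLINT x|M. U (Suc m) x) - (CLINT x|M. U m x) = (CLINT x|M. U (Suc m) x - U m x)"
   by (rule Bochner_Integration.integral_diff[symmetric]) (use m Ui in auto)
  also have "\<dots> = (CLINT x|M. A m x * (R x - complex_of_real (R' x)))"
   unfolding decomp using iA[OF i\<xi>] iA[OF iQ] iR z1 z2 by (simp add: Bochner_Integration.integral_add)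
  finally show ?thesis using bR by (simp add: i_def)
 qed
 have "m \<le> n \<Longrightarrow> cmod ((CLINT x|M. U m x) - 1)
  \<le> exp (C / 2) * (\<Sum>i=1..m. (LINT x|M. \<bar>\<xi> i x\<bar> powr p) + (LINT x|M. (v i x)^2))" for m
 proof (induction m)
  case 0
  then show ?case using prob_space by (simp add: U_def)
 next
  case (Suc m)
  have "cmod ((CLINT x|M. U (Suc m) x) - 1) \<le> cmod ((CLINT x|M. U (Suc m) x) - (CLINT x|M. U m x)) + cmod ((CLINT x|M. U m x) - 1)"
   using norm_triangle_ineq[of "(CLINT x|M. U (Suc m) x) - (CLINT x|M. U m x)" "(CLINT x|M. U m x) - 1"] by simp
  then show ?case using step[of m] Suc by (simp add: distrib_left)
 qed
 from this[of n] show ?thesis by (simp add: U_def)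
qed

text \<open>The random quadratic characteristic in the exponent is replaced by its approximate value \<open>s\<close>, at the cost of
  their distance in the mean.\<close>

lemma martingale_char_estimate:
 fixes \<xi> :: "nat \<Rightarrow> 'w \<Rightarrow> real"
 assumes p: "2 < p" "p \<le> 3"
  and \<xi>: "\<And>i. i \<in> {1..n} \<Longrightarrow> \<xi> i \<in> borel_measurable (F i)"
  and \<xi>2: "\<And>i. i \<in> {1..n} \<Longrightarrow> integrable M (\<lambda>x. (\<xi> i x)^2)"
  and \<xi>p: "\<And>i. i \<in> {1..n} \<Longrightarrow> integrable M (\<lambda>x. \<bar>\<xi> i x\<bar> powr p)"
  and \<xi>0: "\<And>i. i \<in> {1..n} \<Longrightarrow> AE x in M. real_cond_exp M (F (i - 1)) (\<xi> i) x = 0"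
 defines "v \<equiv> \<lambda>i. real_cond_exp M (F (i - 1)) (\<lambda>x. (\<xi> i x)^2)"
 assumes V: "AE x in M. (\<Sum>i=1..n. v i x) \<le> C" and s: "0 \<le> s" "s \<le> C"
 shows "cmod ((CLINT x|M. iexp (\<Sum>i=1..n. \<xi> i x)) - complex_of_real (exp (- s / 2)))
  \<le> exp (C / 2) * ((\<Sum>i=1..n. (LINT x|M. \<bar>\<xi> i x\<bar> powr p) + (LINT x|M. (v i x)^2))
    + (LINT x|M. \<bar>(\<Sum>i=1..n. v i x) - s\<bar>))"
proof -
 define S where "S x = (\<Sum>i=1..n. \<xi> i x)" for x
 define T where "T x = (\<Sum>i=1..n. v i x)" for x
 have "\<xi> i \<in> borel_measurable M" if "i \<in> {1..n}" for i
  using \<xi>[OF that] by (rule measurable_M)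
 then have [measurable]: "S \<in> borel_measurable M" "T \<in> borel_measurable M"
  unfolding S_def T_def v_def by (auto intro!: borel_measurable_sum borel_measurable_cond_exp2)
 have iT: "integrable M T" unfolding T_def v_def
  by (intro Bochner_Integration.integrable_sum F.real_cond_exp_int(1) \<xi>2)
 have b1: "cmod ((CLINT x|M. iexp (S x) * exp (complex_of_real (T x / 2))) - 1)
  \<le> exp (C / 2) * (\<Sum>i=1..n. (LINT x|M. \<bar>\<xi> i x\<bar> powr p) + (LINT x|M. (v i x)^2))"
  unfolding S_def T_def v_def by (rule martingale_char_bound[OF p \<xi> \<xi>2 \<xi>p \<xi>0 V[unfolded v_def]])
 have i1: "integrable M (\<lambda>x. iexp (S x))" by (rule integrable_iexp) auto
 have i2: "integrable M (\<lambda>x. iexp (S x) * exp (complex_of_real (T x / 2)))"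
  by (rule integrable_const_bound[where B="exp (C / 2)"])
    (use V[folded T_def] in \<open>auto simp: norm_mult elim!: eventually_mono\<close>)
 have lip: "\<bar>exp a - exp b\<bar> \<le> exp c * \<bar>a - b\<bar>" if "a \<le> c" "b \<le> c" for a b c :: real
 proof -
  have *: "exp y - exp x \<le> exp c * (y - x)" if "x \<le> y" "y \<le> c" for x y :: real
  proof -
   have "exp y * (1 + (x - y)) \<le> exp y * exp (x - y)" by (intro mult_left_mono exp_ge_add_one_self) simp
   then have "exp y - exp x \<le> exp y * (y - x)" by (simp add: mult_exp_exp algebra_simps)
   also have "\<dots> \<le> exp c * (y - x)" using that by (intro mult_right_mono) auto
   finally show ?thesis .
  qed
  show ?thesis using *[of a b] *[of b a] that by (cases "a \<le> b") auto
 qed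
 have b2: "cmod ((CLINT x|M. iexp (S x)) * complex_of_real (exp (s / 2)) - (CLINT x|M. iexp (S x) * exp (complex_of_real (T x / 2))))
   \<le> exp (C / 2) * (LINT x|M. \<bar>T x - s\<bar>)"
 proof -
  have "(CLINT x|M. iexp (S x)) * complex_of_real (exp (s / 2)) - (CLINT x|M. iexp (S x) * exp (complex_of_real (T x / 2)))
   = (CLINT x|M. iexp (S x) * complex_of_real (exp (s / 2)) - iexp (S x) * exp (complex_of_real (T x / 2)))"
   using i1 i2 by simp
  also have "cmod \<dots> \<le> (LINT x|M. cmod (iexp (S x) * complex_of_real (exp (s / 2)) - iexp (S x) * exp (complex_of_real (T x / 2))))"
   by (rule integral_norm_bound)
  also have "\<dots> \<le> (LINT x|M. exp (C / 2) * \<bar>T x - s\<bar>)"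
  proof (rule integral_mono_AE)
   show "AE x in M. cmod (iexp (S x) * complex_of_real (exp (s / 2)) - iexp (S x) * exp (complex_of_real (T x / 2))) \<le> exp (C / 2) * \<bar>T x - s\<bar>"
    using V[folded T_def]
   proof eventually_elim
    case (elim x)
    have "cmod (iexp (S x) * complex_of_real (exp (s / 2)) - iexp (S x) * exp (complex_of_real (T x / 2))) = \<bar>exp (s / 2) - exp (T x / 2)\<bar>"
     unfolding exp_of_real right_diff_distrib[symmetric] of_real_diff[symmetric] norm_mult norm_of_real by simp
    also have "\<dots> \<le> exp (C / 2) * \<bar>s / 2 - T x / 2\<bar>" by (rule lip) (use elim s in auto)
    also have "\<dots> \<le> exp (C / 2) * \<bar>T x - s\<bar>" by (intro mult_left_mono) (auto simp: abs_if)
    finally show ?case .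
   qed
  qed (use i1 i2 iT in auto)
  finally show ?thesis by simp
 qed
 have "cmod ((CLINT x|M. iexp (S x)) - complex_of_real (exp (- s / 2)))
   = exp (- s / 2) * cmod ((CLINT x|M. iexp (S x)) * complex_of_real (exp (s / 2)) - 1)"
 proof -
  have "(CLINT x|M. iexp (S x)) - complex_of_real (exp (- s / 2)) =
   complex_of_real (exp (- s / 2)) * ((CLINT x|M. iexp (S x)) * complex_of_real (exp (s / 2)) - 1)"
   by (simp add: algebra_simps exp_of_real[symmetric] mult_exp_exp del: exp_of_real) (simp add: exp_minus exp_of_real)?
  then show ?thesis by (simp only: norm_mult norm_of_real) simp
 qed
 also have "\<dots> \<le> 1 * cmod ((CLINT x|M. iexp (S x)) * complex_of_real (exp (s / 2)) - 1)"
  using s by (intro mult_right_mono) auto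
 also have "\<dots> \<le> exp (C / 2) * (LINT x|M. \<bar>T x - s\<bar>) +
   exp (C / 2) * (\<Sum>i=1..n. (LINT x|M. \<bar>\<xi> i x\<bar> powr p) + (LINT x|M. (v i x)^2))"
  using b1 b2 norm_triangle_ineq[of "(CLINT x|M. iexp (S x)) * complex_of_real (exp (s / 2)) - (CLINT x|M. iexp (S x) * exp (complex_of_real (T x / 2)))"
   "(CLINT x|M. iexp (S x) * exp (complex_of_real (T x / 2))) - 1"] by simp
 finally show ?thesis unfolding S_def T_def by (simp only: distrib_left add.commute)
qed

end

section \<open>Riemann--Stieltjes sums for decreasing kernels\<close>

text \<open>Both the sum and the integral lie between the lower and the upper Stieltjes sum of a monotone
 function.\<close>

lemma stieltjes_sum_bound:
 fixes \<kappa> \<kappa>' \<tau> :: "real \<Rightarrow> real" and N :: nat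
 assumes der: "\<And>t. t \<in> {0..1} \<Longrightarrow> (\<kappa> has_real_derivative \<kappa>' t) (at t within {0..1})"
  and cont: "continuous_on {0..1} \<kappa>'" and neg: "\<And>t. t \<in> {0..1} \<Longrightarrow> \<kappa>' t \<le> 0"
  and bound: "\<And>t. t \<in> {0..1} \<Longrightarrow> \<bar>\<kappa>' t\<bar> \<le> B"
  and mono: "\<And>s t. 0 < s \<Longrightarrow> s \<le> t \<Longrightarrow> t \<le> 1 \<Longrightarrow> \<tau> s \<le> \<tau> t"
  and range: "\<And>t. t \<in> {0..1} \<Longrightarrow> \<tau> t \<in> {0..1}"
  and N: "0 < N"
 shows "\<bar>(\<Sum>l=1..<N. (\<kappa> (l / N) - \<kappa> ((l + 1) / N)) * \<tau> (l / N)) - (- integral {0..1} (\<lambda>s. \<kappa>' s * \<tau> s))\<bar> \<le> B / N"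
proof -
 define \<sigma> where "\<sigma> s = (if s \<le> 0 then 0 else if s \<le> 1 then \<tau> s else 1)" for s
 have \<sigma>_mono: "\<sigma> s \<le> \<sigma> t" if "s \<le> t" for s t
  using that mono[of s t] range[of t] range[of s] by (auto simp: \<sigma>_def)
 have \<sigma>01: "0 \<le> \<sigma> s" "\<sigma> s \<le> 1" for s using range[of s] by (auto simp: \<sigma>_def)
 have I0: "integral {0..1} (\<lambda>s. \<kappa>' s * \<tau> s) = integral {0..1} (\<lambda>s. \<kappa>' s * \<sigma> s)"
  by (rule integral_spike[of "{0}"]) (auto simp: \<sigma>_def)
 have int: "(\<lambda>s. \<kappa>' s * \<sigma> s) integrable_on {a..b}" if "{a..b} \<subseteq> {0..1}" and ab: "a \<le> b" for a b
 proof -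
  have "\<kappa>' integrable_on {a..b}"
   by (rule integrable_continuous_real) (rule continuous_on_subset[OF cont that(1)])
  then obtain c where "((\<lambda>s. \<sigma> s * \<kappa>' s) has_integral (\<sigma> a * integral {a..c} \<kappa>' + \<sigma> b * integral {c..b} \<kappa>')) {a..b}"
   by (rule second_mean_value_theorem_full[where g=\<sigma>]) (use ab \<sigma>_mono in auto)
  then show ?thesis by (auto simp: has_integral_integrable mult.commute)
 qed
 have ftc: "(\<kappa>' has_integral (\<kappa> b - \<kappa> a)) {a..b}" if "0 \<le> a" "a \<le> b" "b \<le> 1" for a b
  using that by (intro fundamental_theorem_of_calculus)
   (auto simp: has_real_derivative_iff_has_vector_derivative[symmetric] intro!: DERIV_subset[OF der])
 have piece: "(\<kappa> a - \<kappa> b) * \<sigma> a \<le> - integral {a..b} (\<lambda>s. \<kappa>' s * \<sigma> s)"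
  "- integral {a..b} (\<lambda>s. \<kappa>' s * \<sigma> s) \<le> (\<kappa> a - \<kappa> b) * \<sigma> b"
  "\<kappa> a - \<kappa> b \<le> B * (b - a)" if ab: "0 \<le> a" "a \<le> b" "b \<le> 1" for a b
 proof -
  have sub: "{a..b} \<subseteq> {0..1}" using ab by auto
  have i: "((\<lambda>s. \<kappa>' s * \<sigma> s) has_integral integral {a..b} (\<lambda>s. \<kappa>' s * \<sigma> s)) {a..b}"
   using int[OF sub ab(2)] by (simp add: has_integral_integral)
  have "integral {a..b} (\<lambda>s. \<kappa>' s * \<sigma> s) \<le> (\<kappa> b - \<kappa> a) * \<sigma> a"
   using ab neg by (intro has_integral_le[OF i has_integral_mult_left[OF ftc[OF ab]]])
    (auto intro!: mult_left_mono_neg \<sigma>_mono)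
  then show "(\<kappa> a - \<kappa> b) * \<sigma> a \<le> - integral {a..b} (\<lambda>s. \<kappa>' s * \<sigma> s)" by (simp add: algebra_simps)
  have "(\<kappa> b - \<kappa> a) * \<sigma> b \<le> integral {a..b} (\<lambda>s. \<kappa>' s * \<sigma> s)"
   using ab neg by (intro has_integral_le[OF has_integral_mult_left[OF ftc[OF ab]] i])
    (auto intro!: mult_left_mono_neg \<sigma>_mono)
  then show "- integral {a..b} (\<lambda>s. \<kappa>' s * \<sigma> s) \<le> (\<kappa> a - \<kappa> b) * \<sigma> b" by (simp add: algebra_simps)
  have "((\<lambda>s. - B) has_integral (b - a) * (- B)) {a..b}"
   using has_integral_const_real[of "- B" a b] ab by simp
  then have "(b - a) * (- B) \<le> \<kappa> b - \<kappa> a"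
   using ab by (rule has_integral_le[OF _ ftc]) (use bound ab in \<open>auto simp: abs_le_iff minus_le_iff\<close>)
  then show "\<kappa> a - \<kappa> b \<le> B * (b - a)" by (simp add: algebra_simps)
 qed
 define c where "c l = \<kappa> (real l / N) - \<kappa> (real (Suc l) / N)" for l
 define J where "J l = - integral {real l / N..real (Suc l) / N} (\<lambda>s. \<kappa>' s * \<sigma> s)" for l
 have pos: "0 \<le> real l / N" "real l / N \<le> real (Suc l) / N" for l
  using N by (auto simp: divide_right_mono)
 have le1: "real (Suc l) / N \<le> 1" if "l < N" for l using that N by simp
 have lower: "c l * \<sigma> (real l / N) \<le> J l" and upper: "J l \<le> c l * \<sigma> (real (Suc l) / N)" 
  and cB: "c l \<le> B / N" if "l < N" for l
  using piece[OF pos(1) pos(2) le1[OF that]] N unfolding c_def J_def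
  by (simp_all add: diff_divide_distrib[symmetric])
 have "m \<le> N \<Longrightarrow> - integral {0..real m / N} (\<lambda>s. \<kappa>' s * \<sigma> s) = (\<Sum>l<m. J l)" for m
 proof (induction m)
  case (Suc m)
  have "integral {0..real m / N} (\<lambda>s. \<kappa>' s * \<sigma> s) + integral {real m / N..real (Suc m) / N} (\<lambda>s. \<kappa>' s * \<sigma> s)
    = integral {0..real (Suc m) / N} (\<lambda>s. \<kappa>' s * \<sigma> s)"
  proof (rule Henstock_Kurzweil_Integration.integral_combine[OF pos])
   have "{0..real (Suc m) / N} \<subseteq> {0..1}" using le1[of m] Suc.prems by auto
   then show "(\<lambda>s. \<kappa>' s * \<sigma> s) integrable_on {0..real (Suc m) / N}" by (rule int) (rule pos)
  qed
  then show ?case using Suc by (simp add: J_def)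
 qed simp
 from this[of N] have I: "- integral {0..1} (\<lambda>s. \<kappa>' s * \<sigma> s) = (\<Sum>l<N. J l)" using N by simp
 have S: "(\<Sum>l=1..<N. (\<kappa> (l / N) - \<kappa> ((l + 1) / N)) * \<tau> (l / N)) = (\<Sum>l<N. c l * \<sigma> (real l / N))"
 proof -
  have "(\<Sum>l<N. c l * \<sigma> (real l / N)) = (\<Sum>l=1..<N. c l * \<sigma> (real l / N))"
  proof (rule sum.mono_neutral_right)
   have "\<sigma> 0 = 0" by (simp add: \<sigma>_def)
   then have "c l * \<sigma> (real l / N) = 0" if "l \<in> {..<N} - {1..<N}" for l
    using that by (cases l) auto
   then show "\<forall>l\<in>{..<N} - {1..<N}. c l * \<sigma> (real l / N) = 0" by blast
  qed auto
  also have "\<dots> = (\<Sum>l=1..<N. (\<kappa> (l / N) - \<kappa> ((l + 1) / N)) * \<tau> (l / N))"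
   by (rule sum.cong) (auto simp: \<sigma>_def c_def add.commute divide_le_0_iff)
  finally show ?thesis by simp
 qed
 have "(\<Sum>l<N. c l * \<sigma> (real l / N)) \<le> (\<Sum>l<N. J l)" by (intro sum_mono lower) simp
 moreover have "(\<Sum>l<N. J l) - (\<Sum>l<N. c l * \<sigma> (real l / N)) \<le> B / N"
 proof -
  have "(\<Sum>l<N. J l) - (\<Sum>l<N. c l * \<sigma> (real l / N)) \<le> (\<Sum>l<N. c l * (\<sigma> (real (Suc l) / N) - \<sigma> (real l / N)))"
   unfolding sum_subtractf[symmetric] right_diff_distrib using upper by (intro sum_mono) auto
  also have "\<dots> \<le> (\<Sum>l<N. B / N * (\<sigma> (real (Suc l) / N) - \<sigma> (real l / N)))"
   using cB \<sigma>_mono[OF pos(2)] by (intro sum_mono mult_right_mono) auto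
  also have "\<dots> = B / N * (\<sigma> (real N / N) - \<sigma> 0)"
   unfolding sum_distrib_left[symmetric] using sum_lessThan_telescope[of "\<lambda>l. \<sigma> (real l / N)" N]
   by (simp only: of_nat_0 div_0)
  also have "\<dots> \<le> B / N * 1"
  proof (rule mult_left_mono)
   have "0 \<le> B" using bound[of 0] by auto
   then show "0 \<le> B / N" by simp
  qed (use \<sigma>01[of 1] N in \<open>auto simp: \<sigma>_def\<close>)
  finally show ?thesis by simp
 qed
 ultimately show ?thesis unfolding S I0 I by linarith
qed

text \<open>Within each of the \<open>N\<close> pieces of the unit interval the telescoping sum is the value of \<open>\<kappa>\<close> at the next
  division point, up to the value at \<open>(N + 1) / N\<close>, which is 0 by the condition on the support.\<close>

lemma kernel_step_approximation:
 fixes \<kappa> \<kappa>' :: "real \<Rightarrow> real" and N :: nat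
 assumes der: "\<And>t. t \<in> {0..1} \<Longrightarrow> (\<kappa> has_real_derivative \<kappa>' t) (at t within {0..1})"
  and bound: "\<And>t. t \<in> {0..1} \<Longrightarrow> \<bar>\<kappa>' t\<bar> \<le> B"
  and supp: "\<And>t. t \<notin> {0..1} \<Longrightarrow> \<kappa> t = 0"
  and N: "0 < N" and t: "0 \<le> t"
 shows "\<bar>\<kappa> t - (\<Sum>l=1..N. (\<kappa> (l / N) - \<kappa> ((l + 1) / N)) * indicator {..l / N} t)\<bar> \<le> B / N * indicator {..1} t"
proof (cases "t \<le> 1")
 case False
 have "indicator {..real l / N} t = (0::real)" if "l \<le> N" for l
 proof -
  have "real l / N \<le> 1" using that N by simp
  then show ?thesis using False by (auto simp: indicator_def)
 qed
 then show ?thesis using False supp[of t] by simp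
next
 case True
 define m where "m = max 1 (nat \<lceil>t * N\<rceil>)"
 have ceil: "t * N \<le> of_int \<lceil>t * N\<rceil>" "of_int \<lceil>t * N\<rceil> < t * N + 1" by linarith+
 have c0: "0 \<le> \<lceil>t * N\<rceil>" using t by (simp add: ceiling_le_zero zero_le_ceiling)
   (smt (verit) mult_nonneg_nonneg of_nat_0_le_iff zero_le_ceiling)?
 have nc: "real (nat \<lceil>t * N\<rceil>) = of_int \<lceil>t * N\<rceil>" using c0 by simp
 have tm: "t \<le> real m / N" 
 proof -
  have "real (nat \<lceil>t * N\<rceil>) \<le> real m" unfolding m_def by simp
  then have "t * N \<le> real m" using nc ceil by linarith
  then show ?thesis using N by (simp add: field_simps)
 qed
 have mN: "m \<le> N" and m1: "1 \<le> m"
 proof -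
  have "t * N \<le> N" using True N by simp
  then have "\<lceil>t * N\<rceil> \<le> int N" by (simp add: ceiling_le_iff)
  then show "m \<le> N" using N unfolding m_def by linarith
 qed (simp add: m_def)
 have close: "real m / N - t \<le> 1 / N"
 proof -
  have "real m \<le> t * N + 1" unfolding m_def using nc ceil t by (simp add: max_def)
  then have "real m / N \<le> (t * N + 1) / N" by (intro divide_right_mono) auto
  then show ?thesis using N by (simp add: add_divide_distrib)
 qed
 have ind: "t \<le> real l / N \<longleftrightarrow> m \<le> l" if "1 \<le> l" for l :: nat
 proof
  assume "m \<le> l"
  then have "real m / N \<le> real l / N" by (intro divide_right_mono) auto
  then show "t \<le> real l / N" using tm by simp
 next
  assume "t \<le> real l / N"
  then have "t * N \<le> real l" using N by (simp add: field_simps)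
  then have "t * N \<le> of_int (int l)" by simp
  then have "\<lceil>t * N\<rceil> \<le> int l" unfolding ceiling_le_iff .
  then show "m \<le> l" using that unfolding m_def by linarith
 qed
 have "(\<Sum>l=1..N. (\<kappa> (l / N) - \<kappa> ((l + 1) / N)) * indicator {..l / N} t) = (\<Sum>l=m..N. \<kappa> (l / N) - \<kappa> ((l + 1) / N))"
  using m1 ind by (intro sum.mono_neutral_cong_right) (auto simp: indicator_def)
 also have "\<dots> = \<kappa> (m / N) - \<kappa> ((N + 1) / N)"
  using sum_Suc_diff[of m N "\<lambda>l. - \<kappa> (real l / N)"] mN by (simp add: add.commute algebra_simps)
 also have "\<kappa> ((N + 1) / N) = 0" using N by (intro supp) (simp add: field_simps)
 finally have S: "(\<Sum>l=1..N. (\<kappa> (l / N) - \<kappa> ((l + 1) / N)) * indicator {..l / N} t) = \<kappa> (m / N)" by simp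
 have m01: "real m / N \<in> {0..1}" using mN N by simp
 have "norm (\<kappa> t - \<kappa> (real m / N)) \<le> B * norm (t - real m / N)"
  by (rule field_differentiable_bound[where S="{0..1}" and f'=\<kappa>'])
   (use bound t True m01 der in auto)
 also have "\<dots> \<le> B * (1 / N)"
 proof (rule mult_left_mono)
  show "0 \<le> B" using bound[of 0] by auto
  show "norm (t - real m / N) \<le> 1 / N" using close tm by simp
 qed
 finally show ?thesis unfolding S using True by simp
qed

section \<open>Sigma-algebras of the triangular array\<close>

lemma sigma_join_properties:
 assumes F: "subalgebra M F" and T: "T \<in> M \<rightarrow>\<^sub>M N"
 shows "subalgebra M (sigma_join M F T N)" "subalgebra (sigma_join M F T N) F" "T \<in> sigma_join M F T N \<rightarrow>\<^sub>M N"
proof -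
 define A where "A = sets F \<union> {T -` A \<inter> space M | A. A \<in> sets N}"
 have AM: "A \<subseteq> sets M" using F T unfolding A_def subalgebra_def by (auto dest: measurable_sets)
 then have AP: "A \<subseteq> Pow (space M)" using sets.sets_into_space by blast
 have J: "sigma_join M F T N = sigma (space M) A" by (simp add: sigma_join_def A_def)
 have sp: "space (sigma_join M F T N) = space M" and se: "sets (sigma_join M F T N) = sigma_sets (space M) A"
  unfolding J using AP by simp_all
 show "subalgebra M (sigma_join M F T N)"
  unfolding subalgebra_def sp se using AM sets.sigma_sets_subset by auto
 show "subalgebra (sigma_join M F T N) F"
  using F unfolding subalgebra_def sp se A_def by auto
 show "T \<in> sigma_join M F T N \<rightarrow>\<^sub>M N"
 proof (rule measurableI)
  show "T w \<in> space N" if "w \<in> space (sigma_join M F T N)" for w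
   using that measurable_space[OF T] by (simp add: sp)
  show "T -` B \<inter> space (sigma_join M F T N) \<in> sets (sigma_join M F T N)" if "B \<in> sets N" for B
   unfolding sp se A_def using that by (intro sigma_sets.Basic) auto
 qed
qed

lemma space_pm_borel [simp]: "space (pm_borel d) = UNIV"
 by (simp add: pm_borel_def)

lemma pseudometric_dist_measurable:
 assumes "pseudometric d"
 shows "d x \<in> borel_measurable (pm_borel d)"
proof (rule borel_measurableI_greater)
 fix y
 have "openin (pm_topology d) {z. y < d x z}"
  unfolding openin_pm_topology
 proof (intro ballI exI[where x="d x _ - y"] conjI allI impI)
  fix z assume z: "z \<in> {z. y < d x z}"
  then show "0 < d x z - y" by simp
  fix z' assume "d z z' < d x z - y"
  moreover have "d x z \<le> d x z' + d z' z" "d z' z = d z z'" using assms by (auto simp: pseudometric_def)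
  ultimately show "z' \<in> {z. y < d x z}" by simp
 qed
 then show "{z \<in> space (pm_borel d). y < d x z} \<in> sets (pm_borel d)"
  by (auto simp: pm_borel_def intro: sigma_sets.Basic)
qed

locale functional_regression = prob_space M for M :: "'w measure" +
 fixes d :: "'e \<Rightarrow> 'e \<Rightarrow> real"
  and e :: "nat \<Rightarrow> 'h::{real_inner,banach,second_countable_topology}"
  and X :: "nat \<Rightarrow> nat \<Rightarrow> 'w \<Rightarrow> 'e"
  and Y :: "nat \<Rightarrow> nat \<Rightarrow> 'w \<Rightarrow> 'h"
  and r :: "'e \<Rightarrow> 'h"
  and x :: 'e
  and K \<phi> \<tau>0 :: "real \<Rightarrow> real"
  and h b :: "nat \<Rightarrow> real"
  and f1 :: "'e \<Rightarrow> real"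
  and W :: "nat \<Rightarrow> nat \<Rightarrow> 'e \<Rightarrow> real"
  and \<alpha> \<delta> a0 a1 :: real
 assumes pm: "pseudometric d"
  and basis: "orthonormal_basis e"
  and identical: "identically_distributed_array M d X Y"
  and regression: "regression_function M d X Y r"
  and bandwidths: "\<forall>n\<ge>1. 0 < h n \<and> 0 < b n"
  and A1: "hyp_A1 K"
  and A2: "hyp_A2 M d X Y x \<alpha> \<delta> \<phi> f1 \<tau>0"
  and A3: "hyp_A3 M d X Y e r x h \<delta> W a0 a1"
  and A4: "hyp_A4 M d X Y e r x \<alpha> a0 a1"
  and A5: "hyp_A5 h b \<phi> \<alpha>"
begin

abbreviation D :: "nat \<Rightarrow> nat \<Rightarrow> 'w \<Rightarrow> real" where "D n i w \<equiv> d x (X n i w)"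
abbreviation cdf :: "real \<Rightarrow> real" where "cdf \<equiv> dist_cdf M d X x"
abbreviation ccdf :: "nat \<Rightarrow> nat \<Rightarrow> real \<Rightarrow> 'w \<Rightarrow> real" where "ccdf n i \<equiv> cond_cdf M d X Y n i x"
abbreviation sF :: "nat \<Rightarrow> nat \<Rightarrow> 'w measure" where "sF n i \<equiv> sigF M d X Y n i"
abbreviation sG :: "nat \<Rightarrow> nat \<Rightarrow> 'w measure" where "sG n i \<equiv> sigG M d X Y n i"
abbreviation cexp :: "nat \<Rightarrow> nat \<Rightarrow> ('w \<Rightarrow> real) \<Rightarrow> 'w \<Rightarrow> real" where "cexp n i \<equiv> real_cond_exp M (sF n (i - 1))"

lemma r_measurable [measurable]: "r \<in> pm_borel d \<rightarrow>\<^sub>M borel"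
 using regression by (simp add: regression_function_def)

lemma dist_measurable [measurable]: "d x \<in> borel_measurable (pm_borel d)"
 by (rule pseudometric_dist_measurable[OF pm])

lemma dist_nonneg: "0 \<le> d x y" using pm by (simp add: pseudometric_def)

lemma pair_measurable:
 assumes "1 \<le> i" "i \<le> n"
 shows "(\<lambda>w. (X n i w, Y n i w)) \<in> M \<rightarrow>\<^sub>M pm_borel d \<Otimes>\<^sub>M borel"
proof -
 have "n \<ge> 1" "i \<in> {1..n}" using assms by auto
 then show ?thesis using identical unfolding identically_distributed_array_def by blast
qed

lemma X_measurable: "1 \<le> i \<Longrightarrow> i \<le> n \<Longrightarrow> X n i \<in> M \<rightarrow>\<^sub>M pm_borel d"
 using measurable_compose[OF pair_measurable measurable_fst] by simp

lemma Y_measurable: "1 \<le> i \<Longrightarrow> i \<le> n \<Longrightarrow> Y n i \<in> M \<rightarrow>\<^sub>M borel"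
 using measurable_compose[OF pair_measurable measurable_snd] by simp

lemma D_measurable: "1 \<le> i \<Longrightarrow> i \<le> n \<Longrightarrow> D n i \<in> borel_measurable M"
 using measurable_compose[OF X_measurable dist_measurable] by simp

lemma sigF_space_sets:
 "space (sF n i) = space M"
 "sets (sF n i) = sigma_sets (space M) (\<Union>j\<in>{1..i}. {(\<lambda>w. (X n j w, Y n j w)) -` A \<inter> space M | A. A \<in> sets (pm_borel d \<Otimes>\<^sub>M borel)})"
proof -
 have "(\<Union>j\<in>{1..i}. {(\<lambda>w. (X n j w, Y n j w)) -` A \<inter> space M | A. A \<in> sets (pm_borel d \<Otimes>\<^sub>M borel)}) \<subseteq> Pow (space M)"
  by auto
 then show "space (sF n i) = space M"
  "sets (sF n i) = sigma_sets (space M) (\<Union>j\<in>{1..i}. {(\<lambda>w. (X n j w, Y n j w)) -` A \<inter> space M | A. A \<in> sets (pm_borel d \<Otimes>\<^sub>M borel)})"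
  by (simp_all add: sigF_def)
qed

lemma sigF_subalgebra: "i \<le> n \<Longrightarrow> subalgebra M (sF n i)"
 unfolding subalgebra_def sigF_space_sets
 using measurable_sets[OF pair_measurable] by (intro conjI refl sets.sigma_sets_subset) auto

lemma sigF_mono: "i \<le> j \<Longrightarrow> subalgebra (sF n j) (sF n i)"
 unfolding subalgebra_def sigF_space_sets by (intro conjI refl sigma_sets_mono' UN_mono) auto

lemma sigF_pair_measurable:
 assumes "1 \<le> j" "j \<le> i"
 shows "(\<lambda>w. (X n j w, Y n j w)) \<in> sF n i \<rightarrow>\<^sub>M pm_borel d \<Otimes>\<^sub>M borel"
proof (rule measurableI)
 show "(X n j w, Y n j w) \<in> space (pm_borel d \<Otimes>\<^sub>M borel)" for w
  by (simp add: space_pair_measure)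
 show "(\<lambda>w. (X n j w, Y n j w)) -` A \<inter> space (sF n i) \<in> sets (sF n i)" if "A \<in> sets (pm_borel d \<Otimes>\<^sub>M borel)" for A
  unfolding sigF_space_sets using that assms by (intro sigma_sets.Basic UN_I[of j] CollectI exI[of _ A]) auto
qed

lemma filtered: "filtered_prob M (\<lambda>i. sF n (min i n))"
 by standard (auto intro!: sigF_subalgebra sigF_mono)

lemma sigG_properties:
 assumes "1 \<le> i" "i \<le> n"
 shows "subalgebra M (sG n (i - 1))" "subalgebra (sG n (i - 1)) (sF n (i - 1))" "X n i \<in> sG n (i - 1) \<rightarrow>\<^sub>M pm_borel d"
 unfolding sigG_def using sigma_join_properties[OF sigF_subalgebra[of "i - 1" n] X_measurable[OF assms]] assms by auto

lemma distr_eq: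
 assumes "1 \<le> i" "i \<le> n"
 shows "distr M (pm_borel d \<Otimes>\<^sub>M borel) (\<lambda>w. (X n i w, Y n i w)) =
    distr M (pm_borel d \<Otimes>\<^sub>M borel) (\<lambda>w. (X 1 1 w, Y 1 1 w))"
proof -
 have "n \<ge> 1" "i \<in> {1..n}" using assms by auto
 then show ?thesis using identical unfolding identically_distributed_array_def by blast
qed

lemma integral_distr_eq:
 fixes q :: "'e \<Rightarrow> 'y::{banach,second_countable_topology}"
 assumes "1 \<le> i" "i \<le> n" and q [measurable]: "q \<in> borel_measurable (pm_borel d)"
 shows "(LINT w|M. q (X n i w)) = (LINT w|M. q (X 1 1 w))"
proof -
 have "(LINT w|M. q (X m j w)) = (\<integral>z. q (fst z) \<partial>distr M (pm_borel d \<Otimes>\<^sub>M borel) (\<lambda>w. (X m j w, Y m j w)))"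
  if "1 \<le> j" "j \<le> m" for m j
  using integral_distr[OF pair_measurable[OF that], of "\<lambda>z. q (fst z)"] by simp
 from this[OF assms(1,2)] this[of 1 1] show ?thesis unfolding distr_eq[OF assms(1,2)] by simp
qed

lemma nn_integral_distr_eq:
 assumes "1 \<le> i" "i \<le> n" and q [measurable]: "q \<in> borel_measurable (pm_borel d)"
 shows "(\<integral>\<^sup>+w. q (X n i w) \<partial>M) = (\<integral>\<^sup>+w. q (X 1 1 w) \<partial>M)"
proof -
 have "(\<integral>\<^sup>+w. q (X m j w) \<partial>M) = (\<integral>\<^sup>+z. q (fst z) \<partial>distr M (pm_borel d \<Otimes>\<^sub>M borel) (\<lambda>w. (X m j w, Y m j w)))"
  if "1 \<le> j" "j \<le> m" for m j
  using nn_integral_distr[OF pair_measurable[OF that], of "\<lambda>z. q (fst z)"] by simp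
 from this[OF assms(1,2)] this[of 1 1] show ?thesis unfolding distr_eq[OF assms(1,2)] by simp
qed

lemma integral_ball:
 assumes "1 \<le> i" "i \<le> n"
 shows "(LINT w|M. indicator {..u} (D n i w)) = cdf u" "integrable M (\<lambda>w. indicator {..u} (D n i w) :: real)"
  "(\<integral>\<^sup>+w. indicator {..u} (D n i w) \<partial>M) = ennreal (cdf u)"
proof -
 have [measurable]: "D n i \<in> borel_measurable M" "D 1 1 \<in> borel_measurable M" using D_measurable assms by auto
 have "(LINT w|M. indicator {..u} (D n i w)) = (\<integral>w. indicator {..u} (D 1 1 w) \<partial>M :: real)"
  by (rule integral_distr_eq[OF assms, of "\<lambda>y. indicator {..u} (d x y)"]) measurable
 also have "\<dots> = (LINT w|M. indicator {w\<in>space M. D 1 1 w \<le> u} w)"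
  by (intro Bochner_Integration.integral_cong) (auto simp: indicator_def)
 also have "\<dots> = cdf u"
  unfolding dist_cdf_def by (subst Bochner_Integration.integral_indicator) (auto intro!: arg_cong[where f=prob])
 finally show 1: "(LINT w|M. indicator {..u} (D n i w)) = cdf u" .
 show 2: "integrable M (\<lambda>w. indicator {..u} (D n i w) :: real)"
  by (rule integrable_const_bound[where B=1]) (auto simp: indicator_def)
 have "(\<integral>\<^sup>+w. indicator {..u} (D n i w) \<partial>M) = (\<integral>\<^sup>+w. ennreal (indicator {..u} (D n i w)) \<partial>M)"
  by (intro nn_integral_cong) (auto simp: indicator_def)
 then show "(\<integral>\<^sup>+w. indicator {..u} (D n i w) \<partial>M) = ennreal (cdf u)"
  using nn_integral_eq_integral[OF 2] 1 by simp
qed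

lemma cdf_mono: "u \<le> v \<Longrightarrow> cdf u \<le> cdf v"
 unfolding dist_cdf_def by (rule finite_measure_mono) (use D_measurable[of 1 1] in auto)

lemma cdf_nonneg: "0 \<le> cdf u"
 by (simp add: dist_cdf_def)

lemma h_pos: "1 \<le> n \<Longrightarrow> 0 < h n" using bandwidths by simp

lemma h_tendsto: "h \<longlonglongrightarrow> 0" using A5 by (simp add: hyp_A5_def)

lemma h_at_right: "filterlim h (at_right 0) sequentially"
 by (rule tendsto_imp_filterlim_at_right[OF h_tendsto])
   (use h_pos in \<open>auto simp: eventually_sequentially intro!: exI[of _ 1]\<close>)

lemma scaled_h_at_right: "0 < s \<Longrightarrow> filterlim (\<lambda>n. h n * s) (at_right 0) sequentially"
 by (rule tendsto_imp_filterlim_at_right[OF tendsto_mult_left_zero[OF h_tendsto]])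
   (use h_pos in \<open>auto simp: eventually_sequentially intro!: exI[of _ 1]\<close>)

lemma h_le_eventually: "0 < c \<Longrightarrow> \<forall>\<^sub>F n in sequentially. h n \<le> c"
 using order_tendstoD(2)[OF h_tendsto, of c] by (auto elim!: eventually_mono)

text \<open>The logarithmic factor in the hypothesis on the bandwidth is at most 1 for \<open>n \<ge> 3\<close>.\<close>

lemma nphi_at_top: "filterlim (\<lambda>n. real n * \<phi> (h n)) at_top sequentially"
proof -
 have lim: "filterlim (\<lambda>n. sqrt (real n * \<phi> (h n)) * ln (real n) powr (- max (2 + \<alpha>) (1 / 2))) at_top sequentially"
  using A5 by (simp add: hyp_A5_def)
 have \<phi>0: "0 \<le> \<phi> u" if "0 \<le> u" for u using A2 that by (simp add: hyp_A2_def)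
 have "filterlim (\<lambda>n. sqrt (real n * \<phi> (h n))) at_top sequentially"
 proof (rule filterlim_at_top_mono[OF lim])
  show "\<forall>\<^sub>F n in sequentially. sqrt (real n * \<phi> (h n)) * ln (real n) powr (- max (2 + \<alpha>) (1 / 2)) \<le> sqrt (real n * \<phi> (h n))"
   using eventually_ge_at_top[of 3]
  proof eventually_elim
   case (elim n)
   have "exp 1 \<le> real n" using e_less_272 elim by linarith
   then have "1 \<le> ln (real n)" using elim by (simp add: ln_ge_iff)
   then have "ln (real n) powr (- max (2 + \<alpha>) (1 / 2)) \<le> ln (real n) powr 0"
    by (intro powr_mono) auto
   then have "ln (real n) powr (- max (2 + \<alpha>) (1 / 2)) \<le> 1" using \<open>1 \<le> ln (real n)\<close> by simp
   then have "sqrt (real n * \<phi> (h n)) * ln (real n) powr (- max (2 + \<alpha>) (1 / 2)) \<le> sqrt (real n * \<phi> (h n)) * 1"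
    by (intro mult_left_mono) (use elim h_pos[of n] \<phi>0[of "h n"] in auto)
   then show ?case by simp
  qed
 qed
 then have "filterlim (\<lambda>n. (sqrt (real n * \<phi> (h n)))^2) at_top sequentially"
  by (rule filterlim_pow_at_top[rotated]) simp
 moreover have "\<forall>\<^sub>F n in sequentially. (sqrt (real n * \<phi> (h n)))^2 = real n * \<phi> (h n)"
  using eventually_ge_at_top[of 1] by eventually_elim (use h_pos \<phi>0 in \<open>auto intro!: real_sqrt_pow2 mult_nonneg_nonneg simp: less_imp_le\<close>)
 ultimately show ?thesis by (simp cong: filterlim_cong)
qed

lemma phi_pos: "\<forall>\<^sub>F n in sequentially. 0 < \<phi> (h n)"
 using nphi_at_top[unfolded filterlim_at_top, rule_format, of 1] eventually_ge_at_top[of 1]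
proof eventually_elim
 case (elim n)
 then show ?case by (smt (verit) mult_le_0_iff of_nat_0_le_iff)
qed

lemma phi_ratio:
 assumes "s \<in> {0..1}"
 shows "(\<lambda>n. \<phi> (h n * s) / \<phi> (h n)) \<longlonglongrightarrow> \<tau>0 s"
proof -
 have "uniform_limit {0..1} (\<lambda>h u. \<phi> (h * u) / \<phi> h) \<tau>0 (at_right 0)" using A2 by (simp add: hyp_A2_def)
 from tendsto_uniform_limitI[OF this assms] show ?thesis
  by (rule filterlim_compose[OF _ h_at_right])
qed

lemma phi_bigo: "s \<in> {0..1} \<Longrightarrow> (\<lambda>n. \<phi> (h n * s)) \<in> O(\<lambda>n. \<phi> (h n))"
 by (rule bigoI_tendsto[OF phi_ratio]) (use phi_pos in \<open>auto elim!: eventually_mono\<close>)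

lemma f1_pos: "0 < f1 x"
 using A2 unfolding hyp_A2_def by (elim conjE exE) assumption

text \<open>The ratio is the product of \<open>cdf u / \<phi> u\<close> at \<open>u = h n * s\<close> and of \<open>\<phi> (h n * s) / \<phi> (h n)\<close>.\<close>

lemma cdf_ratio:
 assumes s: "0 < s" "s \<le> 1"
 shows "(\<lambda>n. cdf (h n * s) / \<phi> (h n)) \<longlonglongrightarrow> f1 x * \<tau>0 s"
proof -
 have "(\<lambda>u. cdf u - \<phi> u * f1 x) \<in> o[at_right 0](\<phi>)"
  using A2 unfolding hyp_A2_def by (elim conjE exE) (rule spec)
 then have "(\<lambda>n. cdf (h n * s) - \<phi> (h n * s) * f1 x) \<in> o(\<lambda>n. \<phi> (h n * s))"
  by (rule landau_o.small.compose[OF _ scaled_h_at_right[OF s(1)]])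
 then have "(\<lambda>n. cdf (h n * s) - \<phi> (h n * s) * f1 x) \<in> o(\<lambda>n. \<phi> (h n))"
  using phi_bigo[of s] s by (auto intro: landau_o.small_big_trans)
 from tendsto_add[OF smalloD_tendsto[OF this] tendsto_mult[OF phi_ratio[of s] tendsto_const[of "f1 x"]]] s
 show ?thesis by (simp add: diff_divide_distrib mult.commute)
qed

lemma tau_one: "\<tau>0 1 = 1"
proof -
 have "(\<lambda>n. \<phi> (h n * 1) / \<phi> (h n)) \<longlonglongrightarrow> 1"
  by (rule tendsto_eventually) (use phi_pos in \<open>auto elim!: eventually_mono\<close>)
 then show ?thesis using phi_ratio[of 1] by (auto intro: LIMSEQ_unique)
qed

lemma cdf_ratio_one: "(\<lambda>n. cdf (h n) / \<phi> (h n)) \<longlonglongrightarrow> f1 x"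
 using cdf_ratio[of 1] by (simp add: tau_one)

lemma tau_range: "s \<in> {0..1} \<Longrightarrow> \<tau>0 s \<in> {0..1}"
proof -
 assume s: "s \<in> {0..1}"
 have "\<forall>u\<in>{0..1}. \<tau>0 u \<in> {0..1}"
  using A2 unfolding hyp_A2_def by (elim conjE exE) assumption
 then show ?thesis using s by blast
qed

text \<open>Monotonicity is inherited from the distribution function, of which \<open>\<tau>0\<close> is a scaling limit.\<close>

lemma tau_mono:
 assumes "0 < s" "s \<le> t" "t \<le> 1"
 shows "\<tau>0 s \<le> \<tau>0 t"
proof -
 have "f1 x * \<tau>0 s \<le> f1 x * \<tau>0 t"
 proof (rule LIMSEQ_le[OF cdf_ratio cdf_ratio])
  have "\<forall>\<^sub>F n in sequentially. cdf (h n * s) / \<phi> (h n) \<le> cdf (h n * t) / \<phi> (h n)"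
   using phi_pos eventually_ge_at_top[of 1]
   by eventually_elim (use assms h_pos in \<open>auto intro!: divide_right_mono cdf_mono mult_left_mono simp: less_imp_le\<close>)
  then show "\<exists>N. \<forall>n\<ge>N. cdf (h n * s) / \<phi> (h n) \<le> cdf (h n * t) / \<phi> (h n)"
   by (simp add: eventually_sequentially)
 qed (use assms in auto)
 then show ?thesis using f1_pos by simp
qed

text \<open>The distribution function at \<open>h n\<close> has the order of \<open>\<phi> (h n)\<close> and hence tends to 0. So there is
  no mass at distance 0 of \<open>x\<close>, where the local hypotheses say nothing.\<close>

lemma cdf_zero: "cdf 0 = 0"
proof -
 have "\<forall>\<^sub>F n in sequentially. cdf 0 \<le> cdf (h n)"
  using eventually_ge_at_top[of 1] by eventually_elim (use h_pos in \<open>auto intro!: cdf_mono simp: less_imp_le\<close>)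
 moreover have "(\<lambda>n. cdf (h n)) \<longlonglongrightarrow> 0"
 proof -
  have "(\<phi> \<longlongrightarrow> 0) (at_right 0)" using A2 by (simp add: hyp_A2_def)
  then have "(\<lambda>n. \<phi> (h n)) \<longlonglongrightarrow> 0" by (rule filterlim_compose[OF _ h_at_right])
  from tendsto_mult[OF cdf_ratio_one this]
  have "(\<lambda>n. cdf (h n) / \<phi> (h n) * \<phi> (h n)) \<longlonglongrightarrow> 0" by simp
  moreover have "\<forall>\<^sub>F n in sequentially. cdf (h n) / \<phi> (h n) * \<phi> (h n) = cdf (h n)"
   using phi_pos by eventually_elim simp
  ultimately show ?thesis by (simp add: tendsto_cong)
 qed
 ultimately have "cdf 0 \<le> 0" by (intro tendsto_lowerbound[of "\<lambda>n. cdf (h n)"]) auto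
 then show ?thesis using cdf_nonneg[of 0] by linarith
qed

text \<open>The average of the main terms converges by hypothesis, and the average of the remainders is negligible along
  the radii \<open>h n * s\<close>.\<close>

lemma average_ccdf_tendsto:
 assumes s: "0 < s" "s \<le> 1"
 shows "AE w in M. (\<lambda>n. (\<Sum>i=1..n. ccdf n i (h n * s) w) / (real n * \<phi> (h n))) \<longlonglongrightarrow> f1 x * \<tau>0 s"
proof -
 define u where "u n = (if n = 0 then 1 else h n * s)" for n
 have u: "(\<forall>n. 0 < u n) \<and> u \<longlonglongrightarrow> 0"
 proof
  show "\<forall>n. 0 < u n" using h_pos s by (auto simp: u_def)
  have "(\<lambda>n. h n * s) \<longlonglongrightarrow> 0" using tendsto_mult_left_zero[OF h_tendsto] .
  moreover have "\<forall>\<^sub>F n in sequentially. h n * s = u n"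
   using eventually_ge_at_top[of 1] by eventually_elim (simp add: u_def)
  ultimately show "u \<longlonglongrightarrow> 0" by (rule Lim_transform_eventually)
 qed
 obtain f :: "nat \<Rightarrow> nat \<Rightarrow> 'e \<Rightarrow> 'w \<Rightarrow> real" and g :: "nat \<Rightarrow> nat \<Rightarrow> 'e \<Rightarrow> real \<Rightarrow> 'w \<Rightarrow> real" where
  eq': "\<forall>n\<ge>1. \<forall>i\<in>{1..n}. \<forall>y. \<forall>u>0. AE w in M. cond_cdf M d X Y n i y u w = \<phi> u * f n i y w + g n i y u w"
  and small': "\<forall>y. \<forall>u. (\<forall>n. 0 < u n) \<and> u \<longlonglongrightarrow> 0 \<longrightarrow> (AE w in M.
      (\<lambda>n. (\<Sum>i=1..n. \<bar>g n i y (u n) w\<bar>) / real n) \<in> o(\<lambda>n. \<phi> (u n)))"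
  and avg: "AE w in M. (\<lambda>n. (\<Sum>i=1..n. f n i x w) / real n) \<longlonglongrightarrow> f1 x"
  using A2 unfolding hyp_A2_def by (elim conjE exE) (rule that; assumption)
 have small: "AE w in M. (\<lambda>n. (\<Sum>i=1..n. \<bar>g n i x (u n) w\<bar>) / real n) \<in> o(\<lambda>n. \<phi> (u n))"
  using small' u by blast
 have eq: "n \<ge> 1 \<Longrightarrow> i \<in> {1..n} \<Longrightarrow> AE w in M. ccdf n i (u n) w = \<phi> (u n) * f n i x w + g n i x (u n) w" for n i
  using eq' u by blast
 have "AE w in M. \<forall>n\<in>{1..}. \<forall>i\<in>{1..n}. ccdf n i (u n) w = \<phi> (u n) * f n i x w + g n i x (u n) w"
  using eq by (auto simp: AE_ball_countable)
 then show ?thesis using small avg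
 proof eventually_elim
  case (elim w)
  note ccdf_eq = elim(1)
  have "(\<lambda>n. \<phi> (u n)) \<in> O(\<lambda>n. \<phi> (h n))"
  proof (subst landau_o.big.in_cong)
   show "\<forall>\<^sub>F n in sequentially. \<phi> (u n) = \<phi> (h n * s)"
    using eventually_ge_at_top[of 1] by eventually_elim (simp add: u_def)
  qed (use s phi_bigo[of s] in auto)
  with elim(2) have "(\<lambda>n. (\<Sum>i=1..n. \<bar>g n i x (u n) w\<bar>) / real n) \<in> o(\<lambda>n. \<phi> (h n))"
   by (rule landau_o.small_big_trans)
  from smalloD_tendsto[OF this]
  have abs0: "(\<lambda>n. (\<Sum>i=1..n. \<bar>g n i x (u n) w\<bar>) / real n / \<phi> (h n)) \<longlonglongrightarrow> 0" .
  have g0: "(\<lambda>n. (\<Sum>i=1..n. g n i x (u n) w) / real n / \<phi> (h n)) \<longlonglongrightarrow> 0"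
  proof (rule Lim_null_comparison[OF _ abs0])
   show "\<forall>\<^sub>F n in sequentially. norm ((\<Sum>i=1..n. g n i x (u n) w) / real n / \<phi> (h n))
     \<le> (\<Sum>i=1..n. \<bar>g n i x (u n) w\<bar>) / real n / \<phi> (h n)"
    using phi_pos by eventually_elim (auto intro!: divide_right_mono sum_abs simp: abs_divide)
  qed
  have "(\<lambda>n. \<phi> (h n * s) / \<phi> (h n) * ((\<Sum>i=1..n. f n i x w) / real n) + (\<Sum>i=1..n. g n i x (u n) w) / real n / \<phi> (h n))
    \<longlonglongrightarrow> \<tau>0 s * f1 x + 0"
   using s by (intro tendsto_add tendsto_mult phi_ratio elim(3) g0) auto
  moreover have "\<forall>\<^sub>F n in sequentially. \<phi> (h n * s) / \<phi> (h n) * ((\<Sum>i=1..n. f n i x w) / real n) + (\<Sum>i=1..n. g n i x (u n) w) / real n / \<phi> (h n)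
    = (\<Sum>i=1..n. ccdf n i (h n * s) w) / (real n * \<phi> (h n))"
   using eventually_ge_at_top[of 1] phi_pos
  proof eventually_elim
   case (elim n)
   then have un: "u n = h n * s" by (simp add: u_def)
   have "(\<Sum>i=1..n. ccdf n i (h n * s) w) = (\<Sum>i=1..n. \<phi> (h n * s) * f n i x w + g n i x (u n) w)"
   proof (rule sum.cong)
    fix i assume "i \<in> {1..n}"
    then have "ccdf n i (u n) w = \<phi> (u n) * f n i x w + g n i x (u n) w" using ccdf_eq elim(1) by auto
    then show "ccdf n i (h n * s) w = \<phi> (h n * s) * f n i x w + g n i x (u n) w" unfolding un .
   qed simp
   then show ?case using elim by (simp add: sum.distrib sum_distrib_left[symmetric] field_simps)
  qed
  ultimately show ?case using s by (simp add: tendsto_cong mult.commute)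
 qed
qed

text \<open>Both parts of the decomposition of the conditional distribution function are bounded in essential supremum
  by \<^term>\<open>\<phi> (h n)\<close> times the constants \<open>L n i\<close> of the hypothesis.\<close>

lemma ccdf_bound:
 obtains L :: "nat \<Rightarrow> nat \<Rightarrow> real" and C :: real where "0 \<le> C"
  "\<And>n i. i \<in> {1..n} \<Longrightarrow> 0 \<le> L n i"
  "\<forall>\<^sub>F n in sequentially. (\<Sum>i=1..n. (L n i)^2) \<le> C * real n"
  "\<forall>\<^sub>F n in sequentially. \<forall>i\<in>{1..n}. AE w in M. ccdf n i (h n) w \<le> \<phi> (h n) * L n i"
proof -
 obtain L :: "nat \<Rightarrow> nat \<Rightarrow> real" and Lsup and f :: "nat \<Rightarrow> nat \<Rightarrow> 'e \<Rightarrow> 'w \<Rightarrow> real"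
  and g :: "nat \<Rightarrow> nat \<Rightarrow> 'e \<Rightarrow> real \<Rightarrow> 'w \<Rightarrow> real" where
  L0: "\<forall>n\<ge>1. \<forall>i\<in>{1..n}. 0 \<le> L n i" and
  Ls: "limsup (\<lambda>n. ereal ((\<Sum>i=1..n. (L n i)^2) / real n)) = ereal Lsup" and
  fm: "\<forall>n\<ge>1. \<forall>i\<in>{1..n}. (\<forall>y. f n i y \<in> borel_measurable M) \<and>
      (\<forall>y. \<forall>w\<in>space M. 0 \<le> f n i y w) \<and> (\<exists>B. \<forall>y. \<forall>w\<in>space M. f n i y w \<le> B)" and
  gm: "\<forall>n\<ge>1. \<forall>i\<in>{1..n}. \<forall>y. \<forall>u>0. g n i y u \<in> borel_measurable M" and
  eq: "\<forall>n\<ge>1. \<forall>i\<in>{1..n}. \<forall>y. \<forall>u>0. AE w in M. cond_cdf M d X Y n i y u w = \<phi> u * f n i y w + g n i y u w" and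
  Lb: "\<forall>n\<ge>1. \<forall>i\<in>{1..n}. \<forall>y\<in>pm_cball d x \<delta>.
      Linf_norm M (f n i y) \<le> ereal (L n i) \<and>
      (\<forall>u\<in>{0<..\<delta>}. Linf_norm M (g n i y u) / ereal (\<phi> u) \<le> ereal (L n i))"
  using A2 unfolding hyp_A2_def by (elim conjE exE) (rule that; assumption)
 have \<delta>: "0 < \<delta>" using A2 by (simp add: hyp_A2_def)
 have xb: "x \<in> pm_cball d x \<delta>" using \<delta> pm by (simp add: pm_cball_def pseudometric_def)
 have Linf: "AE w in M. \<bar>q w\<bar> \<le> c" if "q \<in> borel_measurable M" "Linf_norm M q \<le> ereal c" for q c
 proof -
  have "AE w in M. ereal \<bar>q w\<bar> \<le> Linf_norm M q"
   unfolding Linf_norm_def by (rule esssup_AE)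
  then show ?thesis by eventually_elim (use that(2) order_trans in \<open>force\<close>)
 qed
 show thesis
 proof (rule that[of "\<bar>Lsup\<bar> * 4 + 4" "\<lambda>n i. 2 * L n i"])
  show "0 \<le> 2 * L n i" if "i \<in> {1..n}" for n i using L0 that by auto
  have "\<forall>\<^sub>F n in sequentially. ereal ((\<Sum>i=1..n. (L n i)^2) / real n) < ereal (Lsup + 1)"
   using Ls by (intro Limsup_lessD) simp
  then show "\<forall>\<^sub>F n in sequentially. (\<Sum>i=1..n. (2 * L n i)^2) \<le> (\<bar>Lsup\<bar> * 4 + 4) * real n"
   using eventually_ge_at_top[of 1]
  proof eventually_elim
   case (elim n)
   then have "(\<Sum>i=1..n. (L n i)^2) \<le> (Lsup + 1) * real n" by (simp add: divide_less_eq)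
   also have "\<dots> \<le> (\<bar>Lsup\<bar> + 1) * real n" by (intro mult_right_mono) auto
   finally show ?case by (simp add: power_mult_distrib sum_distrib_left[symmetric] algebra_simps)
  qed
  show "\<forall>\<^sub>F n in sequentially. \<forall>i\<in>{1..n}. AE w in M. ccdf n i (h n) w \<le> \<phi> (h n) * (2 * L n i)"
   using eventually_ge_at_top[of 1] phi_pos h_le_eventually[OF \<delta>]
  proof (eventually_elim, intro ballI)
   fix n i assume n: "1 \<le> n" and \<phi>: "0 < \<phi> (h n)" and h: "h n \<le> \<delta>" and i: "i \<in> {1..n}"
   have hn: "0 < h n" using h_pos n by simp
   have 1: "AE w in M. \<bar>f n i x w\<bar> \<le> L n i" using fm Lb n i xb by (intro Linf) auto
   have "Linf_norm M (g n i x (h n)) / ereal (\<phi> (h n)) \<le> ereal (L n i)" using Lb n i xb hn h by auto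
   then have "Linf_norm M (g n i x (h n)) \<le> ereal (\<phi> (h n) * L n i)"
    using \<phi> by (simp add: ereal_divide_le_pos)
   then have 2: "AE w in M. \<bar>g n i x (h n) w\<bar> \<le> \<phi> (h n) * L n i" using gm n i hn by (intro Linf) auto
   have 3: "AE w in M. ccdf n i (h n) w = \<phi> (h n) * f n i x w + g n i x (h n) w" using eq n i hn by auto
   show "AE w in M. ccdf n i (h n) w \<le> \<phi> (h n) * (2 * L n i)"
    using 1 2 3
   proof eventually_elim
    case (elim w)
    have "\<phi> (h n) * f n i x w \<le> \<phi> (h n) * L n i" using elim(1) \<phi> by (intro mult_left_mono) auto
    then show ?case using elim by simp
   qed
  qed
 qed simp
qed

end

section \<open>Conditional moments of the kernel weights\<close>

context functional_regression
begin

lemma sF_prob_subalgebra: "i \<le> n \<Longrightarrow> prob_subalgebra M (sF n i)"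
 by (intro prob_subalgebra.intro prob_space_axioms prob_subalgebra_axioms.intro sigF_subalgebra)

lemma indicator_ball_measurable:
 "i \<in> {1..n} \<Longrightarrow> (\<lambda>w. indicator {..u} (D n i w) :: real) \<in> borel_measurable M"
 using D_measurable[of i n] by (intro measurable_compose[OF _ borel_measurable_indicator]) auto

lemma ccdf_integrable:
 assumes i: "i \<in> {1..n}"
 shows "integrable M (ccdf n i u)"
proof -
 interpret prob_subalgebra M "sF n (i - 1)" by (rule sF_prob_subalgebra) (use i in auto)
 show ?thesis unfolding cond_cdf_def
  by (rule real_cond_exp_int(1)) (use integral_ball(2)[of i n] i in auto)
qed

lemma ccdf_nonneg:
 assumes i: "i \<in> {1..n}"
 shows "AE w in M. 0 \<le> ccdf n i u w"
proof -
 interpret prob_subalgebra M "sF n (i - 1)" by (rule sF_prob_subalgebra) (use i in auto)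
 show ?thesis unfolding cond_cdf_def
  by (rule real_cond_exp_pos) (use indicator_ball_measurable[OF i] in auto)
qed

lemma ccdf_mono:
 assumes i: "i \<in> {1..n}" and "u \<le> v"
 shows "AE w in M. ccdf n i u w \<le> ccdf n i v w"
proof -
 interpret prob_subalgebra M "sF n (i - 1)" by (rule sF_prob_subalgebra) (use i in auto)
 show ?thesis unfolding cond_cdf_def
  by (rule real_cond_exp_mono) (use integral_ball(2)[of i n] i \<open>u \<le> v\<close> in \<open>auto simp: indicator_def\<close>)
qed

text \<open>Dominated convergence: the averages are bounded because \<open>L n i \<le> 1 + (L n i)\<^sup>2\<close>.\<close>

lemma average_ccdf_L1:
 assumes s: "0 < s" "s \<le> 1"
 shows "(\<lambda>n. (LINT w|M. \<bar>(\<Sum>i=1..n. ccdf n i (h n * s) w) / (real n * \<phi> (h n)) - f1 x * \<tau>0 s\<bar>)) \<longlonglongrightarrow> 0"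
proof -
 define S where "S n w = (\<Sum>i=1..n. ccdf n i (h n * s) w) / (real n * \<phi> (h n))" for n w
 obtain L C where C: "0 \<le> C" and L0: "\<And>n i. i \<in> {1..n} \<Longrightarrow> 0 \<le> L n i"
  and ev1: "\<forall>\<^sub>F n in sequentially. (\<Sum>i=1..n. (L n i)^2) \<le> C * real n"
  and ev2: "\<forall>\<^sub>F n in sequentially. \<forall>i\<in>{1..n}. AE w in M. ccdf n i (h n) w \<le> \<phi> (h n) * L n i"
  by (rule ccdf_bound) blast
 have "\<forall>\<^sub>F n in sequentially. AE w in M. \<bar>S n w\<bar> \<le> 1 + C"
  using ev1 ev2 phi_pos eventually_ge_at_top[of 1]
 proof eventually_elim
  case (elim n)
  have "AE w in M. \<forall>i\<in>{1..n}. 0 \<le> ccdf n i (h n * s) w \<and> ccdf n i (h n * s) w \<le> \<phi> (h n) * L n i"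
  proof (rule AE_finite_allI)
   fix i assume i: "i \<in> {1..n}"
   have le: "h n * s \<le> h n" using h_pos[of n] elim(4) s by (simp add: mult_left_le)
   show "AE w in M. 0 \<le> ccdf n i (h n * s) w \<and> ccdf n i (h n * s) w \<le> \<phi> (h n) * L n i"
    using ccdf_nonneg[OF i, of "h n * s"] ccdf_mono[OF i le] bspec[OF elim(2) i]
    by eventually_elim auto
  qed simp
  then show ?case
  proof eventually_elim
   case (elim w)
   have L1: "L n i \<le> 1 + (L n i)^2" for i
   proof -
    have "0 \<le> (L n i - 1)^2 + (L n i)^2 + 1" by simp
    then show ?thesis by (simp add: power2_eq_square algebra_simps)
   qed
   have "(\<Sum>i=1..n. ccdf n i (h n * s) w) \<le> (\<Sum>i=1..n. \<phi> (h n) * L n i)" using elim by (intro sum_mono) auto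
   also have "\<dots> \<le> (\<Sum>i=1..n. \<phi> (h n) * (1 + (L n i)^2))"
    using L1 \<open>0 < \<phi> (h n)\<close> by (intro sum_mono mult_left_mono) auto
   also have "\<dots> = \<phi> (h n) * (real n + (\<Sum>i=1..n. (L n i)^2))" by (simp add: sum_distrib_left[symmetric] sum.distrib)
   also have "\<dots> \<le> \<phi> (h n) * (real n + C * real n)"
    using \<open>0 < \<phi> (h n)\<close> \<open>(\<Sum>i=1..n. (L n i)^2) \<le> C * real n\<close> by (intro mult_left_mono) auto
   finally have "(\<Sum>i=1..n. ccdf n i (h n * s) w) \<le> (1 + C) * (real n * \<phi> (h n))" by (simp add: algebra_simps)
   moreover have "0 \<le> (\<Sum>i=1..n. ccdf n i (h n * s) w)" using elim by (intro sum_nonneg) auto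
   ultimately show ?case using \<open>0 < \<phi> (h n)\<close> \<open>1 \<le> n\<close> by (simp add: S_def divide_le_eq abs_of_nonneg)
  qed
 qed
 then obtain n0 where n0: "\<And>n. n \<ge> n0 \<Longrightarrow> AE w in M. \<bar>S n w\<bar> \<le> 1 + C" by (auto simp: eventually_sequentially)
 have [measurable]: "S n \<in> borel_measurable M" for n
  unfolding S_def using ccdf_integrable by (intro borel_measurable_divide borel_measurable_sum) auto
 have "(\<lambda>n. (LINT w|M. \<bar>S (n + n0) w - f1 x * \<tau>0 s\<bar>)) \<longlonglongrightarrow> (LINT w|M. 0)"
 proof (rule integral_dominated_convergence[where w="\<lambda>_. 1 + C + \<bar>f1 x * \<tau>0 s\<bar>"])
  show "AE w in M. (\<lambda>n. \<bar>S (n + n0) w - f1 x * \<tau>0 s\<bar>) \<longlonglongrightarrow> 0"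
   using average_ccdf_tendsto[OF s]
  proof eventually_elim
   case (elim w)
   then have "(\<lambda>n. S (n + n0) w) \<longlonglongrightarrow> f1 x * \<tau>0 s" unfolding S_def by (rule LIMSEQ_ignore_initial_segment)
   then have "(\<lambda>n. \<bar>S (n + n0) w - f1 x * \<tau>0 s\<bar>) \<longlonglongrightarrow> \<bar>f1 x * \<tau>0 s - f1 x * \<tau>0 s\<bar>" by (intro tendsto_intros)
   then show ?case by simp
  qed
  show "AE w in M. norm (\<bar>S (n + n0) w - f1 x * \<tau>0 s\<bar>) \<le> 1 + C + \<bar>f1 x * \<tau>0 s\<bar>" for n
  proof -
   have "AE w in M. \<bar>S (n + n0) w\<bar> \<le> 1 + C" by (rule n0) simp
   then show ?thesis by eventually_elim auto
  qed
 qed auto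
 then have "(\<lambda>n. (LINT w|M. \<bar>S (n + n0) w - f1 x * \<tau>0 s\<bar>)) \<longlonglongrightarrow> 0" by simp
 then have "(\<lambda>n. (LINT w|M. \<bar>S n w - f1 x * \<tau>0 s\<bar>)) \<longlonglongrightarrow> 0" by (rule LIMSEQ_offset[where k=n0 and f="\<lambda>n. (LINT w|M. \<bar>S n w - f1 x * \<tau>0 s\<bar>)"])
 then show ?thesis by (simp add: S_def)
qed

lemma kernel_properties:
 obtains Km where "0 < Km" "\<And>t. 0 \<le> K t" "\<And>t. K t \<le> Km" "\<And>t. t \<notin> {0..1} \<Longrightarrow> K t = 0" "0 < K 1"
proof -
 have A: "\<forall>t. 0 \<le> K t" "bounded (range K)" "\<forall>t. t \<notin> {0..1} \<longrightarrow> K t = 0" "0 < K 1"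
  using A1 by (auto simp: hyp_A1_def)
 obtain c where "0 < c" "\<And>z. norm (K z) \<le> c"
  using bounded_range_obtain[OF A(2)] by blast
 then show thesis using A by (intro that[of c]) (auto simp: abs_le_iff)
qed

lemma kernel_power_derivative:
 obtains \<kappa>' B where "\<And>t. t \<in> {0..1} \<Longrightarrow> ((\<lambda>t. K t ^ j) has_real_derivative \<kappa>' t) (at t within {0..1})"
  "continuous_on {0..1} \<kappa>'" "\<And>t. t \<in> {0..1} \<Longrightarrow> \<kappa>' t \<le> 0" "0 < B" "\<And>t. t \<in> {0..1} \<Longrightarrow> \<bar>\<kappa>' t\<bar> \<le> B"
proof -
 obtain K' where "(\<forall>t\<in>{0..1}. (K has_real_derivative K' t) (at t within {0..1})) \<and>
      continuous_on {0..1} K' \<and> (\<forall>t\<in>{0..1}. K' t \<le> 0)"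
  using A1 unfolding hyp_A1_def by blast
 then have K': "\<And>t. t \<in> {0..1} \<Longrightarrow> (K has_real_derivative K' t) (at t within {0..1})"
  "continuous_on {0..1} K'" "\<And>t. t \<in> {0..1} \<Longrightarrow> K' t \<le> 0"
  by blast+
 have K0: "0 \<le> K t" for t using A1 by (simp add: hyp_A1_def)
 define \<kappa>' where "\<kappa>' t = real j * (K' t * K t ^ (j - Suc 0))" for t
 have cK: "continuous_on {0..1} K"
  using K'(1) by (intro DERIV_continuous_on) auto
 have c: "continuous_on {0..1} \<kappa>'" unfolding \<kappa>'_def by (intro continuous_intros K' cK)
 have "compact (\<kappa>' ` {0..1})" by (intro compact_continuous_image c) simp
 then have "bounded (\<kappa>' ` {0..1})" by (rule compact_imp_bounded)
 then obtain B where B: "0 < B" "\<And>t. t \<in> {0..1} \<Longrightarrow> \<bar>\<kappa>' t\<bar> \<le> B" by (auto simp: bounded_pos)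
 show thesis
 proof (rule that[OF _ c _ B])
  show "((\<lambda>t. K t ^ j) has_real_derivative \<kappa>' t) (at t within {0..1})" if "t \<in> {0..1}" for t
   unfolding \<kappa>'_def by (rule DERIV_power[OF K'(1)[OF that]])
  show "\<kappa>' t \<le> 0" if "t \<in> {0..1}" for t
   unfolding \<kappa>'_def using K'(3)[OF that] K0[of t] by (simp add: mult_nonneg_nonpos mult_nonpos_nonneg)
 qed auto
qed

lemma M_const_eq:
 assumes "\<And>t. t \<in> {0..1} \<Longrightarrow> ((\<lambda>t. K t ^ j) has_real_derivative \<kappa>' t) (at t within {0..1})"
 shows "M_const K \<tau>0 j = K 1 ^ j + (- integral {0..1} (\<lambda>s. \<kappa>' s * \<tau>0 s))"
proof -
 have "vector_derivative (\<lambda>t. K t ^ j) (at s within {0..1}) = \<kappa>' s" if "s \<in> {0..1}" for s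
  using assms[OF that] that
  by (intro vector_derivative_within_closed_interval) (auto simp: has_real_derivative_iff_has_vector_derivative)
 then have "integral {0..1} (\<lambda>s. vector_derivative (\<lambda>t. K t ^ j) (at s within {0..1}) * \<tau>0 s) = integral {0..1} (\<lambda>s. \<kappa>' s * \<tau>0 s)"
  by (intro Henstock_Kurzweil_Integration.integral_cong) simp
 then show ?thesis
  unfolding M_const_def by simp
qed

text \<open>Both \<open>\<tau>0\<close> and minus the derivative of the kernel are nonnegative, so the boundary term is a lower bound.\<close>

lemma M_const_pos:
 assumes "1 \<le> j"
 shows "0 < M_const K \<tau>0 j"
proof -
 obtain \<kappa>' B where k: "\<And>t. t \<in> {0..1} \<Longrightarrow> ((\<lambda>t. K t ^ j) has_real_derivative \<kappa>' t) (at t within {0..1})"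
  "\<And>t. t \<in> {0..1} \<Longrightarrow> \<kappa>' t \<le> 0" using kernel_power_derivative[of j] by metis
 have "integral {0..1} (\<lambda>s. \<kappa>' s * \<tau>0 s) \<le> 0"
 proof (cases "(\<lambda>s. \<kappa>' s * \<tau>0 s) integrable_on {0..1}")
  case True
  then have "integral {0..1} (\<lambda>s. \<kappa>' s * \<tau>0 s) \<le> integral {0..1} (\<lambda>s::real. 0)"
   using k(2) tau_range by (intro Henstock_Kurzweil_Integration.integral_le) (auto intro!: mult_nonpos_nonneg)
  then show ?thesis by simp
 qed (simp add: not_integrable_integral)
 moreover have "0 < K 1 ^ j" using A1 by (simp add: hyp_A1_def)
 moreover have "M_const K \<tau>0 j = K 1 ^ j + (- integral {0..1} (\<lambda>s. \<kappa>' s * \<tau>0 s))"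
  by (rule M_const_eq) (rule k(1))
 ultimately show ?thesis by linarith
qed

abbreviation weight :: "nat \<Rightarrow> nat \<Rightarrow> 'w \<Rightarrow> real" where
 "weight n i \<equiv> Delta d X K x n (h n) i"

lemma K_measurable [measurable]: "K \<in> borel_measurable borel"
proof -
 obtain K' where "(\<forall>t\<in>{0..1}. (K has_real_derivative K' t) (at t within {0..1})) \<and>
      continuous_on {0..1} K' \<and> (\<forall>t\<in>{0..1}. K' t \<le> 0)"
  using A1 unfolding hyp_A1_def by blast
 then have c: "continuous_on {0..1} K" by (intro DERIV_continuous_on) auto
 have "K = (\<lambda>t. if t \<in> {0..1} then K t else 0)" using A1 by (auto simp: hyp_A1_def)
 moreover have "(\<lambda>t. if t \<in> {0..1} then K t else 0) \<in> borel_measurable borel"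
  by (rule borel_measurable_continuous_on_if) (auto intro: c)
 ultimately show ?thesis by simp
qed

lemma weight_measurable: "i \<in> {1..n} \<Longrightarrow> weight n i \<in> borel_measurable M"
 unfolding Delta_def[abs_def] using D_measurable[of i n] by measurable

text \<open>The averaged conditional moments of the weights are compared with step functions, for which
 the claim is the convergence of the averaged conditional distribution functions.\<close>

lemma kernel_moment_L1:
 assumes j: "1 \<le> j"
 shows "(\<lambda>n. (LINT w|M. \<bar>(\<Sum>i=1..n. cexp n i (\<lambda>w. weight n i w ^ j) w) / (real n * \<phi> (h n))
   - f1 x * M_const K \<tau>0 j\<bar>)) \<longlonglongrightarrow> 0"
proof -
 obtain \<kappa>' B where k: "\<And>t. t \<in> {0..1} \<Longrightarrow> ((\<lambda>t. K t ^ j) has_real_derivative \<kappa>' t) (at t within {0..1})"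
  "continuous_on {0..1} \<kappa>'" "\<And>t. t \<in> {0..1} \<Longrightarrow> \<kappa>' t \<le> 0" and B: "0 < B" "\<And>t. t \<in> {0..1} \<Longrightarrow> \<bar>\<kappa>' t\<bar> \<le> B"
  by (rule kernel_power_derivative[of j]) blast
 obtain Km where Km: "0 < Km" "\<And>t. 0 \<le> K t" "\<And>t. K t \<le> Km" "\<And>t. t \<notin> {0..1} \<Longrightarrow> K t = 0"
  by (rule kernel_properties) blast
 have supp: "K t ^ j = 0" if "t \<notin> {0..1}" for t using Km(4)[OF that] j by simp
 define E where "E n i = cexp n i (\<lambda>w. weight n i w ^ j)" for n i
 define A where "A n w = (\<Sum>i=1..n. E n i w) / (real n * \<phi> (h n))" for n w
 define S where "S s n w = (\<Sum>i=1..n. ccdf n i (h n * s) w) / (real n * \<phi> (h n))" for s n w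
 define m where "m = f1 x * M_const K \<tau>0 j"
 have wi: "integrable M (\<lambda>w. weight n i w ^ j)" if "i \<in> {1..n}" for n i
 proof (rule integrable_const_bound[where B="Km ^ j"])
  show "AE w in M. norm (weight n i w ^ j) \<le> Km ^ j"
   using Km(2,3) by (intro AE_I2) (simp add: Delta_def power_mono)
 qed (use weight_measurable[OF that] in measurable)
 have Ei: "integrable M (E n i)" if "i \<in> {1..n}" for n i
 proof -
  interpret prob_subalgebra M "sF n (i - 1)" by (rule sF_prob_subalgebra) (use that in auto)
  show ?thesis unfolding E_def by (rule real_cond_exp_int(1)[OF wi[OF that]])
 qed
 have bound: "(LINT w|M. \<bar>A n w - m\<bar>) \<le> B / N * (cdf (h n) / \<phi> (h n))
   + (\<Sum>l=1..N. \<bar>K (l / N) ^ j - K ((l + 1) / N) ^ j\<bar> * (LINT w|M. \<bar>S (l / N) n w - f1 x * \<tau>0 (l / N)\<bar>))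
   + f1 x * (B / N)"
  if N: "0 < N" and n: "1 \<le> n" and \<phi>: "0 < \<phi> (h n)" for n N :: nat
 proof -
  define c where "c l = K (real l / N) ^ j - K ((real l + 1) / N) ^ j" for l :: nat
  define q where "q i w = weight n i w ^ j - (\<Sum>l=1..N. c l * indicator {..h n * (l / N)} (D n i w))" for i w
  have hn: "0 < h n" using h_pos n by simp
  have qb: "\<bar>q i w\<bar> \<le> B / N * indicator {..h n} (D n i w)" for i w
  proof -
   have "\<bar>K (D n i w / h n) ^ j - (\<Sum>l=1..N. (K (l / N) ^ j - K ((l + 1) / N) ^ j) * indicator {..l / N} (D n i w / h n))\<bar>
     \<le> B / N * indicator {..1} (D n i w / h n)"
    using kernel_step_approximation[OF k(1) B(2) supp N, of "D n i w / h n"] hn dist_nonneg by simp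
   moreover have "indicator {..real l / N} (D n i w / h n) = (indicator {..h n * (l / N)} (D n i w) :: real)" for l :: nat
    using hn by (auto simp: indicator_def divide_le_eq mult.commute)
   moreover have "indicator {..1} (D n i w / h n) = (indicator {..h n} (D n i w) :: real)"
    using hn by (auto simp: indicator_def divide_le_eq)
   ultimately show ?thesis unfolding q_def c_def Delta_def by (simp only: of_nat_add of_nat_1)
  qed
  have one: "integrable M (\<lambda>w. E n i w - (\<Sum>l=1..N. c l * ccdf n i (h n * (l / N)) w))"
   "(LINT w|M. \<bar>E n i w - (\<Sum>l=1..N. c l * ccdf n i (h n * (l / N)) w)\<bar>) \<le> B / N * cdf (h n)" if i: "i \<in> {1..n}" for i
  proof -
   interpret prob_subalgebra M "sF n (i - 1)" by (rule sF_prob_subalgebra) (use i in auto)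
   have ii: "integrable M (\<lambda>w. c l * indicator {..h n * (l / N)} (D n i w))" for l :: nat
    using integral_ball(2)[of i n] i by auto
   have ist: "integrable M (\<lambda>w. \<Sum>l=1..N. c l * indicator {..h n * (l / N)} (D n i w))"
    by (rule Bochner_Integration.integrable_sum) (rule ii)
   have iq: "integrable M (q i)" unfolding q_def by (rule Bochner_Integration.integrable_diff[OF wi[OF i] ist])
   have "AE w in M. cexp n i (q i) w = E n i w - (\<Sum>l=1..N. c l * ccdf n i (h n * (l / N)) w)"
   proof -
    have 1: "AE w in M. cexp n i (q i) w = E n i w
      - cexp n i (\<lambda>w. \<Sum>l=1..N. c l * indicator {..h n * (l / N)} (D n i w)) w"
     unfolding q_def E_def by (rule real_cond_exp_diff[OF wi[OF i] ist])
    have 2: "AE w in M. cexp n i (\<lambda>w. \<Sum>l=1..N. c l * indicator {..h n * (l / N)} (D n i w)) w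
      = (\<Sum>l=1..N. cexp n i (\<lambda>w. c l * indicator {..h n * (l / N)} (D n i w)) w)"
     by (rule real_cond_exp_sum[OF ii])
    have 3: "AE w in M. \<forall>l\<in>{1..N}. cexp n i (\<lambda>w. c l * indicator {..h n * (l / N)} (D n i w)) w
      = c l * ccdf n i (h n * (l / N)) w"
     unfolding cond_cdf_def
     by (intro AE_finite_allI real_cond_exp_cmult) (use integral_ball(2)[of i n] i in auto)
    show ?thesis using 1 2 3 by eventually_elim simp
   qed
   then have ae: "AE w in M. \<bar>E n i w - (\<Sum>l=1..N. c l * ccdf n i (h n * (l / N)) w)\<bar> = \<bar>cexp n i (q i) w\<bar>"
    by eventually_elim simp
   show i1: "integrable M (\<lambda>w. E n i w - (\<Sum>l=1..N. c l * ccdf n i (h n * (l / N)) w))"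
    using Ei[OF i] ccdf_integrable[OF i] by auto
   have "(LINT w|M. \<bar>E n i w - (\<Sum>l=1..N. c l * ccdf n i (h n * (l / N)) w)\<bar>) = (LINT w|M. \<bar>cexp n i (q i) w\<bar>)"
    by (rule integral_cong_AE) (use i1 ae in auto)
   also have "\<dots> \<le> (LINT w|M. \<bar>q i w\<bar>)" by (rule real_cond_exp_L1_contraction[OF iq])
   also have "\<dots> \<le> (LINT w|M. B / N * indicator {..h n} (D n i w))"
    by (rule integral_mono) (use iq integral_ball(2)[of i n] i qb in auto)
   also have "\<dots> = B / N * cdf (h n)" using integral_ball(1)[of i n "h n"] i by simp
   finally show "(LINT w|M. \<bar>E n i w - (\<Sum>l=1..N. c l * ccdf n i (h n * (l / N)) w)\<bar>) \<le> B / N * cdf (h n)" .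
  qed
  have S_int: "integrable M (S s n)" for s
   unfolding S_def by (intro integrable_divide Bochner_Integration.integrable_sum ccdf_integrable)
  define G where "G w = (\<Sum>i=1..n. \<bar>E n i w - (\<Sum>l=1..N. c l * ccdf n i (h n * (l / N)) w)\<bar>) / (real n * \<phi> (h n))" for w
  have G_int: "integrable M G" unfolding G_def
   by (intro integrable_divide Bochner_Integration.integrable_sum integrable_abs one(1))
  have "(LINT w|M. G w) = (\<Sum>i=1..n. (LINT w|M. \<bar>E n i w - (\<Sum>l=1..N. c l * ccdf n i (h n * (l / N)) w)\<bar>)) / (real n * \<phi> (h n))"
   unfolding G_def
   by (simp only: integral_divide_zero, subst Bochner_Integration.integral_sum) (intro integrable_abs one(1), assumption, rule refl)
  also have "\<dots> \<le> (\<Sum>i=1..n. B / N * cdf (h n)) / (real n * \<phi> (h n))"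
   using one(2) \<phi> by (intro divide_right_mono sum_mono) auto
  also have "\<dots> = B / N * (cdf (h n) / \<phi> (h n))" using n by simp
  finally have G_le: "(LINT w|M. G w) \<le> B / N * (cdf (h n) / \<phi> (h n))" .
  have step_limit: "\<bar>(\<Sum>l=1..N. c l * (f1 x * \<tau>0 (l / N))) - m\<bar> \<le> f1 x * (B / N)"
  proof -
   have "(\<Sum>l=1..N. c l * \<tau>0 (l / N)) = (\<Sum>l=1..<N. c l * \<tau>0 (l / N)) + c N * \<tau>0 1"
    using N by (simp add: sum.last_plus add.commute atLeastLessThanSuc_atLeastAtMost[symmetric])
   moreover have "c N = K 1 ^ j"
   proof -
    have "K ((real N + 1) / N) ^ j = 0" using N by (intro supp) (simp add: field_simps)
    then show ?thesis using N by (simp add: c_def)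
   qed
   moreover have "\<bar>(\<Sum>l=1..<N. c l * \<tau>0 (l / N)) - (- integral {0..1} (\<lambda>s. \<kappa>' s * \<tau>0 s))\<bar> \<le> B / N"
    unfolding c_def
    using stieltjes_sum_bound[OF k B(2) tau_mono tau_range N] by (simp add: add.commute)
   ultimately have le: "\<bar>(\<Sum>l=1..N. c l * \<tau>0 (l / N)) - M_const K \<tau>0 j\<bar> \<le> B / N"
   proof -
    assume "(\<Sum>l=1..N. c l * \<tau>0 (l / N)) = (\<Sum>l=1..<N. c l * \<tau>0 (l / N)) + c N * \<tau>0 1"
     "c N = K 1 ^ j" "\<bar>(\<Sum>l=1..<N. c l * \<tau>0 (l / N)) - (- integral {0..1} (\<lambda>s. \<kappa>' s * \<tau>0 s))\<bar> \<le> B / N"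
    moreover have "M_const K \<tau>0 j = K 1 ^ j + (- integral {0..1} (\<lambda>s. \<kappa>' s * \<tau>0 s))"
     by (rule M_const_eq) (rule k(1))
    ultimately show ?thesis by (simp only: tau_one mult_1_right)
   qed
   have "(\<Sum>l=1..N. c l * (f1 x * \<tau>0 (l / N))) - m = f1 x * ((\<Sum>l=1..N. c l * \<tau>0 (l / N)) - M_const K \<tau>0 j)"
    by (simp add: m_def right_diff_distrib sum_distrib_left mult.left_commute)
   moreover have "f1 x * \<bar>(\<Sum>l=1..N. c l * \<tau>0 (l / N)) - M_const K \<tau>0 j\<bar> \<le> f1 x * (B / N)"
    using le f1_pos by (intro mult_left_mono) auto
   ultimately show ?thesis using f1_pos by (simp only: abs_mult abs_of_pos)
  qed
  have pt: "\<bar>A n w - m\<bar> \<le> G w + (\<Sum>l=1..N. \<bar>c l\<bar> * \<bar>S (l / N) n w - f1 x * \<tau>0 (l / N)\<bar>) + f1 x * (B / N)" for w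
  proof -
   have np: "0 < real n * \<phi> (h n)" using n \<phi> by simp
   have e: "A n w - m = (\<Sum>i=1..n. E n i w - (\<Sum>l=1..N. c l * ccdf n i (h n * (l / N)) w)) / (real n * \<phi> (h n))
     + (\<Sum>l=1..N. c l * (S (l / N) n w - f1 x * \<tau>0 (l / N))) + ((\<Sum>l=1..N. c l * (f1 x * \<tau>0 (l / N))) - m)"
   proof -
    have "(\<Sum>i=1..n. \<Sum>l=1..N. c l * ccdf n i (h n * (l / N)) w) / (real n * \<phi> (h n)) = (\<Sum>l=1..N. c l * S (l / N) n w)"
     unfolding S_def
     by (subst sum.swap) (simp only: sum_distrib_left[symmetric], subst sum_divide_distrib, simp)
    then show ?thesis
     by (simp add: A_def sum_subtractf diff_divide_distrib right_diff_distrib)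
   qed
   have 1: "\<bar>(\<Sum>i=1..n. E n i w - (\<Sum>l=1..N. c l * ccdf n i (h n * (l / N)) w)) / (real n * \<phi> (h n))\<bar> \<le> G w"
    unfolding G_def abs_divide using np by (auto intro!: divide_right_mono sum_abs)
   have 2: "\<bar>\<Sum>l=1..N. c l * (S (l / N) n w - f1 x * \<tau>0 (l / N))\<bar> \<le> (\<Sum>l=1..N. \<bar>c l\<bar> * \<bar>S (l / N) n w - f1 x * \<tau>0 (l / N)\<bar>)"
    by (rule order_trans[OF sum_abs]) (simp add: abs_mult)
   show ?thesis unfolding e using 1 2 step_limit by linarith
  qed
  have iT: "integrable M (\<lambda>w. \<Sum>l=1..N. \<bar>c l\<bar> * \<bar>S (l / N) n w - f1 x * \<tau>0 (l / N)\<bar>)" using S_int by auto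
  have "(LINT w|M. \<bar>A n w - m\<bar>) \<le> (LINT w|M. G w + (\<Sum>l=1..N. \<bar>c l\<bar> * \<bar>S (l / N) n w - f1 x * \<tau>0 (l / N)\<bar>) + f1 x * (B / N))"
  proof (rule integral_mono)
   have "integrable M (A n)"
    unfolding A_def[abs_def] by (intro integrable_divide Bochner_Integration.integrable_sum Ei)
   then show "integrable M (\<lambda>w. \<bar>A n w - m\<bar>)" by simp
  qed (use G_int iT pt in auto)
  also have "\<dots> = (LINT w|M. G w) + (\<Sum>l=1..N. \<bar>c l\<bar> * (LINT w|M. \<bar>S (l / N) n w - f1 x * \<tau>0 (l / N)\<bar>)) + f1 x * (B / N)"
   using G_int iT S_int by (simp add: Bochner_Integration.integral_add Bochner_Integration.integral_sum prob_space)
  finally show ?thesis using G_le unfolding c_def of_nat_add of_nat_1 by linarith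
 qed
 have "(\<lambda>n. (LINT w|M. \<bar>A n w - m\<bar>)) \<longlonglongrightarrow> 0"
 proof (rule tendstoI)
  fix \<epsilon> :: real assume \<epsilon>: "0 < \<epsilon>"
  obtain N :: nat where "2 * B * f1 x / \<epsilon> < real N" using reals_Archimedean2 by blast
  moreover have "0 < 2 * B * f1 x / \<epsilon>" using B f1_pos \<epsilon> by simp
  ultimately have N0: "0 < N" by (metis less_trans of_nat_0_less_iff)
  have "2 * B * f1 x < \<epsilon> * real N"
   using \<open>2 * B * f1 x / \<epsilon> < real N\<close> \<epsilon> by (simp add: divide_less_eq mult.commute)
  then have "B / N * f1 x + 0 + f1 x * (B / N) < \<epsilon>" using N0 by (simp add: field_simps)
  note N = N0 this
  have "(\<lambda>n. B / N * (cdf (h n) / \<phi> (h n))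
   + (\<Sum>l=1..N. \<bar>K (l / N) ^ j - K ((l + 1) / N) ^ j\<bar> * (LINT w|M. \<bar>S (l / N) n w - f1 x * \<tau>0 (l / N)\<bar>))
   + f1 x * (B / N)) \<longlonglongrightarrow> B / N * f1 x + (\<Sum>l=1..N. \<bar>K (l / N) ^ j - K ((l + 1) / N) ^ j\<bar> * 0) + f1 x * (B / N)"
   unfolding S_def by (intro tendsto_intros cdf_ratio_one average_ccdf_L1) (use N in auto)
  then have "\<forall>\<^sub>F n in sequentially. B / N * (cdf (h n) / \<phi> (h n))
   + (\<Sum>l=1..N. \<bar>K (l / N) ^ j - K ((l + 1) / N) ^ j\<bar> * (LINT w|M. \<bar>S (l / N) n w - f1 x * \<tau>0 (l / N)\<bar>))
   + f1 x * (B / N) < \<epsilon>"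
   by (rule order_tendstoD(2)) (use N(2) in simp)
  then show "\<forall>\<^sub>F n in sequentially. dist (LINT w|M. \<bar>A n w - m\<bar>) 0 < \<epsilon>"
   using phi_pos eventually_ge_at_top[of 1]
  proof eventually_elim
   case (elim n)
   then have "(LINT w|M. \<bar>A n w - m\<bar>) < \<epsilon>" using bound[OF N(1) elim(3,2)] by linarith
   then show ?case by (simp add: abs_of_nonneg integral_nonneg)
  qed
 qed
 then show ?thesis by (simp add: A_def E_def m_def)
qed

lemma weight_power_integrable: "i \<in> {1..n} \<Longrightarrow> integrable M (\<lambda>w. weight n i w ^ j)"
proof (rule kernel_properties)
 fix Km assume i: "i \<in> {1..n}" and Km: "\<And>t. 0 \<le> K t" "\<And>t. K t \<le> Km"
 show ?thesis
 proof (rule integrable_const_bound[where B="Km ^ j"])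
  show "AE w in M. norm (weight n i w ^ j) \<le> Km ^ j"
   using Km by (intro AE_I2) (simp add: Delta_def power_mono)
 qed (use weight_measurable[OF i] in measurable)
qed

lemma kernel_moment_tendsto:
 assumes j: "1 \<le> j"
 shows "(\<lambda>n. (LINT w|M. K (D 1 1 w / h n) ^ j) / \<phi> (h n)) \<longlonglongrightarrow> f1 x * M_const K \<tau>0 j"
proof -
 define E where "E n i = cexp n i (\<lambda>w. weight n i w ^ j)" for n i
 define m where "m = f1 x * M_const K \<tau>0 j"
 have E: "integrable M (E n i)" "(LINT w|M. E n i w) = (LINT w|M. K (D 1 1 w / h n) ^ j)" if i: "i \<in> {1..n}" for n i
 proof -
  interpret prob_subalgebra M "sF n (i - 1)" by (rule sF_prob_subalgebra) (use i in auto)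
  show "integrable M (E n i)" unfolding E_def by (rule real_cond_exp_int(1)[OF weight_power_integrable[OF i]])
  have "(LINT w|M. E n i w) = (LINT w|M. weight n i w ^ j)"
   unfolding E_def by (rule real_cond_exp_int(2)[OF weight_power_integrable[OF i]])
  also have "\<dots> = (LINT w|M. K (D 1 1 w / h n) ^ j)"
   unfolding Delta_def using i by (intro integral_distr_eq[of i n "\<lambda>y. K (d x y / h n) ^ j"]) auto
  finally show "(LINT w|M. E n i w) = (LINT w|M. K (D 1 1 w / h n) ^ j)" .
 qed
 have "(\<lambda>n. (LINT w|M. K (D 1 1 w / h n) ^ j) / \<phi> (h n) - m) \<longlonglongrightarrow> 0"
 proof (rule Lim_null_comparison[OF _ kernel_moment_L1[OF j, folded E_def m_def]])
  show "\<forall>\<^sub>F n in sequentially. norm ((LINT w|M. K (D 1 1 w / h n) ^ j) / \<phi> (h n) - m)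
    \<le> (LINT w|M. \<bar>(\<Sum>i=1..n. E n i w) / (real n * \<phi> (h n)) - m\<bar>)"
   using phi_pos eventually_ge_at_top[of 1]
  proof eventually_elim
   case (elim n)
   have "(LINT w|M. K (D 1 1 w / h n) ^ j) / \<phi> (h n) - m = (LINT w|M. (\<Sum>i=1..n. E n i w) / (real n * \<phi> (h n)) - m)"
   proof -
    have "integrable M (\<lambda>w. \<Sum>i=1..n. E n i w)" using E(1) by (intro Bochner_Integration.integrable_sum) auto
    moreover have "(LINT w|M. (\<Sum>i=1..n. E n i w)) = real n * (LINT w|M. K (D 1 1 w / h n) ^ j)"
    proof -
     have "(LINT w|M. (\<Sum>i=1..n. E n i w)) = (\<Sum>i=1..n. (LINT w|M. E n i w))"
      using E(1) by (intro Bochner_Integration.integral_sum) auto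
     also have "\<dots> = (\<Sum>i=1..n. (LINT w|M. K (D 1 1 w / h n) ^ j))" by (intro sum.cong E(2)) auto
     finally show ?thesis by simp
    qed
    ultimately show ?thesis using elim by (simp add: prob_space)
   qed
   then show ?case using integral_norm_bound[of M "\<lambda>w. (\<Sum>i=1..n. E n i w) / (real n * \<phi> (h n)) - m"] by simp
  qed
 qed
 then show ?thesis by (simp add: LIM_zero_iff m_def)
qed

end

section \<open>Local moment estimates\<close>

context functional_regression
begin

abbreviation basis_vec :: "nat \<Rightarrow> 'h" where "basis_vec k \<equiv> e (Suc k)"

sublocale H: separable_hilbert_basis basis_vec
proof
 show "basis_vec j \<bullet> basis_vec k = (if j = k then 1 else 0)" for j k
  using basis by (simp add: orthonormal_basis_def)
 have "range basis_vec = e ` {1..}"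
 proof (intro subset_antisym subsetI)
  fix v assume "v \<in> e ` {1..}"
  then obtain k where k: "1 \<le> k" "v = e k" by auto
  then have "v = basis_vec (k - 1)" by simp
  then show "v \<in> range basis_vec" by blast
 qed auto
 then show "closure (span (range basis_vec)) = UNIV"
  using basis by (simp add: orthonormal_basis_def)
qed

abbreviation ball :: "nat \<Rightarrow> nat \<Rightarrow> 'w \<Rightarrow> real" where
 "ball n i w \<equiv> indicator {..h n} (D n i w)"

definition resid :: "nat \<Rightarrow> nat \<Rightarrow> 'w \<Rightarrow> 'h" where
 "resid n i w = Y n i w - r (X n i w)"

definition score :: "nat \<Rightarrow> nat \<Rightarrow> 'w \<Rightarrow> 'h" where
 "score n i w = weight n i w *\<^sub>R resid n i w"

lemma sG_prob_subalgebra: "i \<in> {1..n} \<Longrightarrow> prob_subalgebra M (sG n (i - 1))"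
 by (intro prob_subalgebra.intro prob_space_axioms prob_subalgebra_axioms.intro sigG_properties(1)) auto

lemma D_sG_measurable: "i \<in> {1..n} \<Longrightarrow> D n i \<in> borel_measurable (sG n (i - 1))"
 using measurable_compose[OF sigG_properties(3)[of i n] dist_measurable] by simp

lemma weight_sG_measurable: "i \<in> {1..n} \<Longrightarrow> weight n i \<in> borel_measurable (sG n (i - 1))"
 unfolding Delta_def[abs_def] using D_sG_measurable[of i n] by measurable

lemma weight_le_ball:
 assumes "\<And>t. K t \<le> Km" "1 \<le> n"
 shows "weight n i w \<le> Km * ball n i w" "0 \<le> weight n i w" "weight n i w * ball n i w = weight n i w"
proof -
 have K: "\<And>t. 0 \<le> K t" "\<And>t. t \<notin> {0..1} \<Longrightarrow> K t = 0" by (rule kernel_properties; blast)+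
 have out: "weight n i w = 0" if "\<not> D n i w \<le> h n"
  unfolding Delta_def using that h_pos[OF assms(2)] by (intro K(2)) (auto simp: divide_le_eq)
 show "weight n i w \<le> Km * ball n i w" "weight n i w * ball n i w = weight n i w"
  using out assms(1)[of "D n i w / h n"] by (auto simp: indicator_def Delta_def)
 show "0 \<le> weight n i w" by (simp add: Delta_def K(1))
qed

lemma Y_cond_exp: "i \<in> {1..n} \<Longrightarrow> is_cond_exp M (sG n (i - 1)) (Y n i) (\<lambda>w. r (X n i w))"
 using A3 by (auto simp: hyp_A3_def)

lemma rX_measurable: "i \<in> {1..n} \<Longrightarrow> (\<lambda>w. r (X n i w)) \<in> borel_measurable M"
 using measurable_compose[OF X_measurable r_measurable] by auto

lemma resid_measurable: "i \<in> {1..n} \<Longrightarrow> resid n i \<in> borel_measurable M"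
 unfolding resid_def[abs_def] using Y_measurable[of i n] rX_measurable[of i n] by measurable

lemma score_measurable: "i \<in> {1..n} \<Longrightarrow> score n i \<in> borel_measurable M"
 unfolding score_def[abs_def] using resid_measurable weight_measurable by measurable

lemma score_sF_measurable:
 assumes "i \<in> {1..n}" "i \<le> j"
 shows "score n i \<in> borel_measurable (sF n j)" "weight n i \<in> borel_measurable (sF n j)"
  "X n i \<in> sF n j \<rightarrow>\<^sub>M pm_borel d"
proof -
 have P: "(\<lambda>w. (X n i w, Y n i w)) \<in> sF n j \<rightarrow>\<^sub>M pm_borel d \<Otimes>\<^sub>M borel"
  by (rule sigF_pair_measurable) (use assms in auto)
 have X: "X n i \<in> sF n j \<rightarrow>\<^sub>M pm_borel d" using measurable_compose[OF P measurable_fst] by simp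
 have [measurable]: "Y n i \<in> sF n j \<rightarrow>\<^sub>M borel" using measurable_compose[OF P measurable_snd] by simp
 have [measurable]: "D n i \<in> sF n j \<rightarrow>\<^sub>M borel" "(\<lambda>w. r (X n i w)) \<in> sF n j \<rightarrow>\<^sub>M borel"
  using measurable_compose[OF X dist_measurable] measurable_compose[OF X r_measurable] by simp_all
 show "X n i \<in> sF n j \<rightarrow>\<^sub>M pm_borel d" by (rule X)
 show "weight n i \<in> borel_measurable (sF n j)" unfolding Delta_def[abs_def] by measurable
 then show "score n i \<in> borel_measurable (sF n j)"
  unfolding score_def[abs_def] resid_def[abs_def] by measurable
qed

lemma Y_moment:
 obtains p0 where "2 < p0" "\<And>n i. i \<in> {1..n} \<Longrightarrow> AE w in M. D n i w \<le> \<delta> \<longrightarrow>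
  nn_cond_exp M (sG n (i - 1)) (\<lambda>w. ennreal (norm (Y n i w) powr p0)) w \<le> 1"
proof -
 obtain H \<delta>' where H: "1 \<le> H" "0 < \<delta>'" and all: "\<forall>n\<ge>1. \<forall>i\<in>{1..n}. \<forall>m\<ge>1. AE w in M.
    X n i w \<in> pm_cball d x \<delta> \<longrightarrow>
    nn_cond_exp M (sG n (i - 1)) (\<lambda>w'. ennreal (norm (Y n i w') powr ((2 + \<delta>') * real m))) w
    \<le> ennreal (fact m * H powi (int m - 2))"
  using A3 unfolding hyp_A3_def by (elim conjE exE bexE) blast
 show thesis
 proof (rule that[of "2 + \<delta>'"])
  fix n i :: nat assume i: "i \<in> {1..n}"
  have "ennreal (fact 1 * H powi (int 1 - 2)) \<le> 1"
   using H by (simp add: power_int_minus field_simps)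
  then show "AE w in M. D n i w \<le> \<delta> \<longrightarrow>
   nn_cond_exp M (sG n (i - 1)) (\<lambda>w. ennreal (norm (Y n i w) powr (2 + \<delta>'))) w \<le> 1"
  proof -
   have "AE w in M. X n i w \<in> pm_cball d x \<delta> \<longrightarrow>
    nn_cond_exp M (sG n (i - 1)) (\<lambda>w'. ennreal (norm (Y n i w') powr ((2 + \<delta>') * real 1))) w
    \<le> ennreal (fact 1 * H powi (int 1 - 2))"
    using all[rule_format, of n i 1] i by auto
   then show ?thesis
   proof eventually_elim
    case (elim w)
    then show ?case
     using order_trans[OF _ \<open>ennreal (fact 1 * H powi (int 1 - 2)) \<le> 1\<close>] by (simp only: pm_cball_def mem_Collect_eq of_nat_1 mult_1_right) blast
   qed
  qed
 qed (use H in simp)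
qed

text \<open>On the window \<open>r (X n i)\<close> is the conditional mean of \<open>Y n i\<close>, and \<open>\<bar>y\<bar> \<le> 1 + \<bar>y\<bar> powr p0\<close>.\<close>

lemma r_bounded:
 assumes i: "i \<in> {1..n}"
 shows "AE w in M. D n i w \<le> \<delta> \<longrightarrow> norm (r (X n i w)) \<le> 2"
proof -
 interpret G: prob_subalgebra M "sG n (i - 1)" by (rule sG_prob_subalgebra[OF i])
 obtain p0 where p0: "2 < p0" and Yall: "\<And>n i. i \<in> {1..n} \<Longrightarrow> AE w in M. D n i w \<le> \<delta> \<longrightarrow>
  nn_cond_exp M (sG n (i - 1)) (\<lambda>w. ennreal (norm (Y n i w) powr p0)) w \<le> 1"
  by (rule Y_moment) blast
 note Y = Yall[OF i]
 have [measurable]: "Y n i \<in> borel_measurable M" using Y_measurable i by auto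
 have pw: "a \<le> 1 + a powr p0" if "0 \<le> a" for a :: real
 proof (cases "a \<le> 1")
  case False
  then have "a powr 1 \<le> a powr p0" using p0 by (intro powr_mono) auto
  then show ?thesis using False by simp
 qed (simp add: add_increasing2)
 have 1: "AE w in M. norm (r (X n i w)) \<le> real_cond_exp M (sG n (i - 1)) (\<lambda>w. norm (Y n i w)) w"
  by (rule G.norm_is_cond_exp_le[OF Y_cond_exp[OF i]])
 have 2: "AE w in M. nn_cond_exp M (sG n (i - 1)) (\<lambda>w. ennreal (norm (Y n i w))) w
   \<le> nn_cond_exp M (sG n (i - 1)) (\<lambda>w. 1 + ennreal (norm (Y n i w) powr p0)) w"
 proof (rule G.nn_cond_exp_mono)
  show "AE w in M. ennreal (norm (Y n i w)) \<le> 1 + ennreal (norm (Y n i w) powr p0)"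
  proof (rule AE_I2)
   fix w
   have "ennreal (norm (Y n i w)) \<le> ennreal (1 + norm (Y n i w) powr p0)" by (intro ennreal_leI pw) simp
   then show "ennreal (norm (Y n i w)) \<le> 1 + ennreal (norm (Y n i w) powr p0)" by (simp add: ennreal_plus)
  qed
 qed measurable
 have 3: "AE w in M. nn_cond_exp M (sG n (i - 1)) (\<lambda>w. 1) w + nn_cond_exp M (sG n (i - 1)) (\<lambda>w. ennreal (norm (Y n i w) powr p0)) w
   = nn_cond_exp M (sG n (i - 1)) (\<lambda>w. 1 + ennreal (norm (Y n i w) powr p0)) w"
  by (rule G.nn_cond_exp_sum) measurable
 have 4: "AE w in M. 1 = nn_cond_exp M (sG n (i - 1)) (\<lambda>w. 1) w"
  by (rule G.nn_cond_exp_F_meas) measurable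
 show ?thesis using 1 2 3 4 Y
 proof eventually_elim
  case (elim w)
  show ?case
  proof
   assume "D n i w \<le> \<delta>"
   then have y: "nn_cond_exp M (sG n (i - 1)) (\<lambda>w. ennreal (norm (Y n i w) powr p0)) w \<le> 1" using elim by simp
   have "nn_cond_exp M (sG n (i - 1)) (\<lambda>w. ennreal (norm (Y n i w))) w \<le> 1 + 1"
   proof -
    have "nn_cond_exp M (sG n (i - 1)) (\<lambda>w. ennreal (norm (Y n i w))) w
     \<le> nn_cond_exp M (sG n (i - 1)) (\<lambda>w. 1) w + nn_cond_exp M (sG n (i - 1)) (\<lambda>w. ennreal (norm (Y n i w) powr p0)) w"
     using elim(2) elim(3) by simp
    also have "\<dots> \<le> 1 + 1" using elim(4) y by (intro add_mono) simp_all
    finally show ?thesis .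
   qed
   then have "enn2real (nn_cond_exp M (sG n (i - 1)) (\<lambda>w. ennreal (norm (Y n i w))) w) \<le> 2"
    by (intro enn2real_leI) auto
   then have "real_cond_exp M (sG n (i - 1)) (\<lambda>w. norm (Y n i w)) w \<le> 2"
    unfolding real_cond_exp_def by (smt (verit) enn2real_nonneg)
   then show "norm (r (X n i w)) \<le> 2" using elim(1) by linarith
  qed
 qed
qed

lemma delta_pos: "0 < \<delta>" using A2 unfolding hyp_A2_def by (elim conjE)

text \<open>The exponent is cut down to at most 3, as the Taylor estimate of the characteristic function requires.\<close>

lemma resid_moment:
 obtains p where "2 < p" "p \<le> 3" "\<And>n i. i \<in> {1..n} \<Longrightarrow> h n \<le> \<delta> \<Longrightarrow> integrable M (\<lambda>w. ball n i w * norm (resid n i w) powr p)"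
  "\<And>n i. i \<in> {1..n} \<Longrightarrow> h n \<le> \<delta> \<Longrightarrow> (LINT w|M. ball n i w * norm (resid n i w) powr p) \<le> 72 * cdf (h n)"
proof -
 obtain p0 where p0: "2 < p0" and Y: "\<And>n i. i \<in> {1..n} \<Longrightarrow> AE w in M. D n i w \<le> \<delta> \<longrightarrow>
  nn_cond_exp M (sG n (i - 1)) (\<lambda>w. ennreal (norm (Y n i w) powr p0)) w \<le> 1"
  by (rule Y_moment) blast
 define p where "p = min p0 3"
 have p: "2 < p" "p \<le> 3" "p \<le> p0" using p0 by (auto simp: p_def)
 have main: "(\<integral>\<^sup>+w. ennreal (ball n i w * norm (resid n i w) powr p) \<partial>M) \<le> ennreal (72 * cdf (h n))"
  if i: "i \<in> {1..n}" and hn: "h n \<le> \<delta>" for n i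
 proof -
  interpret G: prob_subalgebra M "sG n (i - 1)" by (rule sG_prob_subalgebra[OF i])
  have [measurable]: "Y n i \<in> borel_measurable M" "D n i \<in> borel_measurable M" "D n i \<in> borel_measurable (sG n (i - 1))"
   using Y_measurable D_measurable D_sG_measurable i by auto
  define Z where "Z w = ennreal (norm (Y n i w) powr p0)" for w
  have [measurable]: "Z \<in> borel_measurable M" unfolding Z_def by measurable
  have pw: "(a + 2) powr p \<le> 64 + 8 * a powr p0" if "0 \<le> a" for a :: real
  proof (cases "a \<le> 2")
   case True
   then have "(a + 2) powr p \<le> 4 powr p" using that p by (intro powr_mono2) auto
   also have "\<dots> \<le> 4 powr 3" using p by (intro powr_mono) auto
   also have "\<dots> = 64" by (simp add: powr_numeral)
   finally show ?thesis by (simp add: add_increasing2)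
  next
   case False
   then have "(a + 2) powr p \<le> (2 * a) powr p" using p by (intro powr_mono2) auto
   also have "\<dots> = 2 powr p * a powr p" using that by (simp add: powr_mult)
   also have "\<dots> \<le> 2 powr 3 * a powr p0" using p False by (intro mult_mono powr_mono) auto
   also have "\<dots> = 8 * a powr p0" by (simp add: powr_numeral)
   finally show ?thesis by simp
  qed
  have pt: "AE w in M. ennreal (ball n i w * norm (resid n i w) powr p) \<le> 64 * indicator {..h n} (D n i w) + 8 * (indicator {..h n} (D n i w) * Z w)"
   using r_bounded[OF i]
  proof eventually_elim
   case (elim w)
   show ?case
   proof (cases "D n i w \<le> h n")
    case True
    then have r2: "norm (r (X n i w)) \<le> 2" using elim hn by simp
    have "norm (resid n i w) \<le> norm (Y n i w) + 2"
     unfolding resid_def using norm_triangle_ineq4[of "Y n i w" "r (X n i w)"] r2 by linarith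
    then have "norm (resid n i w) powr p \<le> (norm (Y n i w) + 2) powr p" using p by (intro powr_mono2) auto
    also have "\<dots> \<le> 64 + 8 * norm (Y n i w) powr p0" by (rule pw) simp
    finally have "ennreal (norm (resid n i w) powr p) \<le> ennreal (64 + 8 * norm (Y n i w) powr p0)" by (rule ennreal_leI)
    also have "\<dots> = 64 + 8 * Z w" unfolding Z_def
     by (simp add: ennreal_plus ennreal_mult)
    finally show ?thesis using True by simp
   qed simp
  qed
  have "(\<integral>\<^sup>+w. ennreal (ball n i w * norm (resid n i w) powr p) \<partial>M)
    \<le> (\<integral>\<^sup>+w. 64 * indicator {..h n} (D n i w) + 8 * (indicator {..h n} (D n i w) * Z w) \<partial>M)"
   by (rule nn_integral_mono_AE[OF pt])
  also have "\<dots> = 64 * (\<integral>\<^sup>+w. indicator {..h n} (D n i w) \<partial>M) + 8 * (\<integral>\<^sup>+w. indicator {..h n} (D n i w) * Z w \<partial>M)"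
   by (subst nn_integral_add) (auto simp: nn_integral_cmult)
  also have "(\<integral>\<^sup>+w. indicator {..h n} (D n i w) * Z w \<partial>M) = (\<integral>\<^sup>+w. indicator {..h n} (D n i w) * nn_cond_exp M (sG n (i - 1)) Z w \<partial>M)"
   by (rule G.nn_cond_exp_intg[symmetric]) measurable
  also have "\<dots> \<le> (\<integral>\<^sup>+w. indicator {..h n} (D n i w) \<partial>M)"
   using Y[OF i] unfolding Z_def[abs_def, symmetric]
   by (intro nn_integral_mono_AE) (elim eventually_mono, use hn in \<open>auto simp: indicator_def\<close>)
  also have "64 * (\<integral>\<^sup>+w. indicator {..h n} (D n i w) \<partial>M) + 8 * (\<integral>\<^sup>+w. indicator {..h n} (D n i w) \<partial>M) = ennreal (72 * cdf (h n))"
   using integral_ball(3)[of i n "h n"] i cdf_nonneg[of "h n"]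
   by (simp add: ennreal_mult distrib_right[symmetric])
  finally show ?thesis by (simp add: add_left_mono mult_left_mono)
 qed
 show thesis
 proof (rule that[OF p(1,2)])
  fix n i :: nat assume i: "i \<in> {1..n}" and hn: "h n \<le> \<delta>"
  have [measurable]: "resid n i \<in> borel_measurable M" "D n i \<in> borel_measurable M" using resid_measurable D_measurable i by auto
  have "(\<integral>\<^sup>+w. ennreal (ball n i w * norm (resid n i w) powr p) \<partial>M) < \<infinity>"
   using main[OF i hn] by (simp add: order_le_less_trans)
  then show int: "integrable M (\<lambda>w. ball n i w * norm (resid n i w) powr p)"
   by (intro integrableI_nonneg) auto
  have "ennreal (LINT w|M. ball n i w * norm (resid n i w) powr p) = (\<integral>\<^sup>+w. ennreal (ball n i w * norm (resid n i w) powr p) \<partial>M)"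
   by (rule nn_integral_eq_integral[OF int, symmetric]) simp
  then show "(LINT w|M. ball n i w * norm (resid n i w) powr p) \<le> 72 * cdf (h n)"
  proof -
   assume "ennreal (LINT w|M. ball n i w * norm (resid n i w) powr p) = (\<integral>\<^sup>+w. ennreal (ball n i w * norm (resid n i w) powr p) \<partial>M)"
   then have "ennreal (LINT w|M. ball n i w * norm (resid n i w) powr p) \<le> ennreal (72 * cdf (h n))" using main[OF i hn] by (simp only:)
   then show ?thesis by (rule ennreal_le_iff[THEN iffD1, rotated]) (simp add: cdf_nonneg)
  qed
 qed
qed

end

context functional_regression
begin

definition Kmax :: real where "Kmax = (SOME c. 0 < c \<and> (\<forall>t. K t \<le> c))"

lemma Kmax: "0 < Kmax" "K t \<le> Kmax"
proof -
 obtain c where "0 < c" "\<And>t. K t \<le> c" by (rule kernel_properties) blast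
 then have "0 < c \<and> (\<forall>t. K t \<le> c)" by blast
 then have "0 < Kmax \<and> (\<forall>t. K t \<le> Kmax)"
  unfolding Kmax_def by (rule someI[where P="\<lambda>c. 0 < c \<and> (\<forall>t. K t \<le> c)"])
 then show "0 < Kmax" "K t \<le> Kmax" by auto
qed

lemma weight_bounds:
 assumes "1 \<le> n"
 shows "weight n i w \<le> Kmax * ball n i w" "0 \<le> weight n i w" "weight n i w * ball n i w = weight n i w" "weight n i w \<le> Kmax"
 using weight_le_ball[OF Kmax(2) assms, of i w] Kmax(2) by (auto simp: Delta_def)

lemma weight_square_le: "1 \<le> n \<Longrightarrow> (weight n i w)\<^sup>2 \<le> Kmax\<^sup>2 * ball n i w"
 using weight_bounds[of n i w] Kmax(1)
 by (cases "D n i w \<le> h n") (auto simp: power_mono)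

lemma ball_sG:
 assumes i: "i \<in> {1..n}"
 shows "{w \<in> space M. D n i w \<le> h n} \<in> sets (sG n (i - 1))"
proof -
 have "space (sG n (i - 1)) = space M" using sigG_properties(1)[of i n] i by (auto simp: subalgebra_def)
 moreover have "{w \<in> space (sG n (i - 1)). D n i w \<le> h n} \<in> sets (sG n (i - 1))"
  using D_sG_measurable[OF i] by measurable
 ultimately show ?thesis by simp
qed

lemma score_moments:
 obtains p where "2 < p" "p \<le> 3"
  "\<And>n i. i \<in> {1..n} \<Longrightarrow> h n \<le> \<delta> \<Longrightarrow> integrable M (\<lambda>w. norm (score n i w) powr p)"
  "\<And>n i. i \<in> {1..n} \<Longrightarrow> h n \<le> \<delta> \<Longrightarrow> (LINT w|M. norm (score n i w) powr p) \<le> Kmax powr p * (72 * cdf (h n))"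
  "\<And>n i. i \<in> {1..n} \<Longrightarrow> h n \<le> \<delta> \<Longrightarrow> integrable M (\<lambda>w. (norm (score n i w))^2)"
  "\<And>n i. i \<in> {1..n} \<Longrightarrow> h n \<le> \<delta> \<Longrightarrow> integrable M (\<lambda>w. ball n i w * (norm (resid n i w))^2)"
proof -
 obtain p where p: "2 < p" "p \<le> 3"
  and int: "\<And>n i. i \<in> {1..n} \<Longrightarrow> h n \<le> \<delta> \<Longrightarrow> integrable M (\<lambda>w. ball n i w * norm (resid n i w) powr p)"
  and le: "\<And>n i. i \<in> {1..n} \<Longrightarrow> h n \<le> \<delta> \<Longrightarrow> (LINT w|M. ball n i w * norm (resid n i w) powr p) \<le> 72 * cdf (h n)"
  by (rule resid_moment) blast
 show thesis
 proof (rule that[OF p])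
  fix n i :: nat assume i: "i \<in> {1..n}" and hn: "h n \<le> \<delta>"
  have n: "1 \<le> n" using i by simp
  have [measurable]: "score n i \<in> borel_measurable M" "resid n i \<in> borel_measurable M" "D n i \<in> borel_measurable M"
   using score_measurable resid_measurable D_measurable i by auto
  have pt: "norm (score n i w) powr p \<le> Kmax powr p * (ball n i w * norm (resid n i w) powr p)" for w
  proof -
   have "norm (score n i w) \<le> Kmax * (ball n i w * norm (resid n i w))"
    unfolding score_def using weight_bounds[OF n, of i w] by (simp add: mult.assoc[symmetric] mult_right_mono)
   then have "norm (score n i w) powr p \<le> (Kmax * (ball n i w * norm (resid n i w))) powr p" using p by (intro powr_mono2) auto
   also have "\<dots> = Kmax powr p * (ball n i w * norm (resid n i w) powr p)"
    using Kmax(1) p by (simp add: powr_mult indicator_def)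
   finally show ?thesis .
  qed
  have i1: "integrable M (\<lambda>w. Kmax powr p * (ball n i w * norm (resid n i w) powr p))" using int[OF i hn] by simp
  show i2: "integrable M (\<lambda>w. norm (score n i w) powr p)"
   by (rule Bochner_Integration.integrable_bound[OF i1]) (use pt in \<open>auto intro!: AE_I2 order_trans[OF pt] abs_ge_self\<close>)
  have "(LINT w|M. norm (score n i w) powr p) \<le> (LINT w|M. Kmax powr p * (ball n i w * norm (resid n i w) powr p))"
   by (rule integral_mono[OF i2 i1 pt])
  also have "\<dots> \<le> Kmax powr p * (72 * cdf (h n))" using le[OF i hn] by (simp add: mult_left_mono)
  finally show "(LINT w|M. norm (score n i w) powr p) \<le> Kmax powr p * (72 * cdf (h n))" .
  have sq: "a\<^sup>2 \<le> 1 + a powr p" if "0 \<le> a" for a :: real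
  proof (cases "a \<le> 1")
   case True
   then show ?thesis using that by (simp add: power_le_one add_increasing2)
  next
   case False
   then have "a powr 2 \<le> a powr p" using p by (intro powr_mono) auto
   then show ?thesis using False by simp
  qed
  show "integrable M (\<lambda>w. (norm (score n i w))^2)"
  proof (rule Bochner_Integration.integrable_bound)
   show "integrable M (\<lambda>w. 1 + norm (score n i w) powr p)" using i2 by simp
   show "AE w in M. norm ((norm (score n i w))^2) \<le> norm (1 + norm (score n i w) powr p)"
    using sq[of "norm (score n i _)"] by (intro AE_I2) (auto simp: abs_of_nonneg)
  qed measurable
  show "integrable M (\<lambda>w. ball n i w * (norm (resid n i w))^2)"
  proof (rule Bochner_Integration.integrable_bound)
   show "integrable M (\<lambda>w. 1 + ball n i w * norm (resid n i w) powr p)" using int[OF i hn] by simp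
   show "AE w in M. norm (ball n i w * (norm (resid n i w))^2) \<le> norm (1 + ball n i w * norm (resid n i w) powr p)"
    using sq[of "norm (resid n i _)"] by (intro AE_I2) (auto simp: abs_of_nonneg indicator_def)
  qed measurable
 qed
qed

lemma score_square_integrable: "i \<in> {1..n} \<Longrightarrow> h n \<le> \<delta> \<Longrightarrow> integrable M (\<lambda>w. (norm (score n i w))^2)"
 by (rule score_moments)

lemma resid_square_integrable: "i \<in> {1..n} \<Longrightarrow> h n \<le> \<delta> \<Longrightarrow> integrable M (\<lambda>w. ball n i w * (norm (resid n i w))^2)"
 by (rule score_moments)

text \<open>Conditioning first on the past together with the present position, the weight and the window are
  known and the residual has mean zero.\<close>

lemma score_centred:
 assumes i: "i \<in> {1..n}"
 shows "AE w in M. cexp n i (\<lambda>w. score n i w \<bullet> v) w = 0"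
proof -
 have n: "1 \<le> n" using i by simp
 interpret G: prob_subalgebra M "sG n (i - 1)" by (rule sG_prob_subalgebra[OF i])
 interpret F: prob_subalgebra M "sF n (i - 1)" by (rule sF_prob_subalgebra) (use i in auto)
 note ce = Y_cond_exp[OF i]
 have iY: "integrable M (Y n i)" and ir: "integrable M (\<lambda>w. r (X n i w))"
  and rG: "(\<lambda>w. r (X n i w)) \<in> borel_measurable (sG n (i - 1))"
  using ce by (auto simp: is_cond_exp_def)
 have [measurable]: "weight n i \<in> borel_measurable M" "resid n i \<in> borel_measurable M"
  using weight_measurable resid_measurable i by auto
 have iE: "integrable M (\<lambda>w. resid n i w \<bullet> v)" unfolding resid_def using iY ir by (simp add: inner_diff_left)
 have "AE w in M. real_cond_exp M (sG n (i - 1)) (\<lambda>w. Y n i w \<bullet> v - r (X n i w) \<bullet> v) w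
   = real_cond_exp M (sG n (i - 1)) (\<lambda>w. Y n i w \<bullet> v) w - real_cond_exp M (sG n (i - 1)) (\<lambda>w. r (X n i w) \<bullet> v) w"
  using iY ir by (intro G.real_cond_exp_diff) auto
 moreover have "AE w in M. real_cond_exp M (sG n (i - 1)) (\<lambda>w. r (X n i w) \<bullet> v) w = r (X n i w) \<bullet> v"
  using ir rG by (intro G.real_cond_exp_F_meas) auto
 ultimately have c0: "AE w in M. real_cond_exp M (sG n (i - 1)) (\<lambda>w. resid n i w \<bullet> v) w = 0"
  using G.is_cond_exp_inner[OF ce, of v] unfolding resid_def inner_diff_left by eventually_elim simp
 have iW: "integrable M (\<lambda>w. weight n i w * (resid n i w \<bullet> v))"
 proof (rule Bochner_Integration.integrable_bound)
  show "integrable M (\<lambda>w. Kmax * (resid n i w \<bullet> v))" using iE by simp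
  show "AE w in M. norm (weight n i w * (resid n i w \<bullet> v)) \<le> norm (Kmax * (resid n i w \<bullet> v))"
   using weight_bounds[OF n] Kmax(1) by (intro AE_I2) (auto simp: abs_mult intro!: mult_right_mono)
 qed measurable
 have "AE w in M. real_cond_exp M (sG n (i - 1)) (\<lambda>w. weight n i w * (resid n i w \<bullet> v)) w
   = weight n i w * real_cond_exp M (sG n (i - 1)) (\<lambda>w. resid n i w \<bullet> v) w"
  by (rule G.real_cond_exp_mult[OF weight_sG_measurable[OF i] _ iW]) measurable
 then have z: "AE w in M. real_cond_exp M (sG n (i - 1)) (\<lambda>w. weight n i w * (resid n i w \<bullet> v)) w = 0"
  using c0 by eventually_elim simp
 have "AE w in M. cexp n i (real_cond_exp M (sG n (i - 1)) (\<lambda>w. weight n i w * (resid n i w \<bullet> v))) w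
   = cexp n i (\<lambda>w. weight n i w * (resid n i w \<bullet> v)) w"
  using sigG_properties(1,2)[of i n] i iW by (intro F.real_cond_exp_nested_subalg) auto
 moreover have "AE w in M. cexp n i (real_cond_exp M (sG n (i - 1)) (\<lambda>w. weight n i w * (resid n i w \<bullet> v))) w
   = cexp n i (\<lambda>w. 0) w"
  by (rule F.real_cond_exp_cong) (use z in auto)
 moreover have "AE w in M. cexp n i (\<lambda>w. 0) w = 0"
  by (rule F.real_cond_exp_F_meas) auto
 ultimately show ?thesis unfolding score_def inner_scaleR_left by eventually_elim simp
qed

lemma resid_product_integrable:
 assumes i: "i \<in> {1..n}" and hn: "h n \<le> \<delta>"
 shows "integrable M (\<lambda>w. ball n i w * ((resid n i w \<bullet> v) * (resid n i w \<bullet> y)))"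
proof (rule Bochner_Integration.integrable_bound)
 have [measurable]: "resid n i \<in> borel_measurable M" "D n i \<in> borel_measurable M"
  using resid_measurable D_measurable i by auto
 show "integrable M (\<lambda>w. norm v * norm y * (ball n i w * (norm (resid n i w))^2))"
  using resid_square_integrable[OF i hn] by simp
 have "\<bar>(a \<bullet> v) * (a \<bullet> y)\<bar> \<le> norm v * norm y * (norm a)^2" for a :: 'h
  unfolding abs_mult using mult_mono[OF Cauchy_Schwarz_ineq2[of a v] Cauchy_Schwarz_ineq2[of a y]]
  by (simp add: power2_eq_square mult_ac)
 then show "AE w in M. norm (ball n i w * ((resid n i w \<bullet> v) * (resid n i w \<bullet> y))) \<le> norm (norm v * norm y * (ball n i w * (norm (resid n i w))^2))"
  by (intro AE_I2) (auto simp: indicator_def abs_mult)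
 show "(\<lambda>w. ball n i w * ((resid n i w \<bullet> v) * (resid n i w \<bullet> y))) \<in> borel_measurable M" by measurable
qed

lemma resid_covariance:
 assumes i: "i \<in> {1..n}"
 shows "AE w in M. real_cond_exp M (sG n (i - 1)) (\<lambda>w. ball n i w * ((resid n i w \<bullet> basis_vec j) * (resid n i w \<bullet> basis_vec k))) w
   = ball n i w * W (Suc j) (Suc k) (X n i w)"
proof -
 interpret G: prob_subalgebra M "sG n (i - 1)" by (rule sG_prob_subalgebra[OF i])
 have [measurable]: "resid n i \<in> borel_measurable M" using resid_measurable i by auto
 have "\<forall>n\<ge>1. \<forall>i\<in>{1..n}. \<forall>j\<ge>1. \<forall>k\<ge>1. AE w in M.
    real_cond_exp M (sG n (i - 1)) (\<lambda>w'. (e j \<bullet> (Y n i w' - r (X n i w'))) * (e k \<bullet> (Y n i w' - r (X n i w')))) w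
    = W j k (X n i w)"
  using A3 unfolding hyp_A3_def by (elim conjE)
 then have W: "AE w in M. real_cond_exp M (sG n (i - 1)) (\<lambda>w. (resid n i w \<bullet> basis_vec j) * (resid n i w \<bullet> basis_vec k)) w
    = W (Suc j) (Suc k) (X n i w)"
  using i by (simp add: resid_def inner_commute)
 define B where "B = {w \<in> space M. D n i w \<le> h n}"
 have ind: "indicator B w = ball n i w" if "w \<in> space M" for w using that by (auto simp: B_def indicator_def)
 have "AE w in M. real_cond_exp M (sG n (i - 1)) (\<lambda>w. indicator B w * ((resid n i w \<bullet> basis_vec j) * (resid n i w \<bullet> basis_vec k))) w
  = indicator B w * real_cond_exp M (sG n (i - 1)) (\<lambda>w. (resid n i w \<bullet> basis_vec j) * (resid n i w \<bullet> basis_vec k)) w"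
  by (rule G.real_cond_exp_indicator) (use ball_sG[OF i] in \<open>auto simp: B_def\<close>)
 moreover have "AE w in M. real_cond_exp M (sG n (i - 1)) (\<lambda>w. indicator B w * ((resid n i w \<bullet> basis_vec j) * (resid n i w \<bullet> basis_vec k))) w
  = real_cond_exp M (sG n (i - 1)) (\<lambda>w. ball n i w * ((resid n i w \<bullet> basis_vec j) * (resid n i w \<bullet> basis_vec k))) w"
 proof (rule G.real_cond_exp_cong)
  show "AE w in M. indicator B w * ((resid n i w \<bullet> basis_vec j) * (resid n i w \<bullet> basis_vec k)) = ball n i w * ((resid n i w \<bullet> basis_vec j) * (resid n i w \<bullet> basis_vec k))"
   using ind by (intro AE_I2) simp
  have [measurable]: "B \<in> sets M" "D n i \<in> borel_measurable M" unfolding B_def using D_measurable i by auto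
  show "(\<lambda>w. indicator B w * ((resid n i w \<bullet> basis_vec j) * (resid n i w \<bullet> basis_vec k))) \<in> borel_measurable M"
   "(\<lambda>w. ball n i w * ((resid n i w \<bullet> basis_vec j) * (resid n i w \<bullet> basis_vec k))) \<in> borel_measurable M"
   by measurable
 qed
 ultimately show ?thesis using W AE_space by eventually_elim (simp add: ind)
qed

text \<open>The conditional covariance form of the residual at the position \<open>y\<close>, in the first \<open>N\<close> coordinates.\<close>

definition Wform :: "nat \<Rightarrow> 'h \<Rightarrow> 'e \<Rightarrow> real" where
 "Wform N v y = (\<Sum>j<N. \<Sum>k<N. (v \<bullet> basis_vec j) * (v \<bullet> basis_vec k) * W (Suc j) (Suc k) y)"

lemma score_variance:
 assumes i: "i \<in> {1..n}" and hn: "h n \<le> \<delta>"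
 shows "AE w in M. real_cond_exp M (sG n (i - 1)) (\<lambda>w. (score n i w \<bullet> H.proj N v)^2) w = (weight n i w)^2 * Wform N v (X n i w)"
proof -
 have n: "1 \<le> n" using i by simp
 interpret G: prob_subalgebra M "sG n (i - 1)" by (rule sG_prob_subalgebra[OF i])
 define q where "q j k w = ball n i w * ((resid n i w \<bullet> basis_vec j) * (resid n i w \<bullet> basis_vec k))" for j k w
 define c where "c j k = (v \<bullet> basis_vec j) * (v \<bullet> basis_vec k)" for j k
 have [measurable]: "weight n i \<in> borel_measurable M" "resid n i \<in> borel_measurable M" "D n i \<in> borel_measurable M"
  using weight_measurable resid_measurable D_measurable i by auto
 have iq: "integrable M (q j k)" for j k unfolding q_def by (rule resid_product_integrable[OF i hn])
 have wb: "(weight n i w)^2 \<le> Kmax\<^sup>2" for w using weight_bounds[OF n, of i w] by (intro power_mono) auto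
 have iwq: "integrable M (\<lambda>w. (c j k * (weight n i w)^2) * q j k w)" for j k
 proof (rule Bochner_Integration.integrable_bound)
  show "integrable M (\<lambda>w. (\<bar>c j k\<bar> * Kmax\<^sup>2) * q j k w)" using iq by simp
  have "norm ((c j k * (weight n i w)^2) * q j k w) \<le> norm ((\<bar>c j k\<bar> * Kmax\<^sup>2) * q j k w)" for w
   using wb[of w] by (auto simp: abs_mult intro!: mult_right_mono mult_left_mono)
  then show "AE w in M. norm ((c j k * (weight n i w)^2) * q j k w) \<le> norm ((\<bar>c j k\<bar> * Kmax\<^sup>2) * q j k w)" by simp
  show "(\<lambda>w. (c j k * (weight n i w)^2) * q j k w) \<in> borel_measurable M" using iq[of j k] by measurable
 qed
 have expand: "(score n i w \<bullet> H.proj N v)^2 = (\<Sum>jk\<in>{..<N}\<times>{..<N}. (c (fst jk) (snd jk) * (weight n i w)^2) * q (fst jk) (snd jk) w)" for w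
 proof -
  have w2: "(weight n i w)^2 * ball n i w = (weight n i w)^2"
   using weight_bounds(3)[OF n, of i w] by (simp add: power2_eq_square mult.assoc)
  have "(score n i w \<bullet> H.proj N v)^2 = (weight n i w)^2 * (resid n i w \<bullet> H.proj N v)^2"
   by (simp add: score_def power_mult_distrib)
  also have "(resid n i w \<bullet> H.proj N v)^2 = (\<Sum>j<N. \<Sum>k<N. c j k * ((resid n i w \<bullet> basis_vec j) * (resid n i w \<bullet> basis_vec k)))"
   unfolding H.inner_proj_eq power2_eq_square sum_product c_def by (intro sum.cong refl) (simp add: mult_ac)
  also have "\<dots> = (\<Sum>jk\<in>{..<N}\<times>{..<N}. c (fst jk) (snd jk) * ((resid n i w \<bullet> basis_vec (fst jk)) * (resid n i w \<bullet> basis_vec (snd jk))))"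
   by (simp add: sum.cartesian_product case_prod_beta)
  also have "(weight n i w)^2 * \<dots> = (\<Sum>jk\<in>{..<N}\<times>{..<N}. (c (fst jk) (snd jk) * ((weight n i w)^2 * ball n i w)) * ((resid n i w \<bullet> basis_vec (fst jk)) * (resid n i w \<bullet> basis_vec (snd jk))))"
   unfolding w2 by (simp add: sum_distrib_left mult_ac)
  finally show ?thesis by (simp add: q_def mult_ac)
 qed
 have 1: "AE w in M. real_cond_exp M (sG n (i - 1)) (\<lambda>w. \<Sum>jk\<in>{..<N}\<times>{..<N}. (c (fst jk) (snd jk) * (weight n i w)^2) * q (fst jk) (snd jk) w) w
   = (\<Sum>jk\<in>{..<N}\<times>{..<N}. real_cond_exp M (sG n (i - 1)) (\<lambda>w. (c (fst jk) (snd jk) * (weight n i w)^2) * q (fst jk) (snd jk) w) w)"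
  by (rule G.real_cond_exp_sum) (rule iwq)
 have 2: "AE w in M. \<forall>jk\<in>{..<N}\<times>{..<N}. real_cond_exp M (sG n (i - 1)) (\<lambda>w. (c (fst jk) (snd jk) * (weight n i w)^2) * q (fst jk) (snd jk) w) w
   = (c (fst jk) (snd jk) * (weight n i w)^2) * (ball n i w * W (Suc (fst jk)) (Suc (snd jk)) (X n i w))"
 proof (rule AE_finite_allI)
  fix jk assume "jk \<in> {..<N}\<times>{..<N}"
  have "AE w in M. real_cond_exp M (sG n (i - 1)) (\<lambda>w. (c (fst jk) (snd jk) * (weight n i w)^2) * q (fst jk) (snd jk) w) w
    = (c (fst jk) (snd jk) * (weight n i w)^2) * real_cond_exp M (sG n (i - 1)) (q (fst jk) (snd jk)) w"
  proof (rule G.real_cond_exp_mult[OF _ _ iwq])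
   show "(\<lambda>w. c (fst jk) (snd jk) * (weight n i w)^2) \<in> borel_measurable (sG n (i - 1))"
    using weight_sG_measurable[OF i] by measurable
  qed (use iq in auto)
  moreover have "AE w in M. real_cond_exp M (sG n (i - 1)) (q (fst jk) (snd jk)) w = ball n i w * W (Suc (fst jk)) (Suc (snd jk)) (X n i w)"
   unfolding q_def by (rule resid_covariance[OF i])
  ultimately show "AE w in M. real_cond_exp M (sG n (i - 1)) (\<lambda>w. (c (fst jk) (snd jk) * (weight n i w)^2) * q (fst jk) (snd jk) w) w
   = (c (fst jk) (snd jk) * (weight n i w)^2) * (ball n i w * W (Suc (fst jk)) (Suc (snd jk)) (X n i w))"
   by eventually_elim simp
 qed simp
 show ?thesis
  unfolding expand using 1 2
 proof eventually_elim
  case (elim w)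
  have w2: "(weight n i w)^2 * ball n i w = (weight n i w)^2"
   using weight_bounds(3)[OF n, of i w] by (simp add: power2_eq_square mult.assoc)
  have "(\<Sum>jk\<in>{..<N}\<times>{..<N}. (c (fst jk) (snd jk) * (weight n i w)^2) * (ball n i w * W (Suc (fst jk)) (Suc (snd jk)) (X n i w)))
   = (\<Sum>jk\<in>{..<N}\<times>{..<N}. c (fst jk) (snd jk) * W (Suc (fst jk)) (Suc (snd jk)) (X n i w) * ((weight n i w)^2 * ball n i w))"
   by (intro sum.cong refl) (simp only: mult_ac)
  also have "\<dots> = (weight n i w)^2 * Wform N v (X n i w)"
   unfolding w2 Wform_def c_def[symmetric] sum.cartesian_product
   by (simp add: sum_distrib_left mult_ac case_prod_beta)
  finally have eq: "(\<Sum>jk\<in>{..<N}\<times>{..<N}. (c (fst jk) (snd jk) * (weight n i w)^2) * (ball n i w * W (Suc (fst jk)) (Suc (snd jk)) (X n i w)))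
   = (weight n i w)^2 * Wform N v (X n i w)" .
  show ?case unfolding elim(1) eq[symmetric] by (rule sum.cong[OF refl bspec[OF elim(2)]])
 qed
qed

lemma W_continuity:
 assumes "0 < \<epsilon>"
 shows "\<forall>\<^sub>F n in sequentially. \<forall>j k y. d x y \<le> h n \<longrightarrow> \<bar>W (Suc j) (Suc k) y - W (Suc j) (Suc k) x\<bar> \<le> \<epsilon>"
proof -
 have "(\<lambda>n. SUP j\<in>{1..}. SUP k\<in>{1..}. SUP y\<in>pm_cball d x (h n). ereal \<bar>W j k y - W j k x\<bar>) \<longlonglongrightarrow> 0"
  using A3 unfolding hyp_A3_def by (elim conjE)
 then have "\<forall>\<^sub>F n in sequentially. (SUP j\<in>{1..}. SUP k\<in>{1..}. SUP y\<in>pm_cball d x (h n). ereal \<bar>W j k y - W j k x\<bar>) < ereal \<epsilon>"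
  using assms by (intro order_tendstoD(2)) auto
 then show ?thesis
 proof eventually_elim
  case (elim n)
  show ?case
  proof (intro allI impI)
   fix j k y assume "d x y \<le> h n"
   then have "ereal \<bar>W (Suc j) (Suc k) y - W (Suc j) (Suc k) x\<bar> \<le> (SUP j\<in>{1..}. SUP k\<in>{1..}. SUP y\<in>pm_cball d x (h n). ereal \<bar>W j k y - W j k x\<bar>)"
    by (intro SUP_upper2[of "Suc j"] SUP_upper2[of "Suc k"] SUP_upper2[of y]) (auto simp: pm_cball_def)
   then have "ereal \<bar>W (Suc j) (Suc k) y - W (Suc j) (Suc k) x\<bar> < ereal \<epsilon>"
    using elim by (rule order_le_less_trans)
   then show "\<bar>W (Suc j) (Suc k) y - W (Suc j) (Suc k) x\<bar> \<le> \<epsilon>" by simp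
  qed
 qed
qed

lemma Wform_continuity:
 assumes "0 < \<epsilon>"
 shows "\<forall>\<^sub>F n in sequentially. \<forall>y. d x y \<le> h n \<longrightarrow> \<bar>Wform N v y - Wform N v x\<bar> \<le> \<epsilon>"
proof -
 define c where "c = (\<Sum>j<N. \<Sum>k<N. \<bar>(v \<bullet> basis_vec j) * (v \<bullet> basis_vec k)\<bar>)"
 have c0: "0 \<le> c" unfolding c_def by (intro sum_nonneg) auto
 have "0 < \<epsilon> / (c + 1)" using assms c0 by simp
 from W_continuity[OF this] show ?thesis
 proof eventually_elim
  case (elim n)
  show ?case
  proof (intro allI impI)
   fix y assume y: "d x y \<le> h n"
   have "\<bar>Wform N v y - Wform N v x\<bar> = \<bar>\<Sum>j<N. \<Sum>k<N. (v \<bullet> basis_vec j) * (v \<bullet> basis_vec k) * (W (Suc j) (Suc k) y - W (Suc j) (Suc k) x)\<bar>"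
    unfolding Wform_def by (simp add: sum_subtractf right_diff_distrib)
   also have "\<dots> \<le> (\<Sum>j<N. \<Sum>k<N. \<bar>(v \<bullet> basis_vec j) * (v \<bullet> basis_vec k)\<bar> * (\<epsilon> / (c + 1)))"
   proof (intro order_trans[OF sum_abs] sum_mono)
    fix j k
    have "\<bar>W (Suc j) (Suc k) y - W (Suc j) (Suc k) x\<bar> \<le> \<epsilon> / (c + 1)" using elim y by blast
    then show "\<bar>(v \<bullet> basis_vec j) * (v \<bullet> basis_vec k) * (W (Suc j) (Suc k) y - W (Suc j) (Suc k) x)\<bar>
     \<le> \<bar>(v \<bullet> basis_vec j) * (v \<bullet> basis_vec k)\<bar> * (\<epsilon> / (c + 1))"
     unfolding abs_mult[of "(v \<bullet> basis_vec j) * (v \<bullet> basis_vec k)"] by (rule mult_left_mono) simp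
   qed
   also have "\<dots> = c * (\<epsilon> / (c + 1))"
    unfolding sum_distrib_right[symmetric] by (simp only: c_def[symmetric])
   also have "\<dots> \<le> \<epsilon>" using c0 assms by (simp add: field_simps)
   finally show "\<bar>Wform N v y - Wform N v x\<bar> \<le> \<epsilon>" .
  qed
 qed
qed

text \<open>Given the position, the variance is the squared weight times \<open>Wform N v\<close> at the position, which lies in the
  window; there it differs from its value at \<open>x\<close> by at most \<open>\<epsilon>\<close>.\<close>

lemma score_cond_variance:
 assumes "0 < \<epsilon>"
 shows "\<forall>\<^sub>F n in sequentially. \<forall>i\<in>{1..n}. AE w in M.
  \<bar>cexp n i (\<lambda>w. (score n i w \<bullet> H.proj N v)^2) w
    - Wform N v x * cexp n i (\<lambda>w. (weight n i w)^2) w\<bar>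
   \<le> \<epsilon> * cexp n i (\<lambda>w. (weight n i w)^2) w"
 using Wform_continuity[OF assms, of N v] h_le_eventually[OF delta_pos]
proof (eventually_elim, intro ballI)
 fix n i assume c: "\<forall>y. d x y \<le> h n \<longrightarrow> \<bar>Wform N v y - Wform N v x\<bar> \<le> \<epsilon>" and hn: "h n \<le> \<delta>" and i: "i \<in> {1..n}"
 have n: "1 \<le> n" using i by simp
 interpret G: prob_subalgebra M "sG n (i - 1)" by (rule sG_prob_subalgebra[OF i])
 interpret F: prob_subalgebra M "sF n (i - 1)" by (rule sF_prob_subalgebra) (use i in auto)
 define s where "s w = (score n i w \<bullet> H.proj N v)^2" for w
 define q where "q w = (weight n i w)^2" for w
 have is': "integrable M s" unfolding s_def
  by (rule H.integrable_square_coordinate[OF score_measurable[OF i] score_square_integrable[OF i hn]])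
 have iw: "integrable M q" unfolding q_def by (rule weight_power_integrable[OF i])
 have iG: "integrable M (real_cond_exp M (sG n (i - 1)) s)" by (rule G.real_cond_exp_int(1)[OF is'])
 have bnd: "AE w in M. real_cond_exp M (sG n (i - 1)) s w \<le> (Wform N v x + \<epsilon>) * q w"
  "AE w in M. (Wform N v x - \<epsilon>) * q w \<le> real_cond_exp M (sG n (i - 1)) s w"
 proof -
  have "\<bar>(weight n i w)\<^sup>2 * Wform N v (X n i w) - Wform N v x * q w\<bar> \<le> \<epsilon> * q w" for w
  proof (cases "D n i w \<le> h n")
   case True
   then have "\<bar>Wform N v (X n i w) - Wform N v x\<bar> * q w \<le> \<epsilon> * q w" using c by (intro mult_right_mono) (auto simp: q_def)
   moreover have "(weight n i w)^2 * Wform N v (X n i w) - Wform N v x * q w = (Wform N v (X n i w) - Wform N v x) * q w"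
    by (simp add: q_def algebra_simps)
   ultimately show ?thesis by (simp add: abs_mult q_def)
  next
   case False
   then have "weight n i w = 0" using weight_bounds(1,2)[OF n, of i w] by simp
   then show ?thesis by (simp add: q_def)
  qed
  then have "(weight n i w)^2 * Wform N v (X n i w) \<le> (Wform N v x + \<epsilon>) * q w"
   "(Wform N v x - \<epsilon>) * q w \<le> (weight n i w)^2 * Wform N v (X n i w)" for w
   by (simp_all add: abs_le_iff algebra_simps)
  then show "AE w in M. real_cond_exp M (sG n (i - 1)) s w \<le> (Wform N v x + \<epsilon>) * q w"
   "AE w in M. (Wform N v x - \<epsilon>) * q w \<le> real_cond_exp M (sG n (i - 1)) s w"
   using score_variance[OF i hn, of N v] unfolding s_def by (auto elim!: eventually_mono)
 qed
 have nest: "AE w in M. cexp n i (real_cond_exp M (sG n (i - 1)) s) w = cexp n i s w"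
  using sigG_properties(1,2)[of i n] i is' by (intro F.real_cond_exp_nested_subalg) auto
 have up: "AE w in M. cexp n i (real_cond_exp M (sG n (i - 1)) s) w \<le> cexp n i (\<lambda>w. (Wform N v x + \<epsilon>) * q w) w"
  using bnd(1) iG iw by (intro F.real_cond_exp_mono) auto
 have lo: "AE w in M. cexp n i (\<lambda>w. (Wform N v x - \<epsilon>) * q w) w \<le> cexp n i (real_cond_exp M (sG n (i - 1)) s) w"
  using bnd(2) iG iw by (intro F.real_cond_exp_mono) auto
 have cm: "AE w in M. cexp n i (\<lambda>w. a * q w) w = a * cexp n i q w" for a
  by (rule F.real_cond_exp_cmult[OF iw])
 show "AE w in M. \<bar>cexp n i (\<lambda>w. (score n i w \<bullet> H.proj N v)^2) w
    - Wform N v x * cexp n i (\<lambda>w. (weight n i w)^2) w\<bar>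
   \<le> \<epsilon> * cexp n i (\<lambda>w. (weight n i w)^2) w"
  unfolding s_def[symmetric] q_def[symmetric]
  using nest up lo cm[of "Wform N v x + \<epsilon>"] cm[of "Wform N v x - \<epsilon>"]
  by eventually_elim (simp add: abs_le_iff algebra_simps)
qed

end

context functional_regression
begin

text \<open>Given the position, the squared coordinates of the residual have conditional means \<open>W k k\<close>, whose tail sums
  over \<open>k\<close> decay exponentially, uniformly over the window.\<close>

lemma score_tail:
 assumes i: "i \<in> {1..n}" and hn: "h n \<le> \<delta>" and N: "1 \<le> N"
 shows "(\<integral>\<^sup>+w. (\<Sum>k. ennreal ((score n i w \<bullet> basis_vec (k + N))^2)) \<partial>M)
   \<le> ennreal (Kmax\<^sup>2 * (a0 * exp (- a1 * real N)) * cdf (h n))"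
proof -
 have n: "1 \<le> n" using i by simp
 interpret G: prob_subalgebra M "sG n (i - 1)" by (rule sG_prob_subalgebra[OF i])
 have [measurable]: "weight n i \<in> borel_measurable M" "resid n i \<in> borel_measurable M" "D n i \<in> borel_measurable M" "score n i \<in> borel_measurable M"
  using weight_measurable resid_measurable D_measurable score_measurable i by auto
 have w2: "(weight n i w)^2 * ball n i w = (weight n i w)^2" for w
  using weight_bounds(3)[OF n, of i w] by (simp add: power2_eq_square mult.assoc)
 define q where "q k w = ball n i w * ((resid n i w \<bullet> basis_vec k) * (resid n i w \<bullet> basis_vec k))" for k w
 define R where "R k = real_cond_exp M (sG n (i - 1)) (q k)" for k
 have iq: "integrable M (q k)" for k unfolding q_def by (rule resid_product_integrable[OF i hn])
 have [measurable]: "R k \<in> borel_measurable M" for k unfolding R_def by simp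
 have iR: "integrable M (R k)" for k unfolding R_def by (rule G.real_cond_exp_int(1)[OF iq])
 have R0: "AE w in M. 0 \<le> R k w" for k
  unfolding R_def by (rule G.real_cond_exp_pos) (use iq in \<open>auto simp: q_def\<close>)
 have Reg: "AE w in M. R k w = ball n i w * W (Suc k) (Suc k) (X n i w)" for k
  unfolding R_def q_def by (rule resid_covariance[OF i])
 have sq: "(score n i w \<bullet> basis_vec k)^2 = (weight n i w)^2 * q k w" for k w
  unfolding score_def q_def inner_scaleR_left power_mult_distrib mult.assoc[symmetric] w2
  by (simp add: power2_eq_square mult.assoc)
 have is': "integrable M (\<lambda>w. (score n i w \<bullet> basis_vec k)^2)" for k
  by (rule H.integrable_square_coordinate[OF score_measurable[OF i] score_square_integrable[OF i hn]])
 have iwq: "integrable M (\<lambda>w. (weight n i w)^2 * q k w)" for k using is'[of k] by (simp only: sq)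
 have iwR: "integrable M (\<lambda>w. (weight n i w)^2 * R k w)" "(LINT w|M. (weight n i w)^2 * R k w) = (LINT w|M. (weight n i w)^2 * q k w)" for k
  unfolding R_def
  by (rule G.real_cond_exp_intg[OF iwq], use weight_sG_measurable[OF i] iq[of k] in measurable)+
 have each: "(\<integral>\<^sup>+w. ennreal ((score n i w \<bullet> basis_vec k)^2) \<partial>M) = (\<integral>\<^sup>+w. ennreal ((weight n i w)^2 * R k w) \<partial>M)" for k
 proof -
  have "(\<integral>\<^sup>+w. ennreal ((score n i w \<bullet> basis_vec k)^2) \<partial>M) = ennreal (LINT w|M. (weight n i w)^2 * q k w)"
   unfolding sq by (rule nn_integral_eq_integral[OF iwq]) (simp add: q_def)
  also have "\<dots> = (\<integral>\<^sup>+w. ennreal ((weight n i w)^2 * R k w) \<partial>M)"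
   unfolding iwR(2)[symmetric]
   by (rule nn_integral_eq_integral[OF iwR(1), symmetric]) (use R0[of k] in \<open>auto elim!: eventually_mono\<close>)
  finally show ?thesis .
 qed
 have tail: "\<forall>m\<ge>1. \<forall>y\<in>pm_cball d x \<delta>.
    (\<lambda>k. W k k y + (r y \<bullet> e k)^2) summable_on {m<..} \<and>
    (\<Sum>\<^sub>\<infinity>k\<in>{m<..}. W k k y + (r y \<bullet> e k)^2) \<le> a0 * exp (- a1 * real m)"
  using A3 unfolding hyp_A3_def by (elim conjE)
 have "(\<integral>\<^sup>+w. (\<Sum>k. ennreal ((score n i w \<bullet> basis_vec (k + N))^2)) \<partial>M)
   = (\<Sum>k. \<integral>\<^sup>+w. ennreal ((score n i w \<bullet> basis_vec (k + N))^2) \<partial>M)"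
  by (rule nn_integral_suminf) measurable
 also have "\<dots> = (\<Sum>k. \<integral>\<^sup>+w. ennreal ((weight n i w)^2 * R (k + N) w) \<partial>M)" by (simp only: each)
 also have "\<dots> = (\<integral>\<^sup>+w. (\<Sum>k. ennreal ((weight n i w)^2 * R (k + N) w)) \<partial>M)"
  by (rule nn_integral_suminf[symmetric]) measurable
 also have "\<dots> \<le> (\<integral>\<^sup>+w. ennreal (Kmax\<^sup>2 * (a0 * exp (- a1 * real N))) * indicator {..h n} (D n i w) \<partial>M)"
 proof (rule nn_integral_mono_AE)
  have "AE w in M. \<forall>k. 0 \<le> R k w \<and> R k w = ball n i w * W (Suc k) (Suc k) (X n i w)"
   unfolding AE_all_countable using R0 Reg by auto
  then show "AE w in M. (\<Sum>k. ennreal ((weight n i w)^2 * R (k + N) w)) \<le> ennreal (Kmax\<^sup>2 * (a0 * exp (- a1 * real N))) * indicator {..h n} (D n i w)"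
  proof eventually_elim
   case (elim w)
   show ?case
   proof (cases "D n i w \<le> h n")
    case False
    then have "weight n i w = 0" using weight_bounds(1,2)[OF n, of i w] by simp
    then show ?thesis by simp
   next
    case True
    define y where "y = X n i w"
    have yb: "y \<in> pm_cball d x \<delta>" using True hn by (simp add: y_def pm_cball_def)
    have RW: "R k w = W (Suc k) (Suc k) y" "0 \<le> W (Suc k) (Suc k) y" for k
     using elim[rule_format, of k] True by (simp_all add: y_def)
    have Rn: "0 \<le> R k w" for k using elim by blast
    have s: "(\<lambda>k. W k k y + (r y \<bullet> e k)^2) summable_on {N<..}"
     "(\<Sum>\<^sub>\<infinity>k\<in>{N<..}. W k k y + (r y \<bullet> e k)^2) \<le> a0 * exp (- a1 * real N)"
     using tail N yb by auto
    have nn: "0 \<le> W k k y + (r y \<bullet> e k)^2" if "k \<in> {N<..}" for k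
     using RW(2)[of "k - 1"] that by simp
    have part: "(\<Sum>k<m. R (k + N) w) \<le> a0 * exp (- a1 * real N)" for m
    proof -
     have "(\<Sum>k<m. R (k + N) w) \<le> (\<Sum>k<m. W (Suc (k + N)) (Suc (k + N)) y + (r y \<bullet> e (Suc (k + N)))^2)"
      by (rule sum_mono) (simp add: RW(1))
     also have "\<dots> = (\<Sum>k\<in>(\<lambda>k. Suc (k + N)) ` {..<m}. W k k y + (r y \<bullet> e k)^2)"
      by (subst sum.reindex) (auto simp: inj_on_def)
     also have "\<dots> \<le> (\<Sum>\<^sub>\<infinity>k\<in>{N<..}. W k k y + (r y \<bullet> e k)^2)"
      by (rule finite_sum_le_infsum[OF s(1)]) (use nn in auto)
     finally show ?thesis using s(2) by linarith
    qed
    have "(\<Sum>k. ennreal ((weight n i w)^2 * R (k + N) w)) \<le> ennreal (Kmax\<^sup>2 * (a0 * exp (- a1 * real N)))"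
    proof (rule suminf_le_const[OF summableI])
     fix m
     have "(\<Sum>k<m. ennreal ((weight n i w)^2 * R (k + N) w)) = ennreal (\<Sum>k<m. (weight n i w)^2 * R (k + N) w)"
      by (intro sum_ennreal mult_nonneg_nonneg Rn) simp
     also have "\<dots> \<le> ennreal (Kmax\<^sup>2 * (a0 * exp (- a1 * real N)))"
     proof (rule ennreal_leI)
      have "(\<Sum>k<m. (weight n i w)^2 * R (k + N) w) = (weight n i w)^2 * (\<Sum>k<m. R (k + N) w)"
       by (simp add: sum_distrib_left)
      also have "\<dots> \<le> Kmax\<^sup>2 * (a0 * exp (- a1 * real N))"
       using weight_bounds[OF n, of i w] by (intro mult_mono part power_mono sum_nonneg Rn) auto
      finally show "(\<Sum>k<m. (weight n i w)^2 * R (k + N) w) \<le> Kmax\<^sup>2 * (a0 * exp (- a1 * real N))" .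
     qed
     finally show "(\<Sum>k<m. ennreal ((weight n i w)^2 * R (k + N) w)) \<le> ennreal (Kmax\<^sup>2 * (a0 * exp (- a1 * real N)))" .
    qed
    then show ?thesis using True by simp
   qed
  qed
 qed
 also have "\<dots> = ennreal (Kmax\<^sup>2 * (a0 * exp (- a1 * real N))) * ennreal (cdf (h n))"
  using integral_ball(3)[of i n "h n"] i by (subst nn_integral_cmult) auto
 also have "\<dots> = ennreal (Kmax\<^sup>2 * (a0 * exp (- a1 * real N)) * cdf (h n))"
 proof (rule ennreal_mult[symmetric])
  have "0 < a0" using A3 unfolding hyp_A3_def by (elim conjE)
  then show "0 \<le> Kmax\<^sup>2 * (a0 * exp (- a1 * real N))" by simp
 qed (rule cdf_nonneg)
 finally show ?thesis .
qed

section \<open>Local smoothness of the regression function\<close>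

text \<open>The sigma-algebra \<open>sF 1 0\<close> is trivial, so for the first cell of the array the random remainder
 in the hypothesis on the squared increments is deterministic and its essential supremum bounds it
 everywhere.\<close>

lemma trivial_sF_const:
 assumes f: "f \<in> borel_measurable (sF 1 0)" and "w \<in> space M" "w' \<in> space M"
 shows "f w' = (f w :: real)"
proof -
 have "sets (sF 1 0) = {{}, space M}" unfolding sigF_space_sets by (simp add: sigma_sets_empty_eq)
 moreover have "f -` {f w} \<inter> space (sF 1 0) \<in> sets (sF 1 0)" by (rule measurable_sets[OF f]) simp
 ultimately have "f -` {f w} \<inter> space M = {} \<or> f -` {f w} \<inter> space M = space M"
  by (simp add: sigF_space_sets)
 then show ?thesis using assms(2,3) by blast
qed

lemma trivial_Linf:
 assumes f: "f \<in> borel_measurable (sF 1 0)" and "w \<in> space M"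
 shows "ereal \<bar>f w\<bar> \<le> Linf_norm M f"
proof -
 have "AE w in M. ereal \<bar>f w\<bar> \<le> Linf_norm M f" unfolding Linf_norm_def by (rule esssup_AE)
 moreover have "AE w' in M. f w' = f w"
  by (rule AE_I2) (rule trivial_sF_const[OF f assms(2)])
 ultimately have "AE w' in M. ereal \<bar>f w\<bar> \<le> Linf_norm M f" by eventually_elim simp
 then show ?thesis by simp
qed

lemma increment_remainder_bound:
 fixes \<psi> \<psi>' :: "real \<Rightarrow> real"
 assumes s: "0 < s" "s \<le> s0" "s \<le> 1" and "0 < \<alpha>"
  and der: "\<And>s. s \<in> {0..s0} \<Longrightarrow> (\<psi> has_real_derivative \<psi>' s) (at s within {0..})" and \<psi>0: "\<psi> 0 = 0"
  and g: "g \<in> borel_measurable (sF 1 0)" and w: "w \<in> space M"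
  and le: "(SUP u\<in>{0..s}. ereal \<bar>\<psi>' u - \<psi>' 0\<bar>) * ereal s + Linf_norm M g \<le> ereal (L * s powr (1 + \<alpha>))"
 shows "\<bar>\<psi> s + g w\<bar> \<le> (\<bar>\<psi>' 0\<bar> + 2 * L) * s" and "0 \<le> L"
proof -
 define c where "c = L * s powr (1 + \<alpha>)"
 have g0: "ereal \<bar>g w\<bar> \<le> Linf_norm M g" by (rule trivial_Linf[OF g w])
 then have g1: "0 \<le> Linf_norm M g" by (rule order_trans[rotated]) simp
 have sup: "ereal \<bar>\<psi>' u - \<psi>' 0\<bar> \<le> (SUP u\<in>{0..s}. ereal \<bar>\<psi>' u - \<psi>' 0\<bar>)" if "u \<in> {0..s}" for u
  using that by (rule SUP_upper)
 have dev: "ereal (\<bar>\<psi>' u - \<psi>' 0\<bar> * s) + Linf_norm M g \<le> ereal c" if "u \<in> {0..s}" for u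
 proof -
  have "ereal \<bar>\<psi>' u - \<psi>' 0\<bar> * ereal s \<le> (SUP u\<in>{0..s}. ereal \<bar>\<psi>' u - \<psi>' 0\<bar>) * ereal s"
   by (rule ereal_mult_right_mono[OF sup[OF that]]) (use s in simp)
  then have "ereal (\<bar>\<psi>' u - \<psi>' 0\<bar> * s) + Linf_norm M g \<le> (SUP u\<in>{0..s}. ereal \<bar>\<psi>' u - \<psi>' 0\<bar>) * ereal s + Linf_norm M g"
   by (intro add_right_mono) simp
  then show ?thesis using le unfolding c_def by (rule order_trans)
 qed
 have d1: "\<bar>\<psi>' u - \<psi>' 0\<bar> * s \<le> c" if "u \<in> {0..s}" for u
 proof -
  have "ereal (\<bar>\<psi>' u - \<psi>' 0\<bar> * s) + 0 \<le> ereal (\<bar>\<psi>' u - \<psi>' 0\<bar> * s) + Linf_norm M g" using g1 by (intro add_left_mono)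
  then show ?thesis using dev[OF that] order_trans by fastforce
 qed
 have gc: "\<bar>g w\<bar> \<le> c"
 proof -
  have "Linf_norm M g \<le> ereal c" using dev[of 0] s by (simp add: zero_ereal_def[symmetric])
  with g0 have "ereal \<bar>g w\<bar> \<le> ereal c" by (rule order_trans)
  then show ?thesis by simp
 qed
 have c0: "0 \<le> c" using gc by linarith
 then show L: "0 \<le> L" using s by (auto simp: c_def zero_le_mult_iff)
 have "s powr (1 + \<alpha>) \<le> s powr 1" using s \<open>0 < \<alpha>\<close> by (intro powr_mono') auto
 then have cs: "c \<le> L * s" unfolding c_def using L s by (intro mult_left_mono) auto
 have "norm (\<psi> s - \<psi> 0) \<le> (\<bar>\<psi>' 0\<bar> + c / s) * norm (s - 0)"
 proof (rule field_differentiable_bound[where S="{0..s}" and f'=\<psi>'])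
  fix z assume z: "z \<in> {0..s}"
  show "(\<psi> has_field_derivative \<psi>' z) (at z within {0..s})"
   by (rule DERIV_subset[OF der]) (use z s in auto)
  have "\<bar>\<psi>' z - \<psi>' 0\<bar> \<le> c / s" using d1[OF z] s by (simp add: le_divide_eq)
  then show "norm (\<psi>' z) \<le> \<bar>\<psi>' 0\<bar> + c / s" by simp
 qed (use s in auto)
 then have "\<bar>\<psi> s\<bar> \<le> \<bar>\<psi>' 0\<bar> * s + c" using s \<psi>0 by (simp add: distrib_right)
 then have "\<bar>\<psi> s + g w\<bar> \<le> \<bar>\<psi>' 0\<bar> * s + c + c" using gc by linarith
 also have "\<dots> \<le> (\<bar>\<psi>' 0\<bar> + 2 * L) * s" using cs by (simp add: distrib_right)
 finally show "\<bar>\<psi> s + g w\<bar> \<le> (\<bar>\<psi>' 0\<bar> + 2 * L) * s" .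
qed

text \<open>Given the distance \<open>s\<close> from \<open>x\<close>, each squared coordinate of the increment has mean at most a constant
  times \<open>s\<close>, by the mean value theorem for \<open>\<psi>2\<close>, and the constants are summable over the coordinates.\<close>

lemma increment_bound:
 obtains Bc u0 where "0 \<le> Bc" "0 < u0" "\<And>u. 0 < u \<Longrightarrow> u \<le> u0 \<Longrightarrow>
  (\<integral>\<^sup>+w. ennreal ((norm (indicator {..u} (D 1 1 w) *\<^sub>R (r (X 1 1 w) - r x)))^2) \<partial>M) \<le> ennreal (Bc * u * cdf u)"
proof -
 have \<alpha>: "0 < \<alpha>" using A2 unfolding hyp_A2_def by (elim conjE)
 obtain \<psi>2 \<psi>2' :: "nat \<Rightarrow> real \<Rightarrow> real" and gb2 :: "nat \<Rightarrow> nat \<Rightarrow> nat \<Rightarrow> real \<Rightarrow> 'w \<Rightarrow> real"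
  and L2 :: "nat \<Rightarrow> real" and s0 where
  at: "\<forall>k\<ge>1. \<forall>n\<ge>1. \<forall>i\<in>{1..n}.
      cond_exp_at M (sF n (i - 1)) (\<lambda>w. D n i w)
       (\<lambda>w. \<bar>r (X n i w) \<bullet> e k - r x \<bullet> e k\<bar>\<^sup>2)
       (\<lambda>s w. \<psi>2 k s + gb2 k n i s w)" and
  z0: "\<forall>k\<ge>1. \<psi>2 k 0 = 0" and s0: "0 < s0" and
  der: "\<forall>k\<ge>1. (\<forall>s\<in>{0..s0}. (\<psi>2 k has_real_derivative \<psi>2' k s) (at s within {0..})) \<and> \<psi>2' k 0 \<noteq> 0" and
  le: "\<forall>k\<ge>1. \<forall>n\<ge>1. \<forall>i\<in>{1..n}. \<forall>s\<in>{0<..s0}.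
      (SUP u\<in>{0..s}. ereal \<bar>\<psi>2' k u - \<psi>2' k 0\<bar>) * ereal s
       + Linf_norm M (gb2 k n i s) \<le> ereal (L2 k * s powr (1 + \<alpha>))" and
  sm: "\<forall>m\<ge>1. (\<lambda>k. \<bar>\<psi>2' k 0\<bar> + L2 k) summable_on {m<..} \<and>
      (\<Sum>\<^sub>\<infinity>k\<in>{m<..}. \<bar>\<psi>2' k 0\<bar> + L2 k) \<le> a0 * exp (- a1 * real m)"
  using A4 unfolding hyp_A4_def by (elim conjE exE) (rule that; assumption)
 define c where "c k = \<bar>\<psi>2' (Suc k) 0\<bar> + 2 * L2 (Suc k)" for k
 define q where "q k s w = \<psi>2 (Suc k) s + gb2 (Suc k) 1 1 s w" for k s w
 have at1: "cond_exp_at M (sF 1 0) (D 1 1) (\<lambda>w. \<bar>r (X 1 1 w) \<bullet> basis_vec k - r x \<bullet> basis_vec k\<bar>\<^sup>2) (q k)" for k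
  using at[rule_format, of "Suc k" 1 1] by (simp add: q_def[abs_def])
 have gm: "gb2 (Suc k) 1 1 s \<in> borel_measurable (sF 1 0)" for k s
 proof -
  have "(\<lambda>(s, w). q k s w) \<in> borel_measurable (borel \<Otimes>\<^sub>M sF 1 0)" using at1 unfolding cond_exp_at_def by blast
  from measurable_compose[OF measurable_Pair1' this, of s]
  have "q k s \<in> borel_measurable (sF 1 0)" by simp
  then have "(\<lambda>w. q k s w - \<psi>2 (Suc k) s) \<in> borel_measurable (sF 1 0)" by simp
  then show ?thesis by (simp add: q_def)
 qed
 have rem: "\<bar>q k s w\<bar> \<le> c k * s" "0 \<le> L2 (Suc k)" if "0 < s" "s \<le> s0" "s \<le> 1" "w \<in> space M" for k s w
  unfolding q_def c_def
  by (rule increment_remainder_bound[where \<psi>="\<psi>2 (Suc k)" and \<psi>'="\<psi>2' (Suc k)" and g="gb2 (Suc k) 1 1 s" and L="L2 (Suc k)",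
    OF that(1-3) \<alpha> _ _ gm that(4)];
   use der z0 le[rule_format, of "Suc k" 1 1 s] that in \<open>simp\<close>)+
 have L0: "0 \<le> L2 (Suc k)" for k using rem(2)[of "min s0 1"] s0 not_empty by auto
 have c0: "0 \<le> c k" for k using L0[of k] by (simp add: c_def)
 have csum: "summable c"
 proof -
  have "(\<lambda>k. \<bar>\<psi>2' k 0\<bar> + L2 k) summable_on {1<..}" using sm by auto
  note fs = finite_sum_le_infsum[OF this]
  have nn: "0 \<le> \<bar>\<psi>2' k 0\<bar> + L2 k" if "k \<in> {1<..}" for k using L0[of "k - 1"] that by simp
  have "(\<Sum>k<m. c (Suc k)) \<le> 2 * (\<Sum>\<^sub>\<infinity>k\<in>{1<..}. \<bar>\<psi>2' k 0\<bar> + L2 k)" for m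
  proof -
   have "(\<Sum>k<m. c (Suc k)) \<le> (\<Sum>k<m. 2 * (\<bar>\<psi>2' (Suc (Suc k)) 0\<bar> + L2 (Suc (Suc k))))"
    by (intro sum_mono) (simp add: c_def)
   also have "\<dots> = 2 * (\<Sum>k\<in>(\<lambda>k. Suc (Suc k)) ` {..<m}. \<bar>\<psi>2' k 0\<bar> + L2 k)"
    by (subst sum.reindex) (auto simp: inj_on_def sum_distrib_left)
   also have "\<dots> \<le> 2 * (\<Sum>\<^sub>\<infinity>k\<in>{1<..}. \<bar>\<psi>2' k 0\<bar> + L2 k)"
    by (intro mult_left_mono fs) (use nn in auto)
   finally show ?thesis .
  qed
  then have "summable (\<lambda>k. c (Suc k))" by (intro summableI_nonneg_bounded) (auto intro: c0)
  then show ?thesis by (simp add: summable_Suc_iff)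
 qed
 define u0 where "u0 = min \<delta> (min s0 1)"
 have u0: "0 < u0" using delta_pos s0 by (simp add: u0_def)
 have sub: "subalgebra M (sF 1 0)" by (rule sigF_subalgebra) simp
 have [measurable]: "D 1 1 \<in> borel_measurable M" "(\<lambda>w. r (X 1 1 w)) \<in> borel_measurable M"
  using D_measurable[of 1 1] rX_measurable[of 1 1] by auto
 define J where "J = sigma_join M (sF 1 0) (D 1 1) borel"
 have D11: "D 1 1 \<in> borel_measurable M" by (rule D_measurable) simp_all
 have J: "subalgebra M J" "D 1 1 \<in> J \<rightarrow>\<^sub>M borel"
  unfolding J_def by (rule sigma_join_properties[OF sub D11])+
 interpret J: prob_subalgebra M J
  by (intro prob_subalgebra.intro prob_space_axioms prob_subalgebra_axioms.intro J(1))
 show thesis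
 proof (rule that[of "suminf c" u0])
  show "0 \<le> suminf c" by (rule suminf_nonneg[OF csum c0])
  show "0 < u0" by (rule u0)
  fix u :: real assume u: "0 < u" "u \<le> u0"
  define f where "f w = indicator {..u} (D 1 1 w) *\<^sub>R (r (X 1 1 w) - r x)" for w
  have fm [measurable]: "f \<in> borel_measurable M" unfolding f_def by measurable
  have fb: "AE w in M. norm (f w) \<le> 2 + norm (r x)"
  proof -
   have "(1::nat) \<in> {1..1}" by simp
   from r_bounded[OF this] show ?thesis
   proof eventually_elim
    case (elim w)
    show ?case
    proof (cases "D 1 1 w \<le> u")
     case True
     then have "norm (r (X 1 1 w)) \<le> 2" using elim u by (simp add: u0_def)
     then show ?thesis using True norm_triangle_ineq4[of "r (X 1 1 w)" "r x"] by (simp add: f_def)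
    qed (simp add: f_def add_nonneg_nonneg)
   qed
  qed
  have f2: "integrable M (\<lambda>w. (norm (f w))^2)"
   by (rule integrable_const_bound[where B="(2 + norm (r x))^2"])
    (use fb in \<open>auto elim!: eventually_mono intro: power_mono\<close>)
  have each: "(\<integral>\<^sup>+w. ennreal ((f w \<bullet> basis_vec k)^2) \<partial>M) \<le> ennreal (c k * (u * cdf u))" for k
  proof -
   define Z where "Z w = \<bar>r (X 1 1 w) \<bullet> basis_vec k - r x \<bullet> basis_vec k\<bar>\<^sup>2" for w
   define B where "B = {w \<in> space M. D 1 1 w \<le> u}"
   have Zm [measurable]: "Z \<in> borel_measurable M" unfolding Z_def by measurable
   have spJ: "space J = space M" using J(1) by (simp add: subalgebra_def)
   have "{w \<in> space J. D 1 1 w \<le> u} \<in> sets J" using J(2) by measurable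
   then have BJ: "B \<in> sets J" by (simp add: B_def spJ)
   have fZ: "(f w \<bullet> basis_vec k)^2 = indicator B w * Z w" if "w \<in> space M" for w
    using that by (auto simp: f_def B_def Z_def indicator_def inner_diff_left)
   have if2: "integrable M (\<lambda>w. (f w \<bullet> basis_vec k)^2)" by (rule H.integrable_square_coordinate[OF fm f2])
   moreover have "integrable M (\<lambda>w. (f w \<bullet> basis_vec k)^2) = integrable M (\<lambda>w. indicator B w * Z w)"
    by (rule Bochner_Integration.integrable_cong) (simp_all add: fZ)
   ultimately have iBZ: "integrable M (\<lambda>w. indicator B w * Z w)" by simp
   have D0: "AE w in M. D 1 1 w \<noteq> 0"
   proof -
    have "measure M {w \<in> space M. D 1 1 w \<le> 0} = 0" using cdf_zero by (simp add: dist_cdf_def)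
    moreover have "{w \<in> space M. D 1 1 w \<le> 0} \<in> events" using D11 by measurable
    ultimately have "AE w in M. w \<notin> {w \<in> space M. D 1 1 w \<le> 0}" by (simp only: prob_eq_0)
    then have "AE w in M. \<not> D 1 1 w \<le> 0" using AE_space by eventually_elim simp
    then show ?thesis by eventually_elim auto
   qed
   have qZ: "AE w in M. real_cond_exp M J Z w = q k (D 1 1 w) w"
    using at1[of k] unfolding cond_exp_at_def J_def Z_def by blast
   have pull: "AE w in M. real_cond_exp M J (\<lambda>w. indicator B w * Z w) w = indicator B w * real_cond_exp M J Z w"
    by (rule J.real_cond_exp_indicator[OF BJ Zm])
   have "(\<integral>\<^sup>+w. ennreal ((f w \<bullet> basis_vec k)^2) \<partial>M) = ennreal (LINT w|M. (f w \<bullet> basis_vec k)^2)"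
    by (rule nn_integral_eq_integral[OF if2]) simp
   also have "(LINT w|M. (f w \<bullet> basis_vec k)^2) = (LINT w|M. indicator B w * Z w)"
    by (rule Bochner_Integration.integral_cong) (simp_all add: fZ)
   also have "\<dots> = (LINT w|M. real_cond_exp M J (\<lambda>w. indicator B w * Z w) w)"
    by (rule J.real_cond_exp_int(2)[OF iBZ, symmetric])
   also have "\<dots> \<le> (LINT w|M. (c k * u) * indicator {..u} (D 1 1 w))"
   proof (rule integral_mono_AE)
    show "integrable M (real_cond_exp M J (\<lambda>w. indicator B w * Z w))" by (rule J.real_cond_exp_int(1)[OF iBZ])
    show "integrable M (\<lambda>w. (c k * u) * indicator {..u} (D 1 1 w))" using integral_ball(2)[of 1 1 u] by simp
    show "AE w in M. real_cond_exp M J (\<lambda>w. indicator B w * Z w) w \<le> (c k * u) * indicator {..u} (D 1 1 w)"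
     using pull qZ D0 AE_space
    proof eventually_elim
     case (elim w)
     show ?case
     proof (cases "D 1 1 w \<le> u")
      case True
      have dpos: "0 < D 1 1 w" using elim(3) dist_nonneg[of "X 1 1 w"] by linarith
      have "\<bar>q k (D 1 1 w) w\<bar> \<le> c k * D 1 1 w"
       using True u dpos elim(4) by (intro rem(1)) (auto simp: u0_def)
      also have "\<dots> \<le> c k * u" using True c0[of k] by (intro mult_left_mono) auto
      finally have "q k (D 1 1 w) w \<le> c k * u" by linarith
      then show ?thesis using elim True by (simp add: B_def)
     qed (use elim in \<open>simp add: B_def\<close>)
    qed
   qed
   also have "\<dots> = c k * (u * cdf u)" using integral_ball(1)[of 1 1 u] by simp
   finally show ?thesis by (simp add: ennreal_leI)
  qed
  have ucdf: "0 \<le> u * cdf u" using u cdf_nonneg by simp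
  have "(\<integral>\<^sup>+w. ennreal ((norm (f w))^2) \<partial>M) = (\<Sum>k. \<integral>\<^sup>+w. ennreal ((f w \<bullet> basis_vec k)^2) \<partial>M)"
   by (rule H.square_norm_nn_integral) measurable
  also have "\<dots> \<le> (\<Sum>k. ennreal (c k * (u * cdf u)))" by (intro suminf_le each summableI)
  also have "\<dots> = ennreal (\<Sum>k. c k * (u * cdf u))"
   using c0 ucdf csum by (intro suminf_ennreal2) (auto intro: summable_mult2)
  also have "(\<Sum>k. c k * (u * cdf u)) = suminf c * u * cdf u" using suminf_mult2[OF csum, of "u * cdf u"] by simp
  finally show "(\<integral>\<^sup>+w. ennreal ((norm (indicator {..u} (D 1 1 w) *\<^sub>R (r (X 1 1 w) - r x)))^2) \<partial>M) \<le> ennreal (suminf c * u * cdf u)"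
   by (simp add: f_def)
 qed
qed

end

section \<open>The covariance operator\<close>

text \<open>The rows of the matrix are square summable by the Cauchy--Schwarz inequality for the entries and by
  the trace condition; they are the images of the basis vectors.\<close>

lemma (in hilbert_basis) psd_matrix_operator:
 fixes a :: "nat \<Rightarrow> nat \<Rightarrow> real"
 assumes sym: "\<And>j k. a j k = a k j"
  and psd: "\<And>v N. 0 \<le> (\<Sum>j<N. \<Sum>k<N. (v \<bullet> u j) * (v \<bullet> u k) * a j k)"
  and cs: "\<And>j k. (a j k)^2 \<le> a j j * a k k"
  and tr: "summable (\<lambda>k. a k k)"
 obtains C where "bounded_linear C" "\<And>v w. C v \<bullet> w = v \<bullet> C w" "\<And>v. 0 \<le> C v \<bullet> v" "\<And>j k. C (u k) \<bullet> u j = a j k"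
  "\<And>v N. C (proj N v) \<bullet> proj N v = (\<Sum>j<N. \<Sum>k<N. (v \<bullet> u j) * (v \<bullet> u k) * a j k)"
proof -
 have d0: "0 \<le> a k k" for k
 proof -
  have "(\<Sum>j<Suc k. \<Sum>l<Suc k. (u k \<bullet> u j) * (u k \<bullet> u l) * a j l) = (\<Sum>j<Suc k. if j = k then a k k else 0)"
   by (intro sum.cong refl) (auto simp: ortho if_distrib[of "\<lambda>x. x * _"] cong: if_cong)
  then show ?thesis using psd[where v="u k" and N="Suc k"] by simp
 qed
 define t where "t = (\<Sum>k. a k k)"
 have t0: "0 \<le> t" unfolding t_def by (rule suminf_nonneg[OF tr d0])
 have rs: "summable (\<lambda>k. (a j k)^2)" for j
  by (rule summable_comparison_test'[of "\<lambda>k. a j j * a k k" 0]) (use cs tr in \<open>auto intro: summable_mult\<close>)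
 define row where "row j = (\<Sum>k. a j k *\<^sub>R u k)" for j
 have row_u: "row j \<bullet> u k = a j k" for j k unfolding row_def by (rule riesz_fischer(2)[OF rs])
 have row_norm: "(norm (row j))^2 \<le> a j j * t" for j
 proof -
  have "(\<lambda>k. (a j k)^2) sums (norm (row j))\<^sup>2" using parseval[of "row j"] by (simp add: row_u)
  then have "(norm (row j))^2 = (\<Sum>k. (a j k)^2)" by (simp add: sums_iff)
  also have "\<dots> \<le> (\<Sum>k. a j j * a k k)" by (rule suminf_le[OF cs rs summable_mult[OF tr]])
  also have "\<dots> = a j j * t" unfolding t_def by (rule suminf_mult[OF tr])
  finally show ?thesis .
 qed
 have rv: "(row j \<bullet> v)^2 \<le> a j j * (t * (norm v)^2)" for j v
 proof -
  have "(row j \<bullet> v)^2 \<le> (norm (row j))^2 * (norm v)^2"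
   using Cauchy_Schwarz_ineq[of "row j" v] by (simp add: power2_norm_eq_inner)
  also have "\<dots> \<le> (a j j * t) * (norm v)^2" by (intro mult_right_mono row_norm) simp
  finally show ?thesis by (simp add: mult.assoc)
 qed
 have cs2: "summable (\<lambda>j. (row j \<bullet> v)^2)" for v
  by (rule summable_comparison_test'[of "\<lambda>j. a j j * (t * (norm v)^2)" 0]) (use rv tr in \<open>auto intro: summable_mult2\<close>)
 define C where "C v = (\<Sum>j. (row j \<bullet> v) *\<^sub>R u j)" for v
 have Cu: "C v \<bullet> u j = row j \<bullet> v" for v j unfolding C_def by (rule riesz_fischer(2)[OF cs2])
 have Cn: "norm (C v) \<le> norm v * t" for v
 proof (rule power2_le_imp_le)
  have "(\<lambda>j. (row j \<bullet> v)^2) sums (norm (C v))\<^sup>2" using parseval[of "C v"] by (simp add: Cu)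
  then have "(norm (C v))^2 = (\<Sum>j. (row j \<bullet> v)^2)" by (simp add: sums_iff)
  also have "\<dots> \<le> (\<Sum>j. a j j * (t * (norm v)^2))" by (rule suminf_le[OF rv cs2 summable_mult2[OF tr]])
  also have "\<dots> = t * (t * (norm v)^2)" unfolding t_def by (rule suminf_mult2[OF tr, symmetric])
  finally show "(norm (C v))^2 \<le> (norm v * t)^2" by (simp add: power2_eq_square mult_ac)
 qed (use t0 in simp)
 have bl: "bounded_linear C"
 proof (rule bounded_linear_intro[where K=t])
  show "C (v + w) = C v + C w" for v w
   by (rule eq_if_coordinates_eq) (simp add: Cu inner_add_left inner_add_right)
  show "C (c *\<^sub>R v) = c *\<^sub>R C v" for c v
   by (rule eq_if_coordinates_eq) (simp add: Cu)
 qed (rule Cn)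
 then interpret C: bounded_linear C .
 have fin: "C (proj N v) \<bullet> proj N w = (\<Sum>j<N. \<Sum>k<N. (w \<bullet> u j) * (v \<bullet> u k) * a j k)" for N v w
 proof -
  have "C (proj N v) \<bullet> proj N w = (\<Sum>j<N. (w \<bullet> u j) * (row j \<bullet> proj N v))"
   unfolding inner_proj_eq Cu by (simp add: mult.commute)
  also have "\<dots> = (\<Sum>j<N. \<Sum>k<N. (w \<bullet> u j) * (v \<bullet> u k) * a j k)"
   unfolding inner_proj_eq row_u sum_distrib_left by (intro sum.cong refl) (simp add: mult_ac)
  finally show ?thesis .
 qed
 show thesis
 proof (rule that[OF bl])
  show "C v \<bullet> w = v \<bullet> C w" for v w
  proof -
   have "C (proj N v) \<bullet> proj N w = C (proj N w) \<bullet> proj N v" for N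
    unfolding fin by (subst sum.swap) (simp add: sym mult_ac)
   moreover have "(\<lambda>N. C (proj N v) \<bullet> proj N w) \<longlonglongrightarrow> C v \<bullet> w" "(\<lambda>N. C (proj N w) \<bullet> proj N v) \<longlonglongrightarrow> C w \<bullet> v"
    by (intro tendsto_intros C.tendsto proj_tendsto)+
   ultimately show ?thesis using LIMSEQ_unique by (force simp: inner_commute)
  qed
  show "0 \<le> C v \<bullet> v" for v
  proof (rule LIMSEQ_le_const)
   show "(\<lambda>N. C (proj N v) \<bullet> proj N v) \<longlonglongrightarrow> C v \<bullet> v" by (intro tendsto_intros C.tendsto proj_tendsto)
   show "\<exists>N. \<forall>n\<ge>N. 0 \<le> C (proj n v) \<bullet> proj n v" unfolding fin using psd by blast
  qed
  show "C (u k) \<bullet> u j = a j k" for j k by (simp add: Cu row_u)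
  show "C (proj N v) \<bullet> proj N v = (\<Sum>j<N. \<Sum>k<N. (v \<bullet> u j) * (v \<bullet> u k) * a j k)" for N v by (rule fin)
 qed
qed

context functional_regression
begin

lemma kernel_moment_pos: "\<forall>\<^sub>F n in sequentially. 0 < (LINT w|M. K (D 1 1 w / h n) ^ 2)"
proof -
 have "0 < f1 x * M_const K \<tau>0 2" using f1_pos M_const_pos[of 2] by simp
 then have "\<forall>\<^sub>F n in sequentially. 0 < (LINT w|M. K (D 1 1 w / h n) ^ 2) / \<phi> (h n)"
  by (intro order_tendstoD(1)[OF kernel_moment_tendsto]) auto
 then show ?thesis using phi_pos by eventually_elim (simp add: zero_less_divide_iff)
qed

lemma weight_power_expectation:
 assumes i: "i \<in> {1..n}"
 shows "(LINT w|M. (weight n i w) ^ j) = (LINT w|M. K (D 1 1 w / h n) ^ j)"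
 unfolding Delta_def using i by (intro integral_distr_eq[of i n "\<lambda>y. K (d x y / h n) ^ j"]) auto

text \<open>The form at \<open>x\<close> is, up to a small error, the variance of a coordinate of the score divided by the second
  moment of the weight, which is positive.\<close>

lemma Wform_nonneg: "0 \<le> Wform N v x"
proof -
 have "0 \<le> Wform N v x + \<epsilon>" if \<epsilon>: "0 < \<epsilon>" for \<epsilon>
 proof -
  have "\<forall>\<^sub>F n in sequentially. 0 \<le> Wform N v x + \<epsilon>"
   using score_cond_variance[OF \<epsilon>, of N v] kernel_moment_pos eventually_ge_at_top[of 1] h_le_eventually[OF delta_pos]
  proof eventually_elim
   case (elim n)
   have i: "(1::nat) \<in> {1..n}" using elim(3) by simp
   interpret F: prob_subalgebra M "sF n (1 - 1)" by (rule sF_prob_subalgebra) simp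
   define y where "y w = (weight n 1 w)^2" for w
   have iw: "integrable M y" unfolding y_def by (rule weight_power_integrable[OF i])
   have ss: "integrable M (\<lambda>w. (score n 1 w \<bullet> H.proj N v)^2)"
    by (rule H.integrable_square_coordinate[OF score_measurable[OF i] score_square_integrable[OF i elim(4)]])
   have "AE w in M. 0 \<le> real_cond_exp M (sF n (1 - 1)) (\<lambda>w. (score n 1 w \<bullet> H.proj N v)^2) w"
    by (rule F.real_cond_exp_pos) (use ss in auto)
   moreover have "AE w in M. \<bar>real_cond_exp M (sF n (1 - 1)) (\<lambda>w. (score n 1 w \<bullet> H.proj N v)^2) w
     - Wform N v x * real_cond_exp M (sF n (1 - 1)) y w\<bar> \<le> \<epsilon> * real_cond_exp M (sF n (1 - 1)) y w"
    using bspec[OF elim(1) i] unfolding y_def .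
   ultimately have "AE w in M. 0 \<le> (Wform N v x + \<epsilon>) * real_cond_exp M (sF n (1 - 1)) y w"
    by eventually_elim (simp add: distrib_right)
   then have "0 \<le> (LINT w|M. (Wform N v x + \<epsilon>) * real_cond_exp M (sF n (1 - 1)) y w)"
    by (rule integral_nonneg_AE)
   also have "\<dots> = (Wform N v x + \<epsilon>) * (LINT w|M. y w)"
    using F.real_cond_exp_int[OF iw] by simp
   also have "(LINT w|M. y w) = (LINT w|M. K (D 1 1 w / h n) ^ 2)"
    unfolding y_def by (rule weight_power_expectation[OF i])
   finally show ?case using elim(2) by (simp add: zero_le_mult_iff)
  qed
  then show ?thesis by simp
 qed
 then show ?thesis by (rule field_le_epsilon)
qed

lemma cdf_pos: "\<forall>\<^sub>F n in sequentially. 0 < cdf (h n)"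
 using order_tendstoD(1)[OF cdf_ratio_one f1_pos] phi_pos
 by eventually_elim (simp add: zero_less_divide_iff)

text \<open>The functions \<open>W j k\<close> are determined only almost surely. The window around \<open>x\<close> has positive
  probability, so symmetry holds at some of its points and, by continuity, at \<open>x\<close>.\<close>

lemma W_symmetric: "W (Suc j) (Suc k) x = W (Suc k) (Suc j) x"
proof -
 have "\<bar>W (Suc j) (Suc k) x - W (Suc k) (Suc j) x\<bar> \<le> 0 + \<epsilon>" if "0 < \<epsilon>" for \<epsilon>
 proof -
  have "0 < \<epsilon> / 2" using that by simp
  from W_continuity[OF this] have "\<forall>\<^sub>F n in sequentially. \<bar>W (Suc j) (Suc k) x - W (Suc k) (Suc j) x\<bar> \<le> 0 + \<epsilon>"
   using cdf_pos eventually_ge_at_top[of 1]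
  proof eventually_elim
   case (elim n)
   have i: "(1::nat) \<in> {1..n}" using elim(3) by simp
   have comm: "(\<lambda>w. ball n 1 w * ((resid n 1 w \<bullet> basis_vec k) * (resid n 1 w \<bullet> basis_vec j)))
    = (\<lambda>w. ball n 1 w * ((resid n 1 w \<bullet> basis_vec j) * (resid n 1 w \<bullet> basis_vec k)))"
    by (rule ext) simp
   have eq: "AE w in M. ball n 1 w * W (Suc j) (Suc k) (X n 1 w) = ball n 1 w * W (Suc k) (Suc j) (X n 1 w)"
    using resid_covariance[OF i, of j k] resid_covariance[OF i, of k j, unfolded comm]
    by eventually_elim (rule trans[OF sym])
   have close: "\<bar>W (Suc a) (Suc c) (X n 1 w) - W (Suc a) (Suc c) x\<bar> \<le> \<epsilon> / 2" if "D n 1 w \<le> h n" for a c w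
    using elim(1) that by blast
   show ?case
   proof (rule ccontr)
    assume far: "\<not> ?thesis"
    have "AE w in M. ball n 1 w = (0 :: real)"
     using eq
    proof eventually_elim
     case (elim w)
     show ?case
     proof (rule ccontr)
      assume b: "ball n 1 w \<noteq> (0 :: real)"
      then have "D n 1 w \<le> h n" by (auto simp: indicator_def split: if_splits)
      then have "\<bar>W (Suc j) (Suc k) (X n 1 w) - W (Suc j) (Suc k) x\<bar> \<le> \<epsilon> / 2"
       "\<bar>W (Suc k) (Suc j) (X n 1 w) - W (Suc k) (Suc j) x\<bar> \<le> \<epsilon> / 2" by (blast intro: close)+
      moreover have "W (Suc j) (Suc k) (X n 1 w) = W (Suc k) (Suc j) (X n 1 w)" using elim b by simp
      ultimately show False using far by argo
     qed
    qed
    then have "(LINT w|M. ball n 1 w) = (LINT w|M. (0 :: real))"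
     using integral_ball(2)[of 1 n "h n"] i by (intro integral_cong_AE) auto
    then show False using integral_ball(1)[of 1 n "h n"] i elim(2) by simp
   qed
  qed
  then show ?thesis by simp
 qed
 then have "\<bar>W (Suc j) (Suc k) x - W (Suc k) (Suc j) x\<bar> \<le> 0" by (rule field_le_epsilon)
 then show ?thesis by simp
qed

lemma W_cauchy_schwarz: "(W (Suc j) (Suc k) x)^2 \<le> W (Suc j) (Suc j) x * W (Suc k) (Suc k) x"
proof -
 define N where "N = Suc (max j k)"
 define B where "B v w = (\<Sum>j<N. \<Sum>k<N. (v \<bullet> basis_vec j) * (w \<bullet> basis_vec k) * W (Suc j) (Suc k) x)" for v w
 have B: "psd_form B"
  unfolding psd_form_def
 proof (intro conjI allI)
  show "linear (B v)" for v
   unfolding B_def by (intro linearI) (simp_all add: inner_add_left algebra_simps sum.distrib sum_distrib_left)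
  show "B v w = B w v" for v w
   unfolding B_def by (subst sum.swap) (simp add: W_symmetric mult_ac)
  show "0 \<le> B v v" for v using Wform_nonneg[of N v] by (simp add: B_def Wform_def)
 qed
 have "B (basis_vec a) (basis_vec b) = W (Suc a) (Suc b) x" if "a < N" "b < N" for a b
 proof -
  have "B (basis_vec a) (basis_vec b) = (\<Sum>j<N. \<Sum>k<N. if j = a then (if k = b then W (Suc a) (Suc b) x else 0) else 0)"
   unfolding B_def by (intro sum.cong refl) (auto simp: H.ortho)
  also have "\<dots> = (\<Sum>j<N. if j = a then (\<Sum>k<N. if k = b then W (Suc a) (Suc b) x else 0) else 0)"
   by (intro sum.cong refl) simp
  finally show ?thesis using that by simp
 qed
 then show ?thesis using psd_form_cauchy_schwarz[OF B, of "basis_vec j" "basis_vec k"] by (simp add: N_def)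
qed

text \<open>A point has distance 0 from itself, so the bound on the tail of the trace applies at \<open>x\<close>.\<close>

lemma W_trace: "summable (\<lambda>k. W (Suc k) (Suc k) x)"
proof -
 have d0: "0 \<le> W (Suc k) (Suc k) x" for k
 proof -
  have "Wform (Suc k) (basis_vec k) x = (\<Sum>j<Suc k. if j = k then W (Suc k) (Suc k) x else 0)"
   unfolding Wform_def by (intro sum.cong refl) (auto simp: H.ortho if_distrib[of "\<lambda>x. x * _"] cong: if_cong)
  then show ?thesis using Wform_nonneg[of "Suc k" "basis_vec k"] by simp
 qed
 have xb: "x \<in> pm_cball d x \<delta>" using delta_pos pm by (simp add: pm_cball_def pseudometric_def)
 have "\<forall>m\<ge>1. \<forall>y\<in>pm_cball d x \<delta>.
    (\<lambda>k. W k k y + (r y \<bullet> e k)^2) summable_on {m<..} \<and>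
    (\<Sum>\<^sub>\<infinity>k\<in>{m<..}. W k k y + (r y \<bullet> e k)^2) \<le> a0 * exp (- a1 * real m)"
  using A3 unfolding hyp_A3_def by (elim conjE)
 then have s: "(\<lambda>k. W k k x + (r x \<bullet> e k)^2) summable_on {1<..}" using xb by auto
 have nn: "0 \<le> W k k x + (r x \<bullet> e k)^2" if "k \<in> {1<..}" for k using d0[of "k - 1"] that by simp
 have "(\<Sum>k<m. W (Suc (Suc k)) (Suc (Suc k)) x) \<le> (\<Sum>\<^sub>\<infinity>k\<in>{1<..}. W k k x + (r x \<bullet> e k)^2)" for m
 proof -
  have "(\<Sum>k<m. W (Suc (Suc k)) (Suc (Suc k)) x) \<le> (\<Sum>k\<in>(\<lambda>k. Suc (Suc k)) ` {..<m}. W k k x + (r x \<bullet> e k)^2)"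
   by (subst sum.reindex) (auto simp: inj_on_def intro!: sum_mono)
  also have "\<dots> \<le> (\<Sum>\<^sub>\<infinity>k\<in>{1<..}. W k k x + (r x \<bullet> e k)^2)"
   by (intro finite_sum_le_infsum[OF s]) (use nn in auto)
  finally show ?thesis .
 qed
 then have "summable (\<lambda>k. W (Suc (Suc k)) (Suc (Suc k)) x)" by (intro summableI_nonneg_bounded) (auto intro: d0)
 then show ?thesis by (simp add: summable_Suc_iff[of "\<lambda>k. W (Suc k) (Suc k) x"])
qed

definition var_const :: real where
 "var_const = M_const K \<tau>0 2 / ((M_const K \<tau>0 1)^2 * f1 x)"

lemma var_const_pos: "0 < var_const"
 unfolding var_const_def using M_const_pos[of 1] M_const_pos[of 2] f1_pos by simp

text \<open>The double series converges absolutely by the Cauchy--Schwarz inequality for the entries, so it may be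
  summed over squares of growing size, where it is the form of a projection.\<close>

lemma double_sum_limit:
 assumes C: "bounded_linear C" and fin: "\<And>N. C (H.proj N v) \<bullet> H.proj N v = Wform N v x"
  and \<gamma>: "((\<lambda>k. \<gamma> k *\<^sub>R e k) has_sum v) {1..}"
 shows "(\<lambda>(j, k). \<gamma> j * \<gamma> k * W j k x) summable_on {1..} \<times> {1..}"
  and "(\<Sum>\<^sub>\<infinity>(j, k)\<in>{1..} \<times> {1..}. \<gamma> j * \<gamma> k * W j k x) = C v \<bullet> v"
proof -
 interpret C: bounded_linear C by (rule C)
 have \<gamma>k: "\<gamma> (Suc k) = v \<bullet> basis_vec k" for k
 proof -
  have "((\<lambda>j. (\<gamma> j *\<^sub>R e j) \<bullet> basis_vec k) has_sum (v \<bullet> basis_vec k)) {1..}"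
   by (rule has_sum_bounded_linear[OF bounded_linear_inner_left \<gamma>])
  moreover have "((\<lambda>j. (\<gamma> j *\<^sub>R e j) \<bullet> basis_vec k) has_sum (\<gamma> (Suc k))) {1..}"
  proof (rule has_sum_finite_neutralI[of "{Suc k}"])
   show "(\<gamma> j *\<^sub>R e j) \<bullet> basis_vec k = 0" if "j \<in> {1..} - {Suc k}" for j
    using that H.ortho[of "j - 1" k] by auto
   show "\<gamma> (Suc k) = (\<Sum>j\<in>{Suc k}. (\<gamma> j *\<^sub>R e j) \<bullet> basis_vec k)" using H.ortho[of k k] by simp
  qed auto
  ultimately show ?thesis by (rule has_sum_unique[symmetric])
 qed
 define p where "p k = \<bar>\<gamma> (Suc k)\<bar> * sqrt (W (Suc k) (Suc k) x)" for k
 have d0: "0 \<le> W (Suc k) (Suc k) x" for k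
  using W_cauchy_schwarz[of k k] Wform_nonneg[of "Suc k" "basis_vec k"]
  by (simp add: Wform_def H.ortho if_distrib[of "\<lambda>x. x * _"] if_distrib[of "\<lambda>x. _ * x"] cong: if_cong)
 have p0: "0 \<le> p k" for k by (simp add: p_def d0)
 have ps: "summable p"
 proof (rule summable_comparison_test'[of "\<lambda>k. (v \<bullet> basis_vec k)^2 + W (Suc k) (Suc k) x" 0])
  show "summable (\<lambda>k. (v \<bullet> basis_vec k)^2 + W (Suc k) (Suc k) x)"
   using H.parseval[of v] W_trace by (intro summable_add) (auto simp: sums_iff)
  have "\<bar>a\<bar> * sqrt b \<le> a\<^sup>2 + b" if "0 \<le> b" for a b :: real
  proof -
   have "0 \<le> (\<bar>a\<bar> - sqrt b)^2" "0 \<le> \<bar>a\<bar> * sqrt b" using that by auto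
   moreover have "(\<bar>a\<bar> - sqrt b)^2 = a\<^sup>2 - 2 * (\<bar>a\<bar> * sqrt b) + b" using that by (simp add: power2_diff)
   ultimately show ?thesis by linarith
  qed
  then show "norm (p k) \<le> (v \<bullet> basis_vec k)^2 + W (Suc k) (Suc k) x" for k
   using p0[of k] d0[of k] by (simp add: p_def \<gamma>k)
 qed
 define g where "g = (\<lambda>(j, k). \<gamma> j * \<gamma> k * W j k x)"
 have gle: "\<bar>g (Suc j, Suc k)\<bar> \<le> p j * p k" for j k
 proof -
  have "\<bar>W (Suc j) (Suc k) x\<bar> \<le> sqrt (W (Suc j) (Suc j) x) * sqrt (W (Suc k) (Suc k) x)"
   unfolding real_sqrt_mult[symmetric] using W_cauchy_schwarz[of j k] by (intro real_le_rsqrt) simp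
  then have "\<bar>\<gamma> (Suc j)\<bar> * \<bar>\<gamma> (Suc k)\<bar> * \<bar>W (Suc j) (Suc k) x\<bar> \<le> \<bar>\<gamma> (Suc j)\<bar> * \<bar>\<gamma> (Suc k)\<bar> * (sqrt (W (Suc j) (Suc j) x) * sqrt (W (Suc k) (Suc k) x))"
   by (intro mult_left_mono) auto
  then show ?thesis by (simp add: g_def p_def abs_mult mult_ac)
 qed
 have "(\<lambda>z. \<bar>g z\<bar>) summable_on {1..} \<times> {1..}"
 proof (rule nonneg_bdd_above_summable_on)
  show "bdd_above (sum (\<lambda>z. \<bar>g z\<bar>) ` {F. F \<subseteq> {1..} \<times> {1..} \<and> finite F})"
  proof (rule bdd_aboveI2)
   fix F :: "(nat \<times> nat) set" assume "F \<in> {F. F \<subseteq> {1..} \<times> {1..} \<and> finite F}"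
   then have F: "F \<subseteq> {1..} \<times> {1..}" "finite F" by auto
   define m where "m = (\<Sum>z\<in>F. fst z + snd z)"
   have m: "fst z \<le> m \<and> snd z \<le> m" if "z \<in> F" for z
    using member_le_sum[of z F "\<lambda>z. fst z + snd z"] F that by (auto simp: m_def)
   have "F \<subseteq> (\<lambda>(j, k). (Suc j, Suc k)) ` ({..<m} \<times> {..<m})"
   proof
    fix z assume z: "z \<in> F"
    then have "1 \<le> fst z" "1 \<le> snd z" "fst z \<le> m" "snd z \<le> m" using F(1) m by auto
    then show "z \<in> (\<lambda>(j, k). (Suc j, Suc k)) ` ({..<m} \<times> {..<m})"
     by (intro image_eqI[of _ _ "(fst z - 1, snd z - 1)"]) auto
   qed
   then have "(\<Sum>z\<in>F. \<bar>g z\<bar>) \<le> (\<Sum>z\<in>(\<lambda>(j, k). (Suc j, Suc k)) ` ({..<m} \<times> {..<m}). \<bar>g z\<bar>)"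
    by (intro sum_mono2) auto
   also have "\<dots> = (\<Sum>z\<in>{..<m} \<times> {..<m}. \<bar>g (Suc (fst z), Suc (snd z))\<bar>)"
    by (subst sum.reindex) (auto simp: inj_on_def case_prod_beta)
   also have "\<dots> \<le> (\<Sum>z\<in>{..<m} \<times> {..<m}. p (fst z) * p (snd z))" by (intro sum_mono gle)
   also have "\<dots> = (\<Sum>j<m. p j) * (\<Sum>k<m. p k)" by (simp add: sum_product sum.cartesian_product case_prod_beta)
   also have "\<dots> \<le> suminf p * suminf p"
    by (intro mult_mono sum_le_suminf[OF ps] suminf_nonneg[OF ps] sum_nonneg p0) auto
   finally show "sum (\<lambda>z. \<bar>g z\<bar>) F \<le> suminf p * suminf p" .
  qed
 qed auto
 then have gs: "g summable_on {1..} \<times> {1..}"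
  using abs_summable_summable[of g] by simp
 then show "(\<lambda>(j, k). \<gamma> j * \<gamma> k * W j k x) summable_on {1..} \<times> {1..}" by (simp add: g_def)
 have "(sum g \<longlongrightarrow> infsum g ({1..} \<times> {1..})) (finite_subsets_at_top ({1..} \<times> {1..}))"
  using has_sum_infsum[OF gs] by (simp add: has_sum_def)
 moreover have "filterlim (\<lambda>N. {1..N} \<times> {1..N}) (finite_subsets_at_top ({1..} \<times> {1..})) sequentially"
  unfolding filterlim_finite_subsets_at_top
 proof (intro allI impI)
  fix F :: "(nat \<times> nat) set" assume F: "finite F \<and> F \<subseteq> {1..} \<times> {1..}"
  define m where "m = (\<Sum>z\<in>F. fst z + snd z)"
  have m: "fst z \<le> m \<and> snd z \<le> m" if "z \<in> F" for z
   using member_le_sum[of z F "\<lambda>z. fst z + snd z"] F that by (auto simp: m_def)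
  show "\<forall>\<^sub>F N in sequentially. finite ({1..N} \<times> {1..N}) \<and> F \<subseteq> {1..N} \<times> {1..N} \<and> {1..N} \<times> {1..N} \<subseteq> {1..} \<times> {1..}"
   using eventually_ge_at_top[of m]
  proof eventually_elim
   case (elim N)
   have "z \<in> {1..N} \<times> {1..N}" if "z \<in> F" for z
    using m[OF that] F that elim by (cases z) force
   then show ?case by auto
  qed
 qed
 ultimately have "(\<lambda>N. sum g ({1..N} \<times> {1..N})) \<longlonglongrightarrow> infsum g ({1..} \<times> {1..})" by (rule filterlim_compose)
 moreover have "sum g ({1..N} \<times> {1..N}) = C (H.proj N v) \<bullet> H.proj N v" for N
 proof -
  have "sum g ({1..N} \<times> {1..N}) = (\<Sum>j=1..N. \<Sum>k=1..N. g (j, k))" by (simp add: sum.cartesian_product)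
  also have "\<dots> = (\<Sum>j<N. \<Sum>k<N. g (Suc j, Suc k))"
   by (simp add: sum.atLeast1_atMost_eq)
  also have "\<dots> = Wform N v x" by (simp add: Wform_def g_def \<gamma>k)
  finally show ?thesis by (simp add: fin)
 qed
 moreover have "(\<lambda>N. C (H.proj N v) \<bullet> H.proj N v) \<longlonglongrightarrow> C v \<bullet> v"
  by (intro tendsto_intros C.tendsto H.proj_tendsto)
 ultimately have "infsum g ({1..} \<times> {1..}) = C v \<bullet> v" using LIMSEQ_unique by auto
 then show "(\<Sum>\<^sub>\<infinity>(j, k)\<in>{1..} \<times> {1..}. \<gamma> j * \<gamma> k * W j k x) = C v \<bullet> v" by (simp add: g_def)
qed

lemma asymptotic_covariance_exists:
 obtains C where "asymptotic_covariance e K \<tau>0 f1 W x C"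
  "\<And>N v. C (H.proj N v) \<bullet> H.proj N v = var_const * Wform N v x"
  "bounded_linear C" "\<And>v w. C v \<bullet> w = v \<bullet> C w" "\<And>v. 0 \<le> C v \<bullet> v" "summable (\<lambda>k. C (basis_vec k) \<bullet> basis_vec k)"
proof -
 obtain C0 where C0: "bounded_linear C0" "\<And>v w. C0 v \<bullet> w = v \<bullet> C0 w" "\<And>v. 0 \<le> C0 v \<bullet> v"
  "\<And>j k. C0 (basis_vec k) \<bullet> basis_vec j = W (Suc j) (Suc k) x"
  "\<And>v N. C0 (H.proj N v) \<bullet> H.proj N v = (\<Sum>j<N. \<Sum>k<N. (v \<bullet> basis_vec j) * (v \<bullet> basis_vec k) * W (Suc j) (Suc k) x)"
 proof (rule H.psd_matrix_operator[of "\<lambda>j k. W (Suc j) (Suc k) x"])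
  show "0 \<le> (\<Sum>j<N. \<Sum>k<N. (v \<bullet> basis_vec j) * (v \<bullet> basis_vec k) * W (Suc j) (Suc k) x)" for v N
   using Wform_nonneg[of N v] by (simp add: Wform_def)
 qed (use W_symmetric W_cauchy_schwarz W_trace in auto)
 have fin: "C0 (H.proj N v) \<bullet> H.proj N v = Wform N v x" for N v by (simp add: C0(5) Wform_def)
 define C where "C v = var_const *\<^sub>R C0 v" for v
 have bl: "bounded_linear C" unfolding C_def by (rule bounded_linear_compose[OF bounded_linear_scaleR_right C0(1)])
 have tr: "summable (\<lambda>k. C (basis_vec k) \<bullet> basis_vec k)"
  using W_trace by (simp add: C_def C0(4) summable_mult)
 show thesis
 proof (rule that[OF _ _ bl _ _ tr])
  show sym: "C v \<bullet> w = v \<bullet> C w" for v w by (simp add: C_def C0(2))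
  show nn: "0 \<le> C v \<bullet> v" for v using C0(3)[of v] var_const_pos by (simp add: C_def)
  show "C (H.proj N v) \<bullet> H.proj N v = var_const * Wform N v x" for N v by (simp add: C_def fin)
  have "(\<lambda>k. C (e k) \<bullet> e k) summable_on {1..}"
  proof -
   have "(\<lambda>k. C (basis_vec k) \<bullet> basis_vec k) summable_on UNIV"
    using tr nn by (simp add: summable_on_UNIV_nonneg_real_iff)
   then have "(\<lambda>k. C (e k) \<bullet> e k) summable_on range Suc"
    by (subst summable_on_reindex) (auto simp: comp_def)
   moreover have "range Suc = {1..}" by (auto simp: image_iff) (metis Suc_le_D)
   ultimately show ?thesis by simp
  qed
  then show "asymptotic_covariance e K \<tau>0 f1 W x C"
   unfolding asymptotic_covariance_def pos_trace_class_def
   using bl sym nn double_sum_limit[OF C0(1) fin]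
   by (auto simp: C_def[of "_"] var_const_def)
 qed
qed

text \<open>Finite linear combinations of the basis have finite double sums, so the condition determines the quadratic
  form on them; by polarisation and continuity it determines the operator.\<close>

lemma asymptotic_covariance_unique:
 assumes C: "asymptotic_covariance e K \<tau>0 f1 W x C" and C': "asymptotic_covariance e K \<tau>0 f1 W x C'"
 shows "C = C'"
proof -
 have q: "C v \<bullet> v = C' v \<bullet> v" if v: "v = H.proj N v" for v N
 proof -
  define \<gamma> where "\<gamma> k = (if k \<in> {1..N} then v \<bullet> e k else 0)" for k
  have "((\<lambda>k. \<gamma> k *\<^sub>R e k) has_sum v) {1..}"
  proof (rule has_sum_finite_neutralI[of "{1..N}"])
   have "(\<Sum>k\<in>{1..N}. \<gamma> k *\<^sub>R e k) = (\<Sum>k<N. (v \<bullet> basis_vec k) *\<^sub>R basis_vec k)"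
    by (simp add: \<gamma>_def sum.atLeast1_atMost_eq)
   then show "v = (\<Sum>k\<in>{1..N}. \<gamma> k *\<^sub>R e k)" using v by (simp add: H.proj_def)
  qed (auto simp: \<gamma>_def)
  note s = this
  have "C v \<bullet> v = M_const K \<tau>0 2 / ((M_const K \<tau>0 1)^2 * f1 x) * (\<Sum>\<^sub>\<infinity>(j, k)\<in>{1..} \<times> {1..}. \<gamma> j * \<gamma> k * W j k x)"
   using C s unfolding asymptotic_covariance_def by blast
  moreover have "C' v \<bullet> v = M_const K \<tau>0 2 / ((M_const K \<tau>0 1)^2 * f1 x) * (\<Sum>\<^sub>\<infinity>(j, k)\<in>{1..} \<times> {1..}. \<gamma> j * \<gamma> k * W j k x)"
   using C' s unfolding asymptotic_covariance_def by blast
  ultimately show ?thesis by simp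
 qed
 have bl: "bounded_linear C" "bounded_linear C'" and sym: "C v \<bullet> w = v \<bullet> C w" "C' v \<bullet> w = v \<bullet> C' w" for v w
  using C C' unfolding asymptotic_covariance_def pos_trace_class_def by auto
 interpret C: bounded_linear C by (rule bl)
 interpret C': bounded_linear C' by (rule bl)
 have pu: "basis_vec j = H.proj N (basis_vec j)" if "j < N" for j N
  using that by (simp add: H.proj_def H.ortho if_distrib[of "\<lambda>x. x *\<^sub>R _"] cong: if_cong)
 have ent: "C (basis_vec j) \<bullet> basis_vec k = C' (basis_vec j) \<bullet> basis_vec k" for j k
 proof -
  define N where "N = Suc (max j k)"
  have jk: "basis_vec j = H.proj N (basis_vec j)" "basis_vec k = H.proj N (basis_vec k)" by (rule pu; simp add: N_def)+
  then have "basis_vec j + basis_vec k = H.proj N (basis_vec j + basis_vec k)" by (metis H.proj_add)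
  from q[OF this] q[OF jk(1)] q[OF jk(2)] show ?thesis
   using sym(1)[of "basis_vec k" "basis_vec j"] sym(2)[of "basis_vec k" "basis_vec j"]
   by (simp add: C.add C'.add inner_add_left inner_add_right inner_commute)
 qed
 have eq: "C (basis_vec j) = C' (basis_vec j)" for j by (rule H.eq_if_coordinates_eq) (rule ent)
 show ?thesis
 proof
  fix v
  have "C (H.proj N v) = C' (H.proj N v)" for N
   by (simp add: H.proj_def C.sum C'.sum C.scaleR C'.scaleR eq)
  moreover have "(\<lambda>N. C (H.proj N v)) \<longlonglongrightarrow> C v" "(\<lambda>N. C' (H.proj N v)) \<longlonglongrightarrow> C' v"
   by (intro C.tendsto C'.tendsto H.proj_tendsto)+
  ultimately show "C v = C' v" using LIMSEQ_unique by auto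
 qed
qed

end

section \<open>Second moments of centred sums in Hilbert space\<close>

lemma (in hilbert_basis) norm_minus_proj_suminf:
 "ennreal ((norm (z - proj N z))^2) = (\<Sum>k. ennreal ((z \<bullet> u (k + N))^2))"
proof -
 have 1: "(z - proj N z) \<bullet> u k = (if k < N then 0 else z \<bullet> u k)" for k
  by (simp add: inner_diff_left inner_proj)
 have "(\<lambda>k. if k < N then 0 else (z \<bullet> u k)\<^sup>2) sums (norm (z - proj N z))\<^sup>2"
  using parseval[of "z - proj N z"] by (simp add: 1 if_distrib[of "\<lambda>x. x\<^sup>2"] cong: if_cong)
 then have "(\<lambda>k. (z \<bullet> u (k + N))^2) sums (norm (z - proj N z))\<^sup>2"
  by (subst (asm) sums_iff_shift'[of _ N, symmetric]) simp
 then show ?thesis by (intro suminf_ennreal_eq[symmetric]) auto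
qed

text \<open>Orthogonality of martingale differences, coordinate by coordinate. The functions \<open>G i\<close> are versions of
  the conditional expectations; the case \<open>N = 0\<close> concerns the whole norm.\<close>

lemma (in separable_hilbert_basis) centred_sum_norm_second_moment:
 fixes Z G :: "nat \<Rightarrow> 'w \<Rightarrow> 'h"
 assumes filt: "filtered_prob M F"
  and Z: "\<And>i. i \<in> {1..n} \<Longrightarrow> Z i \<in> borel_measurable (F i)"
  and G: "\<And>i. i \<in> {1..n} \<Longrightarrow> G i \<in> borel_measurable M"
  and Z2: "\<And>i. i \<in> {1..n} \<Longrightarrow> integrable M (\<lambda>w. (norm (Z i w))^2)"
  and ce: "\<And>i k. i \<in> {1..n} \<Longrightarrow> AE w in M. real_cond_exp M (F (i - 1)) (\<lambda>w. Z i w \<bullet> u k) w = G i w \<bullet> u k"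
  and b: "\<And>i. i \<in> {1..n} \<Longrightarrow> (\<integral>\<^sup>+w. ennreal ((norm (Z i w - proj N (Z i w)))^2) \<partial>M) \<le> ennreal b" and b0: "0 \<le> b"
 defines "S \<equiv> \<lambda>w. \<Sum>i=1..n. Z i w - G i w"
 shows "(\<integral>\<^sup>+w. ennreal ((norm (S w - proj N (S w)))^2) \<partial>M) \<le> ennreal (n * b)"
proof -
 interpret filtered_prob M F by (rule filt)
 have ZM: "Z i \<in> borel_measurable M" if "i \<in> {1..n}" for i by (rule measurable_M[OF Z[OF that]])
 have SM [measurable]: "S \<in> borel_measurable M" unfolding S_def using ZM G by (intro borel_measurable_sum borel_measurable_diff) auto
 have coord: "(\<integral>\<^sup>+w. ennreal ((S w \<bullet> u k)^2) \<partial>M) \<le> (\<Sum>i=1..n. \<integral>\<^sup>+w. ennreal ((Z i w \<bullet> u k)^2) \<partial>M)" for k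
 proof -
  define z where "z i w = Z i w \<bullet> u k" for i w
  define s where "s w = (\<Sum>i=1..n. z i w - real_cond_exp M (F (i - 1)) (z i) w)" for w
  have z2: "integrable M (\<lambda>w. (z i w)^2)" if "i \<in> {1..n}" for i
   unfolding z_def by (rule integrable_square_coordinate[OF ZM[OF that] Z2[OF that]])
  have zF: "z i \<in> borel_measurable (F i)" if "i \<in> {1..n}" for i
   unfolding z_def using Z[OF that] by measurable
  note m = centred_sum_second_moment[OF zF z2, of n, folded s_def]
  have "AE w in M. \<forall>i\<in>{1..n}. real_cond_exp M (F (i - 1)) (z i) w = G i w \<bullet> u k"
   unfolding z_def by (rule AE_finite_allI[OF finite_atLeastAtMost ce])
  then have "AE w in M. S w \<bullet> u k = s w"
   by eventually_elim (simp add: S_def s_def z_def inner_sum_left inner_diff_left)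
  then have "(\<integral>\<^sup>+w. ennreal ((S w \<bullet> u k)^2) \<partial>M) = (\<integral>\<^sup>+w. ennreal ((s w)^2) \<partial>M)"
   by (rule nn_integral_cong_AE[OF eventually_mono]) simp
  also have "\<dots> = ennreal (LINT w|M. (s w)^2)" by (rule nn_integral_eq_integral) (use m(1) in auto)
  also have "\<dots> \<le> ennreal (\<Sum>i=1..n. (LINT w|M. (z i w)^2))" by (rule ennreal_leI[OF m(2)])
  also have "\<dots> = (\<Sum>i=1..n. ennreal (LINT w|M. (z i w)^2))" by (rule sum_ennreal[symmetric]) simp
  also have "\<dots> = (\<Sum>i=1..n. \<integral>\<^sup>+w. ennreal ((z i w)^2) \<partial>M)"
   by (intro sum.cong refl nn_integral_eq_integral[symmetric] z2) auto
  finally show ?thesis by (simp add: z_def)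
 qed
 have "(\<integral>\<^sup>+w. ennreal ((norm (S w - proj N (S w)))^2) \<partial>M) = (\<Sum>k. \<integral>\<^sup>+w. ennreal ((S w \<bullet> u (k + N))^2) \<partial>M)"
  unfolding norm_minus_proj_suminf by (rule nn_integral_suminf) measurable
 also have "\<dots> \<le> (\<Sum>k. \<Sum>i=1..n. \<integral>\<^sup>+w. ennreal ((Z i w \<bullet> u (k + N))^2) \<partial>M)" by (intro suminf_le coord) auto
 also have "\<dots> = (\<Sum>i=1..n. \<Sum>k. \<integral>\<^sup>+w. ennreal ((Z i w \<bullet> u (k + N))^2) \<partial>M)" by (rule suminf_sum) auto
 also have "\<dots> = (\<Sum>i=1..n. \<integral>\<^sup>+w. ennreal ((norm (Z i w - proj N (Z i w)))^2) \<partial>M)"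
 proof (intro sum.cong refl)
  fix i assume "i \<in> {1..n}"
  then have [measurable]: "Z i \<in> borel_measurable M" by (rule ZM)
  show "(\<Sum>k. \<integral>\<^sup>+w. ennreal ((Z i w \<bullet> u (k + N))^2) \<partial>M) = (\<integral>\<^sup>+w. ennreal ((norm (Z i w - proj N (Z i w)))^2) \<partial>M)"
   unfolding norm_minus_proj_suminf by (rule nn_integral_suminf[symmetric]) measurable
 qed
 also have "\<dots> \<le> (\<Sum>i=1..n. ennreal b)" by (intro sum_mono b)
 also have "\<dots> = ennreal (n * b)" using b0 by (simp add: ennreal_mult ennreal_of_nat_eq_real_of_nat)
 finally show ?thesis .
qed

lemma (in prob_space) first_moment_le:
 fixes f :: "'a \<Rightarrow> real"
 assumes [measurable]: "f \<in> borel_measurable M" and b: "(\<integral>\<^sup>+w. ennreal ((f w)^2) \<partial>M) \<le> ennreal b" "0 \<le> b"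
 shows "integrable M f" "integrable M (\<lambda>w. (f w)^2)" "(LINT w|M. (f w)^2) \<le> b" "(LINT w|M. \<bar>f w\<bar>) \<le> sqrt b"
proof -
 have lt: "(\<integral>\<^sup>+w. ennreal ((f w)^2) \<partial>M) < \<infinity>" using b(1) by (rule le_less_trans) simp
 show i2: "integrable M (\<lambda>w. (f w)^2)" by (rule integrableI_bounded) (use lt in auto)
 show i1: "integrable M f" by (rule integrable_if_square_integrable[OF _ i2]) measurable
 have "ennreal (LINT w|M. (f w)^2) \<le> ennreal b"
  using b(1) by (subst nn_integral_eq_integral[symmetric]) (auto intro: i2)
 then show le: "(LINT w|M. (f w)^2) \<le> b" using b(2) by (simp add: ennreal_le_iff)
 have "(LINT w|M. \<bar>f w\<bar>)^2 \<le> (LINT w|M. \<bar>f w\<bar>\<^sup>2)"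
  using variance_positive[of "\<lambda>w. \<bar>f w\<bar>"] variance_eq[of "\<lambda>w. \<bar>f w\<bar>"] i1 i2 by simp
 then show "(LINT w|M. \<bar>f w\<bar>) \<le> sqrt b" using le by (intro real_le_rsqrt) simp
qed

section \<open>The standardised sum of the scores\<close>

context functional_regression
begin

definition rate :: "nat \<Rightarrow> real" where "rate n = sqrt (real n * \<phi> (h n))"

text \<open>The ratio between the two natural normalisations, by \<^term>\<open>\<phi> (h n)\<close> and by the mean of the weights.\<close>

definition rho :: "nat \<Rightarrow> real" where "rho n = \<phi> (h n) / (LINT w|M. K (D 1 1 w / h n))"

definition scaled_score :: "nat \<Rightarrow> nat \<Rightarrow> 'w \<Rightarrow> 'h" where
 "scaled_score n i w = (rho n / rate n) *\<^sub>R score n i w"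

definition score_sum :: "nat \<Rightarrow> 'w \<Rightarrow> 'h" where
 "score_sum n w = (\<Sum>i=1..n. scaled_score n i w)"

abbreviation score_tail_norm :: "nat \<Rightarrow> nat \<Rightarrow> 'w \<Rightarrow> real" where
 "score_tail_norm n N w \<equiv> norm (score_sum n w - H.proj N (score_sum n w))"

lemma rho_tendsto: "rho \<longlonglongrightarrow> 1 / (f1 x * M_const K \<tau>0 1)"
proof -
 have "(\<lambda>n. 1 / ((LINT w|M. K (D 1 1 w / h n) ^ 1) / \<phi> (h n))) \<longlonglongrightarrow> 1 / (f1 x * M_const K \<tau>0 1)"
  by (intro tendsto_intros kernel_moment_tendsto) (use f1_pos M_const_pos[of 1] in auto)
 then show ?thesis by (simp add: rho_def[abs_def])
qed

lemma rate_square: "(rate n)^2 = real n * \<phi> (h n)" if "1 \<le> n"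
proof -
 have "\<forall>u\<ge>0. 0 \<le> \<phi> u" using A2 unfolding hyp_A2_def by (elim conjE)
 then show ?thesis using h_pos[OF that] by (simp add: rate_def)
qed

lemma a0_a1_pos: "0 < a0" "0 < a1"
proof -
 show "0 < a0" using A3 unfolding hyp_A3_def by (elim conjE)
 show "0 < a1" using A3 unfolding hyp_A3_def by (elim conjE)
qed

lemma rate_at_top: "filterlim rate at_top sequentially"
 unfolding rate_def[abs_def] by (rule filterlim_compose[OF sqrt_at_top nphi_at_top])

lemma rate_pos: "\<forall>\<^sub>F n in sequentially. 0 < rate n"
 using rate_at_top by (simp add: filterlim_at_top_dense)

lemma scaled_score_measurable: "i \<in> {1..n} \<Longrightarrow> scaled_score n i \<in> borel_measurable M"
 unfolding scaled_score_def[abs_def] using score_measurable[of i n] by measurable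

lemma norm_scaled_score: "norm (scaled_score n i w) = \<bar>rho n / rate n\<bar> * norm (score n i w)"
 by (simp only: scaled_score_def norm_scaleR)

lemma scaled_score_square_integrable:
 assumes "i \<in> {1..n}" "h n \<le> \<delta>"
 shows "integrable M (\<lambda>w. (norm (scaled_score n i w))^2)"
proof -
 have "(\<lambda>w. (norm (scaled_score n i w))^2) = (\<lambda>w. (rho n / rate n)^2 * (norm (score n i w))^2)"
  by (rule ext) (simp only: norm_scaled_score power_mult_distrib power2_abs)
 then show ?thesis using score_square_integrable[OF assms] by simp
qed

lemma score_sum_measurable [measurable]: "score_sum n \<in> borel_measurable M"
 unfolding score_sum_def[abs_def] by (intro borel_measurable_sum scaled_score_measurable)

text \<open>The factor that turns sums over a row into averages over the \<^term>\<open>real n * \<phi> (h n)\<close>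
 expected observations in the window.\<close>

lemma scale_square: "1 \<le> n \<Longrightarrow> (rho n / rate n)\<^sup>2 = (rho n)^2 / (real n * \<phi> (h n))"
 by (simp add: power_divide rate_square)

lemma score_second_moment:
 assumes i: "i \<in> {1..n}" and hn: "h n \<le> \<delta>"
 shows "(\<integral>\<^sup>+w. ennreal ((norm (score n i w))^2) \<partial>M) \<le> ennreal (Kmax\<^sup>2 * 73 * cdf (h n))"
proof -
 obtain p where p: "2 < p" "p \<le> 3" "\<And>n i. i \<in> {1..n} \<Longrightarrow> h n \<le> \<delta> \<Longrightarrow> integrable M (\<lambda>w. ball n i w * norm (resid n i w) powr p)"
  "\<And>n i. i \<in> {1..n} \<Longrightarrow> h n \<le> \<delta> \<Longrightarrow> (LINT w|M. ball n i w * norm (resid n i w) powr p) \<le> 72 * cdf (h n)"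
  using resid_moment by blast
 have n: "1 \<le> n" "1 \<le> i" "i \<le> n" using i by auto
 have "(\<integral>\<^sup>+w. ennreal ((norm (score n i w))^2) \<partial>M) \<le> (\<integral>\<^sup>+w. ennreal (Kmax\<^sup>2 * (ball n i w + ball n i w * norm (resid n i w) powr p)) \<partial>M)"
 proof (intro nn_integral_mono ennreal_leI)
  fix w
  have t: "t\<^sup>2 \<le> 1 + t powr p" if "0 \<le> t" for t :: real
  proof (cases "t \<le> 1")
   case True
   then have "t\<^sup>2 \<le> 1" using that by (simp add: power_le_one)
   then show ?thesis using powr_ge_zero[of t p] by linarith
  next
   case False
   then have "t powr 2 \<le> t powr p" using p(1) by (intro powr_mono) auto
   then show ?thesis using False by simp
  qed
  have "(norm (score n i w))^2 = (weight n i w)^2 * (norm (resid n i w))^2" by (simp add: score_def power_mult_distrib)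
  also have "\<dots> \<le> (Kmax\<^sup>2 * ball n i w) * (1 + norm (resid n i w) powr p)"
   by (intro mult_mono weight_square_le n t) auto
  finally show "(norm (score n i w))^2 \<le> Kmax\<^sup>2 * (ball n i w + ball n i w * norm (resid n i w) powr p)"
   by (simp add: distrib_left mult.assoc)
 qed
 also have "\<dots> = ennreal (LINT w|M. Kmax\<^sup>2 * (ball n i w + ball n i w * norm (resid n i w) powr p))"
  using p(3)[OF i hn] integral_ball(2)[OF n(2,3)] by (intro nn_integral_eq_integral) auto
 also have "(LINT w|M. Kmax\<^sup>2 * (ball n i w + ball n i w * norm (resid n i w) powr p))
   = Kmax\<^sup>2 * (cdf (h n) + (LINT w|M. ball n i w * norm (resid n i w) powr p))"
  using p(3)[OF i hn] integral_ball(1,2)[OF n(2,3)] by simp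
 also have "ennreal \<dots> \<le> ennreal (Kmax\<^sup>2 * 73 * cdf (h n))"
 proof (rule ennreal_leI)
  have "cdf (h n) + (LINT w|M. ball n i w * norm (resid n i w) powr p) \<le> 73 * cdf (h n)" using p(4)[OF i hn] by simp
  then show "Kmax\<^sup>2 * (cdf (h n) + (LINT w|M. ball n i w * norm (resid n i w) powr p)) \<le> Kmax\<^sup>2 * 73 * cdf (h n)"
   unfolding mult.assoc by (rule mult_left_mono) simp
 qed
 finally show ?thesis .
qed

text \<open>For \<open>N = 0\<close> the bound is on the whole second moment; 73 is 1 plus the constant 72 of
  \<open>resid_moment\<close>, since \<open>t\<^sup>2 \<le> 1 + t powr p\<close>.\<close>

definition tail_bound :: "nat \<Rightarrow> real" where
 "tail_bound N = Kmax\<^sup>2 * (if N = 0 then 73 else a0 * exp (- a1 * real N))"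

lemma tail_bound_nonneg: "0 \<le> tail_bound N"
 using a0_a1_pos by (simp add: tail_bound_def)

lemma tail_bound_tendsto: "tail_bound \<longlonglongrightarrow> 0"
proof -
 have "0 < a1" by (rule a0_a1_pos)
 then have "(\<lambda>N. Kmax\<^sup>2 * (a0 * exp (- a1 * real N))) \<longlonglongrightarrow> Kmax\<^sup>2 * (a0 * 0)"
  by (intro tendsto_mult tendsto_const filterlim_compose[OF exp_at_bot])
   (simp add: filterlim_tendsto_pos_mult_at_top[OF tendsto_const] filterlim_uminus_at_bot filterlim_real_sequentially)
 then have "(\<lambda>N. Kmax\<^sup>2 * (a0 * exp (- a1 * real N))) \<longlonglongrightarrow> 0" by simp
 moreover have "\<forall>\<^sub>F N in sequentially. Kmax\<^sup>2 * (a0 * exp (- a1 * real N)) = tail_bound N"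
  using eventually_gt_at_top[of 0] by eventually_elim (simp add: tail_bound_def)
 ultimately show ?thesis by (rule Lim_transform_eventually)
qed

lemma score_sum_tail_bound:
 "\<forall>\<^sub>F n in sequentially. \<forall>N. (\<integral>\<^sup>+w. ennreal ((score_tail_norm n N w)^2) \<partial>M)
   \<le> ennreal ((rho n)^2 * (cdf (h n) / \<phi> (h n)) * tail_bound N)"
 using h_le_eventually[OF delta_pos] eventually_ge_at_top[of 1] phi_pos
proof eventually_elim
 case (elim n)
 show ?case
 proof
  fix N
  define c where "c = (rho n / rate n)^2"
  have st: "(\<integral>\<^sup>+w. ennreal ((norm (score n i w - H.proj N (score n i w)))^2) \<partial>M) \<le> ennreal (tail_bound N * cdf (h n))"
   if i: "i \<in> {1..n}" for i
  proof (cases "N = 0")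
   case True
   then show ?thesis using score_second_moment[OF i elim(1)] by (simp add: tail_bound_def H.proj_def)
  next
   case False
   then have "1 \<le> N" by simp
   moreover have "tail_bound N = Kmax\<^sup>2 * (a0 * exp (- a1 * real N))" using False by (simp add: tail_bound_def)
   ultimately show ?thesis unfolding H.norm_minus_proj_suminf using score_tail[OF i elim(1), of N] by (simp only:)
  qed
  have 1: "(\<integral>\<^sup>+w. ennreal ((norm (scaled_score n i w - H.proj N (scaled_score n i w)))^2) \<partial>M) \<le> ennreal (c * (tail_bound N * cdf (h n)))"
   if i: "i \<in> {1..n}" for i
  proof -
   have "(norm (scaled_score n i w - H.proj N (scaled_score n i w)))^2 = c * (norm (score n i w - H.proj N (score n i w)))^2" for w
   proof -
    have "scaled_score n i w - H.proj N (scaled_score n i w) = (rho n / rate n) *\<^sub>R (score n i w - H.proj N (score n i w))"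
     by (simp add: scaled_score_def H.proj_scaleR scaleR_diff_right)
    then have "norm (scaled_score n i w - H.proj N (scaled_score n i w)) = \<bar>rho n / rate n\<bar> * norm (score n i w - H.proj N (score n i w))"
     by (simp only: norm_scaleR)
    then show ?thesis by (simp only: power_mult_distrib c_def power2_abs)
   qed
   then have "(\<integral>\<^sup>+w. ennreal ((norm (scaled_score n i w - H.proj N (scaled_score n i w)))^2) \<partial>M)
     = ennreal c * (\<integral>\<^sup>+w. ennreal ((norm (score n i w - H.proj N (score n i w)))^2) \<partial>M)"
    using score_measurable[OF i] by (subst nn_integral_cmult[symmetric]) (simp_all add: ennreal_mult c_def)
   also have "\<dots> \<le> ennreal c * ennreal (tail_bound N * cdf (h n))" by (intro mult_left_mono st i) simp
   also have "\<dots> = ennreal (c * (tail_bound N * cdf (h n)))"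
    by (rule ennreal_mult[symmetric]) (use tail_bound_nonneg[of N] cdf_nonneg[of "h n"] in \<open>simp_all add: c_def\<close>)
   finally show ?thesis .
  qed
  have "(\<integral>\<^sup>+w. ennreal ((norm ((\<Sum>i=1..n. scaled_score n i w - 0) - H.proj N (\<Sum>i=1..n. scaled_score n i w - 0)))^2) \<partial>M)
    \<le> ennreal (n * (c * (tail_bound N * cdf (h n))))"
  proof (rule H.centred_sum_norm_second_moment[where G="\<lambda>i w. 0", OF filtered[of n]])
   show "scaled_score n i \<in> borel_measurable (sF n (min i n))" if i: "i \<in> {1..n}" for i
    unfolding scaled_score_def[abs_def] using score_sF_measurable(1)[OF i, of i] i by (simp add: min_absorb1)
   show "integrable M (\<lambda>w. (norm (scaled_score n i w))^2)" if "i \<in> {1..n}" for i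
    by (rule scaled_score_square_integrable[OF that elim(1)])
   show "AE w in M. real_cond_exp M (sF n (min (i - 1) n)) (\<lambda>w. scaled_score n i w \<bullet> basis_vec k) w = 0 \<bullet> basis_vec k"
    if i: "i \<in> {1..n}" for i k
   proof -
    have "min (i - 1) n = i - 1" using i by auto
    then show ?thesis using score_centred[OF i, of "(rho n / rate n) *\<^sub>R basis_vec k"] by (simp add: scaled_score_def)
   qed
  qed (use 1 tail_bound_nonneg cdf_nonneg in \<open>auto simp: c_def\<close>)
  also have "real n * (c * (tail_bound N * cdf (h n))) = (rho n)^2 * (cdf (h n) / \<phi> (h n)) * tail_bound N"
   unfolding c_def scale_square[OF elim(2)] using elim by simp
  finally show "(\<integral>\<^sup>+w. ennreal ((score_tail_norm n N w)^2) \<partial>M)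
   \<le> ennreal ((rho n)^2 * (cdf (h n) / \<phi> (h n)) * tail_bound N)" by (simp add: score_sum_def)
 qed
qed

text \<open>The constant is valid for all \<open>N\<close> at once, which gives boundedness in the mean (\<open>N = 0\<close>) and uniformly
  small tails (\<open>N\<close> large).\<close>

lemma score_sum_moments:
 obtains c where "0 \<le> c" "\<forall>\<^sub>F n in sequentially. \<forall>N. integrable M (\<lambda>w. score_tail_norm n N w)
  \<and> (LINT w|M. score_tail_norm n N w) \<le> sqrt (c * tail_bound N)"
proof -
 define l where "l = (1 / (f1 x * M_const K \<tau>0 1))^2 * f1 x"
 have "(\<lambda>n. (rho n)^2 * (cdf (h n) / \<phi> (h n))) \<longlonglongrightarrow> l"
  unfolding l_def by (intro tendsto_intros rho_tendsto cdf_ratio_one)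
 then have lt: "\<forall>\<^sub>F n in sequentially. (rho n)^2 * (cdf (h n) / \<phi> (h n)) < l + 1" by (rule order_tendstoD) simp
 show thesis
 proof (rule that[of "l + 1"])
  show "0 \<le> l + 1" using f1_pos by (simp add: l_def)
  show "\<forall>\<^sub>F n in sequentially. \<forall>N. integrable M (\<lambda>w. score_tail_norm n N w)
   \<and> (LINT w|M. score_tail_norm n N w) \<le> sqrt ((l + 1) * tail_bound N)"
   using score_sum_tail_bound lt
  proof eventually_elim
   case (elim n)
   show ?case
   proof
    fix N
    have "(\<integral>\<^sup>+w. ennreal ((score_tail_norm n N w)^2) \<partial>M) \<le> ennreal ((l + 1) * tail_bound N)"
     using elim(1)[rule_format, of N] by (rule order_trans) (intro ennreal_leI mult_right_mono tail_bound_nonneg less_imp_le[OF elim(2)])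
    then show "integrable M (\<lambda>w. score_tail_norm n N w)
     \<and> (LINT w|M. score_tail_norm n N w) \<le> sqrt ((l + 1) * tail_bound N)"
     using first_moment_le[of "\<lambda>w. score_tail_norm n N w" "(l + 1) * tail_bound N"]
      tail_bound_nonneg[of N] \<open>0 \<le> l + 1\<close> by simp
   qed
  qed
 qed
qed

end

section \<open>Characteristic functions of the finite-dimensional projections\<close>

context functional_regression
begin

abbreviation wvar :: "nat \<Rightarrow> nat \<Rightarrow> 'w \<Rightarrow> real" where
 "wvar n i \<equiv> cexp n i (\<lambda>w. (weight n i w)^2)"

abbreviation cvar :: "nat \<Rightarrow> 'h \<Rightarrow> nat \<Rightarrow> 'w \<Rightarrow> real" where
 "cvar n y i \<equiv> cexp n i (\<lambda>w. (scaled_score n i w \<bullet> y)^2)"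

lemma wvar_bounds:
 assumes i: "i \<in> {1..n}"
 shows "integrable M (wvar n i)" "AE w in M. 0 \<le> wvar n i w" "AE w in M. wvar n i w \<le> Kmax\<^sup>2 * ccdf n i (h n) w"
proof -
 interpret F: prob_subalgebra M "sF n (i - 1)" by (rule sF_prob_subalgebra) (use i in auto)
 have n: "1 \<le> n" "1 \<le> i" "i \<le> n" using i by auto
 have w2: "integrable M (\<lambda>w. (weight n i w)^2)" by (rule weight_power_integrable[OF i])
 show "integrable M (wvar n i)" by (rule F.real_cond_exp_int[OF w2])
 show "AE w in M. 0 \<le> wvar n i w" by (rule F.real_cond_exp_pos) (use w2 in auto)
 have b: "integrable M (ball n i)" by (rule integral_ball(2)[OF n(2,3)])
 have "AE w in M. wvar n i w \<le> cexp n i (\<lambda>w. Kmax\<^sup>2 * ball n i w) w"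
  by (rule F.real_cond_exp_mono[OF _ w2]) (use b weight_square_le[OF n(1)] in auto)
 moreover have "AE w in M. cexp n i (\<lambda>w. Kmax\<^sup>2 * ball n i w) w = Kmax\<^sup>2 * ccdf n i (h n) w"
  unfolding cond_cdf_def by (rule F.real_cond_exp_cmult[OF b])
 ultimately show "AE w in M. wvar n i w \<le> Kmax\<^sup>2 * ccdf n i (h n) w"
  by eventually_elim simp
qed

lemma cvar_properties:
 assumes i: "i \<in> {1..n}" and hn: "h n \<le> \<delta>"
 shows "integrable M (\<lambda>w. (scaled_score n i w \<bullet> y)^2)" "integrable M (cvar n y i)" "AE w in M. 0 \<le> cvar n y i w"
  "AE w in M. cvar n y i w = (rho n / rate n)^2 * cexp n i (\<lambda>w. (score n i w \<bullet> y)^2) w"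
proof -
 interpret F: prob_subalgebra M "sF n (i - 1)" by (rule sF_prob_subalgebra) (use i in auto)
 show s2: "integrable M (\<lambda>w. (scaled_score n i w \<bullet> y)^2)"
  by (rule H.integrable_square_coordinate[OF scaled_score_measurable[OF i] scaled_score_square_integrable[OF assms]])
 show "integrable M (cvar n y i)" by (rule F.real_cond_exp_int[OF s2])
 show "AE w in M. 0 \<le> cvar n y i w" by (rule F.real_cond_exp_pos) (use s2 in auto)
 have eq: "(\<lambda>w. (scaled_score n i w \<bullet> y)^2) = (\<lambda>w. (rho n / rate n)^2 * (score n i w \<bullet> y)^2)"
  by (rule ext) (simp only: scaled_score_def inner_scaleR_left power_mult_distrib)
 show "AE w in M. cvar n y i w = (rho n / rate n)^2 * cexp n i (\<lambda>w. (score n i w \<bullet> y)^2) w"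
  unfolding eq by (rule F.real_cond_exp_cmult)
   (rule H.integrable_square_coordinate[OF score_measurable[OF i] score_square_integrable[OF assms]])
qed

lemma cvar_close:
 assumes \<epsilon>: "0 < \<epsilon>"
 shows "\<forall>\<^sub>F n in sequentially. \<forall>i\<in>{1..n}. AE w in M.
  \<bar>cvar n (H.proj N v) i w - Wform N v x * ((rho n / rate n)^2 * wvar n i w)\<bar> \<le> \<epsilon> * ((rho n / rate n)^2 * wvar n i w)"
 using score_cond_variance[OF \<epsilon>, of N v] h_le_eventually[OF delta_pos]
proof eventually_elim
 case (elim n)
 show ?case
 proof
  fix i assume i: "i \<in> {1..n}"
  show "AE w in M. \<bar>cvar n (H.proj N v) i w - Wform N v x * ((rho n / rate n)^2 * wvar n i w)\<bar>
    \<le> \<epsilon> * ((rho n / rate n)^2 * wvar n i w)"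
   using bspec[OF elim(1) i] cvar_properties(4)[OF i elim(2), of "H.proj N v"]
  proof eventually_elim
   case (elim w)
   define c where "c = (rho n / rate n)^2"
   define q where "q = cexp n i (\<lambda>w. (score n i w \<bullet> H.proj N v)^2) w"
   have "c * \<bar>q - Wform N v x * wvar n i w\<bar> \<le> c * (\<epsilon> * wvar n i w)"
    using elim(1) by (intro mult_left_mono) (simp_all add: q_def c_def)
   moreover have "c * \<bar>q - Wform N v x * wvar n i w\<bar> = \<bar>c * q - Wform N v x * (c * wvar n i w)\<bar>"
   proof -
    have "c * \<bar>q - Wform N v x * wvar n i w\<bar> = \<bar>c * (q - Wform N v x * wvar n i w)\<bar>"
     by (simp add: abs_mult c_def)
    also have "c * (q - Wform N v x * wvar n i w) = c * q - Wform N v x * (c * wvar n i w)"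
     by (simp add: algebra_simps)
    finally show ?thesis .
   qed
   ultimately show ?case unfolding elim(2) c_def[symmetric] q_def[symmetric] by (simp add: mult_ac)
  qed
 qed
qed

lemma rho_square_tendsto: "(\<lambda>n. (rho n)^2 * (f1 x * M_const K \<tau>0 2)) \<longlonglongrightarrow> var_const"
proof -
 have "(\<lambda>n. (rho n)^2 * (f1 x * M_const K \<tau>0 2)) \<longlonglongrightarrow> (1 / (f1 x * M_const K \<tau>0 1))\<^sup>2 * (f1 x * M_const K \<tau>0 2)"
  by (intro tendsto_intros rho_tendsto)
 also have "(1 / (f1 x * M_const K \<tau>0 1))^2 * (f1 x * M_const K \<tau>0 2) = var_const"
  using f1_pos M_const_pos[of 1] by (simp add: var_const_def power2_eq_square)
 finally show ?thesis .
qed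

text \<open>The conditional variances are small uniformly in the row, because the conditional
 probabilities of the window are of the order \<^term>\<open>\<phi> (h n)\<close>.\<close>

lemma cvar_upper:
 obtains L :: "nat \<Rightarrow> nat \<Rightarrow> real" and A C :: real where "0 \<le> A" "0 \<le> C"
  "\<And>n i. i \<in> {1..n} \<Longrightarrow> 0 \<le> L n i"
  "\<forall>\<^sub>F n in sequentially. (\<Sum>i=1..n. (L n i)^2) \<le> C * real n"
  "\<forall>\<^sub>F n in sequentially. \<forall>i\<in>{1..n}. AE w in M. cvar n (H.proj N v) i w \<le> A * L n i / real n"
proof -
 obtain L :: "nat \<Rightarrow> nat \<Rightarrow> real" and C :: real where L: "0 \<le> C" "\<And>n i. i \<in> {1..n} \<Longrightarrow> 0 \<le> L n i"
  "\<forall>\<^sub>F n in sequentially. (\<Sum>i=1..n. (L n i)^2) \<le> C * real n"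
  "\<forall>\<^sub>F n in sequentially. \<forall>i\<in>{1..n}. AE w in M. ccdf n i (h n) w \<le> \<phi> (h n) * L n i"
  by (rule ccdf_bound) blast
 define l where "l = (1 / (f1 x * M_const K \<tau>0 1))^2 + 1"
 have "(\<lambda>n. (rho n)^2) \<longlonglongrightarrow> (1 / (f1 x * M_const K \<tau>0 1))\<^sup>2" by (intro tendsto_intros rho_tendsto)
 then have rl: "\<forall>\<^sub>F n in sequentially. (rho n)^2 < l" by (rule order_tendstoD) (simp add: l_def)
 define A where "A = l * ((Wform N v x + 1) * Kmax\<^sup>2)"
 have l0: "0 \<le> l" by (simp add: l_def)
 have A0: "0 \<le> A" using l0 Wform_nonneg[of N v] by (simp add: A_def)
 show thesis
 proof (rule that[OF A0 L(1) L(2) L(3)])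
  show "\<forall>\<^sub>F n in sequentially. \<forall>i\<in>{1..n}. AE w in M. cvar n (H.proj N v) i w \<le> A * L n i / real n"
   using L(4) rl cvar_close[of 1 N v, simplified] phi_pos eventually_ge_at_top[of 1]
  proof eventually_elim
   case (elim n)
   show ?case
   proof
    fix i assume i: "i \<in> {1..n}"
    define c where "c = (rho n / rate n)^2"
    show "AE w in M. cvar n (H.proj N v) i w \<le> A * L n i / real n"
     using bspec[OF elim(1) i] elim(3)[rule_format, of i] i wvar_bounds(3)[OF i]
    proof -
     have "AE w in M. \<bar>cvar n (H.proj N v) i w - Wform N v x * (c * wvar n i w)\<bar> \<le> c * wvar n i w"
      using elim(3) i unfolding c_def by auto
     then show ?thesis using bspec[OF elim(1) i] wvar_bounds(3)[OF i]
     proof eventually_elim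
      case (elim w)
      have "cvar n (H.proj N v) i w \<le> (Wform N v x + 1) * (c * wvar n i w)"
       using elim(1) by (simp add: distrib_right abs_le_iff)
      also have "\<dots> \<le> (Wform N v x + 1) * (c * (Kmax\<^sup>2 * (\<phi> (h n) * L n i)))"
      proof (intro mult_left_mono)
       show "wvar n i w \<le> Kmax\<^sup>2 * (\<phi> (h n) * L n i)"
        using elim(3) mult_left_mono[OF elim(2), of "Kmax\<^sup>2"] by simp
      qed (use Wform_nonneg[of N v] in \<open>auto simp: c_def\<close>)
      also have "\<dots> = (rho n)^2 * ((Wform N v x + 1) * Kmax\<^sup>2 * L n i / real n)"
       unfolding c_def scale_square[OF \<open>1 \<le> n\<close>] using \<open>0 < \<phi> (h n)\<close> by simp
      also have "\<dots> \<le> l * ((Wform N v x + 1) * Kmax\<^sup>2 * L n i / real n)"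
       using \<open>(rho n)\<^sup>2 < l\<close> Wform_nonneg[of N v] L(2)[OF i] by (intro mult_right_mono) auto
      finally show ?case by (simp add: A_def mult.assoc)
     qed
    qed
   qed
  qed
 qed
qed

text \<open>The weak law for the conditional variances: by continuity the common factor of the scores is the
 variance at \<open>x\<close>, and the sums of the squared kernel weights obey the weak law.\<close>

lemma cvar_sum_L1:
 "(\<lambda>n. (LINT w|M. \<bar>(\<Sum>i=1..n. cvar n (H.proj N v) i w) - var_const * Wform N v x\<bar>)) \<longlonglongrightarrow> 0"
proof -
 define w0 where "w0 = Wform N v x"
 define l where "l = f1 x * M_const K \<tau>0 2"
 define m where "m n w = (\<Sum>i=1..n. wvar n i w) / (real n * \<phi> (h n))" for n w
 define dm where "dm n = (LINT w|M. \<bar>m n w - l\<bar>)" for n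
 have dm: "dm \<longlonglongrightarrow> 0" unfolding dm_def[abs_def] m_def l_def by (rule kernel_moment_L1) simp
 have w0: "0 \<le> w0" unfolding w0_def by (rule Wform_nonneg)
 define B where "B \<epsilon> n = \<epsilon> * (rho n)^2 * (l + dm n) + w0 * ((rho n)^2 * dm n + \<bar>(rho n)\<^sup>2 * l - var_const\<bar>)" for \<epsilon> n
 have rl: "(\<lambda>n. (rho n)^2 * l) \<longlonglongrightarrow> var_const" unfolding l_def by (rule rho_square_tendsto)
 have bound: "\<forall>\<^sub>F n in sequentially. (LINT w|M. \<bar>(\<Sum>i=1..n. cvar n (H.proj N v) i w) - var_const * w0\<bar>) \<le> B \<epsilon> n" if \<epsilon>: "0 < \<epsilon>" for \<epsilon>
  using cvar_close[OF \<epsilon>, of N v] phi_pos eventually_ge_at_top[of 1] h_le_eventually[OF delta_pos]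
 proof eventually_elim
  case (elim n)
  define c where "c = (rho n / rate n)^2"
  have im: "integrable M (m n)"
   unfolding m_def by (rule integrable_divide, rule Bochner_Integration.integrable_sum, rule wvar_bounds(1))
  have im': "integrable M (\<lambda>w. \<bar>m n w - l\<bar>)" using im by auto
  have cm: "(\<Sum>i=1..n. c * wvar n i w) = (rho n)^2 * m n w" for w
   unfolding sum_distrib_left[symmetric] m_def c_def scale_square[OF elim(3)] by simp
  have AEs: "AE w in M. \<forall>i\<in>{1..n}. \<bar>cvar n (H.proj N v) i w - w0 * (c * wvar n i w)\<bar> \<le> \<epsilon> * (c * wvar n i w)"
   using elim(1) unfolding c_def w0_def by (intro AE_finite_allI) auto
  have "AE w in M. \<bar>(\<Sum>i=1..n. cvar n (H.proj N v) i w) - var_const * w0\<bar>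
    \<le> \<epsilon> * (rho n)^2 * (l + \<bar>m n w - l\<bar>) + w0 * ((rho n)^2 * \<bar>m n w - l\<bar> + \<bar>(rho n)\<^sup>2 * l - var_const\<bar>)"
   using AEs
  proof eventually_elim
   case (elim w)
   have "\<bar>(\<Sum>i=1..n. cvar n (H.proj N v) i w) - w0 * ((rho n)^2 * m n w)\<bar> = \<bar>\<Sum>i=1..n. cvar n (H.proj N v) i w - w0 * (c * wvar n i w)\<bar>"
    unfolding cm[symmetric] sum_subtractf sum_distrib_left ..
   also have "\<dots> \<le> (\<Sum>i=1..n. \<epsilon> * (c * wvar n i w))"
    by (intro order_trans[OF sum_abs] sum_mono) (use elim in auto)
   also have "\<dots> = \<epsilon> * (\<Sum>i=1..n. c * wvar n i w)" by (rule sum_distrib_left[symmetric])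
   also have "\<dots> = \<epsilon> * (rho n)^2 * m n w" unfolding cm by (rule mult.assoc[symmetric])
   also have "\<dots> \<le> \<epsilon> * (rho n)^2 * (l + \<bar>m n w - l\<bar>)" using \<epsilon> by (intro mult_left_mono) auto
   finally have 1: "\<bar>(\<Sum>i=1..n. cvar n (H.proj N v) i w) - w0 * ((rho n)^2 * m n w)\<bar> \<le> \<epsilon> * (rho n)^2 * (l + \<bar>m n w - l\<bar>)" .
   have "\<bar>w0 * ((rho n)^2 * m n w) - var_const * w0\<bar> = w0 * \<bar>(rho n)\<^sup>2 * (m n w - l) + ((rho n)^2 * l - var_const)\<bar>"
   proof -
    have "w0 * ((rho n)^2 * m n w) - var_const * w0 = w0 * ((rho n)^2 * (m n w - l) + ((rho n)^2 * l - var_const))"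
     by (simp add: algebra_simps)
    then show ?thesis using w0 by (simp only: abs_mult abs_of_nonneg)
   qed
   also have "\<dots> \<le> w0 * ((rho n)^2 * \<bar>m n w - l\<bar> + \<bar>(rho n)\<^sup>2 * l - var_const\<bar>)"
    using w0 by (intro mult_left_mono order_trans[OF abs_triangle_ineq]) (simp_all add: abs_mult)
   finally show ?case using 1 by linarith
  qed
  then have "(LINT w|M. \<bar>(\<Sum>i=1..n. cvar n (H.proj N v) i w) - var_const * w0\<bar>)
    \<le> (LINT w|M. \<epsilon> * (rho n)^2 * (l + \<bar>m n w - l\<bar>) + w0 * ((rho n)^2 * \<bar>m n w - l\<bar> + \<bar>(rho n)\<^sup>2 * l - var_const\<bar>))"
   using im' by (intro integral_mono_AE' integrable_abs integrable_diff integrable_sum cvar_properties(2)[OF _ elim(4)]) auto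
  also have "\<dots> = B \<epsilon> n" using im' by (simp add: B_def dm_def prob_space)
  finally show ?case .
 qed
 show ?thesis unfolding w0_def[symmetric]
 proof (rule tendstoI)
  fix \<eta> :: real assume \<eta>: "0 < \<eta>"
  define \<epsilon> where "\<epsilon> = \<eta> / (2 * var_const)"
  have \<epsilon>: "0 < \<epsilon>" using \<eta> var_const_pos by (simp add: \<epsilon>_def)
  have "(\<lambda>n. \<epsilon> * ((rho n)^2 * l) + \<epsilon> * (rho n)^2 * dm n + w0 * ((rho n)^2 * dm n + \<bar>(rho n)\<^sup>2 * l - var_const\<bar>))
   \<longlonglongrightarrow> \<epsilon> * var_const + \<epsilon> * (1 / (f1 x * M_const K \<tau>0 1))^2 * 0
    + w0 * ((1 / (f1 x * M_const K \<tau>0 1))^2 * 0 + \<bar>var_const - var_const\<bar>)"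
   by (intro tendsto_intros rl dm rho_tendsto)
  then have "(\<lambda>n. B \<epsilon> n) \<longlonglongrightarrow> \<eta> / 2" using var_const_pos by (simp add: B_def[abs_def] \<epsilon>_def distrib_left mult.assoc)
  then have "\<forall>\<^sub>F n in sequentially. B \<epsilon> n < \<eta>" by (rule order_tendstoD) (use \<eta> in simp)
  then show "\<forall>\<^sub>F n in sequentially. dist (LINT w|M. \<bar>(\<Sum>i=1..n. cvar n (H.proj N v) i w) - var_const * w0\<bar>) 0 < \<eta>"
   using bound[OF \<epsilon>] by eventually_elim (simp add: dist_real_def)
 qed
qed

text \<open>A sum of \<open>n\<close> terms of the order \<open>\<phi> (h n)\<close>, normalised by \<open>rate n powr p\<close>, is of the order
  \<open>rate n powr (2 - p)\<close>.\<close>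

lemma lyapunov_condition:
 obtains p where "2 < p" "p \<le> 3"
  "\<And>n i y. i \<in> {1..n} \<Longrightarrow> h n \<le> \<delta> \<Longrightarrow> integrable M (\<lambda>w. \<bar>scaled_score n i w \<bullet> y\<bar> powr p)"
  "\<And>y. (\<lambda>n. \<Sum>i=1..n. (LINT w|M. \<bar>scaled_score n i w \<bullet> y\<bar> powr p)) \<longlonglongrightarrow> 0"
proof -
 obtain p where p: "2 < p" "p \<le> 3"
  "\<And>n i. i \<in> {1..n} \<Longrightarrow> h n \<le> \<delta> \<Longrightarrow> integrable M (\<lambda>w. norm (score n i w) powr p)"
  "\<And>n i. i \<in> {1..n} \<Longrightarrow> h n \<le> \<delta> \<Longrightarrow> (LINT w|M. norm (score n i w) powr p) \<le> Kmax powr p * (72 * cdf (h n))"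
  by (rule score_moments) blast
 define c where "c n = \<bar>rho n / rate n\<bar>" for n
 have le: "\<bar>scaled_score n i w \<bullet> y\<bar> powr p \<le> c n powr p * norm y powr p * norm (score n i w) powr p" for n i w y
 proof -
  have "\<bar>scaled_score n i w \<bullet> y\<bar> \<le> c n * norm y * norm (score n i w)"
   using Cauchy_Schwarz_ineq2[of "scaled_score n i w" y] by (simp only: norm_scaled_score c_def[symmetric] mult_ac)
  then have "\<bar>scaled_score n i w \<bullet> y\<bar> powr p \<le> (c n * norm y * norm (score n i w)) powr p"
   using p(1) by (intro powr_mono2) auto
  moreover have "0 \<le> c n" by (simp add: c_def)
  ultimately show ?thesis by (simp add: powr_mult)
 qed
 have int: "integrable M (\<lambda>w. \<bar>scaled_score n i w \<bullet> y\<bar> powr p)" if "i \<in> {1..n}" "h n \<le> \<delta>" for n i y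
 proof (rule Bochner_Integration.integrable_bound)
  show "integrable M (\<lambda>w. c n powr p * norm y powr p * norm (score n i w) powr p)" using p(3)[OF that] by simp
  show "(\<lambda>w. \<bar>scaled_score n i w \<bullet> y\<bar> powr p) \<in> borel_measurable M" using scaled_score_measurable[OF that(1)] by measurable
  show "AE w in M. norm (\<bar>scaled_score n i w \<bullet> y\<bar> powr p) \<le> norm (c n powr p * norm y powr p * norm (score n i w) powr p)"
   using le by (simp add: abs_mult)
 qed
 have lim: "(\<lambda>n. \<Sum>i=1..n. (LINT w|M. \<bar>scaled_score n i w \<bullet> y\<bar> powr p)) \<longlonglongrightarrow> 0" for y
 proof (rule tendsto_sandwich[where f="\<lambda>_. 0"])
  define B where "B = norm y powr p * (Kmax powr p * 72)"
  have r0: "0 < 1 / (f1 x * M_const K \<tau>0 1)" using f1_pos M_const_pos[of 1] by simp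
  show "(\<lambda>n. B * ((rho n) powr p * (cdf (h n) / \<phi> (h n)) * rate n powr (2 - p))) \<longlonglongrightarrow> 0"
  proof -
   have "(\<lambda>n. B * ((rho n) powr p * (cdf (h n) / \<phi> (h n)) * rate n powr (2 - p)))
    \<longlonglongrightarrow> B * ((1 / (f1 x * M_const K \<tau>0 1)) powr p * f1 x * 0)"
    by (intro tendsto_mult tendsto_const tendsto_powr rho_tendsto cdf_ratio_one tendsto_neg_powr rate_at_top) (use p r0 in auto)
   then show ?thesis by simp
  qed
  have "\<forall>\<^sub>F n in sequentially. 0 < rho n" by (rule order_tendstoD(1)[OF rho_tendsto r0])
  then show "\<forall>\<^sub>F n in sequentially. (\<Sum>i=1..n. (LINT w|M. \<bar>scaled_score n i w \<bullet> y\<bar> powr p))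
    \<le> B * ((rho n) powr p * (cdf (h n) / \<phi> (h n)) * rate n powr (2 - p))"
   using h_le_eventually[OF delta_pos] rate_pos phi_pos eventually_ge_at_top[of 1]
  proof eventually_elim
   case (elim n)
   have "(LINT w|M. \<bar>scaled_score n i w \<bullet> y\<bar> powr p) \<le> c n powr p * norm y powr p * (Kmax powr p * (72 * cdf (h n)))"
    if i: "i \<in> {1..n}" for i
   proof -
    have "(LINT w|M. \<bar>scaled_score n i w \<bullet> y\<bar> powr p) \<le> (LINT w|M. c n powr p * norm y powr p * norm (score n i w) powr p)"
     by (intro Bochner_Integration.integral_mono int le i elim(2)) (use p(3)[OF i elim(2)] in simp)
    also have "\<dots> \<le> c n powr p * norm y powr p * (Kmax powr p * (72 * cdf (h n)))"
     using p(4)[OF i elim(2)] by (simp add: mult_left_mono)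
    finally show ?thesis .
   qed
   then have "(\<Sum>i=1..n. (LINT w|M. \<bar>scaled_score n i w \<bullet> y\<bar> powr p)) \<le> (\<Sum>i=1..n. c n powr p * norm y powr p * (Kmax powr p * (72 * cdf (h n))))"
    by (rule sum_mono)
   also have "\<dots> = B * (c n powr p * (real n * \<phi> (h n)) * (cdf (h n) / \<phi> (h n)))" using elim(4) by (simp add: B_def)
   also have "c n powr p * (real n * \<phi> (h n)) = rho n powr p * rate n powr (2 - p)"
   proof -
    have "c n powr p = rho n powr p / rate n powr p" using elim by (simp add: c_def powr_divide)
    moreover have "real n * \<phi> (h n) = rate n powr 2" using elim(3) rate_square[OF elim(5)] by simp
    ultimately show ?thesis using elim(3) by (simp add: powr_diff)
   qed
   finally show ?case by (simp add: mult_ac)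
  qed
 qed (auto intro!: always_eventually sum_nonneg)
 show thesis by (rule that[OF p(1,2) int lim])
qed

text \<open>By the bounds \<open>A * L n i / n\<close> the quadratic characteristic is bounded, and the sum of the squared conditional
  variances is of the order \<open>1 / n\<close>.\<close>

lemma char_score_sum_proj:
 "(\<lambda>n. CLINT w|M. iexp (score_sum n w \<bullet> H.proj N v)) \<longlonglongrightarrow> complex_of_real (exp (- (var_const * Wform N v x) / 2))"
proof -
 define y where "y = H.proj N v"
 define s where "s = var_const * Wform N v x"
 have s0: "0 \<le> s" using var_const_pos Wform_nonneg[of N v] by (simp add: s_def)
 obtain L A C where L: "0 \<le> A" "0 \<le> C" "\<And>n i. i \<in> {1..n} \<Longrightarrow> 0 \<le> L n i"
  "\<forall>\<^sub>F n in sequentially. (\<Sum>i=1..n. (L n i)^2) \<le> C * real n"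
  "\<forall>\<^sub>F n in sequentially. \<forall>i\<in>{1..n}. AE w in M. cvar n y i w \<le> A * L n i / real n"
  unfolding y_def by (rule cvar_upper[of N v]) blast
 obtain p where p: "2 < p" "p \<le> 3"
  "\<And>n i y. i \<in> {1..n} \<Longrightarrow> h n \<le> \<delta> \<Longrightarrow> integrable M (\<lambda>w. \<bar>scaled_score n i w \<bullet> y\<bar> powr p)"
  "\<And>y. (\<lambda>n. \<Sum>i=1..n. (LINT w|M. \<bar>scaled_score n i w \<bullet> y\<bar> powr p)) \<longlonglongrightarrow> 0"
  by (rule lyapunov_condition) blast
 define C1 where "C1 = A * (1 + C) + s"
 define lp where "lp n = (\<Sum>i=1..n. (LINT w|M. \<bar>scaled_score n i w \<bullet> y\<bar> powr p))" for n
 define dv where "dv n = (LINT w|M. \<bar>(\<Sum>i=1..n. cvar n y i w) - s\<bar>)" for n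
 have "\<forall>\<^sub>F n in sequentially. cmod ((CLINT w|M. iexp (score_sum n w \<bullet> y)) - complex_of_real (exp (- s / 2)))
   \<le> exp (C1 / 2) * ((lp n + A\<^sup>2 * C / real n) + dv n)"
  using L(4,5) h_le_eventually[OF delta_pos] eventually_ge_at_top[of 1]
 proof eventually_elim
  case (elim n)
  define F where "F i = sF n (min i n)" for i
  interpret filtered_prob M F unfolding F_def by (rule filtered)
  define \<xi> where "\<xi> i w = scaled_score n i w \<bullet> y" for i w
  have Fi: "F (i - 1) = sF n (i - 1)" if "i \<in> {1..n}" for i
  proof -
   have "min (i - 1) n = i - 1" using that by auto
   then show ?thesis by (simp only: F_def)
  qed
  have Lle: "(\<Sum>i=1..n. L n i) \<le> (1 + C) * real n"
  proof -
   have "(\<Sum>i=1..n. L n i) \<le> (\<Sum>i=1..n. 1 + (L n i)^2)"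
   proof (rule sum_mono)
    fix i
    have "0 \<le> (L n i - 1 / 2)^2" by simp
    then show "L n i \<le> 1 + (L n i)^2" by (simp add: power2_eq_square algebra_simps)
   qed
   then show ?thesis using elim(1) by (simp add: sum.distrib distrib_right)
  qed
  have AEs: "AE w in M. \<forall>i\<in>{1..n}. cvar n y i w \<le> A * L n i / real n"
   using elim(2) by (intro AE_finite_allI) auto
  have V: "AE w in M. (\<Sum>i=1..n. real_cond_exp M (F (i - 1)) (\<lambda>w. (\<xi> i w)^2) w) \<le> C1"
   using AEs
  proof eventually_elim
   case (elim w)
   have "(\<Sum>i=1..n. real_cond_exp M (F (i - 1)) (\<lambda>w. (\<xi> i w)^2) w) = (\<Sum>i=1..n. cvar n y i w)"
    by (intro sum.cong refl) (simp only: Fi \<xi>_def)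
   also have "\<dots> \<le> (\<Sum>i=1..n. A * L n i / real n)" using elim by (intro sum_mono) auto
   also have "\<dots> = A * (\<Sum>i=1..n. L n i) / real n" by (simp add: sum_divide_distrib sum_distrib_left)
   also have "\<dots> \<le> A * ((1 + C) * real n) / real n" by (intro divide_right_mono mult_left_mono Lle L(1)) simp
   also have "\<dots> \<le> C1" using s0 \<open>1 \<le> n\<close> by (simp add: C1_def)
   finally show ?case .
  qed
  have sC: "s \<le> C1" using L(1,2) by (simp add: C1_def)
  have est: "cmod ((CLINT w|M. iexp (\<Sum>i=1..n. \<xi> i w)) - complex_of_real (exp (- s / 2)))
   \<le> exp (C1 / 2) * ((\<Sum>i=1..n. (LINT w|M. \<bar>\<xi> i w\<bar> powr p) + (LINT w|M. (real_cond_exp M (F (i - 1)) (\<lambda>w. (\<xi> i w)^2) w)^2))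
    + (LINT w|M. \<bar>(\<Sum>i=1..n. real_cond_exp M (F (i - 1)) (\<lambda>w. (\<xi> i w)^2) w) - s\<bar>))"
  proof (rule martingale_char_estimate[OF p(1,2) _ _ _ _ V s0 sC])
   fix i assume i: "i \<in> {1..n}"
   have [measurable]: "scaled_score n i \<in> borel_measurable (F i)"
    unfolding scaled_score_def[abs_def] F_def using score_sF_measurable(1)[OF i, of i] i by (simp add: min_absorb1)
   show "\<xi> i \<in> borel_measurable (F i)" unfolding \<xi>_def by measurable
   show "integrable M (\<lambda>w. (\<xi> i w)^2)" unfolding \<xi>_def by (rule cvar_properties(1)[OF i elim(3)])
   show "integrable M (\<lambda>w. \<bar>\<xi> i w\<bar> powr p)" unfolding \<xi>_def by (rule p(3)[OF i elim(3)])
   show "AE w in M. real_cond_exp M (F (i - 1)) (\<xi> i) w = 0"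
    using score_centred[OF i, of "(rho n / rate n) *\<^sub>R y"] by (simp only: Fi[OF i] \<xi>_def[abs_def] scaled_score_def inner_scaleR_left inner_scaleR_right)
  qed
  have sq: "(LINT w|M. (cvar n y i w)^2) \<le> (A * L n i / real n)^2" if i: "i \<in> {1..n}" for i
  proof -
   have "AE w in M. (cvar n y i w)^2 \<le> (A * L n i / real n)^2"
    using bspec[OF elim(2) i] cvar_properties(3)[OF i elim(3), of y] by eventually_elim (rule power_mono)
   then have "(LINT w|M. (cvar n y i w)^2) \<le> (LINT w|M. (A * L n i / real n)^2)"
    by (intro integral_mono_AE') auto
   then show ?thesis by (simp add: prob_space)
  qed
  have "(\<Sum>i=1..n. (LINT w|M. (cvar n y i w)^2)) \<le> (\<Sum>i=1..n. (A / real n)^2 * (L n i)^2)"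
   by (intro sum_mono order_trans[OF sq]) (simp_all add: power_mult_distrib power_divide)
  also have "\<dots> \<le> (A / real n)^2 * (C * real n)" unfolding sum_distrib_left[symmetric] by (intro mult_left_mono elim(1)) simp
  also have "\<dots> = A\<^sup>2 * C / real n" by (simp add: power2_eq_square)
  finally have sqs: "(\<Sum>i=1..n. (LINT w|M. (cvar n y i w)^2)) \<le> A\<^sup>2 * C / real n" .
  have "(\<Sum>i=1..n. (LINT w|M. \<bar>\<xi> i w\<bar> powr p) + (LINT w|M. (real_cond_exp M (F (i - 1)) (\<lambda>w. (\<xi> i w)^2) w)^2))
   = lp n + (\<Sum>i=1..n. (LINT w|M. (cvar n y i w)^2))"
   unfolding sum.distrib lp_def by (intro arg_cong2[where f="(+)"] sum.cong refl) (simp_all only: Fi \<xi>_def)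
  moreover have "(LINT w|M. \<bar>(\<Sum>i=1..n. real_cond_exp M (F (i - 1)) (\<lambda>w. (\<xi> i w)^2) w) - s\<bar>) = dv n"
  proof -
   have "(\<Sum>i=1..n. real_cond_exp M (F (i - 1)) (\<lambda>w. (\<xi> i w)^2) w) = (\<Sum>i=1..n. cvar n y i w)" for w
    by (intro sum.cong refl) (simp only: Fi \<xi>_def)
   then show ?thesis by (simp only: dv_def)
  qed
  moreover have "score_sum n w \<bullet> y = (\<Sum>i=1..n. \<xi> i w)" for w by (simp add: score_sum_def inner_sum_left \<xi>_def)
  ultimately have "cmod ((CLINT w|M. iexp (score_sum n w \<bullet> y)) - complex_of_real (exp (- s / 2)))
   \<le> exp (C1 / 2) * ((lp n + (\<Sum>i=1..n. (LINT w|M. (cvar n y i w)^2))) + dv n)" using est by (simp only:)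
  also have "\<dots> \<le> exp (C1 / 2) * ((lp n + A\<^sup>2 * C / real n) + dv n)" using sqs by simp
  finally show ?case .
 qed
 moreover have "(\<lambda>n. exp (C1 / 2) * ((lp n + A\<^sup>2 * C / real n) + dv n)) \<longlonglongrightarrow> 0"
 proof -
  have "lp \<longlonglongrightarrow> 0" unfolding lp_def[abs_def] by (rule p(4))
  moreover have "dv \<longlonglongrightarrow> 0" unfolding dv_def[abs_def] y_def s_def by (rule cvar_sum_L1)
  moreover have "(\<lambda>n. A\<^sup>2 * C / real n) \<longlonglongrightarrow> 0" by (rule lim_const_over_n)
  ultimately show ?thesis by (intro tendsto_mult_right_zero tendsto_add_zero)
 qed
 ultimately have "(\<lambda>n. (CLINT w|M. iexp (score_sum n w \<bullet> y)) - complex_of_real (exp (- s / 2))) \<longlonglongrightarrow> 0"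
  by (rule Lim_null_comparison)
 then show ?thesis unfolding y_def s_def by (rule LIM_zero_cancel)
qed

end

section \<open>The remainder terms\<close>

context functional_regression
begin

definition incr :: "nat \<Rightarrow> nat \<Rightarrow> 'w \<Rightarrow> 'h" where
 "incr n i w = weight n i w *\<^sub>R (r (X n i w) - r x)"

abbreviation wbar :: "nat \<Rightarrow> nat \<Rightarrow> 'w \<Rightarrow> real" where
 "wbar n i \<equiv> cexp n i (weight n i)"

abbreviation wYbar :: "nat \<Rightarrow> nat \<Rightarrow> 'w \<Rightarrow> 'h" where
 "wYbar n i \<equiv> cond_exp M (sF n (i - 1)) (\<lambda>w. weight n i w *\<^sub>R Y n i w)"

text \<open>The conditional expectation of \<open>incr n i\<close>, written in terms of the conditional expectations that define
  the bias.\<close>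

definition incr_bar :: "nat \<Rightarrow> nat \<Rightarrow> 'w \<Rightarrow> 'h" where
 "incr_bar n i w = wYbar n i w - wbar n i w *\<^sub>R r x"

definition mean_incr :: "nat \<Rightarrow> 'w \<Rightarrow> 'h" where
 "mean_incr n w = (\<Sum>i=1..n. incr_bar n i w) /\<^sub>R norming M d X K x n (h n)"

definition incr_rest :: "nat \<Rightarrow> 'w \<Rightarrow> 'h" where
 "incr_rest n w = (rho n / rate n) *\<^sub>R (\<Sum>i=1..n. incr n i w - incr_bar n i w)"

definition weight_rest :: "nat \<Rightarrow> 'w \<Rightarrow> real" where
 "weight_rest n w = (rho n / rate n) * (\<Sum>i=1..n. weight n i w - wbar n i w)"

lemma incr_measurable:
 assumes i: "i \<in> {1..n}"
 shows "incr n i \<in> borel_measurable (sF n i)" "incr n i \<in> borel_measurable M"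
proof -
 interpret F: prob_subalgebra M "sF n i" by (rule sF_prob_subalgebra) (use i in auto)
 have [measurable]: "weight n i \<in> borel_measurable (sF n i)" "X n i \<in> sF n i \<rightarrow>\<^sub>M pm_borel d"
  using score_sF_measurable(2,3)[OF i, of i] by auto
 show "incr n i \<in> borel_measurable (sF n i)" unfolding incr_def[abs_def] by measurable
 then show "incr n i \<in> borel_measurable M" by (rule measurable_from_subalg[OF F.subalg])
qed

text \<open>The increments of \<open>r\<close> over the window are small of the order of the square root of the
 bandwidth, in mean square on the window and hence also in the mean.\<close>

lemma incr_bounds:
 obtains Bc u0 where "0 \<le> Bc" "0 < u0"
  "\<And>n i. i \<in> {1..n} \<Longrightarrow> h n \<le> u0 \<Longrightarrow> (\<integral>\<^sup>+w. ennreal ((norm (incr n i w))^2) \<partial>M) \<le> ennreal (Bc * (h n * cdf (h n)))"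
  "\<And>n i. i \<in> {1..n} \<Longrightarrow> h n \<le> u0 \<Longrightarrow> integrable M (\<lambda>w. (norm (incr n i w))^2)"
  "\<And>n i. i \<in> {1..n} \<Longrightarrow> h n \<le> u0 \<Longrightarrow> integrable M (incr n i)"
  "\<And>n i. i \<in> {1..n} \<Longrightarrow> h n \<le> u0 \<Longrightarrow> (LINT w|M. norm (incr n i w)) \<le> Bc * (sqrt (h n) * cdf (h n))"
proof -
 obtain Bc u0 where Bc: "0 \<le> Bc" "0 < u0" "\<And>u. 0 < u \<Longrightarrow> u \<le> u0 \<Longrightarrow>
  (\<integral>\<^sup>+w. ennreal ((norm (indicator {..u} (D 1 1 w) *\<^sub>R (r (X 1 1 w) - r x)))^2) \<partial>M) \<le> ennreal (Bc * u * cdf u)"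
  by (rule increment_bound) blast
 define B where "B = Kmax\<^sup>2 * Bc + (Kmax + Kmax * Bc)"
 have K0: "0 < Kmax" by (rule Kmax)
 have B0: "0 \<le> B" using Bc(1) K0 by (simp add: B_def)
 have sq: "(\<integral>\<^sup>+w. ennreal ((norm (incr n i w))^2) \<partial>M) \<le> ennreal (Kmax\<^sup>2 * Bc * (h n * cdf (h n)))"
  if i: "i \<in> {1..n}" and hn: "h n \<le> u0" for n i
 proof -
  have n: "1 \<le> n" "1 \<le> i" "i \<le> n" using i by auto
  have [measurable]: "X n i \<in> M \<rightarrow>\<^sub>M pm_borel d" "X 1 1 \<in> M \<rightarrow>\<^sub>M pm_borel d"
   using X_measurable n by auto
  define q where "q y = ennreal ((norm (indicator {..h n} (d x y) *\<^sub>R (r y - r x)))^2)" for y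
  have [measurable]: "q \<in> borel_measurable (pm_borel d)" unfolding q_def[abs_def] by measurable
  have "ennreal ((norm (incr n i w))^2) \<le> ennreal (Kmax\<^sup>2) * q (X n i w)" for w
  proof -
   have "(norm (incr n i w))^2 = (weight n i w)^2 * (norm (r (X n i w) - r x))^2"
    by (simp add: incr_def power_mult_distrib)
   also have "\<dots> \<le> (Kmax\<^sup>2 * ball n i w) * (norm (r (X n i w) - r x))^2"
    by (intro mult_right_mono weight_square_le n) simp
   also have "\<dots> = Kmax\<^sup>2 * (norm (ball n i w *\<^sub>R (r (X n i w) - r x)))^2" by (simp add: indicator_def)
   finally show ?thesis unfolding q_def by (subst ennreal_mult[symmetric]) (auto intro: ennreal_leI)
  qed
  then have "(\<integral>\<^sup>+w. ennreal ((norm (incr n i w))^2) \<partial>M) \<le> (\<integral>\<^sup>+w. ennreal (Kmax\<^sup>2) * q (X n i w) \<partial>M)"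
   by (intro nn_integral_mono)
  also have "\<dots> = ennreal (Kmax\<^sup>2) * (\<integral>\<^sup>+w. q (X n i w) \<partial>M)" by (rule nn_integral_cmult) measurable
  also have "(\<integral>\<^sup>+w. q (X n i w) \<partial>M) = (\<integral>\<^sup>+w. q (X 1 1 w) \<partial>M)" by (rule nn_integral_distr_eq[OF n(2,3)]) measurable
  also have "\<dots> \<le> ennreal (Bc * h n * cdf (h n))" unfolding q_def by (rule Bc(3)[OF h_pos[OF n(1)] hn])
  finally have "(\<integral>\<^sup>+w. ennreal ((norm (incr n i w))^2) \<partial>M) \<le> ennreal (Kmax\<^sup>2) * ennreal (Bc * h n * cdf (h n))"
   by (simp add: mult_left_mono)
  also have "\<dots> = ennreal (Kmax\<^sup>2 * (Bc * h n * cdf (h n)))"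
   by (rule ennreal_mult[symmetric]) (use Bc(1) h_pos[OF n(1)] cdf_nonneg[of "h n"] in auto)
  finally show ?thesis by (simp only: mult.assoc)
 qed
 have hc: "0 \<le> h n * cdf (h n)" if "i \<in> {1..n}" for i n
  using that h_pos[of n] cdf_nonneg[of "h n"] by (cases "1 \<le> n") auto
 have b0: "0 \<le> Kmax\<^sup>2 * Bc * (h n * cdf (h n))" if "i \<in> {1..n}" for i n
  using Bc(1) hc[OF that] by (simp only: mult_nonneg_nonneg zero_le_power2)
 have m: "integrable M (\<lambda>w. norm (incr n i w))" "integrable M (\<lambda>w. (norm (incr n i w))^2)"
  "(LINT w|M. (norm (incr n i w))^2) \<le> Kmax\<^sup>2 * Bc * (h n * cdf (h n))"
  if i: "i \<in> {1..n}" and hn: "h n \<le> u0" for n i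
 proof -
  have [measurable]: "incr n i \<in> borel_measurable M" by (rule incr_measurable(2)[OF i])
  show "integrable M (\<lambda>w. norm (incr n i w))" "integrable M (\<lambda>w. (norm (incr n i w))^2)"
   "(LINT w|M. (norm (incr n i w))^2) \<le> Kmax\<^sup>2 * Bc * (h n * cdf (h n))"
   using first_moment_le(1,2,3)[OF _ sq[OF i hn] b0[OF i]] by simp_all
 qed
 show thesis
 proof (rule that[OF B0 Bc(2)])
  fix n i assume i: "i \<in> {1..n}" and hn: "h n \<le> u0"
  have n: "1 \<le> n" "1 \<le> i" "i \<le> n" using i by auto
  have h0: "0 < h n" by (rule h_pos[OF n(1)])
  have "Kmax\<^sup>2 * Bc * (h n * cdf (h n)) \<le> B * (h n * cdf (h n))"
   using K0 Bc(1) by (intro mult_right_mono hc[OF i]) (simp add: B_def)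
  then show "(\<integral>\<^sup>+w. ennreal ((norm (incr n i w))^2) \<partial>M) \<le> ennreal (B * (h n * cdf (h n)))"
   using sq[OF i hn] by (blast intro: order_trans ennreal_leI)
  show "integrable M (\<lambda>w. (norm (incr n i w))^2)" by (rule m(2)[OF i hn])
  show "integrable M (incr n i)"
   using m(1)[OF i hn] incr_measurable(2)[OF i] by (simp add: integrable_norm_iff)
  \<comment> \<open>on the window, the mean is estimated by the mean square, in the proportion of \<^term>\<open>sqrt (h n)\<close>\<close>
  have le: "norm (incr n i w) \<le> sqrt (h n) * (Kmax * ball n i w) + (norm (incr n i w))^2 / (Kmax * sqrt (h n))" for w
  proof (cases "D n i w \<le> h n")
   case True
   define a where "a = norm (incr n i w)"
   define s where "s = Kmax * sqrt (h n)"
   have s: "0 < s" using h0 K0 by (simp add: s_def)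
   have "a \<le> s + a\<^sup>2 / s"
   proof (cases "a \<le> s")
    case True
    moreover have "0 \<le> a\<^sup>2 / s" using s by simp
    ultimately show ?thesis by linarith
   next
    case False
    then have "a * s \<le> a * a" using s by (intro mult_left_mono) auto
    then have "a \<le> a\<^sup>2 / s" using s by (simp add: field_simps power2_eq_square)
    then show ?thesis using s by linarith
   qed
   then show ?thesis using True by (simp add: a_def s_def mult.commute)
  next
   case False
   then have "weight n i w = 0" using weight_bounds(1,2)[OF n(1), of i w] by simp
   then show ?thesis using h0 K0 by (simp add: incr_def)
  qed
  have "(LINT w|M. norm (incr n i w))
   \<le> (LINT w|M. sqrt (h n) * (Kmax * ball n i w) + (norm (incr n i w))^2 / (Kmax * sqrt (h n)))"
   using integral_ball(2)[OF n(2,3)] m[OF i hn] le by (intro Bochner_Integration.integral_mono Bochner_Integration.integrable_add) auto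
  also have "\<dots> = sqrt (h n) * (Kmax * cdf (h n)) + (LINT w|M. (norm (incr n i w))^2) / (Kmax * sqrt (h n))"
   using integral_ball(1,2)[OF n(2,3)] m[OF i hn] by (subst Bochner_Integration.integral_add) auto
  also have "\<dots> \<le> sqrt (h n) * (Kmax * cdf (h n)) + (Kmax\<^sup>2 * Bc * (h n * cdf (h n))) / (Kmax * sqrt (h n))"
   using m(3)[OF i hn] h0 K0 by (intro add_left_mono divide_right_mono) auto
  also have "(Kmax\<^sup>2 * Bc * (h n * cdf (h n))) / (Kmax * sqrt (h n)) = Kmax * Bc * (sqrt (h n) * cdf (h n))"
  proof -
   have "h n = sqrt (h n) * sqrt (h n)" using h0 by simp
   then have "(Kmax\<^sup>2 * Bc * (h n * cdf (h n))) / (Kmax * sqrt (h n)) = (Kmax\<^sup>2 * Bc * ((sqrt (h n) * sqrt (h n)) * cdf (h n))) / (Kmax * sqrt (h n))"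
    by (simp only:)
   also have "\<dots> = Kmax * Bc * (sqrt (h n) * cdf (h n))" using h0 K0 by (simp add: power2_eq_square del: real_sqrt_mult_self)
   finally show ?thesis .
  qed
  finally have "(LINT w|M. norm (incr n i w)) \<le> (Kmax + Kmax * Bc) * (sqrt (h n) * cdf (h n))"
   by (simp add: algebra_simps)
  also have "\<dots> \<le> B * (sqrt (h n) * cdf (h n))"
   unfolding B_def using Bc(1) h0 cdf_nonneg[of "h n"] by (intro mult_right_mono) auto
  finally show "(LINT w|M. norm (incr n i w)) \<le> B * (sqrt (h n) * cdf (h n))" .
 qed
qed

text \<open>The weighted response is the score plus the increment plus the weight times \<open>r x\<close>, and the score is
  centred. Hence the difference in the definition is a version of the conditional expectation of the increment.\<close>

lemma incr_bar_properties:
 assumes i: "i \<in> {1..n}" and hn: "h n \<le> \<delta>" and i2: "integrable M (\<lambda>w. (norm (incr n i w))^2)" and i1: "integrable M (incr n i)"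
 shows "wYbar n i \<in> borel_measurable M" "incr_bar n i \<in> borel_measurable M"
  "AE w in M. cexp n i (\<lambda>w. incr n i w \<bullet> basis_vec k) w = incr_bar n i w \<bullet> basis_vec k"
  "integrable M (incr_bar n i)" "(LINT w|M. norm (incr_bar n i w)) \<le> (LINT w|M. norm (incr n i w))"
proof -
 interpret F: prob_subalgebra M "sF n (i - 1)" by (rule sF_prob_subalgebra) (use i in auto)
 have [measurable]: "score n i \<in> borel_measurable M" "incr n i \<in> borel_measurable M" "weight n i \<in> borel_measurable M"
  by (rule score_measurable[OF i] incr_measurable(2)[OF i] weight_measurable[OF i])+
 define wY where "wY w = weight n i w *\<^sub>R Y n i w" for w
 have wY: "wY w = score n i w + incr n i w + weight n i w *\<^sub>R r x" for w
  by (simp add: wY_def score_def incr_def resid_def algebra_simps)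
 have [measurable]: "wY \<in> borel_measurable M" unfolding wY by measurable
 have s2: "integrable M (\<lambda>w. (norm (score n i w))^2)" by (rule score_square_integrable[OF i hn])
 have w1: "integrable M (weight n i)" and w2: "integrable M (\<lambda>w. (weight n i w)^2)"
  using weight_power_integrable[OF i, of 1] weight_power_integrable[OF i, of 2] by simp_all
 have "integrable M (\<lambda>w. (norm (wY w))^2)"
 proof (rule Bochner_Integration.integrable_bound)
  show "integrable M (\<lambda>w. 3 * ((norm (score n i w))^2 + (norm (incr n i w))^2 + (weight n i w)^2 * (norm (r x))^2))"
   using s2 i2 w2 by simp
  have "(norm (wY w))^2 \<le> 3 * ((norm (score n i w))^2 + (norm (incr n i w))^2 + (weight n i w)^2 * (norm (r x))^2)" for w
  proof -
   have 3: "(a + b + c)^2 \<le> 3 * (a\<^sup>2 + b\<^sup>2 + c\<^sup>2)" for a b c :: real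
   proof -
    have "3 * (a\<^sup>2 + b\<^sup>2 + c\<^sup>2) - (a + b + c)\<^sup>2 = (a - b)^2 + (b - c)^2 + (a - c)^2"
     by (simp add: power2_eq_square algebra_simps)
    moreover have "0 \<le> (a - b)^2 + (b - c)^2 + (a - c)^2" by simp
    ultimately show ?thesis by linarith
   qed
   have "norm (wY w) \<le> norm (score n i w) + norm (incr n i w) + \<bar>weight n i w\<bar> * norm (r x)"
    unfolding wY norm_scaleR[symmetric] by (rule norm_triangle_le[OF add_right_mono[OF norm_triangle_ineq]])
   then have "(norm (wY w))^2 \<le> (norm (score n i w) + norm (incr n i w) + \<bar>weight n i w\<bar> * norm (r x))^2"
    by (rule power_mono) simp
   also note 3
   finally show ?thesis by (simp add: power_mult_distrib)
  qed
  then show "AE w in M. norm ((norm (wY w))^2) \<le> norm (3 * ((norm (score n i w))^2 + (norm (incr n i w))^2 + (weight n i w)^2 * (norm (r x))^2))"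
   by (intro AE_I2) (simp only: real_norm_def, force intro: order_trans[OF _ abs_ge_self])
 qed measurable
 then have "\<exists>g. is_cond_exp M (sF n (i - 1)) wY g"
  by (intro H.is_cond_exp_exists F.prob_subalgebra_axioms) measurable
 then have ce: "is_cond_exp M (sF n (i - 1)) wY (wYbar n i)"
  unfolding cond_exp_def wY_def[symmetric] by (rule someI_ex)
 then have [measurable]: "wYbar n i \<in> borel_measurable M" by (auto simp: is_cond_exp_def intro: borel_measurable_integrable)
 then show "wYbar n i \<in> borel_measurable M" .
 have [measurable]: "wbar n i \<in> borel_measurable M" by (rule borel_measurable_cond_exp2)
 show [measurable]: "incr_bar n i \<in> borel_measurable M" unfolding incr_bar_def[abs_def] by measurable
 have s1: "integrable M (\<lambda>w. score n i w \<bullet> v)" for v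
  by (rule integrable_if_square_integrable[OF _ H.integrable_square_coordinate[OF _ s2]]) measurable
 have in1: "integrable M (\<lambda>w. incr n i w \<bullet> v)" for v using i1 by simp
 have wY1: "integrable M wY" using ce by (simp add: is_cond_exp_def)
 have coord: "AE w in M. cexp n i (\<lambda>w. incr n i w \<bullet> v) w = incr_bar n i w \<bullet> v" for v
 proof -
  have "(\<lambda>w. incr n i w \<bullet> v) = (\<lambda>w. (wY w \<bullet> v - score n i w \<bullet> v) - (r x \<bullet> v) * weight n i w)"
   by (rule ext) (simp add: wY inner_add_left)
  then have "AE w in M. cexp n i (\<lambda>w. incr n i w \<bullet> v) w
   = cexp n i (\<lambda>w. wY w \<bullet> v - score n i w \<bullet> v) w - cexp n i (\<lambda>w. (r x \<bullet> v) * weight n i w) w"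
   using F.real_cond_exp_diff[of "\<lambda>w. wY w \<bullet> v - score n i w \<bullet> v" "\<lambda>w. (r x \<bullet> v) * weight n i w"] wY1 s1[of v] w1 by simp
  moreover have "AE w in M. cexp n i (\<lambda>w. wY w \<bullet> v - score n i w \<bullet> v) w
   = cexp n i (\<lambda>w. wY w \<bullet> v) w - cexp n i (\<lambda>w. score n i w \<bullet> v) w"
   by (rule F.real_cond_exp_diff) (use wY1 s1 in auto)
  moreover have "AE w in M. cexp n i (\<lambda>w. (r x \<bullet> v) * weight n i w) w = (r x \<bullet> v) * wbar n i w"
   by (rule F.real_cond_exp_cmult[OF w1])
  ultimately show ?thesis using score_centred[OF i, of v] F.is_cond_exp_inner[OF ce, of v]
   by eventually_elim (simp add: incr_bar_def inner_diff_left)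
 qed
 then show "AE w in M. cexp n i (\<lambda>w. incr n i w \<bullet> basis_vec k) w = incr_bar n i w \<bullet> basis_vec k" .
 obtain g where g: "is_cond_exp M (sF n (i - 1)) (incr n i) g"
  using H.is_cond_exp_exists[OF F.prob_subalgebra_axioms _ i2] by auto
 have "AE w in M. \<forall>k. g w \<bullet> basis_vec k = incr_bar n i w \<bullet> basis_vec k"
  unfolding AE_all_countable
 proof
  fix k
  show "AE w in M. g w \<bullet> basis_vec k = incr_bar n i w \<bullet> basis_vec k"
   using coord[of "basis_vec k"] F.is_cond_exp_inner[OF g, of "basis_vec k"] by eventually_elim simp
 qed
 then have eq: "AE w in M. g w = incr_bar n i w" by eventually_elim (rule H.eq_if_coordinates_eq, blast)
 have gi: "integrable M g" using g by (simp add: is_cond_exp_def)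
 then show ib: "integrable M (incr_bar n i)" by (rule integrable_cong_AE_imp) (use eq in \<open>auto elim: eventually_mono\<close>)
 have "AE w in M. norm (incr_bar n i w) \<le> cexp n i (\<lambda>w. norm (incr n i w)) w"
  using F.norm_is_cond_exp_le[OF g] eq by eventually_elim simp
 then have "(LINT w|M. norm (incr_bar n i w)) \<le> (LINT w|M. cexp n i (\<lambda>w. norm (incr n i w)) w)"
  by (intro integral_mono_AE integrable_norm ib F.real_cond_exp_int(1) i1)
 also have "\<dots> = (LINT w|M. norm (incr n i w))" by (rule F.real_cond_exp_int(2)) (use i1 in simp)
 finally show "(LINT w|M. norm (incr_bar n i w)) \<le> (LINT w|M. norm (incr n i w))" .
qed

lemma norming_eq:
 assumes "1 \<le> n" "0 < \<phi> (h n)" "rho n \<noteq> 0"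
 shows "inverse (norming M d X K x n (h n)) = rho n / (real n * \<phi> (h n))"
  "rate n * inverse (norming M d X K x n (h n)) = rho n / rate n"
proof -
 show 1: "inverse (norming M d X K x n (h n)) = rho n / (real n * \<phi> (h n))"
  using assms by (simp add: norming_def Delta_def rho_def field_simps)
 show "rate n * inverse (norming M d X K x n (h n)) = rho n / rate n"
  unfolding 1 rate_square[OF assms(1), symmetric] by (simp add: power2_eq_square)
qed

lemma rho_pos: "\<forall>\<^sub>F n in sequentially. 0 < rho n"
 by (rule order_tendstoD(1)[OF rho_tendsto]) (use f1_pos M_const_pos[of 1] in simp)

text \<open>The centred sums are estimated in mean square. For \<^const>\<open>mean_incr\<close>, which is not centred, the bound is the
  mean of the increments.\<close>

lemma remainder_bounds:
 obtains c r1 r2 where "0 \<le> c" "r1 \<longlonglongrightarrow> 0" "r2 \<longlonglongrightarrow> 0"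
  "\<forall>\<^sub>F n in sequentially. (\<forall>i\<in>{1..n}. wYbar n i \<in> borel_measurable M)"
  "\<forall>\<^sub>F n in sequentially. integrable M (mean_incr n) \<and> (LINT w|M. norm (mean_incr n w)) \<le> r1 n"
  "\<forall>\<^sub>F n in sequentially. integrable M (\<lambda>w. norm (incr_rest n w)) \<and> (LINT w|M. norm (incr_rest n w)) \<le> r2 n"
  "\<forall>\<^sub>F n in sequentially. integrable M (\<lambda>w. (weight_rest n w)^2) \<and> (LINT w|M. (weight_rest n w)^2) \<le> c"
proof -
 obtain B u0 where B: "0 \<le> B" "0 < u0"
  "\<And>n i. i \<in> {1..n} \<Longrightarrow> h n \<le> u0 \<Longrightarrow> (\<integral>\<^sup>+w. ennreal ((norm (incr n i w))^2) \<partial>M) \<le> ennreal (B * (h n * cdf (h n)))"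
  "\<And>n i. i \<in> {1..n} \<Longrightarrow> h n \<le> u0 \<Longrightarrow> integrable M (\<lambda>w. (norm (incr n i w))^2)"
  "\<And>n i. i \<in> {1..n} \<Longrightarrow> h n \<le> u0 \<Longrightarrow> integrable M (incr n i)"
  "\<And>n i. i \<in> {1..n} \<Longrightarrow> h n \<le> u0 \<Longrightarrow> (LINT w|M. norm (incr n i w)) \<le> B * (sqrt (h n) * cdf (h n))"
  by (rule incr_bounds) blast
 define q where "q n = cdf (h n) / \<phi> (h n)" for n
 have q: "q \<longlonglongrightarrow> f1 x" unfolding q_def[abs_def] by (rule cdf_ratio_one)
 define l where "l = 1 / (f1 x * M_const K \<tau>0 1)"
 have rho: "rho \<longlonglongrightarrow> l" unfolding l_def by (rule rho_tendsto)
 define r1 where "r1 n = rho n * (B * (sqrt (h n) * q n))" for n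
 define r2 where "r2 n = sqrt ((rho n)^2 * (B * (h n * q n)))" for n
 have "r1 \<longlonglongrightarrow> l * (B * (sqrt 0 * f1 x))" unfolding r1_def[abs_def] by (intro tendsto_intros rho q h_tendsto)
 then have r1: "r1 \<longlonglongrightarrow> 0" by simp
 have "r2 \<longlonglongrightarrow> sqrt (l\<^sup>2 * (B * (0 * f1 x)))" unfolding r2_def[abs_def] by (intro tendsto_intros rho q h_tendsto)
 then have r2: "r2 \<longlonglongrightarrow> 0" by simp
 define c where "c = l\<^sup>2 * (Kmax\<^sup>2 * f1 x) + 1"
 have c0: "0 \<le> c" using f1_pos by (simp add: c_def)
 have "(\<lambda>n. (rho n)^2 * (Kmax\<^sup>2 * q n)) \<longlonglongrightarrow> l\<^sup>2 * (Kmax\<^sup>2 * f1 x)" by (intro tendsto_intros rho q)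
 then have cl: "\<forall>\<^sub>F n in sequentially. (rho n)^2 * (Kmax\<^sup>2 * q n) < c" by (rule order_tendstoD) (simp add: c_def)
 note ev = h_le_eventually[OF delta_pos] h_le_eventually[OF B(2)] phi_pos rho_pos rate_pos eventually_ge_at_top[of 1]
 show thesis
 proof (rule that[OF c0 r1 r2])
  show "\<forall>\<^sub>F n in sequentially. (\<forall>i\<in>{1..n}. wYbar n i \<in> borel_measurable M)"
   using ev(1,2)
  proof eventually_elim
   case (elim n)
   show ?case using incr_bar_properties(1)[OF _ elim(1) B(4)[OF _ elim(2)] B(5)[OF _ elim(2)]] by blast
  qed
  show "\<forall>\<^sub>F n in sequentially. integrable M (mean_incr n) \<and> (LINT w|M. norm (mean_incr n w)) \<le> r1 n"
   using ev
  proof eventually_elim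
   case (elim n)
   note p = incr_bar_properties[OF _ elim(1) B(4)[OF _ elim(2)] B(5)[OF _ elim(2)]]
   define g where "g = rho n / (real n * \<phi> (h n))"
   have g0: "0 \<le> g" using elim by (simp add: g_def)
   have mi: "mean_incr n w = g *\<^sub>R (\<Sum>i=1..n. incr_bar n i w)" for w
    using norming_eq(1)[OF elim(6,3)] elim(4) by (simp add: mean_incr_def g_def)
   have int: "integrable M (mean_incr n)"
    unfolding mi[abs_def] by (rule integrable_scaleR_right, rule Bochner_Integration.integrable_sum) (use p(4) in simp)
   have "(LINT w|M. norm (mean_incr n w)) \<le> (LINT w|M. g * (\<Sum>i=1..n. norm (incr_bar n i w)))"
   proof (rule Bochner_Integration.integral_mono)
    show "integrable M (\<lambda>w. norm (mean_incr n w))" using int by simp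
    show "integrable M (\<lambda>w. g * (\<Sum>i=1..n. norm (incr_bar n i w)))"
     by (rule integrable_mult_right, rule Bochner_Integration.integrable_sum, rule integrable_norm) (use p(4) in simp)
    show "norm (mean_incr n w) \<le> g * (\<Sum>i=1..n. norm (incr_bar n i w))" for w
     unfolding mi using g0 by (simp add: mult_left_mono norm_sum)
   qed
   also have "\<dots> = g * (\<Sum>i=1..n. (LINT w|M. norm (incr_bar n i w)))"
    using p(4) by (subst integral_mult_right_zero, subst Bochner_Integration.integral_sum) auto
   also have "\<dots> \<le> g * (\<Sum>i=1..n. B * (sqrt (h n) * cdf (h n)))"
   proof (intro mult_left_mono[OF _ g0] sum_mono)
    fix i assume i: "i \<in> {1..n}"
    show "(LINT w|M. norm (incr_bar n i w)) \<le> B * (sqrt (h n) * cdf (h n))"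
     by (rule order_trans[OF p(5)[OF i i i] B(6)[OF i elim(2)]])
   qed
   also have "\<dots> = r1 n" using elim by (simp add: g_def r1_def q_def)
   finally show ?case using int by simp
  qed
  show "\<forall>\<^sub>F n in sequentially. integrable M (\<lambda>w. norm (incr_rest n w)) \<and> (LINT w|M. norm (incr_rest n w)) \<le> r2 n"
   using ev
  proof eventually_elim
   case (elim n)
   note p = incr_bar_properties[OF _ elim(1) B(4)[OF _ elim(2)] B(5)[OF _ elim(2)]]
   define b where "b = B * (h n * cdf (h n))"
   have b0: "0 \<le> b" using B(1) h_pos[OF elim(6)] cdf_nonneg[of "h n"] by (simp add: b_def)
   define S where "S w = (\<Sum>i=1..n. incr n i w - incr_bar n i w)" for w
   define c where "c = (rho n / rate n)^2"
   have [measurable]: "S \<in> borel_measurable M" unfolding S_def[abs_def]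
    by (intro borel_measurable_sum borel_measurable_diff incr_measurable(2) p(2))
   have "(\<integral>\<^sup>+w. ennreal ((norm (S w - H.proj 0 (S w)))^2) \<partial>M) \<le> ennreal (n * b)"
    unfolding S_def
   proof (rule H.centred_sum_norm_second_moment[OF filtered[of n]])
    fix i assume i: "i \<in> {1..n}"
    have mi: "min (i - 1) n = i - 1" "min i n = i" using i by auto
    show "incr n i \<in> borel_measurable (sF n (min i n))" unfolding mi by (rule incr_measurable(1)[OF i])
    show "incr_bar n i \<in> borel_measurable M" by (rule p(2)[OF i i i])
    show "integrable M (\<lambda>w. (norm (incr n i w))^2)" by (rule B(4)[OF i elim(2)])
    show "AE w in M. real_cond_exp M (sF n (min (i - 1) n)) (\<lambda>w. incr n i w \<bullet> basis_vec k) w = incr_bar n i w \<bullet> basis_vec k" for k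
     unfolding mi by (rule p(3)[OF i i i])
    show "(\<integral>\<^sup>+w. ennreal ((norm (incr n i w - H.proj 0 (incr n i w)))^2) \<partial>M) \<le> ennreal b"
     using B(3)[OF i elim(2)] by (simp add: b_def H.proj_def)
   qed (rule b0)
   then have S: "(\<integral>\<^sup>+w. ennreal ((norm (S w))^2) \<partial>M) \<le> ennreal (n * b)" by (simp add: H.proj_def)
   have sq: "(norm (incr_rest n w))^2 = c * (norm (S w))^2" for w
    unfolding incr_rest_def S_def c_def by (simp only: norm_scaleR power_mult_distrib power2_abs)
   have "(\<integral>\<^sup>+w. ennreal ((norm (incr_rest n w))^2) \<partial>M) = ennreal c * (\<integral>\<^sup>+w. ennreal ((norm (S w))^2) \<partial>M)"
    unfolding sq by (subst nn_integral_cmult[symmetric]) (simp_all add: ennreal_mult c_def)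
   also have "\<dots> \<le> ennreal c * ennreal (n * b)" by (intro mult_left_mono S) simp
   also have "\<dots> = ennreal (c * (n * b))" by (rule ennreal_mult[symmetric]) (use b0 in \<open>simp_all add: c_def\<close>)
   also have "c * (n * b) = (rho n)^2 * (B * (h n * q n))"
    unfolding c_def scale_square[OF elim(6)] b_def q_def using elim(3,6) by simp
   finally have le: "(\<integral>\<^sup>+w. ennreal ((norm (incr_rest n w))^2) \<partial>M) \<le> ennreal ((rho n)^2 * (B * (h n * q n)))" .
   have [measurable]: "incr_rest n \<in> borel_measurable M"
    unfolding incr_rest_def[abs_def] S_def[symmetric] by measurable
   have nn: "0 \<le> (rho n)^2 * (B * (h n * q n))"
    using B(1) h_pos[OF elim(6)] cdf_nonneg[of "h n"] elim(3) by (simp add: q_def)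
   show ?case
    using first_moment_le(1,4)[OF _ le nn] by (simp add: r2_def)
  qed
  show "\<forall>\<^sub>F n in sequentially. integrable M (\<lambda>w. (weight_rest n w)^2) \<and> (LINT w|M. (weight_rest n w)^2) \<le> c"
   using ev(3,6) cl
  proof eventually_elim
   case (elim n)
   define F where "F i = sF n (min i n)" for i
   interpret filtered_prob M F unfolding F_def by (rule filtered)
   define S where "S w = (\<Sum>i=1..n. weight n i w - real_cond_exp M (F (i - 1)) (weight n i) w)" for w
   have wm: "weight n i \<in> borel_measurable (F i)" if i: "i \<in> {1..n}" for i
   proof -
    have "min i n = i" using i by auto
    then show ?thesis using score_sF_measurable(2)[OF i, of i] by (simp add: F_def)
   qed
   have w2: "integrable M (\<lambda>w. (weight n i w)^2)" if "i \<in> {1..n}" for i by (rule weight_power_integrable[OF that])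
   have S: "integrable M (\<lambda>w. (S w)^2)" "(LINT w|M. (S w)^2) \<le> (\<Sum>i=1..n. (LINT w|M. (weight n i w)^2))"
    unfolding S_def using centred_sum_second_moment[OF wm w2, of n] by simp_all
   have "(\<Sum>i=1..n. (LINT w|M. (weight n i w)^2)) \<le> (\<Sum>i=1..n. Kmax\<^sup>2 * cdf (h n))"
   proof (rule sum_mono)
    fix i assume i: "i \<in> {1..n}"
    then have i': "1 \<le> i" "i \<le> n" by auto
    have "(LINT w|M. (weight n i w)^2) \<le> (LINT w|M. Kmax\<^sup>2 * ball n i w)"
     using integral_ball(2)[OF i'] by (intro Bochner_Integration.integral_mono w2[OF i] weight_square_le[OF elim(2)]) simp
    then show "(LINT w|M. (weight n i w)^2) \<le> Kmax\<^sup>2 * cdf (h n)" using integral_ball(1)[OF i'] by simp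
   qed
   then have S2: "(LINT w|M. (S w)^2) \<le> real n * (Kmax\<^sup>2 * cdf (h n))" using S(2) by simp
   have eq: "weight_rest n w = (rho n / rate n) * S w" for w
    unfolding weight_rest_def S_def
   proof (intro arg_cong2[where f="(*)"] refl sum.cong arg_cong2[where f="(-)"])
    fix i assume "i \<in> {1..n}"
    then have "min (i - 1) n = i - 1" by auto
    then show "wbar n i w = real_cond_exp M (F (i - 1)) (weight n i) w" by (simp only: F_def)
   qed
   have "(LINT w|M. (weight_rest n w)^2) = (rho n / rate n)^2 * (LINT w|M. (S w)^2)"
    unfolding eq power_mult_distrib by simp
   also have "\<dots> \<le> (rho n / rate n)^2 * (real n * (Kmax\<^sup>2 * cdf (h n)))" by (intro mult_left_mono S2) simp
   also have "\<dots> = (rho n)^2 * (Kmax\<^sup>2 * q n)"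
    unfolding scale_square[OF elim(2)] q_def using elim(1,2) by simp
   finally have le: "(LINT w|M. (weight_rest n w)^2) \<le> (rho n)^2 * (Kmax\<^sup>2 * q n)" .
   have "integrable M (\<lambda>w. (weight_rest n w)^2)"
    unfolding eq power_mult_distrib by (rule integrable_mult_right[OF S(1)])
   then show ?case using le elim(3) by simp
  qed
 qed
qed

end

section \<open>The estimator and the sum of the scores\<close>

text \<open>If \<open>a\<close> and \<open>b\<close> are close to 1 and \<open>w\<close> is not too large, then the norm is small; the first,
 second and fifth term on the right exceed 1 in the other cases.\<close>

lemma perturbed_ratio_bound:
 fixes T R A S :: "'h::real_normed_vector"
 assumes S: "a \<noteq> 0 \<Longrightarrow> b \<noteq> 0 \<Longrightarrow> S = (1 / a) *\<^sub>R (T + R) - (w / (a * b)) *\<^sub>R A"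
  and \<eta>: "0 < \<eta>" "\<eta> \<le> 1 / 2" and B: "0 < B"
 shows "min 1 (norm (S - T)) \<le> \<bar>a - 1\<bar> / \<eta> + 2 * \<bar>b - 1\<bar> + 2 * \<eta> * norm T + 2 * norm R + w\<^sup>2 / B\<^sup>2 + 4 * B * norm A"
proof -
 define t where "t = (\<bar>a - 1\<bar> / \<eta>, \<bar>b - 1\<bar>, w\<^sup>2 / B\<^sup>2)"
 define u where "u = 2 * \<eta> * norm T + 2 * norm R + 4 * B * norm A"
 have nn: "0 \<le> fst t" "0 \<le> fst (snd t)" "0 \<le> snd (snd t)" "0 \<le> u"
  using \<eta> B by (simp_all add: t_def u_def)
 have goal: "?thesis \<longleftrightarrow> min 1 (norm (S - T)) \<le> fst t + 2 * fst (snd t) + snd (snd t) + u"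
  by (simp add: t_def u_def algebra_simps)
 consider "\<eta> < \<bar>a - 1\<bar>" | "1 / 2 < \<bar>b - 1\<bar>" | "B < \<bar>w\<bar>" | "\<bar>a - 1\<bar> \<le> \<eta>" "\<bar>b - 1\<bar> \<le> 1 / 2" "\<bar>w\<bar> \<le> B" by linarith
 then show ?thesis
 proof cases
  case 1
  then have "1 \<le> fst t" using \<eta> by (simp add: t_def)
  then show ?thesis unfolding goal using nn by linarith
 next
  case 2
  then have "1 / 2 < fst (snd t)" by (simp add: t_def)
  then show ?thesis unfolding goal using nn by linarith
 next
  case 3
  then have "B\<^sup>2 \<le> w\<^sup>2" using B by (intro abs_le_square_iff[THEN iffD1]) simp
  then have "1 \<le> snd (snd t)" using B by (simp add: t_def)
  then show ?thesis unfolding goal using nn by linarith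
 next
  case 4
  then have a: "1 / 2 \<le> a" and b: "1 / 2 \<le> b" using \<eta> by linarith+
  have ia: "1 / a \<le> 2" and ib: "1 / b \<le> 2" using a b by (simp_all add: field_simps)
  have "S - T = ((1 - a) * (1 / a)) *\<^sub>R T + (1 / a) *\<^sub>R R - (w * ((1 / a) * (1 / b))) *\<^sub>R A"
  proof -
   have "(1 - a) * (1 / a) = 1 / a - 1" using a by (simp add: field_simps)
   then show ?thesis using S a b by (simp add: scaleR_add_right scaleR_diff_left)
  qed
  then have "norm (S - T) \<le> norm (((1 - a) * (1 / a)) *\<^sub>R T) + norm ((1 / a) *\<^sub>R R) + norm ((w * ((1 / a) * (1 / b))) *\<^sub>R A)"
   using norm_triangle_ineq4 norm_triangle_ineq by (metis (no_types, lifting) add_right_mono order_trans)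
  also have "\<dots> = \<bar>1 - a\<bar> * (1 / a) * norm T + (1 / a) * norm R + \<bar>w\<bar> * ((1 / a) * (1 / b)) * norm A"
   using a b by (simp add: abs_mult)
  also have "\<dots> \<le> \<eta> * 2 * norm T + 2 * norm R + B * (2 * 2) * norm A"
   using a b ia ib 4 \<eta> B by (intro add_mono mult_right_mono mult_mono) auto
  finally have "norm (S - T) \<le> u" by (simp add: u_def)
  then show ?thesis unfolding goal using nn by linarith
 qed
qed

lemma norm_integral_le:
 fixes f :: "'w \<Rightarrow> 'v::{banach,second_countable_topology}"
 assumes "integrable M f" "integrable M g" "\<And>w. norm (f w) \<le> g w"
 shows "norm (LINT w|M. f w) \<le> (LINT w|M. g w)"
 by (rule order_trans[OF integral_norm_bound Bochner_Integration.integral_mono]) (use assms in auto)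

context functional_regression
begin

abbreviation r1hat :: "nat \<Rightarrow> 'w \<Rightarrow> real" where "r1hat n \<equiv> rhat1 M d X K x n (h n)"
abbreviation r1bar :: "nat \<Rightarrow> 'w \<Rightarrow> real" where "r1bar n \<equiv> rbar1 M d X Y K x n (h n)"

definition statistic :: "nat \<Rightarrow> 'w \<Rightarrow> 'h" where
 "statistic n w = sqrt (real n * \<phi> (h n)) *\<^sub>R
   (rhat M d X Y K x n (h n) w - r x - cond_bias M d X Y K r x n (h n) w)"

lemma weight_rest_eq:
 assumes "1 \<le> n" "0 < \<phi> (h n)" "0 < rho n"
 shows "weight_rest n w = rate n * (r1hat n w - r1bar n w)"
proof -
 have "rho n / rate n = rate n * inverse (norming M d X K x n (h n))" using norming_eq(2) assms by simp
 then show ?thesis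
  unfolding weight_rest_def rhat1_def rbar1_def divide_inverse[of "sum _ _"] sum_subtractf
  by (simp only: left_diff_distrib right_diff_distrib mult_ac)
qed

text \<open>Both fractions contain \<open>r x\<close> with coefficient 1 and \<open>mean_incr n\<close> in the numerator; these cancel up to the
  difference of the reciprocal denominators, which is of the order \<open>1 / rate n\<close>.\<close>

lemma statistic_expansion:
 assumes n: "1 \<le> n" "0 < \<phi> (h n)" "0 < rho n" "0 < rate n" and a: "r1hat n w \<noteq> 0" and b: "r1bar n w \<noteq> 0"
 shows "statistic n w = (1 / r1hat n w) *\<^sub>R (score_sum n w + incr_rest n w)
  - (weight_rest n w / (r1hat n w * r1bar n w)) *\<^sub>R mean_incr n w"
proof -
 define g where "g = inverse (norming M d X K x n (h n))"
 define a where "a = r1hat n w"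
 define b where "b = r1bar n w"
 have ab: "a \<noteq> 0" "b \<noteq> 0" using assms(5,6) by (simp_all add: a_def b_def)
 have sg: "rho n / rate n = rate n * g" using norming_eq(2)[OF n(1,2)] n(3) by (simp add: g_def)
 have a': "a = g * (\<Sum>i=1..n. weight n i w)" by (simp add: a_def rhat1_def g_def divide_inverse mult.commute)
 have b': "b = g * (\<Sum>i=1..n. wbar n i w)" by (simp add: b_def rbar1_def g_def divide_inverse mult.commute)
 have hat: "rhat2 M d X Y K x n (h n) w = a *\<^sub>R r x + (1 / rate n) *\<^sub>R (score_sum n w + incr_rest n w) + mean_incr n w"
 proof -
  have "(\<Sum>i=1..n. weight n i w *\<^sub>R Y n i w)
   = (\<Sum>i=1..n. weight n i w *\<^sub>R r x + (score n i w + (incr n i w - incr_bar n i w) + incr_bar n i w))"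
   by (intro sum.cong refl) (simp add: score_def incr_def resid_def algebra_simps)
  also have "\<dots> = (\<Sum>i=1..n. weight n i w) *\<^sub>R r x + ((\<Sum>i=1..n. score n i w) + (\<Sum>i=1..n. incr n i w - incr_bar n i w)
    + (\<Sum>i=1..n. incr_bar n i w))"
   by (simp only: sum.distrib scaleR_sum_left)
  finally have "rhat2 M d X Y K x n (h n) w = a *\<^sub>R r x + (g *\<^sub>R (\<Sum>i=1..n. score n i w) + g *\<^sub>R (\<Sum>i=1..n. incr n i w - incr_bar n i w)
    + mean_incr n w)"
   by (simp only: rhat2_def g_def[symmetric] a' mean_incr_def scaleR_add_right scaleR_scaleR)
  moreover have "g *\<^sub>R (\<Sum>i=1..n. score n i w) = (1 / rate n) *\<^sub>R score_sum n w"
   unfolding score_sum_def scaled_score_def scaleR_sum_right[symmetric] sg using n(4) by simp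
  moreover have "g *\<^sub>R (\<Sum>i=1..n. incr n i w - incr_bar n i w) = (1 / rate n) *\<^sub>R incr_rest n w"
   unfolding incr_rest_def sg using n(4) by simp
  ultimately show ?thesis by (simp add: scaleR_add_right)
 qed
 have bar: "rbar2 M d X Y K x n (h n) w = b *\<^sub>R r x + mean_incr n w"
 proof -
  have "(\<Sum>i=1..n. wYbar n i w) = (\<Sum>i=1..n. wbar n i w *\<^sub>R r x + incr_bar n i w)"
   by (intro sum.cong refl) (simp add: incr_bar_def)
  also have "\<dots> = (\<Sum>i=1..n. wbar n i w) *\<^sub>R r x + (\<Sum>i=1..n. incr_bar n i w)"
   by (simp only: sum.distrib scaleR_sum_left)
  finally show ?thesis
   by (simp only: rbar2_def g_def[symmetric] b' mean_incr_def scaleR_add_right scaleR_scaleR)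
 qed
 have y: "weight_rest n w = rate n * (a - b)"
  unfolding a_def b_def by (rule weight_rest_eq[OF n(1-3)])
 have "statistic n w = rate n *\<^sub>R ((1 / a) *\<^sub>R (a *\<^sub>R r x + (1 / rate n) *\<^sub>R (score_sum n w + incr_rest n w) + mean_incr n w)
   - r x - ((1 / b) *\<^sub>R (b *\<^sub>R r x + mean_incr n w) - r x))"
  by (simp only: statistic_def rate_def rhat_def cond_bias_def hat bar a_def b_def inverse_eq_divide)
 also have "\<dots> = (1 / a) *\<^sub>R (score_sum n w + incr_rest n w) + (rate n * (1 / a - 1 / b)) *\<^sub>R mean_incr n w"
  using ab n(4) by (simp add: scaleR_add_right scaleR_diff_right scaleR_diff_left right_diff_distrib)
 also have "rate n * (1 / a - 1 / b) = - (weight_rest n w / (a * b))" unfolding y using ab by (simp add: field_simps)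
 finally show ?thesis by (simp add: a_def b_def)
qed

text \<open>By \<open>kernel_moment_L1\<close> the numerator divided by \<open>n * \<phi> (h n)\<close> tends to \<open>f1 x * M_const K \<tau>0 1\<close>, of which
  \<open>rho n\<close> tends to the reciprocal.\<close>

lemma r1bar_L1:
 "\<forall>\<^sub>F n in sequentially. integrable M (r1bar n)" "(\<lambda>n. (LINT w|M. \<bar>r1bar n w - 1\<bar>)) \<longlonglongrightarrow> 0"
proof -
 have wi: "integrable M (wbar n i)" if i: "i \<in> {1..n}" for n i
 proof -
  interpret F: prob_subalgebra M "sF n (i - 1)" by (rule sF_prob_subalgebra) (use i in auto)
  show ?thesis by (rule F.real_cond_exp_int(1)) (use weight_power_integrable[OF i, of 1] in simp)
 qed
 have int: "integrable M (r1bar n)" for n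
  unfolding rbar1_def[abs_def] by (rule integrable_divide, rule Bochner_Integration.integrable_sum, rule wi)
 then show "\<forall>\<^sub>F n in sequentially. integrable M (r1bar n)" by simp
 define l where "l = f1 x * M_const K \<tau>0 1"
 have l0: "0 < l" using f1_pos M_const_pos[of 1] by (simp add: l_def)
 define m where "m n w = (\<Sum>i=1..n. wbar n i w) / (real n * \<phi> (h n))" for n w
 define dm where "dm n = (LINT w|M. \<bar>m n w - l\<bar>)" for n
 have mi: "integrable M (m n)" for n
  unfolding m_def[abs_def] by (rule integrable_divide, rule Bochner_Integration.integrable_sum, rule wi)
 have dm: "dm \<longlonglongrightarrow> 0" unfolding dm_def[abs_def] m_def l_def using kernel_moment_L1[of 1] by (simp only: power_one_right)
 have rho: "rho \<longlonglongrightarrow> 1 / l" unfolding l_def by (rule rho_tendsto)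
 have "(\<lambda>n. \<bar>rho n\<bar> * dm n + \<bar>rho n * l - 1\<bar>) \<longlonglongrightarrow> \<bar>1 / l\<bar> * 0 + \<bar>1 / l * l - 1\<bar>"
  by (intro tendsto_intros rho dm)
 then have lim: "(\<lambda>n. \<bar>rho n\<bar> * dm n + \<bar>rho n * l - 1\<bar>) \<longlonglongrightarrow> 0" using l0 by simp
 have "\<forall>\<^sub>F n in sequentially. norm (LINT w|M. \<bar>r1bar n w - 1\<bar>) \<le> \<bar>rho n\<bar> * dm n + \<bar>rho n * l - 1\<bar>"
  using phi_pos rho_pos eventually_ge_at_top[of 1]
 proof eventually_elim
  case (elim n)
  have eq: "r1bar n w = rho n * m n w" for w
   using norming_eq(1)[OF elim(3,1)] elim(2) by (simp add: rbar1_def m_def divide_inverse)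
  have "\<bar>r1bar n w - 1\<bar> \<le> \<bar>rho n\<bar> * \<bar>m n w - l\<bar> + \<bar>rho n * l - 1\<bar>" for w
  proof -
   have "r1bar n w - 1 = rho n * (m n w - l) + (rho n * l - 1)" by (simp add: eq algebra_simps)
   then show ?thesis using abs_triangle_ineq[of "rho n * (m n w - l)" "rho n * l - 1"] by (simp add: abs_mult)
  qed
  then have "(LINT w|M. \<bar>r1bar n w - 1\<bar>) \<le> (LINT w|M. \<bar>rho n\<bar> * \<bar>m n w - l\<bar> + \<bar>rho n * l - 1\<bar>)"
   using int[of n] mi[of n] by (intro Bochner_Integration.integral_mono) auto
  also have "\<dots> = \<bar>rho n\<bar> * dm n + \<bar>rho n * l - 1\<bar>" using mi[of n] by (simp add: dm_def prob_space)
  finally show ?case by simp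
 qed
 then show "(\<lambda>n. (LINT w|M. \<bar>r1bar n w - 1\<bar>)) \<longlonglongrightarrow> 0" by (rule Lim_null_comparison[OF _ lim])
qed

lemma statistic_measurable:
 assumes "\<forall>i\<in>{1..n}. wYbar n i \<in> borel_measurable M"
 shows "statistic n \<in> borel_measurable M"
proof -
 have "weight n i \<in> borel_measurable M" "Y n i \<in> borel_measurable M" if "i \<in> {1..n}" for i
  using that weight_measurable[OF that] Y_measurable[of i n] by auto
 then have [measurable]: "(\<lambda>w. \<Sum>i=1..n. weight n i w) \<in> borel_measurable M" "(\<lambda>w. \<Sum>i=1..n. weight n i w *\<^sub>R Y n i w) \<in> borel_measurable M"
  by (intro borel_measurable_sum borel_measurable_scaleR; simp)+
 have [measurable]: "(\<lambda>w. \<Sum>i=1..n. wbar n i w) \<in> borel_measurable M" "(\<lambda>w. \<Sum>i=1..n. wYbar n i w) \<in> borel_measurable M"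
  using assms by (auto intro!: borel_measurable_sum borel_measurable_cond_exp2)
 show ?thesis
  unfolding statistic_def[abs_def] rhat_def rhat2_def rhat1_def cond_bias_def rbar2_def rbar1_def by measurable
qed

text \<open>In \<open>perturbed_ratio_bound\<close> the parameters \<open>\<eta>\<close> and \<open>B\<close> are fixed first, small enough and large enough for
  the terms with bounded means; the other terms tend to 0.\<close>

lemma statistic_close:
 "(\<lambda>n. (LINT w|M. min 1 (norm (statistic n w - score_sum n w)))) \<longlonglongrightarrow> 0"
 "\<forall>\<^sub>F n in sequentially. statistic n \<in> borel_measurable M"
proof -
 obtain c r1 r2 where c: "0 \<le> c" and r: "r1 \<longlonglongrightarrow> 0" "r2 \<longlonglongrightarrow> 0" and
  wY: "\<forall>\<^sub>F n in sequentially. (\<forall>i\<in>{1..n}. wYbar n i \<in> borel_measurable M)" and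
  A: "\<forall>\<^sub>F n in sequentially. integrable M (mean_incr n) \<and> (LINT w|M. norm (mean_incr n w)) \<le> r1 n" and
  R: "\<forall>\<^sub>F n in sequentially. integrable M (\<lambda>w. norm (incr_rest n w)) \<and> (LINT w|M. norm (incr_rest n w)) \<le> r2 n" and
  y: "\<forall>\<^sub>F n in sequentially. integrable M (\<lambda>w. (weight_rest n w)^2) \<and> (LINT w|M. (weight_rest n w)^2) \<le> c"
  by (rule remainder_bounds) blast
 show sm: "\<forall>\<^sub>F n in sequentially. statistic n \<in> borel_measurable M"
  using wY by eventually_elim (rule statistic_measurable)
 obtain cT0 where cT0: "0 \<le> cT0" "\<forall>\<^sub>F n in sequentially. \<forall>N. integrable M (\<lambda>w. score_tail_norm n N w)
  \<and> (LINT w|M. score_tail_norm n N w) \<le> sqrt (cT0 * tail_bound N)"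
  by (rule score_sum_moments) blast
 define cT where "cT = sqrt (cT0 * tail_bound 0)"
 have cT: "0 \<le> cT" using cT0(1) tail_bound_nonneg[of 0] by (simp add: cT_def)
 have T: "\<forall>\<^sub>F n in sequentially. integrable M (\<lambda>w. norm (score_sum n w)) \<and> (LINT w|M. norm (score_sum n w)) \<le> cT"
  using cT0(2)
 proof eventually_elim
  case (elim n)
  show ?case using elim[rule_format, of 0] by (simp add: H.proj_def cT_def)
 qed
 define eb where "eb n = (LINT w|M. \<bar>r1bar n w - 1\<bar>)" for n
 have eb: "eb \<longlonglongrightarrow> 0" unfolding eb_def[abs_def] by (rule r1bar_L1(2))
 have ea: "\<forall>\<^sub>F n in sequentially. integrable M (\<lambda>w. \<bar>r1hat n w - 1\<bar>) \<and> (LINT w|M. \<bar>r1hat n w - 1\<bar>) \<le> (1 + c) / rate n + eb n"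
  using y r1bar_L1(1) phi_pos rho_pos rate_pos eventually_ge_at_top[of 1]
 proof eventually_elim
  case (elim n)
  have i1: "integrable M (r1hat n)"
   unfolding rhat1_def[abs_def] by (rule integrable_divide, rule Bochner_Integration.integrable_sum)
    (use weight_power_integrable[of _ n 1] in simp)
  have le: "\<bar>r1hat n w - 1\<bar> \<le> (1 + (weight_rest n w)^2) / rate n + \<bar>r1bar n w - 1\<bar>" for w
  proof -
   have "weight_rest n w = rate n * (r1hat n w - r1bar n w)" by (rule weight_rest_eq[OF elim(6,3,4)])
   then have "r1hat n w - 1 = weight_rest n w / rate n + (r1bar n w - 1)" using elim(5) by simp
   then have "\<bar>r1hat n w - 1\<bar> \<le> \<bar>weight_rest n w\<bar> / rate n + \<bar>r1bar n w - 1\<bar>"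
    using elim(5) abs_triangle_ineq[of "weight_rest n w / rate n" "r1bar n w - 1"] by simp
   moreover have "\<bar>weight_rest n w\<bar> \<le> 1 + (weight_rest n w)^2"
   proof -
    have "0 \<le> (\<bar>weight_rest n w\<bar> - 1 / 2)^2" by simp
    then show ?thesis by (simp add: power2_diff power2_eq_square[of "1 / 2 :: real"])
   qed
   then have "\<bar>weight_rest n w\<bar> / rate n \<le> (1 + (weight_rest n w)^2) / rate n" using elim(5) by (intro divide_right_mono) auto
   ultimately show ?thesis by linarith
  qed
  have "(LINT w|M. \<bar>r1hat n w - 1\<bar>) \<le> (LINT w|M. (1 + (weight_rest n w)^2) / rate n + \<bar>r1bar n w - 1\<bar>)"
   using i1 elim(1,2) le by (intro Bochner_Integration.integral_mono) auto
  also have "\<dots> = (1 + (LINT w|M. (weight_rest n w)^2)) / rate n + eb n"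
   using elim(1,2) by (simp add: eb_def prob_space)
  also have "\<dots> \<le> (1 + c) / rate n + eb n" using elim(1,5) by (simp add: divide_right_mono)
  finally show ?case using i1 by simp
 qed
 have ir: "(\<lambda>n. (1 + c) / rate n) \<longlonglongrightarrow> 0"
  by (rule tendsto_divide_0[OF tendsto_const filterlim_at_top_imp_at_infinity[OF rate_at_top]])
 show "(\<lambda>n. (LINT w|M. min 1 (norm (statistic n w - score_sum n w)))) \<longlonglongrightarrow> 0"
 proof (rule tendstoI)
  fix \<epsilon> :: real assume \<epsilon>: "0 < \<epsilon>"
  define \<eta> where "\<eta> = min (1 / 2) (\<epsilon> / (8 * (cT + 1)))"
  have \<eta>: "0 < \<eta>" "\<eta> \<le> 1 / 2"
  proof -
   show "0 < \<eta>" using \<epsilon> cT by (simp add: \<eta>_def)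
   show "\<eta> \<le> 1 / 2" unfolding \<eta>_def by (rule min.cobounded1)
  qed
  have "2 * \<eta> * cT \<le> 2 * (\<epsilon> / (8 * (cT + 1))) * (cT + 1)" using \<epsilon> cT by (intro mult_mono) (auto simp: \<eta>_def)
  also have "\<dots> = \<epsilon> / 4" using cT by (simp add: field_simps)
  finally have 1: "2 * \<eta> * cT \<le> \<epsilon> / 4" .
  define B where "B = sqrt (4 * (c + 1) / \<epsilon>)"
  have B: "0 < B" using c \<epsilon> by (simp add: B_def)
  have "B\<^sup>2 = 4 * (c + 1) / \<epsilon>" using c \<epsilon> by (simp add: B_def)
  then have "c \<le> \<epsilon> / 4 * B\<^sup>2" using \<epsilon> by simp
  then have 2: "c / B\<^sup>2 \<le> \<epsilon> / 4" using B by (simp add: pos_divide_le_eq)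
  define Z where "Z n = ((1 + c) / rate n + eb n) / \<eta> + 2 * eb n + 2 * \<eta> * cT + 2 * r2 n + c / B\<^sup>2 + 4 * B * r1 n" for n
  have "Z \<longlonglongrightarrow> (0 + 0) / \<eta> + 2 * 0 + 2 * \<eta> * cT + 2 * 0 + c / B\<^sup>2 + 4 * B * 0"
   unfolding Z_def[abs_def] by (intro tendsto_add tendsto_divide tendsto_mult ir eb r tendsto_const) (use \<eta> in simp)
  moreover have "(0 + 0) / \<eta> + 2 * 0 + 2 * \<eta> * cT + 2 * 0 + c / B\<^sup>2 + 4 * B * 0 = 2 * \<eta> * cT + c / B\<^sup>2" by simp
  moreover have "2 * \<eta> * cT + c / B\<^sup>2 < \<epsilon>" using 1 2 \<epsilon> by linarith
  ultimately have "\<forall>\<^sub>F n in sequentially. Z n < \<epsilon>" by (intro order_tendstoD(2)) simp_all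
  then show "\<forall>\<^sub>F n in sequentially. dist (LINT w|M. min 1 (norm (statistic n w - score_sum n w))) 0 < \<epsilon>"
   using sm T A R y r1bar_L1(1) ea phi_pos rho_pos rate_pos eventually_ge_at_top[of 1]
  proof eventually_elim
   case (elim n)
   have [measurable]: "statistic n \<in> borel_measurable M" by (rule elim(2))
   define U where "U w = \<bar>r1hat n w - 1\<bar> / \<eta> + 2 * \<bar>r1bar n w - 1\<bar> + 2 * \<eta> * norm (score_sum n w) + 2 * norm (incr_rest n w)
     + (weight_rest n w)^2 / B\<^sup>2 + 4 * B * norm (mean_incr n w)" for w
   have le: "min 1 (norm (statistic n w - score_sum n w)) \<le> U w" for w
    unfolding U_def by (intro perturbed_ratio_bound statistic_expansion elim \<eta> B)
   have i: "integrable M (\<lambda>w. \<bar>r1bar n w - 1\<bar>)" "integrable M (\<lambda>w. norm (mean_incr n w))" using elim(4,7) by auto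
   have Ui: "integrable M U"
    unfolding U_def[abs_def] by (intro Bochner_Integration.integrable_add integrable_divide integrable_mult_right) (use elim i in auto)
   have "(LINT w|M. min 1 (norm (statistic n w - score_sum n w))) \<le> (LINT w|M. U w)"
    by (intro integral_mono_AE'[OF Ui] AE_I2 le order_trans[OF _ le]) simp
   also have "\<dots> = (LINT w|M. \<bar>r1hat n w - 1\<bar>) / \<eta> + 2 * eb n + 2 * \<eta> * (LINT w|M. norm (score_sum n w)) + 2 * (LINT w|M. norm (incr_rest n w))
     + (LINT w|M. (weight_rest n w)^2) / B\<^sup>2 + 4 * B * (LINT w|M. norm (mean_incr n w))"
    unfolding U_def eb_def using elim i by (simp add: Bochner_Integration.integral_add)
   also have "\<dots> \<le> Z n"
    unfolding Z_def using elim \<eta> B by (intro add_mono divide_right_mono mult_left_mono) auto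
   also have "\<dots> < \<epsilon>" by (rule elim(1))
   finally show ?case by (simp add: dist_real_def abs_of_nonneg Bochner_Integration.integral_nonneg)
  qed
 qed
qed

section \<open>The limit distribution\<close>

text \<open>Approximation by the projections, uniformly in \<open>n\<close>: the difference of the characteristic functionals at \<open>v\<close> and at
  \<open>H.proj N v\<close> is at most \<open>norm v\<close> times the mean norm of the tail.\<close>

lemma char_score_sum:
 assumes C: "bounded_linear C" and fin: "\<And>N. C (H.proj N v) \<bullet> H.proj N v = var_const * Wform N v x"
 shows "(\<lambda>n. CLINT w|M. iexp (score_sum n w \<bullet> v)) \<longlonglongrightarrow> complex_of_real (exp (- (C v \<bullet> v) / 2))"
proof -
 interpret C: bounded_linear C by (rule C)
 obtain c where c: "0 \<le> c" "\<forall>\<^sub>F n in sequentially. \<forall>N. integrable M (\<lambda>w. score_tail_norm n N w)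
  \<and> (LINT w|M. score_tail_norm n N w) \<le> sqrt (c * tail_bound N)"
  by (rule score_sum_moments) blast
 define a where "a n = (CLINT w|M. iexp (score_sum n w \<bullet> v))" for n
 define a0 where "a0 = complex_of_real (exp (- (C v \<bullet> v) / 2))"
 define p where "p N n = (CLINT w|M. iexp (score_sum n w \<bullet> H.proj N v))" for N n
 define p0 where "p0 N = complex_of_real (exp (- (C (H.proj N v) \<bullet> H.proj N v) / 2))" for N
 have p: "p N \<longlonglongrightarrow> p0 N" for N unfolding p_def[abs_def] p0_def fin by (rule char_score_sum_proj)
 have p0: "p0 \<longlonglongrightarrow> a0" unfolding p0_def[abs_def] a0_def by (intro tendsto_intros C.tendsto H.proj_tendsto) simp
 have "(\<lambda>N. norm v * sqrt (c * tail_bound N)) \<longlonglongrightarrow> norm v * sqrt (c * 0)" by (intro tendsto_intros tail_bound_tendsto)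
 then have tl: "(\<lambda>N. norm v * sqrt (c * tail_bound N)) \<longlonglongrightarrow> 0" by simp
 have ap: "\<forall>\<^sub>F n in sequentially. cmod (a n - p N n) \<le> norm v * sqrt (c * tail_bound N)" for N
  using c(2)
 proof eventually_elim
  case (elim n)
  have ii: "integrable M (\<lambda>w. iexp (score_sum n w \<bullet> y))" for y
   by (rule integrable_const_bound[where B=1]) auto
  have lip: "cmod (iexp s - iexp t) \<le> \<bar>s - t\<bar>" for s t :: real
  proof -
   have "iexp s - iexp t = iexp t * (iexp (s - t) - 1)" by (simp add: algebra_simps exp_add[symmetric])
   then show ?thesis using iexp_approx1[of "s - t" 0] by (simp add: norm_mult)
  qed
  have "cmod (a n - p N n) = cmod (CLINT w|M. iexp (score_sum n w \<bullet> v) - iexp (score_sum n w \<bullet> H.proj N v))"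
   unfolding a_def p_def by (subst Bochner_Integration.integral_diff[OF ii ii]) simp
  also have "\<dots> \<le> (LINT w|M. norm v * score_tail_norm n N w)"
  proof (rule norm_integral_le)
   show "integrable M (\<lambda>w. iexp (score_sum n w \<bullet> v) - iexp (score_sum n w \<bullet> H.proj N v))" by (intro Bochner_Integration.integrable_diff ii)
   show "integrable M (\<lambda>w. norm v * score_tail_norm n N w)" using elim by simp
   fix w
   have "\<bar>score_sum n w \<bullet> v - score_sum n w \<bullet> H.proj N v\<bar> \<le> norm v * score_tail_norm n N w"
    unfolding H.inner_proj_swap inner_diff_left[symmetric] using Cauchy_Schwarz_ineq2[of "score_sum n w - H.proj N (score_sum n w)" v]
    by (simp add: mult.commute)
   then show "cmod (iexp (score_sum n w \<bullet> v) - iexp (score_sum n w \<bullet> H.proj N v)) \<le> norm v * score_tail_norm n N w"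
    by (rule order_trans[OF lip])
  qed
  also have "\<dots> \<le> norm v * sqrt (c * tail_bound N)" using elim by (simp add: mult_left_mono)
  finally show ?case .
 qed
 have "a \<longlonglongrightarrow> a0"
 proof (rule tendstoI)
  fix \<epsilon> :: real assume \<epsilon>: "0 < \<epsilon>"
  have "\<forall>\<^sub>F N in sequentially. norm v * sqrt (c * tail_bound N) < \<epsilon> / 3" "\<forall>\<^sub>F N in sequentially. dist (p0 N) a0 < \<epsilon> / 3"
   by (rule order_tendstoD[OF tl] tendstoD[OF p0], use \<epsilon> in simp)+
  from eventually_happens[OF eventually_conj[OF this]]
  obtain N where N: "norm v * sqrt (c * tail_bound N) < \<epsilon> / 3" "dist (p0 N) a0 < \<epsilon> / 3" by auto
  have "\<forall>\<^sub>F n in sequentially. dist (p N n) (p0 N) < \<epsilon> / 3" using \<epsilon> by (intro tendstoD[OF p]) simp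
  then show "\<forall>\<^sub>F n in sequentially. dist (a n) a0 < \<epsilon>"
   using ap[of N]
  proof eventually_elim
   case (elim n)
   then show ?case using N dist_triangle[of "a n" a0 "p N n"] dist_triangle[of "p N n" a0 "p0 N"]
    by (simp add: dist_norm)
  qed
 qed
 then show ?thesis by (simp add: a_def[abs_def] a0_def)
qed

text \<open>A bounded Lipschitz function distinguishes the statistic and the sum of the scores by at most a multiple of
  the truncated norm of their difference.\<close>

lemma statistic_converges:
 assumes C: "bounded_linear C" and fin: "\<And>v N. C (H.proj N v) \<bullet> H.proj N v = var_const * Wform N v x"
  and g: "gaussian_measure 0 C \<nu>"
 shows "converges_in_distribution M statistic \<nu>"
proof -
 define \<mu> where "\<mu> n = distr M borel (score_sum n)" for n
 have \<nu>: "prob_space \<nu>" "sets \<nu> = sets borel" using g by (auto simp: gaussian_measure_def)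
 have char_\<mu>: "(CLINT z|\<mu> n. iexp (z \<bullet> v)) = (CLINT w|M. iexp (score_sum n w \<bullet> v))" for n v
  unfolding \<mu>_def by (rule integral_distr) measurable
 have char_\<nu>: "(CLINT z|\<nu>. iexp (z \<bullet> v)) = complex_of_real (exp (- (C v \<bullet> v) / 2))" for v
 proof -
  have "(CLINT z|\<nu>. iexp (z \<bullet> v)) = exp (\<i> * complex_of_real (0 \<bullet> v) - complex_of_real (C v \<bullet> v / 2))"
   using g unfolding gaussian_measure_def by blast
  then show ?thesis by (simp add: exp_of_real[symmetric])
 qed
 have "char_convergence \<mu> \<nu>"
 proof (rule char_convergence.intro)
  show "prob_space (\<mu> n)" for n unfolding \<mu>_def by (rule prob_space_distr) measurable
  show "prob_space \<nu>" by (rule \<nu>(1))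
  show "sets (\<mu> n) = sets borel" for n by (simp add: \<mu>_def)
  show "sets \<nu> = sets borel" by (rule \<nu>(2))
  show "(\<lambda>n. CLINT z|\<mu> n. iexp (z \<bullet> v)) \<longlonglongrightarrow> (CLINT z|\<nu>. iexp (z \<bullet> v))" for v
   unfolding char_\<mu> char_\<nu> by (rule char_score_sum[OF C fin])
 qed
 then interpret cc: char_convergence_basis \<mu> \<nu> basis_vec
  by (rule char_convergence_basis.intro[OF _ H.hilbert_basis_axioms])
 obtain c where c: "0 \<le> c" "\<forall>\<^sub>F n in sequentially. \<forall>N. integrable M (\<lambda>w. score_tail_norm n N w)
  \<and> (LINT w|M. score_tail_norm n N w) \<le> sqrt (c * tail_bound N)"
  by (rule score_sum_moments) blast
 have tail: "\<exists>N0. \<forall>N\<ge>N0. \<forall>\<^sub>F n in sequentially. (\<integral>z. min 1 (norm (z - H.proj N z)) \<partial>\<mu> n) \<le> \<epsilon>" if \<epsilon>: "0 < \<epsilon>" for \<epsilon>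
 proof -
  have "(\<lambda>N. sqrt (c * tail_bound N)) \<longlonglongrightarrow> sqrt (c * 0)" by (intro tendsto_intros tail_bound_tendsto)
  then have "\<forall>\<^sub>F N in sequentially. sqrt (c * tail_bound N) < \<epsilon>" by (rule order_tendstoD) (use \<epsilon> in simp)
  then obtain N0 where N0: "\<forall>N\<ge>N0. sqrt (c * tail_bound N) < \<epsilon>" unfolding eventually_sequentially by blast
  show ?thesis
  proof (intro exI[of _ N0] allI impI)
   fix N assume N: "N0 \<le> N"
   show "\<forall>\<^sub>F n in sequentially. (\<integral>z. min 1 (norm (z - H.proj N z)) \<partial>\<mu> n) \<le> \<epsilon>"
    using c(2)
   proof eventually_elim
    case (elim n)
    have [measurable]: "H.proj N \<in> borel_measurable borel" by (rule H.proj_measurable)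
    have "(\<integral>z. min 1 (norm (z - H.proj N z)) \<partial>\<mu> n) = (LINT w|M. min 1 (score_tail_norm n N w))"
     unfolding \<mu>_def by (rule integral_distr) measurable
    also have "\<dots> \<le> (LINT w|M. score_tail_norm n N w)"
     using elim by (intro integral_mono_AE') auto
    also have "\<dots> \<le> \<epsilon>" using elim N0 N less_imp_le order_trans by blast
    finally show ?case .
   qed
  qed
 qed
 \<comment> \<open>the finitely many statistics that may fail to be measurable are replaced\<close>
 define Z where "Z n = (if statistic n \<in> borel_measurable M then statistic n else score_sum n)" for n
 have [measurable]: "Z n \<in> borel_measurable M" for n by (simp add: Z_def)
 have Z: "\<forall>\<^sub>F n in sequentially. Z n = statistic n" using statistic_close(2) by eventually_elim (simp add: Z_def)
 have lip: "(\<lambda>n. \<integral>z. g z \<partial>distr M borel (Z n)) \<longlonglongrightarrow> (\<integral>z. g z \<partial>\<nu>)"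
  if L: "\<And>z z'. \<bar>g z - g z'\<bar> \<le> L * norm (z - z')" "0 \<le> L" and B: "\<And>z. \<bar>g z\<bar> \<le> B" for g :: "'h \<Rightarrow> real" and L B
 proof -
  have "L-lipschitz_on UNIV g" using L by (intro lipschitz_onI) (simp_all add: dist_norm)
  then have "continuous_on UNIV g" by (rule lipschitz_on_continuous_on)
  then have [measurable]: "g \<in> borel_measurable borel" by (rule borel_measurable_continuous_onI)
  have T: "(\<lambda>n. \<integral>z. g z \<partial>\<mu> n) \<longlonglongrightarrow> (\<integral>z. g z \<partial>\<nu>)" by (rule cc.integral_lipschitz_tendsto[OF tail L B])
  define k where "k = L + 2 * B"
  have B0: "0 \<le> B" using B[of 0] by linarith
  have "(\<lambda>n. (\<integral>z. g z \<partial>distr M borel (Z n)) - (\<integral>z. g z \<partial>\<mu> n)) \<longlonglongrightarrow> 0"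
  proof (rule Lim_null_comparison)
   show "(\<lambda>n. k * (LINT w|M. min 1 (norm (statistic n w - score_sum n w)))) \<longlonglongrightarrow> 0"
    by (rule tendsto_mult_right_zero[OF statistic_close(1)])
   show "\<forall>\<^sub>F n in sequentially. norm ((\<integral>z. g z \<partial>distr M borel (Z n)) - (\<integral>z. g z \<partial>\<mu> n))
     \<le> k * (LINT w|M. min 1 (norm (statistic n w - score_sum n w)))"
    using Z
   proof eventually_elim
    case (elim n)
    have gi: "integrable M (\<lambda>w. g (Z n w))" "integrable M (\<lambda>w. g (score_sum n w))"
     by (rule integrable_const_bound[where B=B]; use B in simp)+
    have mi: "integrable M (\<lambda>w. min 1 (norm (Z n w - score_sum n w)))"
     by (rule integrable_const_bound[where B=1]) auto
    have "(\<integral>z. g z \<partial>distr M borel (Z n)) - (\<integral>z. g z \<partial>\<mu> n) = (LINT w|M. g (Z n w) - g (score_sum n w))"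
     unfolding \<mu>_def by (subst (1 2) integral_distr) (simp_all add: gi)
    also have "norm \<dots> \<le> (LINT w|M. k * min 1 (norm (Z n w - score_sum n w)))"
    proof (rule norm_integral_le)
     fix w
     define t where "t = norm (Z n w - score_sum n w)"
     have t: "0 \<le> t" by (simp add: t_def)
     have "\<bar>g (Z n w) - g (score_sum n w)\<bar> \<le> k * min 1 t"
     proof (cases "t \<le> 1")
      case True
      then have "L * t \<le> k * min 1 t" using B0 t by (simp add: k_def mult_right_mono)
      then show ?thesis using L(1)[of "Z n w" "score_sum n w"] unfolding t_def by linarith
     next
      case False
      then show ?thesis using B[of "Z n w"] B[of "score_sum n w"] L(2) by (simp add: k_def)
     qed
     then show "norm (g (Z n w) - g (score_sum n w)) \<le> k * min 1 (norm (Z n w - score_sum n w))" by (simp add: t_def)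
    qed (use gi mi in auto)
    finally show ?case using elim by simp
   qed
  qed
  from tendsto_add[OF this T] show ?thesis by simp
 qed
 show ?thesis
  unfolding converges_in_distribution_def
 proof (intro allI impI, elim conjE)
  fix f :: "'h \<Rightarrow> real" assume f: "continuous_on UNIV f" "bounded (range f)"
  have "(\<lambda>n. \<integral>z. f z \<partial>distr M borel (Z n)) \<longlonglongrightarrow> (\<integral>z. f z \<partial>\<nu>)"
   by (rule weak_convergence_if_lipschitz[OF _ \<nu>(1) _ \<nu>(2) lip f]) (simp_all add: prob_space_distr)
  then show "(\<lambda>n. \<integral>z. f z \<partial>distr M borel (statistic n)) \<longlonglongrightarrow> (\<integral>z. f z \<partial>\<nu>)"
   by (rule Lim_transform_eventually) (use Z in \<open>eventually_elim, simp\<close>)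
 qed
qed

end

theorem theorem2p1:
 fixes M :: "'w measure"
  and d :: "'e \<Rightarrow> 'e \<Rightarrow> real"
  and e :: "nat \<Rightarrow> 'h::{real_inner,banach,second_countable_topology}"
  and X :: "nat \<Rightarrow> nat \<Rightarrow> 'w \<Rightarrow> 'e"
  and Y :: "nat \<Rightarrow> nat \<Rightarrow> 'w \<Rightarrow> 'h"
  and r :: "'e \<Rightarrow> 'h"
  and x :: 'e
  and K \<phi> \<tau>0 :: "real \<Rightarrow> real"
  and h b :: "nat \<Rightarrow> real"
  and f1 :: "'e \<Rightarrow> real"
  and W :: "nat \<Rightarrow> nat \<Rightarrow> 'e \<Rightarrow> real"
  and \<alpha> \<delta> a0 a1 :: real
 assumes "prob_space M"
  and "pseudometric d"
  and "orthonormal_basis e"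
  and "identically_distributed_array M d X Y"
  and "regression_function M d X Y r"
  and "\<forall>n\<ge>1. 0 < h n \<and> 0 < b n"
  and "hyp_A1 K"
  and "hyp_A2 M d X Y x \<alpha> \<delta> \<phi> f1 \<tau>0"
  and "hyp_A3 M d X Y e r x h \<delta> W a0 a1"
  and "hyp_A4 M d X Y e r x \<alpha> a0 a1"
  and "hyp_A5 h b \<phi> \<alpha>"
 shows "(\<exists>!C. asymptotic_covariance e K \<tau>0 f1 W x C) \<and>
  (\<forall>C. asymptotic_covariance e K \<tau>0 f1 W x C \<longrightarrow>
   (\<exists>\<mu>. gaussian_measure 0 C \<mu> \<and>
    converges_in_distribution M
     (\<lambda>n \<omega>. sqrt (real n * \<phi> (h n)) *\<^sub>R
       (rhat M d X Y K x n (h n) \<omega> - r x - cond_bias M d X Y K r x n (h n) \<omega>))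
     \<mu>))"
proof -
 interpret functional_regression M d e X Y r x K \<phi> \<tau>0 h b f1 W \<alpha> \<delta> a0 a1
  using assms by (simp add: functional_regression_def functional_regression_axioms_def)
 obtain C where C: "asymptotic_covariance e K \<tau>0 f1 W x C"
  "\<And>N v. C (H.proj N v) \<bullet> H.proj N v = var_const * Wform N v x"
  "bounded_linear C" "\<And>v w. C v \<bullet> w = v \<bullet> C w" "\<And>v. 0 \<le> C v \<bullet> v" "summable (\<lambda>k. C (basis_vec k) \<bullet> basis_vec k)"
  by (rule asymptotic_covariance_exists) blast
 have unique: "C' = C" if "asymptotic_covariance e K \<tau>0 f1 W x C'" for C'
  by (rule asymptotic_covariance_unique[OF that C(1)])
 obtain \<mu> where \<mu>: "gaussian_measure 0 C \<mu>"
  using H.gaussian_measure_exists[OF C(3-6)] by blast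
 have "converges_in_distribution M (\<lambda>n \<omega>. sqrt (real n * \<phi> (h n)) *\<^sub>R
    (rhat M d X Y K x n (h n) \<omega> - r x - cond_bias M d X Y K r x n (h n) \<omega>)) \<mu>"
  using statistic_converges[OF C(3,2) \<mu>] by (simp add: statistic_def[abs_def])
 then show ?thesis using C(1) \<mu> unique by blast
qed

end
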